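(* There exists an ergodic unimodular random graph $(G,o)$ with $\rho(G,o)<1$ such that its Bernoulli graphing $\mathcal{B}$ is not strongly ergodic. In particular, $\rho(\mathcal{B})=1$.
   Context: All graphs have vertex degrees bounded by a fixed $D\in\mathbb{N}$ (for the purposes of this existence statement, $D$ may be chosen) and no isolated vertices. $\mathbb{G}_\bullet$ is the standard Borel space of isomorphism classes of connected rooted graphs $(G,o)$; $\mathbb{G}_{\bullet\bullet}$ is the space of isomorphism classes of connected doubly rooted graphs $(G,o,o')$; $\mathbb{G}_\bullet^+$ is the space of isomorphism classes of connected rooted graphs $(G,\xi,o)$ with a vertex labelling $\xi: V(G)\to[0,1]$. A unimodular random graph is a random element $(G,o)$ of $\mathbb{G}_\bullet$, with law $\nu$, satisfying the Mass Transport Principle: for every Borel $f:\mathbb{G}_{\bullet\bullet}\to\mathbb{R}_{\ge 0}$, $\int \sum_{o'\in V(G)} f(G,o',o)\,d\nu(G,o) = \int \sum_{o'\in V(G)} f(G,o,o')\,d\nu(G,o)$. It is ergodic if every Borel $U\subseteq\mathbb{G}_\bullet$ that is rerooting invariant ($(G,o)\in U$ implies $(G,o')\in U$ for all $o'\in V(G)$) has $\nu(U)\in\{0,1\}$. For a connected graph $G$, $M_G$ is the self-adjoint operator $(M_Gf)(u)=\frac{1}{\deg(u)}\sum_{(u,v)\in E(G)}f(v)$ on $\ell^2(G,\deg)$, the space of functions on $V(G)$ with inner product $\langle f,g\rangle=\sum_u f(u)\overline{g(u)}\deg(u)$; $\rho(G,o)=\sup\{|\lambda| : \lambda\in\sigma(M_G)\}$,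 which is root-independent and hence almost surely constant for ergodic $(G,o)$. The Bernoulli graphing of $(G,o)$ is $(\mathcal{B},\mathbb{G}_\bullet^+,\mu)$, where $\mathcal B$ is the Borel graph on $\mathbb{G}_\bullet^+$ with an edge between $(G,\xi,o)$ and $(H,\eta,p)$ iff there is a neighbour $o'$ of $o$ in $G$ with $(G,\xi,o')\cong(H,\eta,p)$, and $\int f\,d\mu=\int_{\mathbb{G}_\bullet}\int_{[0,1]^{V(G)}} f(G,\xi,o)\,d\mathrm{Leb}^{\otimes V(G)}(\xi)\,d\nu(G,o)$. With $\mu^*$ given by $\int f\,d\mu^*=\int f\deg\,d\mu/\int\deg\,d\mu$, the Markov operator is $(\mathcal{M}f)(x)=\frac{1}{\deg(x)}\sum_{(x,y)\in\mathcal{B}} f(y)$ on $L^2(\mathbb{G}_\bullet^+,\mu^* )$, and $\rho(\mathcal{B})$ is the spectral radius of its restriction to the orthogonal complement of the constants. A graphing $(\mathcal{G},X,\mu)$ is strongly ergodic if for every sequence of Borel sets $A_n\subseteq X$ for which the measure of the set of $x\in A_n$ having a $\mathcal G$-neighbour outside $A_n$ tends to $0$, one has $\mu(A_n)(1-\mu(A_n))\to0$. *)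

theory Defs
  imports "HOL-Probability.Probability"
begin

section \<open>Graphs and rooted isomorphism classes\<close>

text \<open>
  Connected graphs of bounded degree are countable, so every isomorphism class has a
  representative whose vertices are natural numbers. Graphs are simple and undirected, the edge
  set being a symmetric irreflexive relation.
\<close>

record graph =
  verts :: "nat set"
  edges :: "nat rel"

text \<open>The degree is taken in an arbitrary relation, since it is also needed for graphings.\<close>

definition deg :: "'a rel \<Rightarrow> 'a \<Rightarrow> nat" where
  "deg R x = card {y. (x, y) \<in> R}"

definition connected_graph :: "nat \<Rightarrow> graph \<Rightarrow> bool" where
  "connected_graph D G \<longleftrightarrow>
     verts G \<noteq> {} \<and> edges G \<subseteq> verts G \<times> verts G \<and> sym (edges G) \<and> irrefl (edges G) \<and>
     (\<forall>u\<in>verts G. finite {v. (u, v) \<in> edges G} \<and> 1 \<le> deg (edges G) u \<and> deg (edges G) u \<le> D) \<and>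
     (\<forall>u\<in>verts G. \<forall>v\<in>verts G. (u, v) \<in> (edges G)\<^sup>*)"

definition graph_iso :: "(nat \<Rightarrow> nat) \<Rightarrow> graph \<Rightarrow> graph \<Rightarrow> bool" where
  "graph_iso \<phi> G H \<longleftrightarrow>
     bij_betw \<phi> (verts G) (verts H) \<and>
     (\<forall>u\<in>verts G. \<forall>v\<in>verts G. (u, v) \<in> edges G \<longleftrightarrow> (\<phi> u, \<phi> v) \<in> edges H)"

definition rooted_graphs :: "nat \<Rightarrow> (graph \<times> nat) set" where
  "rooted_graphs D = {(G, r). connected_graph D G \<and> r \<in> verts G}"

definition rooted_iso :: "nat \<Rightarrow> (graph \<times> nat) rel" where
  "rooted_iso D = {((G, r), (H, p)).
     (G, r) \<in> rooted_graphs D \<and> (H, p) \<in> rooted_graphs D \<and> (\<exists>\<phi>. graph_iso \<phi> G H \<and> \<phi> r = p)}"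

definition doubly_rooted_graphs :: "nat \<Rightarrow> (graph \<times> nat \<times> nat) set" where
  "doubly_rooted_graphs D = {(G, r, s). connected_graph D G \<and> r \<in> verts G \<and> s \<in> verts G}"

definition doubly_rooted_iso :: "nat \<Rightarrow> (graph \<times> nat \<times> nat) rel" where
  "doubly_rooted_iso D = {((G, r, s), (H, p, q)).
     (G, r, s) \<in> doubly_rooted_graphs D \<and> (H, p, q) \<in> doubly_rooted_graphs D \<and>
     (\<exists>\<phi>. graph_iso \<phi> G H \<and> \<phi> r = p \<and> \<phi> s = q)}"

text \<open>
  Labellings of G are extensional functions (\<open>undefined\<close> off the vertex set), so that
  they are exactly the points of the product space over the vertices of G.
\<close>

definition labelled_graphs :: "nat \<Rightarrow> (graph \<times> (nat \<Rightarrow> real) \<times> nat) set" where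
  "labelled_graphs D =
     {(G, \<xi>, r). connected_graph D G \<and> \<xi> \<in> verts G \<rightarrow>\<^sub>E {0..1} \<and> r \<in> verts G}"

definition labelled_iso :: "nat \<Rightarrow> (graph \<times> (nat \<Rightarrow> real) \<times> nat) rel" where
  "labelled_iso D = {((G, \<xi>, r), (H, \<eta>, p)).
     (G, \<xi>, r) \<in> labelled_graphs D \<and> (H, \<eta>, p) \<in> labelled_graphs D \<and>
     (\<exists>\<phi>. graph_iso \<phi> G H \<and> \<phi> r = p \<and> (\<forall>v\<in>verts G. \<eta> (\<phi> v) = \<xi> v))}"

type_synonym rooted_class = "(graph \<times> nat) set"
type_synonym doubly_rooted_class = "(graph \<times> nat \<times> nat) set"
type_synonym labelled_class = "(graph \<times> (nat \<Rightarrow> real) \<times> nat) set"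

definition rclass :: "nat \<Rightarrow> graph \<Rightarrow> nat \<Rightarrow> rooted_class" where
  "rclass D G r = rooted_iso D `` {(G, r)}"

definition drclass :: "nat \<Rightarrow> graph \<Rightarrow> nat \<Rightarrow> nat \<Rightarrow> doubly_rooted_class" where
  "drclass D G r s = doubly_rooted_iso D `` {(G, r, s)}"

definition lclass :: "nat \<Rightarrow> graph \<Rightarrow> (nat \<Rightarrow> real) \<Rightarrow> nat \<Rightarrow> labelled_class" where
  "lclass D G \<xi> r = labelled_iso D `` {(G, \<xi>, r)}"

text \<open>
  A representative of an isomorphism class. Everything below that is defined through
  representatives is invariant under rooted isomorphism.
\<close>

definition rep_graph :: "rooted_class \<Rightarrow> graph" where
  "rep_graph c = fst (SOME x. x \<in> c)"

definition rep_root :: "rooted_class \<Rightarrow> nat" where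
  "rep_root c = snd (SOME x. x \<in> c)"

lemma graph_iso_id: "graph_iso (\<lambda>x. x) G G"
  by (auto simp: graph_iso_def bij_betw_def)

lemma graph_iso_comp:
  assumes "graph_iso \<phi> G H" "graph_iso \<psi> H K"
  shows "graph_iso (\<lambda>x. \<psi> (\<phi> x)) G K"
proof -
  have "\<phi> u \<in> verts H" if "u \<in> verts G" for u
    using assms(1) that by (auto simp: graph_iso_def dest: bij_betw_apply)
  then show ?thesis
    using assms bij_betw_trans[of \<phi> "verts G" "verts H" \<psi> "verts K"]
    by (simp add: graph_iso_def comp_def)
qed

lemma graph_iso_inv:
  assumes "graph_iso \<phi> G H"
  shows "graph_iso (inv_into (verts G) \<phi>) H G"
  using assms unfolding graph_iso_def
  by (auto simp: bij_betw_inv_into bij_betw_inv_into_right bij_betw_apply[OF bij_betw_inv_into])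

lemma graph_iso_inv_apply:
  "graph_iso \<phi> G H \<Longrightarrow> v \<in> verts G \<Longrightarrow> inv_into (verts G) \<phi> (\<phi> v) = v"
  unfolding graph_iso_def by (auto simp: bij_betw_def)

lemma equiv_rooted_iso: "equiv (rooted_graphs D) (rooted_iso D)"
proof (rule equivI)
  show "refl_on (rooted_graphs D) (rooted_iso D)"
    using graph_iso_id by (fastforce simp: refl_on_def rooted_iso_def)
  show "sym (rooted_iso D)"
    unfolding sym_def rooted_iso_def
    by (auto simp: rooted_graphs_def) (metis graph_iso_inv graph_iso_inv_apply)
  show "trans (rooted_iso D)"
    unfolding trans_def rooted_iso_def by (auto dest: graph_iso_comp)
qed (auto simp: rooted_iso_def)

lemma equiv_doubly_rooted_iso: "equiv (doubly_rooted_graphs D) (doubly_rooted_iso D)"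
proof (rule equivI)
  show "refl_on (doubly_rooted_graphs D) (doubly_rooted_iso D)"
    using graph_iso_id by (fastforce simp: refl_on_def doubly_rooted_iso_def)
  show "sym (doubly_rooted_iso D)"
    unfolding sym_def doubly_rooted_iso_def
    by (auto simp: doubly_rooted_graphs_def) (metis graph_iso_inv graph_iso_inv_apply)
  show "trans (doubly_rooted_iso D)"
    unfolding trans_def doubly_rooted_iso_def
    by clarsimp (metis (no_types, lifting) graph_iso_comp)
qed (auto simp: doubly_rooted_iso_def)

lemma equiv_labelled_iso: "equiv (labelled_graphs D) (labelled_iso D)"
proof (rule equivI)
  show "refl_on (labelled_graphs D) (labelled_iso D)"
    using graph_iso_id by (fastforce simp: refl_on_def labelled_iso_def)
  show "sym (labelled_iso D)"
  proof (rule symI)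
    fix x y assume "(x, y) \<in> labelled_iso D"
    then obtain G \<xi> r H \<eta> p \<phi> where xy: "x = (G, \<xi>, r)" "y = (H, \<eta>, p)"
      and mem: "x \<in> labelled_graphs D" "y \<in> labelled_graphs D"
      and iso: "graph_iso \<phi> G H" "\<phi> r = p" "\<forall>v\<in>verts G. \<eta> (\<phi> v) = \<xi> v"
      by (auto simp: labelled_iso_def)
    let ?\<psi> = "inv_into (verts G) \<phi>"
    have r: "?\<psi> p = r"
      using iso mem xy graph_iso_inv_apply by (auto simp: labelled_graphs_def)
    have b: "bij_betw \<phi> (verts G) (verts H)" using iso by (simp add: graph_iso_def)
    have "\<xi> (?\<psi> w) = \<eta> w" if "w \<in> verts H" for w
      using iso(3) that b bij_betw_inv_into_right[OF b that]
        bij_betw_apply[OF bij_betw_inv_into[OF b] that] by metis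
    then show "(y, x) \<in> labelled_iso D"
      using graph_iso_inv[OF iso(1)] r mem xy by (auto simp: labelled_iso_def)
  qed
  show "trans (labelled_iso D)"
  proof (rule transI)
    fix x y z assume "(x, y) \<in> labelled_iso D" "(y, z) \<in> labelled_iso D"
    then obtain G \<xi> r H \<eta> p K \<zeta> q \<phi> \<psi>
      where xyz: "x = (G, \<xi>, r)" "y = (H, \<eta>, p)" "z = (K, \<zeta>, q)"
      and mem: "x \<in> labelled_graphs D" "z \<in> labelled_graphs D"
      and \<phi>: "graph_iso \<phi> G H" "\<phi> r = p" "\<forall>v\<in>verts G. \<eta> (\<phi> v) = \<xi> v"
      and \<psi>: "graph_iso \<psi> H K" "\<psi> p = q" "\<forall>v\<in>verts H. \<zeta> (\<psi> v) = \<eta> v"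
      by (auto simp: labelled_iso_def)
    have "\<forall>v\<in>verts G. \<phi> v \<in> verts H"
      using \<phi>(1) by (auto simp: graph_iso_def dest: bij_betw_apply)
    then show "(x, z) \<in> labelled_iso D"
      using graph_iso_comp[OF \<phi>(1) \<psi>(1)] \<phi> \<psi> mem xyz
      by (auto simp: labelled_iso_def intro!: exI[of _ "\<lambda>v. \<psi> (\<phi> v)"])
  qed
qed (auto simp: labelled_iso_def)


section \<open>The Borel spaces of isomorphism classes\<close>

definition ball_graph :: "graph \<Rightarrow> nat \<Rightarrow> nat \<Rightarrow> graph" where
  "ball_graph G r n =
     (let B = {v \<in> verts G. \<exists>k\<le>n. (r, v) \<in> edges G ^^ k}
      in \<lparr>verts = B, edges = edges G \<inter> B \<times> B\<rparr>)"

text \<open>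
  The topology is that of local convergence. The sets below are a base consisting of open
  sets and the topology is second countable, hence they generate the Borel sets.
\<close>

definition cylinder :: "nat \<Rightarrow> graph \<Rightarrow> nat \<Rightarrow> nat \<Rightarrow> rooted_class set" where
  "cylinder D H p n = {rclass D G r | G r. (G, r) \<in> rooted_graphs D \<and>
     (\<exists>\<phi>. graph_iso \<phi> (ball_graph G r n) (ball_graph H p n) \<and> \<phi> r = p)}"

definition doubly_cylinder ::
    "nat \<Rightarrow> graph \<Rightarrow> nat \<Rightarrow> nat \<Rightarrow> nat \<Rightarrow> doubly_rooted_class set" where
  "doubly_cylinder D H p q n = {drclass D G r s | G r s. (G, r, s) \<in> doubly_rooted_graphs D \<and>
     s \<in> verts (ball_graph G r n) \<and>
     (\<exists>\<phi>. graph_iso \<phi> (ball_graph G r n) (ball_graph H p n) \<and> \<phi> r = p \<and> \<phi> s = q)}"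

definition labelled_cylinder ::
    "nat \<Rightarrow> graph \<Rightarrow> nat \<Rightarrow> nat \<Rightarrow> (nat \<Rightarrow> real set) \<Rightarrow> labelled_class set" where
  "labelled_cylinder D H p n U = {lclass D G \<xi> r | G \<xi> r. (G, \<xi>, r) \<in> labelled_graphs D \<and>
     (\<exists>\<phi>. graph_iso \<phi> (ball_graph G r n) (ball_graph H p n) \<and> \<phi> r = p \<and>
          (\<forall>v\<in>verts (ball_graph G r n). \<xi> v \<in> U (\<phi> v)))}"

definition rooted_space :: "nat \<Rightarrow> rooted_class measure" where
  "rooted_space D = sigma (rooted_graphs D // rooted_iso D)
     {cylinder D H p n | H p n. (H, p) \<in> rooted_graphs D}"

definition doubly_rooted_space :: "nat \<Rightarrow> doubly_rooted_class measure" where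
  "doubly_rooted_space D = sigma (doubly_rooted_graphs D // doubly_rooted_iso D)
     {doubly_cylinder D H p q n | H p q n. (H, p, q) \<in> doubly_rooted_graphs D}"

definition labelled_space :: "nat \<Rightarrow> labelled_class measure" where
  "labelled_space D = sigma (labelled_graphs D // labelled_iso D)
     {labelled_cylinder D H p n U | H p n U. (H, p) \<in> rooted_graphs D \<and> (\<forall>v. open (U v))}"


section \<open>Unimodular random graphs\<close>

definition unimodular_random_graph :: "nat \<Rightarrow> rooted_class measure \<Rightarrow> bool" where
  "unimodular_random_graph D \<nu> \<longleftrightarrow>
     prob_space \<nu> \<and> sets \<nu> = sets (rooted_space D) \<and>
     (\<forall>f :: doubly_rooted_class \<Rightarrow> real.
        f \<in> borel_measurable (doubly_rooted_space D) \<and>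
        (\<forall>c\<in>space (doubly_rooted_space D). 0 \<le> f c) \<longrightarrow>
        (\<integral>\<^sup>+ c. (\<integral>\<^sup>+ s. ennreal (f (drclass D (rep_graph c) s (rep_root c)))
                   \<partial>count_space (verts (rep_graph c))) \<partial>\<nu>) =
        (\<integral>\<^sup>+ c. (\<integral>\<^sup>+ s. ennreal (f (drclass D (rep_graph c) (rep_root c) s))
                   \<partial>count_space (verts (rep_graph c))) \<partial>\<nu>))"

definition rerooting_invariant :: "nat \<Rightarrow> rooted_class set \<Rightarrow> bool" where
  "rerooting_invariant D U \<longleftrightarrow>
     (\<forall>G r s. (G, r) \<in> rooted_graphs D \<and> s \<in> verts G \<and> rclass D G r \<in> U \<longrightarrow> rclass D G s \<in> U)"

definition ergodic_random_graph :: "nat \<Rightarrow> rooted_class measure \<Rightarrow> bool" where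
  "ergodic_random_graph D \<nu> \<longleftrightarrow>
     (\<forall>U\<in>sets (rooted_space D). rerooting_invariant D U \<longrightarrow> measure \<nu> U \<in> {0, 1})"


section \<open>Spectra of Markov operators\<close>

definition L2 :: "'a measure \<Rightarrow> ('a \<Rightarrow> complex) set" where
  "L2 M = {f \<in> borel_measurable M. integrable M (\<lambda>x. (cmod (f x))\<^sup>2)}"

definition L2_norm :: "'a measure \<Rightarrow> ('a \<Rightarrow> complex) \<Rightarrow> real" where
  "L2_norm M f = sqrt (\<integral>x. (cmod (f x))\<^sup>2 \<partial>M)"

text \<open>
  A subspace H of functions with seminorm N stands for the normed space obtained by
  identifying f and g when f - g has seminorm 0; equations between vectors are therefore stated
  up to seminorm 0. In particular, bounded operators act on the quotient, and the spectrum of T is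
  the set of those z for which T - z has no inverse among them.
\<close>

definition bounded_operator ::
    "('a \<Rightarrow> complex) set \<Rightarrow> (('a \<Rightarrow> complex) \<Rightarrow> real) \<Rightarrow> (('a \<Rightarrow> complex) \<Rightarrow> 'a \<Rightarrow> complex) \<Rightarrow> bool"
  where
  "bounded_operator H N S \<longleftrightarrow>
     S \<in> H \<rightarrow> H \<and>
     (\<forall>f\<in>H. \<forall>g\<in>H. N (\<lambda>x. S (\<lambda>y. f y + g y) x - (S f x + S g x)) = 0) \<and>
     (\<forall>c. \<forall>f\<in>H. N (\<lambda>x. S (\<lambda>y. c * f y) x - c * S f x) = 0) \<and>
     (\<exists>C. \<forall>f\<in>H. N (S f) \<le> C * N f)"

definition spectrum_on ::
    "('a \<Rightarrow> complex) set \<Rightarrow> (('a \<Rightarrow> complex) \<Rightarrow> real) \<Rightarrow> (('a \<Rightarrow> complex) \<Rightarrow> 'a \<Rightarrow> complex) \<Rightarrow>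
      complex set"
  where
  "spectrum_on H N T = {z. \<not> (\<exists>S. bounded_operator H N S \<and>
     (\<forall>f\<in>H. N (\<lambda>x. S (\<lambda>y. T f y - z * f y) x - f x) = 0 \<and>
            N (\<lambda>x. (T (S f) x - z * S f x) - f x) = 0))}"

definition spectral_radius_on ::
    "('a \<Rightarrow> complex) set \<Rightarrow> (('a \<Rightarrow> complex) \<Rightarrow> real) \<Rightarrow> (('a \<Rightarrow> complex) \<Rightarrow> 'a \<Rightarrow> complex) \<Rightarrow> real"
  where
  "spectral_radius_on H N T = Sup (cmod ` spectrum_on H N T)"

definition markov :: "'a rel \<Rightarrow> ('a \<Rightarrow> complex) \<Rightarrow> 'a \<Rightarrow> complex" where
  "markov R f x = (1 / of_nat (deg R x)) * (\<Sum>y | (x, y) \<in> R. f y)"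

text \<open>The space of square-summable functions with vertices weighted by their degrees is the
  \<open>L2\<close> space of the following measure.\<close>

definition deg_measure :: "graph \<Rightarrow> nat measure" where
  "deg_measure G = point_measure (verts G) (\<lambda>u. of_nat (deg (edges G) u))"

definition rho_graph :: "graph \<Rightarrow> real" where
  "rho_graph G =
     spectral_radius_on (L2 (deg_measure G)) (L2_norm (deg_measure G)) (markov (edges G))"


section \<open>Graphings\<close>

definition strongly_ergodic :: "'a rel \<Rightarrow> 'a measure \<Rightarrow> bool" where
  "strongly_ergodic R \<mu> \<longleftrightarrow>
     (\<forall>A :: nat \<Rightarrow> 'a set.
        (\<forall>n. A n \<in> sets \<mu>) \<and>
        (\<lambda>n. measure \<mu> {x \<in> A n. \<exists>y. (x, y) \<in> R \<and> y \<notin> A n}) \<longlonglongrightarrow> 0 \<longrightarrow>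
        (\<lambda>n. measure \<mu> (A n) * (1 - measure \<mu> (A n))) \<longlonglongrightarrow> 0)"

definition deg_biased :: "'a rel \<Rightarrow> 'a measure \<Rightarrow> 'a measure" where
  "deg_biased R \<mu> = density \<mu> (\<lambda>x. ennreal (real (deg R x) / (\<integral>y. real (deg R y) \<partial>\<mu>)))"

definition orthogonal_to_constants :: "'a measure \<Rightarrow> ('a \<Rightarrow> complex) set" where
  "orthogonal_to_constants M = {f \<in> L2 M. \<forall>c. (\<integral>x. f x * cnj c \<partial>M) = 0}"

definition rho_graphing :: "'a rel \<Rightarrow> 'a measure \<Rightarrow> real" where
  "rho_graphing R \<mu> = spectral_radius_on
     (orthogonal_to_constants (deg_biased R \<mu>)) (L2_norm (deg_biased R \<mu>)) (markov R)"

definition bernoulli_graph :: "nat \<Rightarrow> labelled_class rel" where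
  "bernoulli_graph D = {(lclass D G \<xi> r, lclass D H \<eta> p) | G \<xi> r H \<eta> p.
     (G, \<xi>, r) \<in> labelled_graphs D \<and> (H, \<eta>, p) \<in> labelled_graphs D \<and>
     (\<exists>s. (r, s) \<in> edges G \<and> ((G, \<xi>, s), (H, \<eta>, p)) \<in> labelled_iso D)}"

definition bernoulli_measure :: "nat \<Rightarrow> rooted_class measure \<Rightarrow> labelled_class measure" where
  "bernoulli_measure D \<nu> = \<nu> \<bind> (\<lambda>c.
     distr (PiM (verts (rep_graph c)) (\<lambda>_. restrict_space lborel {0..1})) (labelled_space D)
       (\<lambda>\<xi>. lclass D (rep_graph c) \<xi> (rep_root c)))"

end

theory Submission
  imports Defs "HOL-Library.Diagonal_Subsequence"
begin

text \<open>A sequence of fair coin flips \<open>x\<close> determines the graph. Among the sequences that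
  differ from \<open>x\<close> in finitely many places, \<open>0 ... 0 1 b z\<close> is joined
  to its parent \<open>0 ... 0 0 1 z\<close>. For almost every \<open>x\<close> this is a canopy
  tree: the level of a sequence is the position \<open>k\<close> of its first one, every
  sequence has a parent one level up and, unless its level is 0, two children one level down,
  which are told apart by the forgotten bit \<open>b\<close>, their mark. A vertex of the random
  graph consists of such a sequence, a reduced word in four involutions and one of two copy
  numbers. Neighbours of a vertex arise in two ways: the sequence is kept and the word is
  multiplied by one of the first three involutions (of all four if the sequence is marked), or
  the word is kept and the sequence moves along the canopy tree. The copy number is
  unconstrained, so that the two copies have the same neighbours. The root is the identity word
  over \<open>x\<close>.

  Unimodularity and ergodicity. Moving the root amounts to flipping finitely many coins of
  \<open>x\<close> (\<open>translate_iso\<close>). This preserves the law of the flips, which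
  gives the Mass Transport Principle (\<open>mass_transport\<close>), and a rerooting invariant
  event is a tail event, so Kolmogorov's zero-one law applies (\<open>zero_one_law\<close>).

  Spectral radius of the graph. At least three of at most seven moves are multiplications of the
  word, which take place in a regular tree of degree three or four. The weight
  \<open>(3/5)^n\<close> on words of length \<open>n\<close> is multiplied by at most
  \<open>59/60\<close> when averaged over neighbours, and the Schur test turns this into a bound
  for the norm of the Markov operator (\<open>markov_ball_bound\<close>). The spectral radius is
  a supremum over the spectrum, which has to be nonempty for the bound to have content; this is
  the purpose of the two copies, as the difference of the indicators of two vertices with the
  same neighbours is an eigenfunction for 0 (\<open>rho_graph_less_1\<close>).

  Failure of strong ergodicity. Let \<open>A n\<close> consist of the vertices of level at most
  \<open>n\<close> whose ancestor at level \<open>n\<close> is marked. Almost surely this says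
  that the first one of the sequence is at position at most \<open>n\<close> and that the bit at
  position \<open>n + 1\<close> is one, which has probability between \<open>1/4\<close> and
  \<open>1/2\<close>. A neighbour of a vertex in \<open>A n\<close> lies outside only if the
  vertex has level \<open>n\<close> and the neighbour is its parent, so the boundary of \<open>A
  n\<close> has probability at most \<open>(1/2)^n\<close> (\<open>up_bit_boundary\<close>).
  Levels and marks are visible in the degrees, so \<open>A n\<close> is an event about a bounded
  neighbourhood of the root, even without the labels.

  Spectral radius of the graphing. The Bernoulli graphing is reversible for every unimodular
  random graph: its labels are almost surely distinct, so summing over its neighbours is a mass
  transport (\<open>reversible_indicator\<close>). Hence the Markov operator is a contraction,
  and the centred indicators of the sets \<open>A n\<close> are approximate eigenvectors for the
  eigenvalue 1 (\<open>approx_eigen\<close>).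

  All these arguments need that certain functions of isomorphism classes are measurable. Functions
  that depend on a ball around the root are (\<open>measurable_local_fun\<close>), and for the
  degrees and neighbour sums of the Bernoulli graphing measurability rests on a compactness
  argument (\<open>lclass_eq_if_balls_iso\<close>).\<close>

section \<open>Balls and isomorphisms between them\<close>

abbreviation vball :: "graph \<Rightarrow> nat \<Rightarrow> nat \<Rightarrow> nat set" where
  "vball G r n \<equiv> verts (ball_graph G r n)"

text \<open>An isomorphism of balls is a function on all vertices of which only the values on the ball
  matter, so that restricting it to a smaller ball leaves the function unchanged.\<close>
definition ball_iso :: "(nat \<Rightarrow> nat) \<Rightarrow> graph \<Rightarrow> nat \<Rightarrow> graph \<Rightarrow> nat \<Rightarrow> nat \<Rightarrow> bool" where
  "ball_iso \<phi> G r H p n \<longleftrightarrow> graph_iso \<phi> (ball_graph G r n) (ball_graph H p n) \<and> \<phi> r = p"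

lemma vball_eq: "vball G r n = {v \<in> verts G. \<exists>k\<le>n. (r, v) \<in> edges G ^^ k}"
  by (simp add: ball_graph_def Let_def)

lemma edges_ball_graph: "edges (ball_graph G r n) = edges G \<inter> vball G r n \<times> vball G r n"
  by (simp add: ball_graph_def Let_def)

lemma rooted_graphs_iff: "(G, r) \<in> rooted_graphs D \<longleftrightarrow> connected_graph D G \<and> r \<in> verts G"
  by (simp add: rooted_graphs_def)

lemma connected_graph_edgeD:
  assumes "connected_graph D G" "(u, v) \<in> edges G"
  shows "u \<in> verts G" "v \<in> verts G" "u \<noteq> v" "(v, u) \<in> edges G"
  using assms by (auto simp: connected_graph_def irrefl_def dest: symD)

lemma connected_graph_finite_nbrs:
  "connected_graph D G \<Longrightarrow> finite {v. (u, v) \<in> edges G}"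
  by (cases "u \<in> verts G") (auto simp: connected_graph_def dest: subsetD intro: finite_subset[of _ "{}"])

lemma connected_graph_deg:
  assumes "connected_graph D G" "u \<in> verts G"
  shows "1 \<le> deg (edges G) u" "deg (edges G) u \<le> D"
  using assms by (auto simp: connected_graph_def)

lemma relpow_verts:
  assumes "connected_graph D G" "(u, v) \<in> edges G ^^ k" "u \<in> verts G"
  shows "v \<in> verts G"
  using assms(2,3) by (cases k) (auto dest: connected_graph_edgeD[OF assms(1)])

lemma vball_iff:
  assumes "connected_graph D G" "r \<in> verts G"
  shows "v \<in> vball G r n \<longleftrightarrow> (\<exists>k\<le>n. (r, v) \<in> edges G ^^ k)"
  using relpow_verts[OF assms(1) _ assms(2)] by (auto simp: vball_eq)

lemma vball_subset_verts: "vball G r n \<subseteq> verts G"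
  by (auto simp: vball_eq)

lemma root_in_vball [simp]: "r \<in> verts G \<Longrightarrow> r \<in> vball G r n"
  by (auto simp: vball_eq intro!: exI[of _ 0])

lemma vball_mono: "m \<le> n \<Longrightarrow> vball G r m \<subseteq> vball G r n"
  unfolding vball_eq using order_trans by blast

lemma vball_trans:
  assumes "s \<in> vball G r m" "v \<in> vball G s n"
  shows "v \<in> vball G r (m + n)"
proof -
  from assms obtain j k where jk: "j \<le> m" "(r, s) \<in> edges G ^^ j" "k \<le> n" "(s, v) \<in> edges G ^^ k"
    by (auto simp: vball_eq)
  then have "(r, v) \<in> edges G ^^ (j + k)" by (auto simp: relpow_add)
  then show ?thesis using jk assms by (auto simp: vball_eq intro!: exI[of _ "j + k"])
qed

lemma nbr_in_vball:
  assumes "connected_graph D G" "(r, s) \<in> edges G"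
  shows "s \<in> vball G r (Suc n)"
  using assms connected_graph_edgeD[OF assms] by (auto simp: vball_eq intro!: exI[of _ 1])

lemma finite_vball:
  assumes "connected_graph D G"
  shows "finite (vball G r n)"
proof (induction n)
  case 0
  then show ?case by (auto simp: vball_eq intro: finite_subset[of _ "{r}"])
next
  case (Suc n)
  have "vball G r (Suc n) \<subseteq> vball G r n \<union> (\<Union>u\<in>vball G r n. {v. (u, v) \<in> edges G})"
  proof
    fix v assume "v \<in> vball G r (Suc n)"
    then obtain k where k: "k \<le> Suc n" "(r, v) \<in> edges G ^^ k" "v \<in> verts G"
      by (auto simp: vball_eq)
    show "v \<in> vball G r n \<union> (\<Union>u\<in>vball G r n. {v. (u, v) \<in> edges G})"
    proof (cases "k \<le> n")
      case True then show ?thesis using k by (auto simp: vball_eq)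
    next
      case False
      then have "k = Suc n" using k by simp
      then obtain u where "(r, u) \<in> edges G ^^ n" "(u, v) \<in> edges G" using k(2) by auto
      moreover from this have "u \<in> vball G r n"
        using connected_graph_edgeD[OF assms] by (auto simp: vball_eq)
      ultimately show ?thesis by blast
    qed
  qed
  then show ?case
    using Suc connected_graph_finite_nbrs[OF assms] by (auto intro: finite_subset)
qed

lemma in_some_vball:
  assumes "connected_graph D G" "r \<in> verts G" "v \<in> verts G"
  obtains n where "v \<in> vball G r n"
proof -
  have "(r, v) \<in> (edges G)\<^sup>*" using assms by (auto simp: connected_graph_def)
  then obtain n where "(r, v) \<in> edges G ^^ n" by (auto dest: rtrancl_imp_relpow)
  then show ?thesis using assms that[of n] by (auto simp: vball_eq)
qed

text \<open>A path of length \<open>k\<close> that starts at distance \<open>j\<close> from the root stays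
  in the ball of radius \<open>j + k\<close>, where edges are preserved.\<close>
lemma ball_iso_path:
  assumes G: "connected_graph D G" "r \<in> verts G" and iso: "ball_iso \<phi> G r H p n"
    and u: "(r, u) \<in> edges G ^^ j"
  shows "(u, v) \<in> edges G ^^ k \<Longrightarrow> j + k \<le> n \<Longrightarrow> (\<phi> u, \<phi> v) \<in> edges H ^^ k"
proof (induction k arbitrary: v)
  case 0 then show ?case by simp
next
  case (Suc k)
  then obtain w where w: "(u, w) \<in> edges G ^^ k" "(w, v) \<in> edges G" by auto
  have rw: "(r, w) \<in> edges G ^^ (j + k)" using u w(1) by (auto simp: relpow_add)
  then have rv: "(r, v) \<in> edges G ^^ Suc (j + k)" using w(2) by auto
  have "w \<in> vball G r n" unfolding vball_iff[OF G] using rw Suc.prems(2) by (intro exI[of _ "j + k"]) auto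
  moreover have "v \<in> vball G r n" unfolding vball_iff[OF G] using rv Suc.prems(2) by (intro exI[of _ "Suc (j + k)"]) auto
  ultimately have "(\<phi> w, \<phi> v) \<in> edges H"
    using iso w(2) unfolding ball_iso_def graph_iso_def edges_ball_graph by blast
  then show ?case using Suc w by auto
qed

lemma ball_iso_bij: "ball_iso \<phi> G r H p n \<Longrightarrow> bij_betw \<phi> (vball G r n) (vball H p n)"
  by (simp add: ball_iso_def graph_iso_def)

lemma ball_iso_mem: "ball_iso \<phi> G r H p n \<Longrightarrow> v \<in> vball G r n \<Longrightarrow> \<phi> v \<in> vball H p n"
  using ball_iso_bij bij_betw_apply by metis

lemma ball_iso_root: "ball_iso \<phi> G r H p n \<Longrightarrow> \<phi> r = p"
  by (simp add: ball_iso_def)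

lemma ball_iso_edge:
  "ball_iso \<phi> G r H p n \<Longrightarrow> u \<in> vball G r n \<Longrightarrow> v \<in> vball G r n \<Longrightarrow>
    (u, v) \<in> edges G \<longleftrightarrow> (\<phi> u, \<phi> v) \<in> edges H"
  using ball_iso_mem[of \<phi> G r H p n] by (auto simp: ball_iso_def graph_iso_def edges_ball_graph)

lemma ball_iso_inv:
  assumes "ball_iso \<phi> G r H p n" "r \<in> verts G"
  shows "ball_iso (inv_into (vball G r n) \<phi>) H p G r n"
  using assms graph_iso_inv graph_iso_inv_apply[of \<phi> "ball_graph G r n" _ r]
  by (auto simp: ball_iso_def)

lemma ball_iso_comp:
  "ball_iso \<phi> G r H p n \<Longrightarrow> ball_iso \<psi> H p K q n \<Longrightarrow> ball_iso (\<lambda>x. \<psi> (\<phi> x)) G r K q n"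
  by (auto simp: ball_iso_def intro: graph_iso_comp)

text \<open>A ball around a point of a ball depends on the larger ball only, so an isomorphism of balls
  restricts to balls around other centres, and in particular to smaller radii.\<close>

lemma ball_iso_recenter:
  assumes G: "connected_graph D G" "r \<in> verts G" and H: "connected_graph D H" "p \<in> verts H"
    and iso: "ball_iso \<phi> G r H p (m + n)" and s: "s \<in> vball G r m"
  shows "ball_iso \<phi> G s H (\<phi> s) n" "\<phi> s \<in> vball H p m"
proof -
  have aux: "\<phi>' s' \<in> vball H' p' m \<and> \<phi>' ` vball G' s' n \<subseteq> vball H' (\<phi>' s') n"
    if c: "connected_graph D G'" "r' \<in> verts G'" "connected_graph D H'" "p' \<in> verts H'"
      "ball_iso \<phi>' G' r' H' p' (m + n)" "s' \<in> vball G' r' m" for \<phi>' G' r' H' p' s'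
  proof -
    obtain j where j: "j \<le> m" "(r', s') \<in> edges G' ^^ j"
      using c(6) vball_iff[OF c(1,2)] by auto
    have s'': "s' \<in> verts G'" using c(6) vball_subset_verts by blast
    have 1: "(p', \<phi>' s') \<in> edges H' ^^ j"
      using ball_iso_path[OF c(1,2,5), of r' 0 s' j] j ball_iso_root[OF c(5)] by auto
    then have v: "\<phi>' s' \<in> verts H'" using relpow_verts[OF c(3) _ c(4)] by blast
    have "\<phi>' v \<in> vball H' (\<phi>' s') n" if v': "v \<in> vball G' s' n" for v
      using v' ball_iso_path[OF c(1,2,5) j(2)] j(1)
      unfolding vball_iff[OF c(1) s''] vball_iff[OF c(3) v] by (meson add_mono)
    then show ?thesis using 1 j unfolding vball_iff[OF c(3,4)] by blast
  qed
  let ?\<psi> = "inv_into (vball G r (m + n)) \<phi>"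
  have fwd: "\<phi> s \<in> vball H p m" "\<phi> ` vball G s n \<subseteq> vball H (\<phi> s) n"
    using aux[OF G H iso s] by auto
  have sub: "vball G s n \<subseteq> vball G r (m + n)" using vball_trans[OF s] by blast
  have s_in: "s \<in> vball G r (m + n)" using s vball_mono[of m "m + n"] by auto
  have bij: "bij_betw \<phi> (vball G r (m + n)) (vball H p (m + n))" by (rule ball_iso_bij[OF iso])
  then have psi: "?\<psi> (\<phi> v) = v" if "v \<in> vball G r (m + n)" for v
    using that by (simp add: bij_betw_def)
  have bwd: "?\<psi> ` vball H (\<phi> s) n \<subseteq> vball G s n"
    using aux[OF H G ball_iso_inv[OF iso G(2)] fwd(1)] psi[OF s_in] by auto
  have subH: "vball H (\<phi> s) n \<subseteq> vball H p (m + n)" using vball_trans[OF fwd(1)] by blast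
  have "bij_betw \<phi> (vball G s n) (vball H (\<phi> s) n)"
    unfolding bij_betw_def
  proof
    show "inj_on \<phi> (vball G s n)" using bij sub by (auto simp: bij_betw_def intro: inj_on_subset)
    show "\<phi> ` vball G s n = vball H (\<phi> s) n"
    proof (rule equalityI[OF fwd(2)], rule subsetI)
      fix w assume w: "w \<in> vball H (\<phi> s) n"
      then have "\<phi> (?\<psi> w) = w" using subH bij by (auto intro: bij_betw_inv_into_right)
      then show "w \<in> \<phi> ` vball G s n" using w bwd by (metis image_eqI image_subset_iff)
    qed
  qed
  moreover have "(u, v) \<in> edges (ball_graph G s n) \<longleftrightarrow> (\<phi> u, \<phi> v) \<in> edges (ball_graph H (\<phi> s) n)"
    if "u \<in> vball G s n" "v \<in> vball G s n" for u v
    using that sub fwd(2) ball_iso_edge[OF iso, of u v] by (auto simp: edges_ball_graph)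
  ultimately show "ball_iso \<phi> G s H (\<phi> s) n" by (simp add: ball_iso_def graph_iso_def)
  show "\<phi> s \<in> vball H p m" by (rule fwd)
qed

lemma ball_iso_mono:
  assumes "connected_graph D G" "r \<in> verts G" "connected_graph D H" "p \<in> verts H"
    "ball_iso \<phi> G r H p n" "k \<le> n"
  shows "ball_iso \<phi> G r H p k"
  using ball_iso_recenter(1)[OF assms(1-4), of \<phi> "n - k" k r] assms ball_iso_root by fastforce

lemma ball_iso_vball:
  assumes "connected_graph D G" "r \<in> verts G" "connected_graph D H" "p \<in> verts H"
    "ball_iso \<phi> G r H p n" "k \<le> n"
  shows "bij_betw \<phi> (vball G r k) (vball H p k)"
  using ball_iso_bij[OF ball_iso_mono[OF assms]] .

lemma ball_iso_nbrs:
  assumes G: "connected_graph D G" "r \<in> verts G" and H: "connected_graph D H" "p \<in> verts H"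
    and iso: "ball_iso \<phi> G r H p (Suc n)" and s: "s \<in> vball G r n"
  shows "bij_betw \<phi> {t. (s, t) \<in> edges G} {t. (\<phi> s, t) \<in> edges H}"
proof -
  have i: "ball_iso \<phi> G s H (\<phi> s) 1"
    using ball_iso_recenter(1)[OF G H, of \<phi> n 1 s] iso s by simp
  have sG: "s \<in> verts G" and sH: "\<phi> s \<in> verts H"
    using s vball_subset_verts ball_iso_recenter(2)[OF G H, of \<phi> n 1 s] iso by auto
  have eq: "{t. (u, t) \<in> edges K} = {t \<in> vball K u 1. (u, t) \<in> edges K}" if "connected_graph D K" for K u
    using nbr_in_vball[OF that, of u _ 0] by auto
  have "bij_betw \<phi> {t \<in> vball G s 1. (s, t) \<in> edges G} {t \<in> vball H (\<phi> s) 1. (\<phi> s, t) \<in> edges H}"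
    unfolding bij_betw_def
  proof
    show "inj_on \<phi> {t \<in> vball G s 1. (s, t) \<in> edges G}"
      using ball_iso_bij[OF i] by (auto simp: bij_betw_def intro: inj_on_subset)
    show "\<phi> ` {t \<in> vball G s 1. (s, t) \<in> edges G} = {t \<in> vball H (\<phi> s) 1. (\<phi> s, t) \<in> edges H}"
    proof safe
      fix t assume t: "t \<in> vball H (\<phi> s) 1" "(\<phi> s, t) \<in> edges H"
      then obtain u where "u \<in> vball G s 1" "t = \<phi> u"
        using ball_iso_bij[OF i] by (auto simp: bij_betw_def)
      then show "t \<in> \<phi> ` {t \<in> vball G s 1. (s, t) \<in> edges G}"
        using t ball_iso_edge[OF i, of s u] sG by auto
    qed (use ball_iso_edge[OF i, of s] ball_iso_mem[OF i] sG in auto)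
  qed
  then show ?thesis unfolding eq[OF G(1)] eq[OF H(1)] .
qed

lemma ball_iso_deg:
  assumes "connected_graph D G" "r \<in> verts G" "connected_graph D H" "p \<in> verts H"
    "ball_iso \<phi> G r H p (Suc n)" "s \<in> vball G r n"
  shows "deg (edges H) (\<phi> s) = deg (edges G) s"
  using bij_betw_same_card[OF ball_iso_nbrs[OF assms]] by (simp add: deg_def)

lemma graph_iso_path:
  assumes G: "connected_graph D G" and iso: "graph_iso \<phi> G H"
  shows "(u, v) \<in> edges G ^^ k \<Longrightarrow> (\<phi> u, \<phi> v) \<in> edges H ^^ k"
proof (induction k arbitrary: v)
  case (Suc k)
  then obtain w where w: "(u, w) \<in> edges G ^^ k" "(w, v) \<in> edges G" by auto
  then have "(\<phi> w, \<phi> v) \<in> edges H"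
    using iso connected_graph_edgeD[OF G w(2)] by (auto simp: graph_iso_def)
  then show ?case using Suc w by auto
qed auto

lemma graph_iso_ball_iso:
  assumes G: "connected_graph D G" "r \<in> verts G" and H: "connected_graph D H"
    and iso: "graph_iso \<phi> G H"
  shows "ball_iso \<phi> G r H (\<phi> r) n"
proof -
  have b: "bij_betw \<phi> (verts G) (verts H)" using iso by (simp add: graph_iso_def)
  then have pr: "\<phi> r \<in> verts H" using G by (auto dest: bij_betw_apply)
  have "\<phi> ` vball G r n = vball H (\<phi> r) n"
  proof safe
    fix v assume "v \<in> vball G r n"
    then show "\<phi> v \<in> vball H (\<phi> r) n"
      unfolding vball_iff[OF G] vball_iff[OF H pr] using graph_iso_path[OF G(1) iso] by blast
  next
    fix w assume w: "w \<in> vball H (\<phi> r) n"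
    then obtain k where k: "k \<le> n" "(\<phi> r, w) \<in> edges H ^^ k" unfolding vball_iff[OF H pr] by blast
    let ?\<psi> = "inv_into (verts G) \<phi>"
    have "(r, ?\<psi> w) \<in> edges G ^^ k"
      using graph_iso_path[OF H graph_iso_inv[OF iso] k(2)] graph_iso_inv_apply[OF iso G(2)] by simp
    then have "?\<psi> w \<in> vball G r n" unfolding vball_iff[OF G] using k by blast
    moreover have "\<phi> (?\<psi> w) = w"
      using w vball_subset_verts b by (metis bij_betw_inv_into_right subsetD)
    ultimately show "w \<in> \<phi> ` vball G r n" by (metis image_eqI)
  qed
  moreover have "inj_on \<phi> (vball G r n)"
    using b vball_subset_verts unfolding bij_betw_def by (blast intro: inj_on_subset)
  ultimately show ?thesis using iso vball_subset_verts[of G r n]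
    unfolding ball_iso_def graph_iso_def edges_ball_graph bij_betw_def by blast
qed

section \<open>Measurability of local properties\<close>

lemma countable_finite_graphs: "countable {K :: graph. finite (verts K) \<and> finite (edges K)}"
proof -
  have "{K :: graph. finite (verts K) \<and> finite (edges K)} \<subseteq>
      (\<lambda>(V, E). \<lparr>verts = V, edges = E\<rparr>) ` ({V. finite V \<and> V \<subseteq> UNIV} \<times> {E. finite E \<and> E \<subseteq> UNIV})"
  proof
    fix K :: graph assume K: "K \<in> {K. finite (verts K) \<and> finite (edges K)}"
    have "K = (\<lambda>(V, E). \<lparr>verts = V, edges = E\<rparr>) (verts K, edges K)" by simp
    then show "K \<in> (\<lambda>(V, E). \<lparr>verts = V, edges = E\<rparr>) ` ({V. finite V \<and> V \<subseteq> UNIV} \<times> {E. finite E \<and> E \<subseteq> UNIV})"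
      using K by (intro image_eqI[of _ _ "(verts K, edges K)"]) auto
  qed
  then show ?thesis
    by (rule countable_subset)
       (intro countable_image countable_SIGMA countable_Collect_finite_subset; simp)
qed

lemma finite_ball_graph:
  "connected_graph D G \<Longrightarrow> finite (verts (ball_graph G r n)) \<and> finite (edges (ball_graph G r n))"
  using finite_vball[of D G r n] by (auto simp: edges_ball_graph intro: finite_subset)

subsection \<open>Rooted graphs\<close>

lemma space_rooted_space: "space (rooted_space D) = rooted_graphs D // rooted_iso D"
  by (simp add: rooted_space_def space_measure_of_conv)

lemma rclass_in_space: "(G, r) \<in> rooted_graphs D \<Longrightarrow> rclass D G r \<in> space (rooted_space D)"
  by (simp add: space_rooted_space rclass_def quotientI)

lemma rclass_eq_iff:
  assumes "(G, r) \<in> rooted_graphs D" "(H, p) \<in> rooted_graphs D"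
  shows "rclass D G r = rclass D H p \<longleftrightarrow> (\<exists>\<phi>. graph_iso \<phi> G H \<and> \<phi> r = p)"
  unfolding rclass_def using eq_equiv_class_iff[OF equiv_rooted_iso assms] assms
  by (simp add: rooted_iso_def)

lemma rep_rooted:
  assumes "c \<in> space (rooted_space D)"
  shows "(rep_graph c, rep_root c) \<in> rooted_graphs D" "rclass D (rep_graph c) (rep_root c) = c"
proof -
  obtain G r where Gr: "(G, r) \<in> rooted_graphs D" "c = rooted_iso D `` {(G, r)}"
    using assms by (auto simp: space_rooted_space elim!: quotientE)
  have "(G, r) \<in> c" using Gr equiv_class_self[OF equiv_rooted_iso] by simp
  then have "(SOME x. x \<in> c) \<in> c" by (rule someI)
  then have "(rep_graph c, rep_root c) \<in> c" by (simp add: rep_graph_def rep_root_def)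
  then have *: "((G, r), (rep_graph c, rep_root c)) \<in> rooted_iso D" using Gr by simp
  then show "(rep_graph c, rep_root c) \<in> rooted_graphs D" by (simp add: rooted_iso_def)
  show "rclass D (rep_graph c) (rep_root c) = c"
    using equiv_class_eq[OF equiv_rooted_iso *] Gr by (simp add: rclass_def)
qed

lemma rep_rclass_iso:
  assumes "(G, r) \<in> rooted_graphs D"
  obtains \<phi> where "graph_iso \<phi> G (rep_graph (rclass D G r))" "\<phi> r = rep_root (rclass D G r)"
  using rep_rooted[OF rclass_in_space[OF assms]] rclass_eq_iff[OF assms] by metis

lemma rclass_in_cylinder_iff:
  assumes "(G, r) \<in> rooted_graphs D"
  shows "rclass D G r \<in> cylinder D H p n \<longleftrightarrow> (\<exists>\<phi>. ball_iso \<phi> G r H p n)"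
proof
  assume "rclass D G r \<in> cylinder D H p n"
  then obtain G' r' \<phi> where 1: "rclass D G r = rclass D G' r'" "(G', r') \<in> rooted_graphs D"
    "ball_iso \<phi> G' r' H p n" by (auto simp: cylinder_def ball_iso_def)
  then obtain \<theta> where "graph_iso \<theta> G G'" "\<theta> r = r'" using rclass_eq_iff[OF assms 1(2)] by auto
  then have "ball_iso \<theta> G r G' r' n"
    using graph_iso_ball_iso[of D G r G' \<theta> n] assms 1 by (auto simp: rooted_graphs_iff)
  then show "\<exists>\<phi>. ball_iso \<phi> G r H p n" using ball_iso_comp 1 by blast
qed (use assms in \<open>auto simp: cylinder_def ball_iso_def\<close>)

lemma cylinder_subset: "cylinder D H p n \<subseteq> space (rooted_space D)"
  by (auto simp: cylinder_def intro: rclass_in_space)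

lemma sets_rooted_space:
  "sets (rooted_space D) = sigma_sets (rooted_graphs D // rooted_iso D)
     {cylinder D H p n | H p n. (H, p) \<in> rooted_graphs D}"
  unfolding rooted_space_def by (rule sets_measure_of) (use cylinder_subset space_rooted_space in blast)

lemma cylinder_sets: "(H, p) \<in> rooted_graphs D \<Longrightarrow> cylinder D H p n \<in> sets (rooted_space D)"
  unfolding sets_rooted_space by (rule sigma_sets.Basic) blast

text \<open>The topology of local convergence, expressed through representatives.\<close>
definition ropen :: "nat \<Rightarrow> rooted_class set \<Rightarrow> bool" where
  "ropen D U \<longleftrightarrow> U \<subseteq> space (rooted_space D) \<and>
     (\<forall>G r. (G, r) \<in> rooted_graphs D \<and> rclass D G r \<in> U \<longrightarrow>
       (\<exists>n. \<forall>H p \<phi>. (H, p) \<in> rooted_graphs D \<and> ball_iso \<phi> G r H p n \<longrightarrow> rclass D H p \<in> U))"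

lemma countable_cylinders: "countable {cylinder D H p n | H p n. (H, p) \<in> rooted_graphs D}"
proof -
  let ?F = "\<lambda>(K, p, n). {rclass D G r | G r. (G, r) \<in> rooted_graphs D \<and>
     (\<exists>\<phi>. graph_iso \<phi> (ball_graph G r n) K \<and> \<phi> r = p)}"
  have "{cylinder D H p n | H p n. (H, p) \<in> rooted_graphs D} \<subseteq>
    ?F ` ({K. finite (verts K) \<and> finite (edges K)} \<times> (UNIV \<times> UNIV))"
  proof safe
    fix H p n assume "(H, p) \<in> rooted_graphs D"
    then have "finite (verts (ball_graph H p n)) \<and> finite (edges (ball_graph H p n))"
      using finite_ball_graph by (auto simp: rooted_graphs_iff)
    then show "cylinder D H p n \<in> ?F ` ({K. finite (verts K) \<and> finite (edges K)} \<times> (UNIV \<times> UNIV))"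
      by (intro image_eqI[of _ _ "(ball_graph H p n, p, n)"]) (auto simp: cylinder_def)
  qed
  then show ?thesis
    by (rule countable_subset) (intro countable_image countable_SIGMA countable_finite_graphs; simp)
qed

text \<open>There are countably many finite graphs and hence countably many cylinders, so arbitrary unions
  of cylinders are measurable.\<close>
lemma ropen_sets:
  assumes "ropen D U"
  shows "U \<in> sets (rooted_space D)"
proof -
  let ?C = "{cylinder D H p n | H p n. (H, p) \<in> rooted_graphs D}"
  have "U = \<Union>{C \<in> ?C. C \<subseteq> U}"
  proof (rule equalityI)
    show "U \<subseteq> \<Union>{C \<in> ?C. C \<subseteq> U}"
    proof
      fix c assume c: "c \<in> U"
      then have cs: "c \<in> space (rooted_space D)" using assms by (auto simp: ropen_def)
      let ?G = "rep_graph c" and ?r = "rep_root c"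
      note rep = rep_rooted[OF cs]
      obtain n where n: "\<And>H p \<phi>. (H, p) \<in> rooted_graphs D \<Longrightarrow> ball_iso \<phi> ?G ?r H p n \<Longrightarrow> rclass D H p \<in> U"
        using assms rep c unfolding ropen_def by metis
      have "cylinder D ?G ?r n \<subseteq> U"
      proof
        fix d assume "d \<in> cylinder D ?G ?r n"
        then obtain H p \<phi> where "(H, p) \<in> rooted_graphs D" "d = rclass D H p" "ball_iso \<phi> H p ?G ?r n"
          by (auto simp: cylinder_def ball_iso_def)
        then show "d \<in> U" using n ball_iso_inv by (metis rooted_graphs_iff)
      qed
      moreover have "c \<in> cylinder D ?G ?r n"
        using rclass_in_cylinder_iff[OF rep(1), of ?G ?r n] rep(2) graph_iso_id
        by (auto simp: ball_iso_def)
      ultimately show "c \<in> \<Union>{C \<in> ?C. C \<subseteq> U}" using rep(1) by blast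
    qed
  qed blast
  moreover have "\<Union>{C \<in> ?C. C \<subseteq> U} \<in> sets (rooted_space D)"
  proof (rule sets.countable_Union)
    show "countable {C \<in> ?C. C \<subseteq> U}" by (rule countable_subset[OF _ countable_cylinders]) blast
  qed (use cylinder_sets in blast)
  ultimately show ?thesis by simp
qed

text \<open>Functions that see only a bounded neighbourhood of the root. They are invariant under
  isomorphism and constant on the members of a countable partition into cylinders, which makes
  them measurable.\<close>
definition local_fun :: "nat \<Rightarrow> nat \<Rightarrow> (graph \<Rightarrow> nat \<Rightarrow> 'a) \<Rightarrow> bool" where
  "local_fun D n P \<longleftrightarrow> (\<forall>G r H p \<phi>. (G, r) \<in> rooted_graphs D \<longrightarrow> (H, p) \<in> rooted_graphs D \<longrightarrow>
     ball_iso \<phi> G r H p n \<longrightarrow> P G r = P H p)"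

lemma local_funD:
  "local_fun D n P \<Longrightarrow> (G, r) \<in> rooted_graphs D \<Longrightarrow> (H, p) \<in> rooted_graphs D \<Longrightarrow>
    ball_iso \<phi> G r H p n \<Longrightarrow> P G r = P H p"
  unfolding local_fun_def by blast

lemma local_fun_rep:
  assumes "local_fun D n P" "(G, r) \<in> rooted_graphs D"
  shows "P (rep_graph (rclass D G r)) (rep_root (rclass D G r)) = P G r"
proof -
  obtain \<phi> where \<phi>: "graph_iso \<phi> G (rep_graph (rclass D G r))" "\<phi> r = rep_root (rclass D G r)"
    using rep_rclass_iso[OF assms(2)] .
  have rep: "(rep_graph (rclass D G r), rep_root (rclass D G r)) \<in> rooted_graphs D"
    using rep_rooted rclass_in_space assms(2) by blast
  have "ball_iso \<phi> G r (rep_graph (rclass D G r)) (rep_root (rclass D G r)) n"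
    using graph_iso_ball_iso[of D G r "rep_graph (rclass D G r)" \<phi> n] \<phi> assms rep
    by (auto simp: rooted_graphs_iff)
  then show ?thesis using local_funD[OF assms rep] by simp
qed

lemma measurable_local_fun:
  assumes "local_fun D n P"
  shows "(\<lambda>c. P (rep_graph c) (rep_root c)) \<in> rooted_space D \<rightarrow>\<^sub>M count_space UNIV"
proof (rule measurableI)
  fix A
  let ?U = "(\<lambda>c. P (rep_graph c) (rep_root c)) -` A \<inter> space (rooted_space D)"
  have "ropen D ?U"
    unfolding ropen_def
  proof safe
    fix G r assume *: "(G, r) \<in> rooted_graphs D" 
      "P (rep_graph (rclass D G r)) (rep_root (rclass D G r)) \<in> A"
    show "\<exists>n. \<forall>H p \<phi>. (H, p) \<in> rooted_graphs D \<and> ball_iso \<phi> G r H p n \<longrightarrow> rclass D H p \<in> ?U"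
    proof (intro exI[of _ n] allI impI)
      fix H p \<phi> assume H: "(H, p) \<in> rooted_graphs D \<and> ball_iso \<phi> G r H p n"
      then show "rclass D H p \<in> ?U"
        using * local_fun_rep[OF assms] local_funD[OF assms, of G r H p \<phi>] rclass_in_space by auto
    qed
  qed
  then show "?U \<in> sets (rooted_space D)" by (rule ropen_sets)
qed simp

lemma local_fun_mono:
  assumes "local_fun D n P" "n \<le> m"
  shows "local_fun D m P"
  unfolding local_fun_def using local_funD[OF assms(1)] ball_iso_mono assms(2)
  by (metis rooted_graphs_iff)

lemma local_fun_comp: "local_fun D n P \<Longrightarrow> local_fun D n (\<lambda>G r. f (P G r))"
  unfolding local_fun_def by metis

lemma local_fun_comp2:
  "local_fun D n P \<Longrightarrow> local_fun D n Q \<Longrightarrow> local_fun D n (\<lambda>G r. f (P G r) (Q G r))"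
  unfolding local_fun_def by metis

lemma local_fun_deg: "local_fun D (Suc n) (\<lambda>G r. deg (edges G) r)"
  unfolding local_fun_def using ball_iso_deg ball_iso_root root_in_vball
  by (metis rooted_graphs_iff)

lemma local_fun_ex_nbr:
  assumes "local_fun D n P"
  shows "local_fun D (Suc n) (\<lambda>G r. \<exists>s. (r, s) \<in> edges G \<and> P G s)"
  unfolding local_fun_def
proof safe
  have aux: "\<exists>s. (p, s) \<in> edges H \<and> P H s"
    if c: "(G, r) \<in> rooted_graphs D" "(H, p) \<in> rooted_graphs D" "ball_iso \<phi> G r H p (Suc n)"
      "(r, s) \<in> edges G" "P G s" for G r H p \<phi> s
  proof -
    have G: "connected_graph D G" "r \<in> verts G" and H: "connected_graph D H" "p \<in> verts H"
      using c by (auto simp: rooted_graphs_iff)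
    have s1: "s \<in> vball G r 1" using nbr_in_vball[OF G(1) c(4), of 0] by simp
    have "ball_iso \<phi> G s H (\<phi> s) n" "\<phi> s \<in> vball H p 1"
      using ball_iso_recenter[OF G H, of \<phi> 1 n s] s1 c by auto
    moreover have "(p, \<phi> s) \<in> edges H"
      using ball_iso_edge[OF c(3), of r s] nbr_in_vball[OF G(1) c(4)] G c ball_iso_root[OF c(3)] by auto
    ultimately show ?thesis
      using local_funD[OF assms, of G s H "\<phi> s" \<phi>] c connected_graph_edgeD G H
      by (auto simp: rooted_graphs_iff)
  qed
  fix G r H p \<phi> s
  assume c: "(G, r) \<in> rooted_graphs D" "(H, p) \<in> rooted_graphs D" "ball_iso \<phi> G r H p (Suc n)"
  { assume "(r, s) \<in> edges G" "P G s" then show "\<exists>s. (p, s) \<in> edges H \<and> P H s" using aux c by blast }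
  { assume "(p, s) \<in> edges H" "P H s"
    moreover have "ball_iso (inv_into (vball G r (Suc n)) \<phi>) H p G r (Suc n)"
      using ball_iso_inv c by (auto simp: rooted_graphs_iff)
    ultimately show "\<exists>s. (r, s) \<in> edges G \<and> P G s" using aux c by blast }
qed

subsection \<open>Doubly rooted graphs\<close>

lemma doubly_rooted_graphs_iff:
  "(G, r, s) \<in> doubly_rooted_graphs D \<longleftrightarrow> connected_graph D G \<and> r \<in> verts G \<and> s \<in> verts G"
  by (simp add: doubly_rooted_graphs_def)

lemma space_doubly_rooted_space:
  "space (doubly_rooted_space D) = doubly_rooted_graphs D // doubly_rooted_iso D"
  by (simp add: doubly_rooted_space_def space_measure_of_conv)

lemma drclass_in_space:
  "(G, r, s) \<in> doubly_rooted_graphs D \<Longrightarrow> drclass D G r s \<in> space (doubly_rooted_space D)"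
  by (simp add: space_doubly_rooted_space drclass_def quotientI)

lemma drclass_eq_iff:
  assumes "(G, r, s) \<in> doubly_rooted_graphs D" "(H, p, q) \<in> doubly_rooted_graphs D"
  shows "drclass D G r s = drclass D H p q \<longleftrightarrow> (\<exists>\<phi>. graph_iso \<phi> G H \<and> \<phi> r = p \<and> \<phi> s = q)"
  unfolding drclass_def using eq_equiv_class_iff[OF equiv_doubly_rooted_iso assms] assms
  by (simp add: doubly_rooted_iso_def)

lemma drclass_cases:
  assumes "c \<in> space (doubly_rooted_space D)"
  obtains G r s where "(G, r, s) \<in> doubly_rooted_graphs D" "c = drclass D G r s"
proof -
  from assms obtain x where x: "x \<in> doubly_rooted_graphs D" "c = doubly_rooted_iso D `` {x}"
    by (auto simp: space_doubly_rooted_space elim!: quotientE)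
  obtain G r s where "x = (G, r, s)" by (cases x)
  then show ?thesis using x that[of G r s] by (simp add: drclass_def)
qed

lemma doubly_cylinder_subset: "doubly_cylinder D H p q n \<subseteq> space (doubly_rooted_space D)"
  by (auto simp: doubly_cylinder_def intro: drclass_in_space)

lemma drclass_in_doubly_cylinder_iff:
  assumes "(G, r, s) \<in> doubly_rooted_graphs D"
  shows "drclass D G r s \<in> doubly_cylinder D H p q n \<longleftrightarrow>
    s \<in> vball G r n \<and> (\<exists>\<phi>. ball_iso \<phi> G r H p n \<and> \<phi> s = q)"
proof
  assume "drclass D G r s \<in> doubly_cylinder D H p q n"
  then obtain G' r' s' \<phi> where 1: "drclass D G r s = drclass D G' r' s'"
    "(G', r', s') \<in> doubly_rooted_graphs D" "s' \<in> vball G' r' n"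
    "ball_iso \<phi> G' r' H p n" "\<phi> s' = q" by (auto simp: doubly_cylinder_def ball_iso_def)
  then obtain \<theta> where \<theta>: "graph_iso \<theta> G' G" "\<theta> r' = r" "\<theta> s' = s"
    using drclass_eq_iff[OF 1(2) assms] by auto
  then have i: "ball_iso \<theta> G' r' G r n"
    using graph_iso_ball_iso[of D G' r' G \<theta> n] assms 1 by (auto simp: doubly_rooted_graphs_iff)
  have r': "r' \<in> verts G'" using 1 by (auto simp: doubly_rooted_graphs_iff)
  let ?\<psi> = "inv_into (vball G' r' n) \<theta>"
  have "ball_iso ?\<psi> G r G' r' n" by (rule ball_iso_inv[OF i r'])
  moreover have "?\<psi> s = s'" using ball_iso_bij[OF i] 1(3) \<theta>(3) by (auto simp: bij_betw_def)
  moreover have "s \<in> vball G r n" using ball_iso_mem[OF i 1(3)] \<theta> by simp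
  ultimately show "s \<in> vball G r n \<and> (\<exists>\<phi>. ball_iso \<phi> G r H p n \<and> \<phi> s = q)"
    using ball_iso_comp[OF _ 1(4)] 1(5) by blast
qed (use assms in \<open>auto simp: doubly_cylinder_def ball_iso_def\<close>)

lemma sets_doubly_rooted_space:
  "sets (doubly_rooted_space D) = sigma_sets (doubly_rooted_graphs D // doubly_rooted_iso D)
     {doubly_cylinder D H p q n | H p q n. (H, p, q) \<in> doubly_rooted_graphs D}"
  unfolding doubly_rooted_space_def
  by (rule sets_measure_of) (use doubly_cylinder_subset space_doubly_rooted_space in blast)

text \<open>The witnessing ball around the first root has to contain the second root, which is then located
  by the isomorphism of balls.\<close>
definition dopen :: "nat \<Rightarrow> doubly_rooted_class set \<Rightarrow> bool" where
  "dopen D U \<longleftrightarrow> U \<subseteq> space (doubly_rooted_space D) \<and>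
     (\<forall>G r s. (G, r, s) \<in> doubly_rooted_graphs D \<and> drclass D G r s \<in> U \<longrightarrow>
       (\<exists>n. s \<in> vball G r n \<and> (\<forall>H p \<phi>. (H, p) \<in> rooted_graphs D \<and> ball_iso \<phi> G r H p n \<longrightarrow>
          drclass D H p (\<phi> s) \<in> U)))"

lemma countable_doubly_cylinders:
  "countable {doubly_cylinder D H p q n | H p q n. (H, p, q) \<in> doubly_rooted_graphs D}"
proof -
  let ?F = "\<lambda>(K, p, q, n). {drclass D G r s | G r s. (G, r, s) \<in> doubly_rooted_graphs D \<and>
     s \<in> verts (ball_graph G r n) \<and>
     (\<exists>\<phi>. graph_iso \<phi> (ball_graph G r n) K \<and> \<phi> r = p \<and> \<phi> s = q)}"
  have "{doubly_cylinder D H p q n | H p q n. (H, p, q) \<in> doubly_rooted_graphs D} \<subseteq>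
    ?F ` ({K. finite (verts K) \<and> finite (edges K)} \<times> (UNIV \<times> (UNIV \<times> UNIV)))"
  proof safe
    fix H p q n assume "(H, p, q) \<in> doubly_rooted_graphs D"
    then have "finite (verts (ball_graph H p n)) \<and> finite (edges (ball_graph H p n))"
      using finite_ball_graph by (auto simp: doubly_rooted_graphs_iff)
    then show "doubly_cylinder D H p q n \<in>
        ?F ` ({K. finite (verts K) \<and> finite (edges K)} \<times> (UNIV \<times> (UNIV \<times> UNIV)))"
      by (intro image_eqI[of _ _ "(ball_graph H p n, p, q, n)"]) (auto simp: doubly_cylinder_def)
  qed
  then show ?thesis
    by (rule countable_subset) (intro countable_image countable_SIGMA countable_finite_graphs; simp)
qed

lemma dopen_sets:
  assumes "dopen D U"
  shows "U \<in> sets (doubly_rooted_space D)"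
proof -
  let ?C = "{doubly_cylinder D H p q n | H p q n. (H, p, q) \<in> doubly_rooted_graphs D}"
  have "U = \<Union>{C \<in> ?C. C \<subseteq> U}"
  proof (rule equalityI)
    show "U \<subseteq> \<Union>{C \<in> ?C. C \<subseteq> U}"
    proof
      fix c assume c: "c \<in> U"
      then obtain G r s where Grs: "(G, r, s) \<in> doubly_rooted_graphs D" "c = drclass D G r s"
        using drclass_cases assms unfolding dopen_def by (metis subsetD)
      then obtain n where n: "s \<in> vball G r n" "\<And>H p \<phi>. (H, p) \<in> rooted_graphs D \<Longrightarrow> ball_iso \<phi> G r H p n \<Longrightarrow> drclass D H p (\<phi> s) \<in> U"
        using assms c[unfolded Grs(2)] Grs(1) unfolding dopen_def by blast
      have "doubly_cylinder D G r s n \<subseteq> U"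
      proof
        fix d assume "d \<in> doubly_cylinder D G r s n"
        then obtain H p q \<phi> where H: "(H, p, q) \<in> doubly_rooted_graphs D" "d = drclass D H p q"
          "q \<in> vball H p n" "ball_iso \<phi> H p G r n" "\<phi> q = s"
          by (auto simp: doubly_cylinder_def ball_iso_def)
        have "inv_into (vball H p n) \<phi> s = q" using ball_iso_bij[OF H(4)] H by (auto simp: bij_betw_def)
        moreover have "ball_iso (inv_into (vball H p n) \<phi>) G r H p n"
          using ball_iso_inv[OF H(4)] H by (auto simp: doubly_rooted_graphs_iff)
        ultimately show "d \<in> U" using n(2) H by (metis rooted_graphs_iff doubly_rooted_graphs_iff)
      qed
      moreover have "c \<in> doubly_cylinder D G r s n"
        using drclass_in_doubly_cylinder_iff[OF Grs(1), of G r s n] Grs(2) n(1) graph_iso_id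
        by (auto simp: ball_iso_def)
      ultimately show "c \<in> \<Union>{C \<in> ?C. C \<subseteq> U}" using Grs(1) by blast
    qed
  qed blast
  moreover have "\<Union>{C \<in> ?C. C \<subseteq> U} \<in> sets (doubly_rooted_space D)"
  proof (rule sets.countable_Union)
    show "countable {C \<in> ?C. C \<subseteq> U}" by (rule countable_subset[OF _ countable_doubly_cylinders]) blast
    show "{C \<in> ?C. C \<subseteq> U} \<subseteq> sets (doubly_rooted_space D)" unfolding sets_doubly_rooted_space by blast
  qed
  ultimately show ?thesis by simp
qed

lemma dopen_doubly_cylinder:
  assumes "(H, p, q) \<in> doubly_rooted_graphs D"
  shows "dopen D (doubly_cylinder D H p q n)"
  unfolding dopen_def
proof safe
  fix G r s assume G: "(G, r, s) \<in> doubly_rooted_graphs D" "drclass D G r s \<in> doubly_cylinder D H p q n"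
  then obtain \<psi> where psi: "s \<in> vball G r n" "ball_iso \<psi> G r H p n" "\<psi> s = q"
    using drclass_in_doubly_cylinder_iff by blast
  show "\<exists>m. s \<in> vball G r m \<and> (\<forall>K k \<phi>. (K, k) \<in> rooted_graphs D \<and> ball_iso \<phi> G r K k m \<longrightarrow>
          drclass D K k (\<phi> s) \<in> doubly_cylinder D H p q n)"
  proof (intro exI[of _ n] conjI allI impI)
    fix K k \<phi> assume K: "(K, k) \<in> rooted_graphs D \<and> ball_iso \<phi> G r K k n"
    have s': "\<phi> s \<in> vball K k n" using ball_iso_mem K psi by blast
    have "ball_iso (inv_into (vball G r n) \<phi>) K k G r n"
      using ball_iso_inv K G by (auto simp: doubly_rooted_graphs_iff)
    then have "ball_iso (\<lambda>x. \<psi> (inv_into (vball G r n) \<phi> x)) K k H p n"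
      using ball_iso_comp psi by blast
    moreover have "inv_into (vball G r n) \<phi> (\<phi> s) = s"
      using K psi ball_iso_bij by (fastforce simp: bij_betw_def)
    moreover have "(K, k, \<phi> s) \<in> doubly_rooted_graphs D"
      using K s' vball_subset_verts by (auto simp: doubly_rooted_graphs_iff rooted_graphs_iff)
    ultimately show "drclass D K k (\<phi> s) \<in> doubly_cylinder D H p q n"
      using drclass_in_doubly_cylinder_iff s' psi by auto
  qed (rule psi)
qed (use doubly_cylinder_subset in blast)

lemma dopen_Int:
  assumes "dopen D U" "dopen D V"
  shows "dopen D (U \<inter> V)"
  unfolding dopen_def
proof safe
  fix G r s assume G: "(G, r, s) \<in> doubly_rooted_graphs D" "drclass D G r s \<in> U" "drclass D G r s \<in> V"
  then have Gc: "connected_graph D G" "r \<in> verts G" by (auto simp: doubly_rooted_graphs_iff)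
  obtain m where m: "s \<in> vball G r m" "\<And>H p \<phi>. (H, p) \<in> rooted_graphs D \<Longrightarrow> ball_iso \<phi> G r H p m \<Longrightarrow> drclass D H p (\<phi> s) \<in> U"
    using assms(1) G unfolding dopen_def by blast
  obtain n where n: "s \<in> vball G r n" "\<And>H p \<phi>. (H, p) \<in> rooted_graphs D \<Longrightarrow> ball_iso \<phi> G r H p n \<Longrightarrow> drclass D H p (\<phi> s) \<in> V"
    using assms(2) G unfolding dopen_def by blast
  show "\<exists>n. s \<in> vball G r n \<and> (\<forall>H p \<phi>. (H, p) \<in> rooted_graphs D \<and> ball_iso \<phi> G r H p n \<longrightarrow>
      drclass D H p (\<phi> s) \<in> U \<inter> V)"
    apply (intro exI[of _ "max m n"] conjI allI impI)
    using m(1) vball_mono[of m "max m n" G r] apply auto[1]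
    using m(2) n(2) ball_iso_mono[OF Gc] by (metis IntI max.cobounded1 max.cobounded2 rooted_graphs_iff)
qed (use assms in \<open>auto simp: dopen_def\<close>)

text \<open>Open sets are closed under intersection and can thus serve as the basis of an induction over the
  measurable sets.\<close>
lemma sets_doubly_rooted_space_dopen:
  "sets (doubly_rooted_space D) = sigma_sets (space (doubly_rooted_space D)) {U. dopen D U}"
proof
  show "sets (doubly_rooted_space D) \<subseteq> sigma_sets (space (doubly_rooted_space D)) {U. dopen D U}"
    unfolding sets_doubly_rooted_space space_doubly_rooted_space
    by (rule sigma_sets_mono') (use dopen_doubly_cylinder in blast)
  show "sigma_sets (space (doubly_rooted_space D)) {U. dopen D U} \<subseteq> sets (doubly_rooted_space D)"
    by (rule sets.sigma_sets_subset) (use dopen_sets in blast)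
qed

subsection \<open>Labelled graphs\<close>

lemma labelled_graphs_iff:
  "(G, \<xi>, r) \<in> labelled_graphs D \<longleftrightarrow> connected_graph D G \<and> \<xi> \<in> verts G \<rightarrow>\<^sub>E {0..1} \<and> r \<in> verts G"
  by (simp add: labelled_graphs_def)

lemma space_labelled_space: "space (labelled_space D) = labelled_graphs D // labelled_iso D"
  by (simp add: labelled_space_def space_measure_of_conv)

lemma lclass_in_space:
  "(G, \<xi>, r) \<in> labelled_graphs D \<Longrightarrow> lclass D G \<xi> r \<in> space (labelled_space D)"
  by (simp add: space_labelled_space lclass_def quotientI)

lemma lclass_eq_iff:
  assumes "(G, \<xi>, r) \<in> labelled_graphs D" "(H, \<eta>, p) \<in> labelled_graphs D"
  shows "lclass D G \<xi> r = lclass D H \<eta> p \<longleftrightarrow>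
    (\<exists>\<phi>. graph_iso \<phi> G H \<and> \<phi> r = p \<and> (\<forall>v\<in>verts G. \<eta> (\<phi> v) = \<xi> v))"
  unfolding lclass_def using eq_equiv_class_iff[OF equiv_labelled_iso assms] assms
  by (simp add: labelled_iso_def)

lemma lclass_cases:
  assumes "c \<in> space (labelled_space D)"
  obtains G \<xi> r where "(G, \<xi>, r) \<in> labelled_graphs D" "c = lclass D G \<xi> r"
proof -
  from assms obtain x where x: "x \<in> labelled_graphs D" "c = labelled_iso D `` {x}"
    by (auto simp: space_labelled_space elim!: quotientE)
  obtain G r s where "x = (G, r, s)" by (cases x)
  then show ?thesis using x that[of G r s] by (simp add: lclass_def)
qed

lemma labelled_cylinder_subset: "labelled_cylinder D H p n U \<subseteq> space (labelled_space D)"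
  by (auto simp: labelled_cylinder_def intro: lclass_in_space)

lemma lclass_in_labelled_cylinder_iff:
  assumes "(G, \<xi>, r) \<in> labelled_graphs D"
  shows "lclass D G \<xi> r \<in> labelled_cylinder D H p n U \<longleftrightarrow>
    (\<exists>\<phi>. ball_iso \<phi> G r H p n \<and> (\<forall>v\<in>vball G r n. \<xi> v \<in> U (\<phi> v)))"
proof
  assume "lclass D G \<xi> r \<in> labelled_cylinder D H p n U"
  then obtain G' \<xi>' r' \<phi> where 1: "lclass D G \<xi> r = lclass D G' \<xi>' r'"
    "(G', \<xi>', r') \<in> labelled_graphs D" 
    "ball_iso \<phi> G' r' H p n" "\<forall>v\<in>vball G' r' n. \<xi>' v \<in> U (\<phi> v)"
    by (auto simp: labelled_cylinder_def ball_iso_def)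
  then obtain \<theta> where \<theta>: "graph_iso \<theta> G G'" "\<theta> r = r'" "\<forall>v\<in>verts G. \<xi>' (\<theta> v) = \<xi> v"
    using lclass_eq_iff[OF assms 1(2)] by auto
  then have i: "ball_iso \<theta> G r G' r' n"
    using graph_iso_ball_iso[of D G r G' \<theta> n] assms 1 by (auto simp: labelled_graphs_iff)
  have "\<forall>v\<in>vball G r n. \<xi> v \<in> U (\<phi> (\<theta> v))"
    using 1(4) ball_iso_mem[OF i] \<theta>(3) vball_subset_verts by (metis subsetD)
  then show "\<exists>\<phi>. ball_iso \<phi> G r H p n \<and> (\<forall>v\<in>vball G r n. \<xi> v \<in> U (\<phi> v))"
    using ball_iso_comp[OF i 1(3)] by blast
qed (use assms in \<open>auto simp: labelled_cylinder_def ball_iso_def\<close>)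

lemma sets_labelled_space:
  "sets (labelled_space D) = sigma_sets (labelled_graphs D // labelled_iso D)
     {labelled_cylinder D H p n U | H p n U. (H, p) \<in> rooted_graphs D \<and> (\<forall>v. open (U v))}"
  unfolding labelled_space_def
  by (rule sets_measure_of) (use labelled_cylinder_subset space_labelled_space in blast)

text \<open>Two labelled graphs are close if large balls are isomorphic with almost the same labels.\<close>
definition lopen :: "nat \<Rightarrow> labelled_class set \<Rightarrow> bool" where
  "lopen D U \<longleftrightarrow> U \<subseteq> space (labelled_space D) \<and>
     (\<forall>G \<xi> r. (G, \<xi>, r) \<in> labelled_graphs D \<and> lclass D G \<xi> r \<in> U \<longrightarrow>
       (\<exists>n \<epsilon>. \<epsilon> > 0 \<and> (\<forall>H \<eta> p \<phi>. (H, \<eta>, p) \<in> labelled_graphs D \<and> ball_iso \<phi> G r H p n \<and>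
          (\<forall>v\<in>vball G r n. \<bar>\<eta> (\<phi> v) - \<xi> v\<bar> < \<epsilon>) \<longrightarrow> lclass D H \<eta> p \<in> U)))"

lemma lopenD:
  assumes "lopen D U" "(G, \<xi>, r) \<in> labelled_graphs D" "lclass D G \<xi> r \<in> U"
  obtains n \<epsilon> where "\<epsilon> > 0" "\<And>H \<eta> p \<phi>. (H, \<eta>, p) \<in> labelled_graphs D \<Longrightarrow> ball_iso \<phi> G r H p n \<Longrightarrow>
    (\<forall>v\<in>vball G r n. \<bar>\<eta> (\<phi> v) - \<xi> v\<bar> < \<epsilon>) \<Longrightarrow> lclass D H \<eta> p \<in> U"
proof -
  note * = conjunct2[OF iffD1[OF lopen_def assms(1)], THEN spec, THEN spec, THEN spec, THEN mp,
      OF conjI[OF assms(2,3)]]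
  then obtain n \<epsilon> where "\<epsilon> > 0" and n: "\<forall>H \<eta> p \<phi>. (H, \<eta>, p) \<in> labelled_graphs D \<and> ball_iso \<phi> G r H p n \<and>
          (\<forall>v\<in>vball G r n. \<bar>\<eta> (\<phi> v) - \<xi> v\<bar> < \<epsilon>) \<longrightarrow> lclass D H \<eta> p \<in> U" by (elim exE conjE)
  show thesis
  proof (rule that[of \<epsilon> n])
    fix H \<eta> p \<phi>
    assume a: "(H, \<eta>, p) \<in> labelled_graphs D" "ball_iso \<phi> G r H p n" "\<forall>v\<in>vball G r n. \<bar>\<eta> (\<phi> v) - \<xi> v\<bar> < \<epsilon>"
    show "lclass D H \<eta> p \<in> U"
      by (rule n[THEN spec, THEN spec, THEN spec, THEN spec, THEN mp, OF conjI[OF a(1) conjI[OF a(2,3)]]])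
  qed fact
qed

text \<open>Finitely many rational intervals, listed by their end points, constrain the labels of finitely
  many vertices; there are countably many such lists.\<close>
definition rat_box :: "(rat \<times> rat) list \<Rightarrow> nat \<Rightarrow> real set" where
  "rat_box l v = (if v < length l then {of_rat (fst (l ! v))<..<of_rat (snd (l ! v))} else UNIV)"

lemma open_rat_box: "open (rat_box l v)"
  by (simp add: rat_box_def)

lemma ex_rat_box:
  assumes "finite B" "\<epsilon> > (0 :: real)"
  obtains l where "\<And>v. v \<in> B \<Longrightarrow> \<xi> v \<in> rat_box l v" "\<And>v y. v \<in> B \<Longrightarrow> y \<in> rat_box l v \<Longrightarrow> \<bar>y - \<xi> v\<bar> < \<epsilon>"
proof -
  have "\<exists>a b. \<xi> v - \<epsilon> < of_rat a \<and> of_rat a < \<xi> v \<and> \<xi> v < of_rat b \<and> of_rat b < \<xi> v + \<epsilon>" for v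
    using of_rat_dense[of "\<xi> v - \<epsilon>" "\<xi> v"] of_rat_dense[of "\<xi> v" "\<xi> v + \<epsilon>"] assms(2) by auto
  then obtain a b where ab: "\<And>v. \<xi> v - \<epsilon> < of_rat (a v) \<and> of_rat (a v) < \<xi> v \<and> \<xi> v < of_rat (b v) \<and> of_rat (b v) < \<xi> v + \<epsilon>"
    by metis
  obtain N where N: "\<And>v. v \<in> B \<Longrightarrow> v < N"
    using assms(1) by (meson finite_nat_set_iff_bounded)
  show ?thesis
  proof (rule that[of "map (\<lambda>v. (a v, b v)) [0..<N]"])
    fix v assume v: "v \<in> B"
    then have eq: "rat_box (map (\<lambda>v. (a v, b v)) [0..<N]) v = {of_rat (a v)<..<of_rat (b v)}"
      using N by (simp add: rat_box_def)
    show "\<xi> v \<in> rat_box (map (\<lambda>v. (a v, b v)) [0..<N]) v" using eq ab[of v] by simp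
    fix y assume "y \<in> rat_box (map (\<lambda>v. (a v, b v)) [0..<N]) v"
    then show "\<bar>y - \<xi> v\<bar> < \<epsilon>" using eq ab[of v] by auto
  qed
qed

lemma countable_rat_box_cylinders:
  "countable {labelled_cylinder D H p n (rat_box l) | H p n l. (H, p) \<in> rooted_graphs D}"
proof -
  let ?F = "\<lambda>(K, p, n, l). {lclass D G \<xi> r | G \<xi> r. (G, \<xi>, r) \<in> labelled_graphs D \<and>
     (\<exists>\<phi>. graph_iso \<phi> (ball_graph G r n) K \<and> \<phi> r = p \<and>
          (\<forall>v\<in>verts (ball_graph G r n). \<xi> v \<in> rat_box l (\<phi> v)))}"
  have "{labelled_cylinder D H p n (rat_box l) | H p n l. (H, p) \<in> rooted_graphs D} \<subseteq>
    ?F ` ({K. finite (verts K) \<and> finite (edges K)} \<times> (UNIV \<times> (UNIV \<times> UNIV)))"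
  proof safe
    fix H p n l assume "(H, p) \<in> rooted_graphs D"
    then have "finite (verts (ball_graph H p n)) \<and> finite (edges (ball_graph H p n))"
      using finite_ball_graph by (auto simp: rooted_graphs_iff)
    then show "labelled_cylinder D H p n (rat_box l) \<in>
        ?F ` ({K. finite (verts K) \<and> finite (edges K)} \<times> (UNIV \<times> (UNIV \<times> UNIV)))"
      by (intro image_eqI[of _ _ "(ball_graph H p n, p, n, l)"]) (auto simp: labelled_cylinder_def)
  qed
  then show ?thesis
    by (rule countable_subset) (intro countable_image countable_SIGMA countable_finite_graphs; simp)
qed

lemma lopen_sets:
  assumes "lopen D U"
  shows "U \<in> sets (labelled_space D)"
proof -
  let ?C = "{labelled_cylinder D H p n (rat_box l) | H p n l. (H, p) \<in> rooted_graphs D}"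
  have "U = \<Union>{C \<in> ?C. C \<subseteq> U}"
  proof (rule equalityI)
    show "U \<subseteq> \<Union>{C \<in> ?C. C \<subseteq> U}"
    proof
      fix c assume c: "c \<in> U"
      then obtain G \<xi> r where G: "(G, \<xi>, r) \<in> labelled_graphs D" "c = lclass D G \<xi> r"
        using lclass_cases assms unfolding lopen_def by (metis subsetD)
      then obtain n \<epsilon> where n: "\<epsilon> > 0" "\<And>H \<eta> p \<phi>. (H, \<eta>, p) \<in> labelled_graphs D \<Longrightarrow> ball_iso \<phi> G r H p n \<Longrightarrow>
          (\<forall>v\<in>vball G r n. \<bar>\<eta> (\<phi> v) - \<xi> v\<bar> < \<epsilon>) \<Longrightarrow> lclass D H \<eta> p \<in> U"
        using lopenD[OF assms G(1) c[unfolded G(2)]] by metis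
      have Gr: "(G, r) \<in> rooted_graphs D" using G by (auto simp: labelled_graphs_iff rooted_graphs_iff)
      have fin: "finite (vball G r n)" using finite_vball G by (auto simp: labelled_graphs_iff)
      obtain l where l: "\<And>v. v \<in> vball G r n \<Longrightarrow> \<xi> v \<in> rat_box l v"
        "\<And>v y. v \<in> vball G r n \<Longrightarrow> y \<in> rat_box l v \<Longrightarrow> \<bar>y - \<xi> v\<bar> < \<epsilon>"
        using ex_rat_box[OF fin n(1), of \<xi>] by blast
      have "labelled_cylinder D G r n (rat_box l) \<subseteq> U"
      proof
        fix d assume "d \<in> labelled_cylinder D G r n (rat_box l)"
        then obtain H \<eta> p \<phi> where H: "(H, \<eta>, p) \<in> labelled_graphs D" "d = lclass D H \<eta> p"
          "ball_iso \<phi> H p G r n" "\<forall>v\<in>vball H p n. \<eta> v \<in> rat_box l (\<phi> v)"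
          by (auto simp: labelled_cylinder_def ball_iso_def)
        let ?\<psi> = "inv_into (vball H p n) \<phi>"
        have i: "ball_iso ?\<psi> G r H p n"
          using ball_iso_inv[OF H(3)] H by (auto simp: labelled_graphs_iff)
        have "\<bar>\<eta> (?\<psi> v) - \<xi> v\<bar> < \<epsilon>" if v: "v \<in> vball G r n" for v
        proof -
          have "\<phi> (?\<psi> v) = v" using ball_iso_bij[OF H(3)] v by (auto intro: bij_betw_inv_into_right)
          then show ?thesis using l(2)[OF v] H(4) ball_iso_mem[OF i v] by force
        qed
        then show "d \<in> U" using n(2)[OF H(1) i] H(2) by blast
      qed
      moreover have "c \<in> labelled_cylinder D G r n (rat_box l)"
        using lclass_in_labelled_cylinder_iff[OF G(1), of G r n] G(2) l(1) graph_iso_id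
        by (auto simp: ball_iso_def intro!: exI[of _ "\<lambda>x. x"])
      ultimately show "c \<in> \<Union>{C \<in> ?C. C \<subseteq> U}" using Gr by blast
    qed
  qed blast
  moreover have "\<Union>{C \<in> ?C. C \<subseteq> U} \<in> sets (labelled_space D)"
  proof (rule sets.countable_Union)
    show "countable {C \<in> ?C. C \<subseteq> U}" by (rule countable_subset[OF _ countable_rat_box_cylinders]) blast
    show "{C \<in> ?C. C \<subseteq> U} \<subseteq> sets (labelled_space D)" unfolding sets_labelled_space
      using open_rat_box by blast
  qed
  ultimately show ?thesis by simp
qed

lemma lopen_labelled_cylinder:
  assumes "(H, p) \<in> rooted_graphs D" "\<And>v. open (U v)"
  shows "lopen D (labelled_cylinder D H p n U)"
  unfolding lopen_def
proof safe
  fix G \<xi> r assume G: "(G, \<xi>, r) \<in> labelled_graphs D" "lclass D G \<xi> r \<in> labelled_cylinder D H p n U"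
  then obtain \<psi> where psi: "ball_iso \<psi> G r H p n" "\<And>v. v \<in> vball G r n \<Longrightarrow> \<xi> v \<in> U (\<psi> v)"
    using lclass_in_labelled_cylinder_iff[OF G(1)] G(2) by blast
  have fin: "finite (vball G r n)" using finite_vball G by (auto simp: labelled_graphs_iff)
  have "\<forall>v\<in>vball G r n. \<exists>e>0. \<forall>y. \<bar>y - \<xi> v\<bar> < e \<longrightarrow> y \<in> U (\<psi> v)"
    using psi(2) assms(2) by (metis open_real)
  then obtain e where e: "\<And>v. v \<in> vball G r n \<Longrightarrow> e v > 0 \<and> (\<forall>y. \<bar>y - \<xi> v\<bar> < e v \<longrightarrow> y \<in> U (\<psi> v))"
    by metis
  define \<epsilon> where "\<epsilon> = Min (insert 1 (e ` vball G r n))"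
  have eps: "\<epsilon> > 0" using fin e by (auto simp: \<epsilon>_def)
  have le: "\<epsilon> \<le> e v" if "v \<in> vball G r n" for v using fin that by (auto simp: \<epsilon>_def)
  show "\<exists>m \<epsilon>. \<epsilon> > 0 \<and> (\<forall>K \<eta> k \<phi>. (K, \<eta>, k) \<in> labelled_graphs D \<and> ball_iso \<phi> G r K k m \<and>
          (\<forall>v\<in>vball G r m. \<bar>\<eta> (\<phi> v) - \<xi> v\<bar> < \<epsilon>) \<longrightarrow> lclass D K \<eta> k \<in> labelled_cylinder D H p n U)"
  proof (intro exI[of _ n] exI[of _ \<epsilon>] conjI allI impI)
    fix K \<eta> k \<phi> assume K: "(K, \<eta>, k) \<in> labelled_graphs D \<and> ball_iso \<phi> G r K k n \<and>
          (\<forall>v\<in>vball G r n. \<bar>\<eta> (\<phi> v) - \<xi> v\<bar> < \<epsilon>)"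
    let ?\<phi> = "inv_into (vball G r n) \<phi>"
    have i: "ball_iso ?\<phi> K k G r n"
      using ball_iso_inv K G by (auto simp: labelled_graphs_iff)
    have "\<eta> v \<in> U (\<psi> (?\<phi> v))" if v: "v \<in> vball K k n" for v
    proof -
      have "\<phi> (?\<phi> v) = v" using K v ball_iso_bij bij_betw_inv_into_right by metis
      moreover have m: "?\<phi> v \<in> vball G r n" by (rule ball_iso_mem[OF i v])
      ultimately have "\<bar>\<eta> v - \<xi> (?\<phi> v)\<bar> < \<epsilon>" using K by (metis (no_types, lifting))
      then show ?thesis using e[OF m] le[OF m] by auto
    qed
    then show "lclass D K \<eta> k \<in> labelled_cylinder D H p n U"
      using lclass_in_labelled_cylinder_iff[of K \<eta> k D] K ball_iso_comp[OF i psi(1)] by blast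
  qed (rule eps)
qed (use labelled_cylinder_subset in blast)

lemma lopen_Int:
  assumes "lopen D U" "lopen D V"
  shows "lopen D (U \<inter> V)"
  unfolding lopen_def
proof safe
  fix G \<xi> r assume G: "(G, \<xi>, r) \<in> labelled_graphs D" "lclass D G \<xi> r \<in> U" "lclass D G \<xi> r \<in> V"
  then have Gc: "connected_graph D G" "r \<in> verts G" by (auto simp: labelled_graphs_iff)
  obtain m e where m: "e > 0" "\<And>H \<eta> p \<phi>. (H, \<eta>, p) \<in> labelled_graphs D \<Longrightarrow> ball_iso \<phi> G r H p m \<Longrightarrow>
      (\<forall>v\<in>vball G r m. \<bar>\<eta> (\<phi> v) - \<xi> v\<bar> < e) \<Longrightarrow> lclass D H \<eta> p \<in> U"
    using lopenD[OF assms(1) G(1,2)] by metis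
  obtain n f where n: "f > 0" "\<And>H \<eta> p \<phi>. (H, \<eta>, p) \<in> labelled_graphs D \<Longrightarrow> ball_iso \<phi> G r H p n \<Longrightarrow>
      (\<forall>v\<in>vball G r n. \<bar>\<eta> (\<phi> v) - \<xi> v\<bar> < f) \<Longrightarrow> lclass D H \<eta> p \<in> V"
    using lopenD[OF assms(2) G(1,3)] by metis
  show "\<exists>n \<epsilon>. \<epsilon> > 0 \<and> (\<forall>H \<eta> p \<phi>. (H, \<eta>, p) \<in> labelled_graphs D \<and> ball_iso \<phi> G r H p n \<and>
          (\<forall>v\<in>vball G r n. \<bar>\<eta> (\<phi> v) - \<xi> v\<bar> < \<epsilon>) \<longrightarrow> lclass D H \<eta> p \<in> U \<inter> V)"
  proof (intro exI[of _ "max m n"] exI[of _ "min e f"] conjI allI impI)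
    fix H \<eta> p \<phi> assume H: "(H, \<eta>, p) \<in> labelled_graphs D \<and> ball_iso \<phi> G r H p (max m n) \<and>
          (\<forall>v\<in>vball G r (max m n). \<bar>\<eta> (\<phi> v) - \<xi> v\<bar> < min e f)"
    then have Hc: "connected_graph D H" "p \<in> verts H" by (auto simp: labelled_graphs_iff)
    have "ball_iso \<phi> G r H p m" "ball_iso \<phi> G r H p n"
      using ball_iso_mono[OF Gc Hc] H by auto
    moreover have "vball G r m \<subseteq> vball G r (max m n)" "vball G r n \<subseteq> vball G r (max m n)"
      using vball_mono by auto
    ultimately show "lclass D H \<eta> p \<in> U \<inter> V" using H m(2)[of H \<eta> p \<phi>] n(2)[of H \<eta> p \<phi>] by auto
  qed (use m n in auto)
qed (use assms in \<open>auto simp: lopen_def\<close>)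

text \<open>As for doubly rooted graphs, this generator is closed under intersection.\<close>
lemma sets_labelled_space_lopen:
  "sets (labelled_space D) = sigma_sets (space (labelled_space D)) {U. lopen D U}"
proof
  show "sets (labelled_space D) \<subseteq> sigma_sets (space (labelled_space D)) {U. lopen D U}"
    unfolding sets_labelled_space space_labelled_space
    by (rule sigma_sets_mono') (use lopen_labelled_cylinder in blast)
  show "sigma_sets (space (labelled_space D)) {U. lopen D U} \<subseteq> sets (labelled_space D)"
    by (rule sets.sigma_sets_subset) (use lopen_sets in blast)
qed

section \<open>Neighbours in the Bernoulli graph\<close>

text \<open>The pigeonhole step of a diagonal argument.\<close>
lemma eventually_constant_subsequence:
  fixes F :: "nat \<Rightarrow> 'a \<Rightarrow> 'b" and s :: "nat \<Rightarrow> nat"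
  assumes "finite S" "\<And>k. k \<ge> d \<Longrightarrow> F k v \<in> S" "strict_mono s"
  shows "\<exists>r :: nat \<Rightarrow> nat. strict_mono r \<and> (\<exists>w. \<forall>k. F ((s \<circ> r) k) v = w)"
proof -
  have ge: "s k \<ge> k" for k using assms(3) by (rule strict_mono_imp_increasing)
  have "F (s k) v \<in> S" if "k \<in> {d..}" for k using assms(2) ge that by (meson atLeast_iff order_trans)
  then have "finite ((\<lambda>k. F (s k) v) ` {d..})" using assms(1) by (auto intro: finite_subset)
  then obtain a where a: "infinite {k \<in> {d..}. F (s k) v = F (s a) v}"
    using pigeonhole_infinite[of "{d..}" "\<lambda>k. F (s k) v"] infinite_Ici by blast
  let ?S = "{k \<in> {d..}. F (s k) v = F (s a) v}"
  define r where "r = wellorder_class.enumerate ?S"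
  have "r k \<in> ?S" for k unfolding r_def by (rule enumerate_in_set[OF a])
  then have "F ((s \<circ> r) k) v = F (s a) v" for k by simp
  moreover have "strict_mono r" unfolding r_def by (rule strict_mono_enumerate[OF a])
  ultimately show ?thesis by (intro exI[of _ r] exI[of _ "F (s a) v"] conjI allI)
qed

text \<open>Compactness: a vertex has finitely many possible images under isomorphisms of large balls, so a
  diagonal subsequence of these isomorphisms stabilises at every vertex, and its limit is an
  isomorphism of the whole graphs.\<close>
lemma lclass_eq_if_balls_iso:
  assumes G: "(G, \<xi>, r) \<in> labelled_graphs D" and H: "(H, \<eta>, p) \<in> labelled_graphs D"
    and balls: "\<And>n. \<exists>\<phi>. ball_iso \<phi> G r H p n \<and> (\<forall>v\<in>vball G r n. \<eta> (\<phi> v) = \<xi> v)"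
  shows "lclass D G \<xi> r = lclass D H \<eta> p"
proof -
  have Gc: "connected_graph D G" "r \<in> verts G" and Hc: "connected_graph D H" "p \<in> verts H"
    using G H by (auto simp: labelled_graphs_iff)
  obtain F where F: "\<And>n. ball_iso (F n) G r H p n" "\<And>n v. v \<in> vball G r n \<Longrightarrow> \<eta> (F n v) = \<xi> v"
    using balls by metis
  define P where "P = (\<lambda>v s. v \<in> verts G \<longrightarrow> (\<exists>w. \<forall>\<^sub>F k in sequentially. F (s k) v = w))"
  interpret subseqs P
  proof
    fix v :: nat and s :: "nat \<Rightarrow> nat" assume s: "strict_mono s"
    show "\<exists>r'. strict_mono r' \<and> P v (s \<circ> r')"
    proof (cases "v \<in> verts G")
      case True
      then obtain d where d: "v \<in> vball G r d" using in_some_vball Gc by metis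
      have "F k v \<in> vball H p d" if "k \<ge> d" for k
        using ball_iso_mem[OF ball_iso_mono[OF Gc Hc F(1) that] d] .
      from eventually_constant_subsequence[of "vball H p d" d F v s, OF finite_vball[OF Hc(1)] this s]
      show ?thesis unfolding P_def by (auto intro!: always_eventually)
    qed (use s in \<open>auto simp: P_def intro: strict_mono_id\<close>)
  qed
  define \<delta> where "\<delta> = diagseq"
  have ge: "\<delta> k \<ge> k" for k
    unfolding \<delta>_def by (rule strict_mono_imp_increasing[OF subseq_diagseq])
  have "\<exists>w. \<forall>\<^sub>F k in sequentially. F (\<delta> k) v = w" if v: "v \<in> verts G" for v
  proof -
    have "P v (diagseq \<circ> (+) (Suc v))"
    proof (rule diagseq_holds)
      fix r' s :: "nat \<Rightarrow> nat" and n assume r': "strict_mono r'" and Pn: "P n s"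
      show "P n (s \<circ> r')"
        unfolding P_def
      proof
        assume "n \<in> verts G"
        then obtain w where "\<forall>\<^sub>F k in sequentially. F (s k) n = w" using Pn unfolding P_def by blast
        then have "\<forall>\<^sub>F k in sequentially. F (s (r' k)) n = w" by (rule eventually_subseq[OF r'])
        then show "\<exists>w. \<forall>\<^sub>F k in sequentially. F ((s \<circ> r') k) n = w" by auto
      qed
    qed
    then obtain w where "\<forall>\<^sub>F k in sequentially. F (\<delta> (k + Suc v)) v = w"
      using v by (auto simp: P_def \<delta>_def comp_def add.commute)
    then have "\<forall>\<^sub>F k in sequentially. F (\<delta> k) v = w"
      by (subst (asm) eventually_sequentially_seg)
    then show ?thesis by blast
  qed
  then obtain \<phi> where \<phi>: "\<And>v. v \<in> verts G \<Longrightarrow> \<forall>\<^sub>F k in sequentially. F (\<delta> k) v = \<phi> v" by metis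
  have big: "\<forall>\<^sub>F k in sequentially. n \<le> \<delta> k" for n
    using ge by (auto simp: eventually_sequentially intro: order_trans exI[of _ n])
  \<comment> \<open>on a finite set the limit coincides with an isomorphism of an arbitrarily large ball\<close>
  have agree: "\<exists>k\<ge>0. n \<le> \<delta> k \<and> (\<forall>v\<in>B. F (\<delta> k) v = \<phi> v)" if "finite B" "B \<subseteq> verts G" for B n
  proof -
    have "\<forall>\<^sub>F k in sequentially. \<forall>v\<in>B. F (\<delta> k) v = \<phi> v"
      using that \<phi> by (intro eventually_ball_finite) auto
    then have "\<forall>\<^sub>F k in sequentially. n \<le> \<delta> k \<and> (\<forall>v\<in>B. F (\<delta> k) v = \<phi> v)"
      using big by (rule eventually_conj[rotated])
    then show ?thesis by (auto dest: eventually_happens'[rotated])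
  qed
  have pair: "\<exists>m n. n \<le> m \<and> u \<in> vball G r n \<and> v \<in> vball G r n \<and> F m u = \<phi> u \<and> F m v = \<phi> v"
    if uv: "u \<in> verts G" "v \<in> verts G" for u v
  proof -
    obtain a where "u \<in> vball G r a" using in_some_vball[OF Gc uv(1)] .
    moreover obtain b where "v \<in> vball G r b" using in_some_vball[OF Gc uv(2)] .
    ultimately have "u \<in> vball G r (max a b)" "v \<in> vball G r (max a b)"
      using subsetD[OF vball_mono, of a "max a b" u G r] subsetD[OF vball_mono, of b "max a b" v G r] by auto
    then show ?thesis using agree[of "{u, v}" "max a b"] uv by blast
  qed
  have "\<phi> r = p" using pair[OF Gc(2) Gc(2)] F(1) ball_iso_root by metis
  moreover have "(\<phi> u, \<phi> v) \<in> edges H \<longleftrightarrow> (u, v) \<in> edges G" if uv: "u \<in> verts G" "v \<in> verts G" for u v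
  proof -
    obtain m n where m: "n \<le> m" "u \<in> vball G r n" "v \<in> vball G r n" "F m u = \<phi> u" "F m v = \<phi> v"
      using pair[OF uv] by blast
    then have "u \<in> vball G r m" "v \<in> vball G r m" using vball_mono by blast+
    then show ?thesis using ball_iso_edge[OF F(1)] m by metis
  qed
  moreover have "\<eta> (\<phi> v) = \<xi> v" if v: "v \<in> verts G" for v
  proof -
    obtain m n where m: "n \<le> m" "v \<in> vball G r n" "F m v = \<phi> v"
      using pair[OF v v] by blast
    then have "v \<in> vball G r m" using vball_mono by blast
    then show ?thesis using F(2) m by metis
  qed
  moreover have "bij_betw \<phi> (verts G) (verts H)"
    unfolding bij_betw_def
  proof
    show "inj_on \<phi> (verts G)"
    proof (rule inj_onI)
      fix u v assume uv: "u \<in> verts G" "v \<in> verts G" "\<phi> u = \<phi> v"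
      obtain m n where m: "n \<le> m" "u \<in> vball G r n" "v \<in> vball G r n" "F m u = \<phi> u" "F m v = \<phi> v"
        using pair[OF uv(1,2)] by blast
      then have "u \<in> vball G r m" "v \<in> vball G r m" using vball_mono by blast+
      then show "u = v" using ball_iso_bij[OF F(1)[of m]] m uv(3) unfolding bij_betw_def inj_on_def by metis
    qed
    show "\<phi> ` verts G = verts H"
    proof safe
      fix v assume v: "v \<in> verts G"
      obtain m n where m: "n \<le> m" "v \<in> vball G r n" "F m v = \<phi> v" using pair[OF v v] by blast
      then have "v \<in> vball G r m" using vball_mono by blast
      then have "F m v \<in> vball H p m" by (rule ball_iso_mem[OF F(1)])
      then show "\<phi> v \<in> verts H" using m vball_subset_verts by auto
    next
      fix w assume w: "w \<in> verts H"
      then obtain d where d: "w \<in> vball H p d" using in_some_vball Hc by metis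
      obtain k where k: "d \<le> \<delta> k" "\<And>v. v \<in> vball G r d \<Longrightarrow> F (\<delta> k) v = \<phi> v"
        using agree[OF finite_vball[OF Gc(1)] vball_subset_verts] by blast
      have "F (\<delta> k) ` vball G r d = vball H p d"
        by (rule bij_betw_imp_surj_on[OF ball_iso_vball[OF Gc Hc F(1) k(1)]])
      then have "w \<in> F (\<delta> k) ` vball G r d" using d by simp
      then obtain v where "v \<in> vball G r d" "w = F (\<delta> k) v" by (rule imageE)
      then show "w \<in> \<phi> ` verts G" using k(2) vball_subset_verts by blast
    qed
  qed
  ultimately show ?thesis
    unfolding lclass_eq_iff[OF G H] graph_iso_def by (intro exI[of _ \<phi>]) auto
qed

text \<open>Isomorphic graphs have isomorphic rerootings, so the neighbours may be computed in any
  representative.\<close>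
lemma bernoulli_nbrs:
  assumes "(G, \<xi>, r) \<in> labelled_graphs D"
  shows "{y. (lclass D G \<xi> r, y) \<in> bernoulli_graph D} = lclass D G \<xi> ` {s. (r, s) \<in> edges G}"
proof safe
  have Gc: "connected_graph D G" using assms by (auto simp: labelled_graphs_iff)
  fix y
  { fix s assume s: "(r, s) \<in> edges G"
    then have "(G, \<xi>, s) \<in> labelled_graphs D"
      using assms connected_graph_edgeD[OF Gc s] by (auto simp: labelled_graphs_iff)
    moreover from this have "((G, \<xi>, s), (G, \<xi>, s)) \<in> labelled_iso D"
      using equiv_labelled_iso by (meson equivE refl_onD)
    ultimately show "(lclass D G \<xi> r, lclass D G \<xi> s) \<in> bernoulli_graph D"
      using assms s unfolding bernoulli_graph_def by blast }
  assume "(lclass D G \<xi> r, y) \<in> bernoulli_graph D"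
  then obtain G' \<xi>' r' H \<eta> p s' where *: "lclass D G \<xi> r = lclass D G' \<xi>' r'" "y = lclass D H \<eta> p"
    "(G', \<xi>', r') \<in> labelled_graphs D" "(r', s') \<in> edges G'" "((G', \<xi>', s'), (H, \<eta>, p)) \<in> labelled_iso D"
    unfolding bernoulli_graph_def by blast
  then have y: "y = lclass D G' \<xi>' s'"
    using equiv_class_eq[OF equiv_labelled_iso] by (auto simp: lclass_def)
  obtain \<theta> where \<theta>: "graph_iso \<theta> G' G" "\<theta> r' = r" "\<forall>v\<in>verts G'. \<xi> (\<theta> v) = \<xi>' v"
    using lclass_eq_iff[OF *(3) assms] *(1) by auto
  have G'c: "connected_graph D G'" using * by (auto simp: labelled_graphs_iff)
  note s' = connected_graph_edgeD[OF G'c *(4)]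
  have e: "(r, \<theta> s') \<in> edges G" using \<theta> s' *(4) by (auto simp: graph_iso_def)
  then have "(G, \<xi>, \<theta> s') \<in> labelled_graphs D" "(G', \<xi>', s') \<in> labelled_graphs D"
    using assms * s' connected_graph_edgeD[OF Gc e] by (auto simp: labelled_graphs_iff)
  then have "lclass D G' \<xi>' s' = lclass D G \<xi> (\<theta> s')" using lclass_eq_iff \<theta> by blast
  then show "y \<in> lclass D G \<xi> ` {s. (r, s) \<in> edges G}" using y e by blast
qed

lemma finite_bernoulli_nbrs:
  assumes "x \<in> space (labelled_space D)"
  shows "finite {y. (x, y) \<in> bernoulli_graph D}"
proof -
  obtain G \<xi> r where *: "(G, \<xi>, r) \<in> labelled_graphs D" "x = lclass D G \<xi> r" using lclass_cases assms by metis
  then show ?thesis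
    using bernoulli_nbrs[OF *(1)] connected_graph_finite_nbrs[of D G r] by (simp add: labelled_graphs_iff)
qed

lemma bernoulli_nbrs_space:
  assumes "(x, y) \<in> bernoulli_graph D"
  shows "x \<in> space (labelled_space D)" "y \<in> space (labelled_space D)"
  using assms lclass_in_space unfolding bernoulli_graph_def by blast+

lemma label_gap:
  assumes "finite B"
  obtains \<epsilon> :: real where "\<epsilon> > 0" "\<And>u v. u \<in> B \<Longrightarrow> v \<in> B \<Longrightarrow> \<bar>\<xi> u - \<xi> v\<bar> < 2 * \<epsilon> \<Longrightarrow> \<xi> u = (\<xi> v :: real)"
proof -
  let ?S = "insert 1 ((\<lambda>(u, v). \<bar>\<xi> u - \<xi> v\<bar>) ` {(u, v) \<in> B \<times> B. \<xi> u \<noteq> \<xi> v})"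
  have fin: "finite ?S" using assms by (auto intro: finite_subset[of _ "B \<times> B"])
  have pos: "Min ?S > 0" using fin by (subst Min_gr_iff) auto
  show ?thesis
  proof (rule that[of "Min ?S / 2"])
    fix u v assume uv: "u \<in> B" "v \<in> B" "\<bar>\<xi> u - \<xi> v\<bar> < 2 * (Min ?S / 2)"
    show "\<xi> u = \<xi> v"
    proof (rule ccontr)
      assume "\<xi> u \<noteq> \<xi> v"
      then have "Min ?S \<le> \<bar>\<xi> u - \<xi> v\<bar>" using uv fin by (intro Min_le) auto
      then show False using uv by simp
    qed
  qed (use pos in simp)
qed

text \<open>The number of neighbours in an open set is lower semicontinuous. Inequivalent rerootings at two
  neighbours differ already on a large ball, by compactness, and labels on this ball that are
  different stay so under small perturbations. Hence distinct neighbours do not merge.\<close>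
lemma lopen_card_nbrs:
  assumes U: "lopen D U"
  shows "lopen D {x \<in> space (labelled_space D). k \<le> card ({y. (x, y) \<in> bernoulli_graph D} \<inter> U)}"
  unfolding lopen_def
proof safe
  fix G \<xi> r assume G: "(G, \<xi>, r) \<in> labelled_graphs D"
    and k: "k \<le> card ({y. (lclass D G \<xi> r, y) \<in> bernoulli_graph D} \<inter> U)"
  have Gc: "connected_graph D G" "r \<in> verts G" using G by (auto simp: labelled_graphs_iff)
  let ?N = "{s. (r, s) \<in> edges G}"
  have Ns: "(G, \<xi>, s) \<in> labelled_graphs D" if "s \<in> ?N" for s
    using G that connected_graph_edgeD[OF Gc(1)] by (auto simp: labelled_graphs_iff)
  have "{y. (lclass D G \<xi> r, y) \<in> bernoulli_graph D} \<inter> U \<subseteq> lclass D G \<xi> ` ?N"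
    using bernoulli_nbrs[OF G] by blast
  then obtain T where T: "T \<subseteq> ?N" "inj_on (lclass D G \<xi>) T"
    "{y. (lclass D G \<xi> r, y) \<in> bernoulli_graph D} \<inter> U = lclass D G \<xi> ` T"
    by (meson subset_image_inj)
  have finT: "finite T" using T(1) connected_graph_finite_nbrs[OF Gc(1)] finite_subset by blast
  have kT: "k \<le> card T" using k T card_image[OF T(2)] by simp
  \<comment> \<open>a common radius for separating the classes and for staying in \<open>U\<close>\<close>
  define sep where "sep = (\<lambda>n s t. \<not> (\<exists>\<phi>. ball_iso \<phi> G s G t n \<and> (\<forall>v\<in>vball G s n. \<xi> (\<phi> v) = \<xi> v)))"
  have sep_mono: "sep m s t" if "sep n s t" "n \<le> m" "s \<in> ?N" "t \<in> ?N" for n m s t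
    unfolding sep_def
  proof safe
    fix \<phi> assume *: "ball_iso \<phi> G s G t m" "\<forall>v\<in>vball G s m. \<xi> (\<phi> v) = \<xi> v"
    have "ball_iso \<phi> G s G t n"
      using ball_iso_mono[OF _ _ _ _ *(1) that(2)] Ns that by (auto simp: labelled_graphs_iff)
    moreover have "\<forall>v\<in>vball G s n. \<xi> (\<phi> v) = \<xi> v" using * vball_mono[OF that(2)] by blast
    ultimately show False using that(1) unfolding sep_def by blast
  qed
  have "\<exists>n. sep n s t" if st: "s \<in> T" "t \<in> T" "s \<noteq> t" for s t
  proof (rule ccontr)
    assume no: "\<nexists>n. sep n s t"
    have "lclass D G \<xi> s = lclass D G \<xi> t"
      by (rule lclass_eq_if_balls_iso[OF Ns Ns]) (use no st T(1) in \<open>auto simp: sep_def\<close>)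
    then show False using T(2) st by (auto simp: inj_on_def)
  qed
  then obtain a where a: "\<And>s t. s \<in> T \<Longrightarrow> t \<in> T \<Longrightarrow> s \<noteq> t \<Longrightarrow> sep (a s t) s t" by metis
  define good where "good = (\<lambda>s n (e :: real). e > 0 \<and> (\<forall>H \<eta> p \<phi>. (H, \<eta>, p) \<in> labelled_graphs D \<longrightarrow>
      ball_iso \<phi> G s H p n \<longrightarrow> (\<forall>v\<in>vball G s n. \<bar>\<eta> (\<phi> v) - \<xi> v\<bar> < e) \<longrightarrow> lclass D H \<eta> p \<in> U))"
  have "\<exists>n e. good s n e" if s: "s \<in> T" for s
  proof -
    have "lclass D G \<xi> s \<in> U" "s \<in> ?N" using s T by blast+
    then obtain n e where "e > 0" "\<And>H \<eta> p \<phi>. (H, \<eta>, p) \<in> labelled_graphs D \<Longrightarrow> ball_iso \<phi> G s H p n \<Longrightarrow>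
      (\<forall>v\<in>vball G s n. \<bar>\<eta> (\<phi> v) - \<xi> v\<bar> < e) \<Longrightarrow> lclass D H \<eta> p \<in> U"
      using lopenD[OF U Ns[of s]] by metis
    then have "good s n e" unfolding good_def by blast
    then show ?thesis by blast
  qed
  then obtain b e where good: "\<And>s. s \<in> T \<Longrightarrow> good s (b s) (e s)" by metis
  have be: "e s > 0" if "s \<in> T" for s using good[OF that] by (simp add: good_def)
  define N where "N = Max (insert 0 ((\<lambda>(s, t). a s t) ` (T \<times> T) \<union> b ` T))"
  have aN: "a s t \<le> N" if "s \<in> T" "t \<in> T" for s t
    using finT that unfolding N_def by (intro Max_ge) auto
  have bN: "b s \<le> N" if "s \<in> T" for s using finT that unfolding N_def by (intro Max_ge) auto
  \<comment> \<open>different labels in the ball are at least \<open>2 * \<delta>\<close> apart, so labels perturbed by less than \<open>\<delta>\<close> coincide only if the original ones do\<close>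
  obtain \<delta> where \<delta>: "\<delta> > 0" "\<And>u v. u \<in> vball G r (1 + N) \<Longrightarrow> v \<in> vball G r (1 + N) \<Longrightarrow>
      \<bar>\<xi> u - \<xi> v\<bar> < 2 * \<delta> \<Longrightarrow> \<xi> u = \<xi> v"
    using label_gap[OF finite_vball[OF Gc(1)]] by metis
  define \<epsilon> where "\<epsilon> = Min (insert \<delta> (e ` T))"
  have eps: "\<epsilon> > 0" "\<epsilon> \<le> \<delta>" using finT \<delta> be by (auto simp: \<epsilon>_def)
  have eps_e: "\<epsilon> \<le> e s" if "s \<in> T" for s using finT that by (auto simp: \<epsilon>_def)
  show "\<exists>n \<epsilon>. \<epsilon> > 0 \<and> (\<forall>H \<eta> p \<phi>. (H, \<eta>, p) \<in> labelled_graphs D \<and> ball_iso \<phi> G r H p n \<and>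
      (\<forall>v\<in>vball G r n. \<bar>\<eta> (\<phi> v) - \<xi> v\<bar> < \<epsilon>) \<longrightarrow>
      lclass D H \<eta> p \<in> {x \<in> space (labelled_space D). k \<le> card ({y. (x, y) \<in> bernoulli_graph D} \<inter> U)})"
  proof (intro exI[of _ "1 + N"] exI[of _ \<epsilon>] conjI allI impI)
    fix H \<eta> p \<psi>
    assume "(H, \<eta>, p) \<in> labelled_graphs D \<and> ball_iso \<psi> G r H p (1 + N) \<and>
      (\<forall>v\<in>vball G r (1 + N). \<bar>\<eta> (\<psi> v) - \<xi> v\<bar> < \<epsilon>)"
    then have H: "(H, \<eta>, p) \<in> labelled_graphs D" and psi: "ball_iso \<psi> G r H p (1 + N)"
      and lab: "\<And>v. v \<in> vball G r (1 + N) \<Longrightarrow> \<bar>\<eta> (\<psi> v) - \<xi> v\<bar> < \<epsilon>" by auto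
    have Hc: "connected_graph D H" "p \<in> verts H" using H by (auto simp: labelled_graphs_iff)
    have s1: "s \<in> vball G r 1" if "s \<in> T" for s using nbr_in_vball[OF Gc(1), of r s 0] that T(1) by auto
    have rec: "ball_iso \<psi> G s H (\<psi> s) N" if "s \<in> T" for s
      using ball_iso_recenter(1)[OF Gc Hc psi s1[OF that]] .
    have sub: "vball G s N \<subseteq> vball G r (1 + N)" if "s \<in> T" for s
      using vball_trans[OF s1[OF that]] by blast
    have edge: "(p, \<psi> s) \<in> edges H" if "s \<in> T" for s
      using that T(1) ball_iso_edge[OF psi, of r s] ball_iso_root[OF psi] Gc nbr_in_vball[OF Gc(1)] by auto
    have HL: "(H, \<eta>, \<psi> s) \<in> labelled_graphs D" if "s \<in> T" for s
      using H connected_graph_edgeD[OF Hc(1) edge[OF that]] by (auto simp: labelled_graphs_iff)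
    let ?f = "\<lambda>s. lclass D H \<eta> (\<psi> s)"
    have inj: "inj_on ?f T"
    proof (rule inj_onI, rule ccontr)
      fix s t assume st: "s \<in> T" "t \<in> T" "?f s = ?f t" "s \<noteq> t"
      then obtain \<theta> where \<theta>: "graph_iso \<theta> H H" "\<theta> (\<psi> s) = \<psi> t" "\<forall>v\<in>verts H. \<eta> (\<theta> v) = \<eta> v"
        using lclass_eq_iff[OF HL HL] by blast
      let ?i = "inv_into (vball G t N) \<psi>"
      have tG: "t \<in> verts G" using st T(1) connected_graph_edgeD[OF Gc(1)] by blast
      have th: "ball_iso \<theta> H (\<psi> s) H (\<psi> t) N"
        using graph_iso_ball_iso[OF Hc(1) _ Hc(1) \<theta>(1), of "\<psi> s" N] \<theta>(2) HL[OF st(1)] by (simp add: labelled_graphs_iff)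
      have c: "ball_iso (\<lambda>x. ?i (\<theta> (\<psi> x))) G s G t N"
        using ball_iso_comp[OF ball_iso_comp[OF rec[OF st(1)] th] ball_iso_inv[OF rec[OF st(2)] tG]] .
      have "\<xi> (?i (\<theta> (\<psi> v))) = \<xi> v" if v: "v \<in> vball G s N" for v
      proof (rule \<delta>(2))
        let ?w = "?i (\<theta> (\<psi> v))"
        have w: "?w \<in> vball G t N" by (rule ball_iso_mem[OF c v])
        show "?w \<in> vball G r (1 + N)" "v \<in> vball G r (1 + N)" using w v sub st by blast+
        have pv: "\<psi> v \<in> vball H (\<psi> s) N" by (rule ball_iso_mem[OF rec[OF st(1)] v])
        then have "\<theta> (\<psi> v) \<in> vball H (\<psi> t) N" by (rule ball_iso_mem[OF th])
        then have "\<psi> ?w = \<theta> (\<psi> v)"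
          using ball_iso_bij[OF rec[OF st(2)]] by (rule bij_betw_inv_into_right[rotated])
        moreover have "\<eta> (\<theta> (\<psi> v)) = \<eta> (\<psi> v)" using \<theta>(3) pv vball_subset_verts by blast
        ultimately have "\<eta> (\<psi> ?w) = \<eta> (\<psi> v)" by simp
        then show "\<bar>\<xi> ?w - \<xi> v\<bar> < 2 * \<delta>"
          using lab[of ?w] lab[of v] w v sub st eps by (smt (verit) subsetD)
      qed
      then have "\<not> sep N s t" using c unfolding sep_def by blast
      moreover have "sep N s t" using sep_mono[OF a[OF st(1,2,4)] aN[OF st(1,2)]] st T(1) by blast
      ultimately show False by blast
    qed
    have "?f s \<in> U" if s: "s \<in> T" for s
    proof -
      have "ball_iso \<psi> G s H (\<psi> s) (b s)"
        by (rule ball_iso_mono[OF Gc(1) _ Hc(1) _ rec[OF s] bN[OF s]])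
           (use s T(1) Ns HL[OF s] in \<open>auto simp: labelled_graphs_iff\<close>)
      moreover have "\<forall>v\<in>vball G s (b s). \<bar>\<eta> (\<psi> v) - \<xi> v\<bar> < e s"
        using lab sub[OF s] vball_mono[OF bN[OF s], of G s] eps_e[OF s] by (meson less_le_trans subsetD)
      ultimately show ?thesis using good[OF s] HL[OF s] unfolding good_def by blast
    qed
    then have "?f ` T \<subseteq> {y. (lclass D H \<eta> p, y) \<in> bernoulli_graph D} \<inter> U"
      using bernoulli_nbrs[OF H] edge by blast
    moreover have "finite ({y. (lclass D H \<eta> p, y) \<in> bernoulli_graph D} \<inter> U)"
      using finite_bernoulli_nbrs[OF lclass_in_space[OF H]] by blast
    ultimately have "card T \<le> card ({y. (lclass D H \<eta> p, y) \<in> bernoulli_graph D} \<inter> U)"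
      using card_mono card_image[OF inj] by metis
    then show "lclass D H \<eta> p \<in> {x \<in> space (labelled_space D). k \<le> card ({y. (x, y) \<in> bernoulli_graph D} \<inter> U)}"
      using kT lclass_in_space[OF H] by simp
  qed (rule eps)
qed

lemma lopen_space: "lopen D (space (labelled_space D))"
  unfolding lopen_def using lclass_in_space by (auto intro!: exI[of _ "1::real"])

abbreviation nbr_sum :: "nat \<Rightarrow> (labelled_class \<Rightarrow> 'a :: comm_monoid_add) \<Rightarrow> labelled_class \<Rightarrow> 'a" where
  "nbr_sum D f x \<equiv> (\<Sum>y | (x, y) \<in> bernoulli_graph D. f y)"

text \<open>Open sets are covered by semicontinuity; the sets with a measurable count of neighbours form a
  Dynkin system.\<close>
lemma measurable_nbr_sum_indicator:
  assumes "A \<in> sets (labelled_space D)"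
  shows "nbr_sum D (indicator A :: _ \<Rightarrow> ennreal) \<in> borel_measurable (labelled_space D)"
proof -
  let ?M = "labelled_space D"
  let ?R = "\<lambda>x. {y. (x, y) \<in> bernoulli_graph D}"
  have openc: "nbr_sum D (indicator U :: _ \<Rightarrow> ennreal) \<in> borel_measurable ?M" if U: "lopen D U" for U
  proof -
    have *: "{x \<in> space ?M. k \<le> card (?R x \<inter> U)} \<in> sets ?M" for k
      by (rule lopen_sets[OF lopen_card_nbrs[OF U]])
    have "(\<lambda>x. card (?R x \<inter> U)) \<in> measurable ?M (count_space UNIV)"
    proof (subst measurable_count_space_eq2_countable, safe)
      fix k
      have "(\<lambda>x. card (?R x \<inter> U)) -` {k} \<inter> space ?M =
          {x \<in> space ?M. k \<le> card (?R x \<inter> U)} - {x \<in> space ?M. Suc k \<le> card (?R x \<inter> U)}" by auto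
      then show "(\<lambda>x. card (?R x \<inter> U)) -` {k} \<inter> space ?M \<in> sets ?M" by (simp only: sets.Diff[OF * *])
    qed auto
    then have "(\<lambda>x. of_nat (card (?R x \<inter> U)) :: ennreal) \<in> borel_measurable ?M" by measurable
    then show ?thesis
    proof (rule measurable_cong[THEN iffD1, rotated])
      fix x assume "x \<in> space ?M"
      then show "(of_nat (card (?R x \<inter> U)) :: ennreal) = nbr_sum D (indicator U) x"
        using finite_bernoulli_nbrs by (simp add: indicator_def sum_of_bool_eq Int_def)
    qed
  qed
  have "Int_stable {U. lopen D U}" by (auto simp: Int_stable_def lopen_Int)
  moreover have "{U. lopen D U} \<subseteq> Pow (space ?M)" by (auto simp: lopen_def)
  moreover have "A \<in> sigma_sets (space ?M) {U. lopen D U}"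
    using assms sets_labelled_space_lopen by simp
  ultimately show ?thesis
  proof (induction rule: sigma_sets_induct_disjoint)
    case (basic U) then show ?case using openc by simp
  next
    case empty show ?case by simp
  next
    case (compl U)
    have "(\<lambda>x. nbr_sum D (indicator (space ?M)) x - nbr_sum D (indicator U) x :: ennreal) \<in> borel_measurable ?M"
      using compl openc[OF lopen_space] by measurable
    then show ?case
    proof (rule measurable_cong[THEN iffD1, rotated])
      fix x assume x: "x \<in> space ?M"
      have U: "U \<subseteq> space ?M"
        using compl(1) sets_labelled_space_lopen[of D] sets.sets_into_space[of U ?M] by simp
      have "nbr_sum D (indicator (space ?M) :: _ \<Rightarrow> ennreal) x = nbr_sum D (indicator U) x + nbr_sum D (indicator (space ?M - U)) x"
        unfolding sum.distrib[symmetric] using U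
        by (intro sum.cong) (auto split: split_indicator)
      moreover have "nbr_sum D (indicator U :: _ \<Rightarrow> ennreal) x \<noteq> \<top>"
        using finite_bernoulli_nbrs[OF x] by (simp add: indicator_def sum_of_bool_eq)
      ultimately show "nbr_sum D (indicator (space ?M)) x - nbr_sum D (indicator U) x =
          (nbr_sum D (indicator (space ?M - U)) x :: ennreal)" by simp
    qed
  next
    case (union A)
    have eq: "nbr_sum D (indicator (\<Union>i. A i)) x = (\<Sum>i. nbr_sum D (indicator (A i)) x :: ennreal)" for x
    proof -
      have "(\<Sum>i. nbr_sum D (indicator (A i)) x :: ennreal) = (\<Sum>y\<in>?R x. \<Sum>i. indicator (A i) y)"
        by (rule suminf_sum) simp
      then show ?thesis using suminf_indicator[OF union(1)] by simp
    qed
    show ?case unfolding eq using union by measurable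
  qed
qed

lemma measurable_nbr_sum_nonneg:
  fixes f :: "labelled_class \<Rightarrow> real"
  assumes "f \<in> borel_measurable (labelled_space D)" "\<And>x. 0 \<le> f x"
  shows "nbr_sum D f \<in> borel_measurable (labelled_space D)"
  using assms
proof (induction f rule: borel_measurable_induct_real)
  case (set A)
  have "(\<lambda>x. enn2real (nbr_sum D (indicator A) x)) \<in> borel_measurable (labelled_space D)"
    using measurable_nbr_sum_indicator[OF set] by measurable
  moreover have "enn2real (nbr_sum D (indicator A) x) = nbr_sum D (indicator A :: _ \<Rightarrow> real) x" for x
  proof -
    have "nbr_sum D (indicator A :: _ \<Rightarrow> ennreal) x = ennreal (nbr_sum D (indicator A :: _ \<Rightarrow> real) x)"
      by (subst sum_ennreal[symmetric]) (auto simp: ennreal_indicator)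
    then show ?thesis by (simp add: sum_nonneg)
  qed
  ultimately show ?case by simp
next
  case (mult u c) then show ?case by (simp flip: sum_distrib_left)
next
  case (add u v) then show ?case by (simp add: sum.distrib)
next
  case (seq U)
  show ?case
  proof (rule borel_measurable_LIMSEQ_real)
    show "nbr_sum D (U i) \<in> borel_measurable (labelled_space D)" for i by (rule seq)
    fix x assume "x \<in> space (labelled_space D)"
    show "(\<lambda>i. nbr_sum D (U i) x) \<longlonglongrightarrow> nbr_sum D f x"
      using seq bernoulli_nbrs_space by (intro tendsto_sum) blast
  qed
qed

lemma measurable_nbr_sum_real:
  fixes f :: "labelled_class \<Rightarrow> real"
  assumes [measurable]: "f \<in> borel_measurable (labelled_space D)"
  shows "nbr_sum D f \<in> borel_measurable (labelled_space D)"
proof -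
  have "(\<lambda>x. nbr_sum D (\<lambda>y. max 0 (f y)) x - nbr_sum D (\<lambda>y. max 0 (- f y)) x) \<in> borel_measurable (labelled_space D)"
    by (intro borel_measurable_diff measurable_nbr_sum_nonneg) auto
  moreover have "nbr_sum D (\<lambda>y. max 0 (f y)) x - nbr_sum D (\<lambda>y. max 0 (- f y)) x = nbr_sum D f x" for x
    unfolding sum_subtractf[symmetric] by (intro sum.cong) (auto simp: max_def)
  ultimately show ?thesis by simp
qed

lemma measurable_nbr_sum_complex:
  fixes f :: "labelled_class \<Rightarrow> complex"
  assumes [measurable]: "f \<in> borel_measurable (labelled_space D)"
  shows "nbr_sum D f \<in> borel_measurable (labelled_space D)"
proof -
  have "nbr_sum D (\<lambda>y. Re (f y)) \<in> borel_measurable (labelled_space D)"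
    "nbr_sum D (\<lambda>y. Im (f y)) \<in> borel_measurable (labelled_space D)"
    by (intro measurable_nbr_sum_real; measurable)+
  then show ?thesis by (subst borel_measurable_complex_iff) simp
qed

lemma measurable_deg_bernoulli:
  "(\<lambda>x. real (deg (bernoulli_graph D) x)) \<in> borel_measurable (labelled_space D)"
proof -
  have "nbr_sum D (\<lambda>_. 1 :: real) \<in> borel_measurable (labelled_space D)"
    by (rule measurable_nbr_sum_real) simp
  then show ?thesis by (simp add: deg_def)
qed

section \<open>Vertex sums and random labels\<close>

lemma drclass_iso:
  assumes "connected_graph D G" "connected_graph D H" "graph_iso \<phi> G H" "r \<in> verts G" "s \<in> verts G"
  shows "drclass D H (\<phi> r) (\<phi> s) = drclass D G r s"
proof -
  have "\<phi> r \<in> verts H" "\<phi> s \<in> verts H"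
    using assms by (auto simp: graph_iso_def dest: bij_betw_apply)
  then have "(G, r, s) \<in> doubly_rooted_graphs D" "(H, \<phi> r, \<phi> s) \<in> doubly_rooted_graphs D"
    using assms by (auto simp: doubly_rooted_graphs_iff)
  then show ?thesis using drclass_eq_iff assms(3) by metis
qed

text \<open>Balls exhaust the vertices, and sums over balls are finite and local.\<close>
lemma nn_integral_vballs:
  assumes "connected_graph D G" "r \<in> verts G"
  shows "(\<integral>\<^sup>+ s. f s \<partial>count_space (verts G)) = (SUP n. \<Sum>s\<in>vball G r n. f s)"
proof -
  let ?F = "\<lambda>n s. f s * indicator (vball G r n) s"
  have "(\<integral>\<^sup>+ s. (SUP n. ?F n s) \<partial>count_space (verts G)) = (SUP n. \<integral>\<^sup>+ s. ?F n s \<partial>count_space (verts G))"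
  proof (rule nn_integral_monotone_convergence_SUP)
    show "incseq ?F"
      using vball_mono[of _ _ G r] by (auto simp: incseq_def le_fun_def split: split_indicator)
  qed auto
  moreover have "(SUP n. ?F n s) = f s" if s: "s \<in> verts G" for s
  proof -
    obtain n where "s \<in> vball G r n" using in_some_vball[OF assms s] .
    then have "f s \<le> (SUP n. ?F n s)" by (intro SUP_upper2[of n]) auto
    moreover have "(SUP n. ?F n s) \<le> f s" by (intro SUP_least) (auto split: split_indicator)
    ultimately show ?thesis by (rule antisym[rotated])
  qed
  moreover have "(\<integral>\<^sup>+ s. ?F n s \<partial>count_space (verts G)) = (\<Sum>s\<in>vball G r n. f s)" for n
  proof -
    have "(\<integral>\<^sup>+ s. ?F n s \<partial>count_space (verts G)) = (\<integral>\<^sup>+ s. f s \<partial>count_space (vball G r n))"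
      using vball_subset_verts[of G r n] 
      by (simp add: nn_integral_count_space_indicator) (intro nn_integral_cong, auto split: split_indicator)
    then show ?thesis using nn_integral_count_space_finite[OF finite_vball[OF assms(1)]] by simp
  qed
  ultimately show ?thesis by (simp cong: nn_integral_cong_simp)
qed

text \<open>The Mass Transport Principle involves a function of the two roots in both orders. The map
  \<open>\<kappa>\<close> stands for either order; it is isomorphism invariant and, by the last
  assumption, continuous.\<close>
locale root_pair_map =
  fixes D :: nat and \<kappa> :: "graph \<Rightarrow> nat \<Rightarrow> nat \<Rightarrow> doubly_rooted_class"
  assumes inv: "\<And>\<phi> G H r s. connected_graph D G \<Longrightarrow> connected_graph D H \<Longrightarrow> graph_iso \<phi> G H \<Longrightarrow>
      r \<in> verts G \<Longrightarrow> s \<in> verts G \<Longrightarrow> \<kappa> H (\<phi> r) (\<phi> s) = \<kappa> G r s"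
    and sp: "\<And>G r s. (G, r, s) \<in> doubly_rooted_graphs D \<Longrightarrow> \<kappa> G r s \<in> space (doubly_rooted_space D)"
    and nhd: "\<And>U G r s. dopen D U \<Longrightarrow> (G, r, s) \<in> doubly_rooted_graphs D \<Longrightarrow> \<kappa> G r s \<in> U \<Longrightarrow>
      \<exists>n. \<forall>m\<ge>n. \<forall>H p \<phi>. (H, p) \<in> rooted_graphs D \<and> ball_iso \<phi> G r H p m \<longrightarrow> \<kappa> H p (\<phi> s) \<in> U"
begin

lemma sum_vball_iso:
  assumes G: "connected_graph D G" "r \<in> verts G" and H: "connected_graph D H" and iso: "graph_iso \<phi> G H"
  shows "(\<Sum>s\<in>vball H (\<phi> r) n. f (\<kappa> H (\<phi> r) s)) = (\<Sum>s\<in>vball G r n. f (\<kappa> G r s))"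
proof -
  have "bij_betw \<phi> (vball G r n) (vball H (\<phi> r) n)"
    using ball_iso_bij graph_iso_ball_iso[OF G H iso] by blast
  then have "(\<Sum>s\<in>vball H (\<phi> r) n. f (\<kappa> H (\<phi> r) s)) = (\<Sum>s\<in>vball G r n. f (\<kappa> H (\<phi> r) (\<phi> s)))"
    by (rule sum.reindex_bij_betw[symmetric])
  also have "\<dots> = (\<Sum>s\<in>vball G r n. f (\<kappa> G r s))"
    using inv[OF G(1) H iso G(2)] vball_subset_verts by (intro sum.cong refl) (metis subsetD)
  finally show ?thesis .
qed

abbreviation ball_sum :: "nat \<Rightarrow> (doubly_rooted_class \<Rightarrow> 'b :: comm_monoid_add) \<Rightarrow> rooted_class \<Rightarrow> 'b" where
  "ball_sum n f c \<equiv> (\<Sum>s\<in>vball (rep_graph c) (rep_root c) n. f (\<kappa> (rep_graph c) (rep_root c) s))"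

lemma ball_sum_rclass:
  assumes "(G, r) \<in> rooted_graphs D"
  shows "ball_sum n f (rclass D G r) = (\<Sum>s\<in>vball G r n. f (\<kappa> G r s))"
proof -
  obtain \<phi> where "graph_iso \<phi> G (rep_graph (rclass D G r))" "\<phi> r = rep_root (rclass D G r)"
    using rep_rclass_iso[OF assms] .
  then show ?thesis
    using sum_vball_iso[of G r "rep_graph (rclass D G r)" \<phi> f n] assms
      rep_rooted(1)[OF rclass_in_space[OF assms]] by (simp add: rooted_graphs_iff)
qed

text \<open>Each of the finitely many vertices counted remains in \<open>U\<close> when a large enough ball
  around the root is preserved, so the count is lower semicontinuous.\<close>
lemma ropen_card:
  assumes U: "dopen D U"
  shows "ropen D {c \<in> space (rooted_space D). k \<le> (ball_sum n (indicator U) c :: nat)}"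
  unfolding ropen_def
proof safe
  fix G r assume Gr: "(G, r) \<in> rooted_graphs D" and "k \<le> (ball_sum n (indicator U) (rclass D G r) :: nat)"
  then have k: "k \<le> (\<Sum>s\<in>vball G r n. indicator U (\<kappa> G r s) :: nat)"
    by (simp add: ball_sum_rclass)
  have G: "connected_graph D G" "r \<in> verts G" using Gr by (auto simp: rooted_graphs_iff)
  let ?S = "{s \<in> vball G r n. \<kappa> G r s \<in> U}"
  define good where "good = (\<lambda>s m. \<forall>m'\<ge>m. \<forall>H p \<phi>. (H, p) \<in> rooted_graphs D \<and> ball_iso \<phi> G r H p m' \<longrightarrow>
      \<kappa> H p (\<phi> s) \<in> U)"
  have "\<exists>m. good s m" if "s \<in> ?S" for s
    unfolding good_def using that G vball_subset_verts by (intro nhd[OF U]) (auto simp: doubly_rooted_graphs_iff)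
  then obtain m where good: "\<And>s. s \<in> ?S \<Longrightarrow> good s (m s)" by metis
  have finS: "finite ?S" using finite_vball[OF G(1)] by simp
  define N where "N = Max (insert n (m ` ?S))"
  have N: "n \<le> N" "\<And>s. s \<in> ?S \<Longrightarrow> m s \<le> N" using finS by (auto simp: N_def)
  show "\<exists>n'. \<forall>H p \<phi>. (H, p) \<in> rooted_graphs D \<and> ball_iso \<phi> G r H p n' \<longrightarrow>
      rclass D H p \<in> {c \<in> space (rooted_space D). k \<le> (ball_sum n (indicator U) c :: nat)}"
  proof (intro exI[of _ N] allI impI)
    fix H p \<phi> assume H: "(H, p) \<in> rooted_graphs D \<and> ball_iso \<phi> G r H p N"
    then have Hc: "connected_graph D H" "p \<in> verts H" by (auto simp: rooted_graphs_iff)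
    have bij: "bij_betw \<phi> (vball G r n) (vball H p n)"
      using ball_iso_vball[OF G Hc _ N(1)] H by blast
    have m: "\<kappa> H p (\<phi> s) \<in> U" if s: "s \<in> ?S" for s
      using good[OF s] N(2)[OF s] H unfolding good_def by blast
    have "(\<Sum>s\<in>vball G r n. indicator U (\<kappa> G r s) :: nat) \<le> (\<Sum>s\<in>vball G r n. indicator U (\<kappa> H p (\<phi> s)))"
      using m by (intro sum_mono) (auto split: split_indicator)
    also have "\<dots> = (\<Sum>s\<in>vball H p n. indicator U (\<kappa> H p s))"
      using bij by (rule sum.reindex_bij_betw)
    also have "\<dots> = ball_sum n (indicator U) (rclass D H p)"
      using H by (simp add: ball_sum_rclass)
    finally show "rclass D H p \<in> {c \<in> space (rooted_space D). k \<le> (ball_sum n (indicator U) c :: nat)}"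
      using k rclass_in_space H by simp
  qed
qed

lemma dopen_space: "dopen D (space (doubly_rooted_space D))"
  unfolding dopen_def
proof safe
  fix G r s assume G: "(G, r, s) \<in> doubly_rooted_graphs D"
  then have "connected_graph D G" "r \<in> verts G" "s \<in> verts G" by (auto simp: doubly_rooted_graphs_iff)
  then obtain n where "s \<in> vball G r n" by (rule in_some_vball)
  then show "\<exists>n. s \<in> vball G r n \<and> (\<forall>H p \<phi>. (H, p) \<in> rooted_graphs D \<and> ball_iso \<phi> G r H p n \<longrightarrow>
      drclass D H p (\<phi> s) \<in> space (doubly_rooted_space D))"
  proof (intro exI[of _ n] conjI allI impI)
    fix H p \<phi> assume H: "(H, p) \<in> rooted_graphs D \<and> ball_iso \<phi> G r H p n"
      and s: "s \<in> vball G r n"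
    then have "\<phi> s \<in> verts H" using ball_iso_mem[of \<phi> G r H p n s] vball_subset_verts[of H p n] by blast
    then show "drclass D H p (\<phi> s) \<in> space (doubly_rooted_space D)"
      using H by (intro drclass_in_space) (auto simp: doubly_rooted_graphs_iff rooted_graphs_iff)
  qed
qed

text \<open>Semicontinuity settles open sets and a Dynkin system argument the others, as for the neighbours
  in the Bernoulli graph.\<close>
lemma measurable_ball_sum_indicator:
  assumes "A \<in> sets (doubly_rooted_space D)"
  shows "(\<lambda>c. ball_sum n (indicator A) c :: ennreal) \<in> borel_measurable (rooted_space D)"
proof -
  let ?M = "rooted_space D" and ?S = "space (doubly_rooted_space D)"
  have k_space: "\<kappa> (rep_graph c) (rep_root c) s \<in> ?S"
    if "c \<in> space ?M" "s \<in> vball (rep_graph c) (rep_root c) n" for c s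
    using that rep_rooted(1)[OF that(1)] vball_subset_verts
    by (intro sp) (auto simp: doubly_rooted_graphs_iff rooted_graphs_iff)
  have openc: "(\<lambda>c. ball_sum n (indicator U) c :: ennreal) \<in> borel_measurable ?M" if U: "dopen D U" for U
  proof -
    let ?g = "\<lambda>c. ball_sum n (indicator U) c :: nat"
    have *: "{c \<in> space ?M. k \<le> ?g c} \<in> sets ?M" for k
      by (rule ropen_sets[OF ropen_card[OF U]])
    have "?g \<in> measurable ?M (count_space UNIV)"
    proof (subst measurable_count_space_eq2_countable, safe)
      fix k
      have "?g -` {k} \<inter> space ?M = {c \<in> space ?M. k \<le> ?g c} - {c \<in> space ?M. Suc k \<le> ?g c}" by auto
      then show "?g -` {k} \<inter> space ?M \<in> sets ?M" by (simp only: sets.Diff[OF * *])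
    qed auto
    then have "(\<lambda>c. of_nat (?g c) :: ennreal) \<in> borel_measurable ?M" by measurable
    moreover have "(of_nat (?g c) :: ennreal) = ball_sum n (indicator U) c" for c
      unfolding of_nat_sum by (intro sum.cong) (auto split: split_indicator)
    ultimately show ?thesis by simp
  qed
  have "Int_stable {U. dopen D U}" by (auto simp: Int_stable_def dopen_Int)
  moreover have "{U. dopen D U} \<subseteq> Pow ?S" by (auto simp: dopen_def)
  moreover have "A \<in> sigma_sets ?S {U. dopen D U}"
    using assms sets_doubly_rooted_space_dopen by simp
  ultimately show ?thesis
  proof (induction rule: sigma_sets_induct_disjoint)
    case (basic U) then show ?case using openc by simp
  next
    case empty show ?case by simp
  next
    case (compl U)
    have "(\<lambda>c. ball_sum n (indicator ?S) c - ball_sum n (indicator U) c :: ennreal) \<in> borel_measurable ?M"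
      using compl openc[OF dopen_space] by measurable
    then show ?case
    proof (rule measurable_cong[THEN iffD1, rotated])
      fix c assume c: "c \<in> space ?M"
      have U: "U \<subseteq> ?S"
        using compl(1) sets_doubly_rooted_space_dopen[of D] sets.sets_into_space[of U "doubly_rooted_space D"] by simp
      have "ball_sum n (indicator ?S :: _ \<Rightarrow> ennreal) c = ball_sum n (indicator U) c + ball_sum n (indicator (?S - U)) c"
        unfolding sum.distrib[symmetric] using U
        by (intro sum.cong) (auto split: split_indicator)
      moreover have "ball_sum n (indicator U :: _ \<Rightarrow> ennreal) c \<noteq> \<top>"
        using finite_vball[of D] rep_rooted(1)[OF c]
        by (auto simp: rooted_graphs_iff split: split_indicator)
      ultimately show "ball_sum n (indicator ?S) c - ball_sum n (indicator U) c =
          (ball_sum n (indicator (?S - U)) c :: ennreal)" by simp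
    qed
  next
    case (union A)
    have eq: "ball_sum n (indicator (\<Union>i. A i)) c = (\<Sum>i. ball_sum n (indicator (A i)) c :: ennreal)" for c
    proof -
      have "(\<Sum>i. ball_sum n (indicator (A i)) c :: ennreal) =
          (\<Sum>s\<in>vball (rep_graph c) (rep_root c) n. \<Sum>i. indicator (A i) (\<kappa> (rep_graph c) (rep_root c) s))"
        by (rule suminf_sum) simp
      then show ?thesis using suminf_indicator[OF union(1)] by simp
    qed
    show ?case unfolding eq using union by measurable
  qed
qed

lemma measurable_ball_sum:
  fixes f :: "doubly_rooted_class \<Rightarrow> real"
  assumes "f \<in> borel_measurable (doubly_rooted_space D)" "\<And>x. 0 \<le> f x"
  shows "ball_sum n f \<in> borel_measurable (rooted_space D)"
  using assms
proof (induction f rule: borel_measurable_induct_real)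
  case (set A)
  have "(\<lambda>c. enn2real (ball_sum n (indicator A) c)) \<in> borel_measurable (rooted_space D)"
    using measurable_ball_sum_indicator[OF set] by measurable
  moreover have "enn2real (ball_sum n (indicator A) c) = (ball_sum n (indicator A) c :: real)" for c
  proof -
    have "ball_sum n (indicator A :: _ \<Rightarrow> ennreal) c = ennreal (ball_sum n (indicator A :: _ \<Rightarrow> real) c)"
      by (subst sum_ennreal[symmetric]) (auto simp: ennreal_indicator)
    then show ?thesis by (simp add: sum_nonneg)
  qed
  ultimately show ?case by simp
next
  case (mult u c) then show ?case by (simp flip: sum_distrib_left)
next
  case (add u v) then show ?case by (simp add: sum.distrib)
next
  case (seq U)
  show ?case
  proof (rule borel_measurable_LIMSEQ_real)
    show "ball_sum n (U i) \<in> borel_measurable (rooted_space D)" for i by (rule seq)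
    fix c assume c: "c \<in> space (rooted_space D)"
    have "\<kappa> (rep_graph c) (rep_root c) s \<in> space (doubly_rooted_space D)"
      if "s \<in> vball (rep_graph c) (rep_root c) n" for s
      using that rep_rooted(1)[OF c] vball_subset_verts
      by (intro sp) (auto simp: doubly_rooted_graphs_iff rooted_graphs_iff)
    then show "(\<lambda>i. ball_sum n (U i) c) \<longlonglongrightarrow> ball_sum n f c"
      using seq by (intro tendsto_sum) blast
  qed
qed

lemma measurable_vertex_sum:
  fixes f :: "doubly_rooted_class \<Rightarrow> real"
  assumes f[measurable]: "f \<in> borel_measurable (doubly_rooted_space D)"
    and nn: "\<And>c. c \<in> space (doubly_rooted_space D) \<Longrightarrow> 0 \<le> f c"
  shows "(\<lambda>c. \<integral>\<^sup>+ s. ennreal (f (\<kappa> (rep_graph c) (rep_root c) s)) \<partial>count_space (verts (rep_graph c)))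
    \<in> borel_measurable (rooted_space D)"
proof -
  let ?f = "\<lambda>x. max 0 (f x)"
  have "(\<lambda>c. SUP n. ennreal (ball_sum n ?f c)) \<in> borel_measurable (rooted_space D)"
  proof (rule borel_measurable_SUP)
    fix n show "(\<lambda>c. ennreal (ball_sum n ?f c)) \<in> borel_measurable (rooted_space D)"
      using measurable_ball_sum[of ?f n] by measurable
  qed auto
  then show ?thesis
  proof (rule measurable_cong[THEN iffD1, rotated])
    fix c assume c: "c \<in> space (rooted_space D)"
    have rep: "connected_graph D (rep_graph c)" "rep_root c \<in> verts (rep_graph c)"
      using rep_rooted(1)[OF c] by (auto simp: rooted_graphs_iff)
    have "f (\<kappa> (rep_graph c) (rep_root c) s) \<ge> 0" if "s \<in> vball (rep_graph c) (rep_root c) n" for s n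
      using that rep vball_subset_verts by (intro nn sp) (auto simp: doubly_rooted_graphs_iff)
    then show "(SUP n. ennreal (ball_sum n ?f c)) =
        (\<integral>\<^sup>+ s. ennreal (f (\<kappa> (rep_graph c) (rep_root c) s)) \<partial>count_space (verts (rep_graph c)))"
      unfolding nn_integral_vballs[OF rep] by (intro SUP_cong refl) (simp add: sum_ennreal)
  qed
qed

end

lemma root_pair_map_drclass: "root_pair_map D (drclass D)"
proof
  fix U G r s assume U: "dopen D U" "(G, r, s) \<in> doubly_rooted_graphs D" "drclass D G r s \<in> U"
  then have G: "connected_graph D G" "r \<in> verts G" by (auto simp: doubly_rooted_graphs_iff)
  obtain n where "\<And>H p \<phi>. (H, p) \<in> rooted_graphs D \<Longrightarrow> ball_iso \<phi> G r H p n \<Longrightarrow> drclass D H p (\<phi> s) \<in> U"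
    using U unfolding dopen_def by blast
  then show "\<exists>n. \<forall>m\<ge>n. \<forall>H p \<phi>. (H, p) \<in> rooted_graphs D \<and> ball_iso \<phi> G r H p m \<longrightarrow> drclass D H p (\<phi> s) \<in> U"
    using ball_iso_mono[OF G] by (intro exI[of _ n]) (auto simp: rooted_graphs_iff)
qed (use drclass_iso drclass_in_space in auto)

lemma root_pair_map_drclass_swap: "root_pair_map D (\<lambda>G r s. drclass D G s r)"
proof
  fix U G r s assume U: "dopen D U" "(G, r, s) \<in> doubly_rooted_graphs D" "drclass D G s r \<in> U"
  then have G: "connected_graph D G" "r \<in> verts G" "s \<in> verts G" by (auto simp: doubly_rooted_graphs_iff)
  then have "(G, s, r) \<in> doubly_rooted_graphs D" by (simp add: doubly_rooted_graphs_iff)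
  then obtain n where n: "\<And>H p \<phi>. (H, p) \<in> rooted_graphs D \<Longrightarrow> ball_iso \<phi> G s H p n \<Longrightarrow> drclass D H p (\<phi> r) \<in> U"
    using U unfolding dopen_def by blast
  obtain d where d: "s \<in> vball G r d" using in_some_vball G by metis
  show "\<exists>n. \<forall>m\<ge>n. \<forall>H p \<phi>. (H, p) \<in> rooted_graphs D \<and> ball_iso \<phi> G r H p m \<longrightarrow> drclass D H (\<phi> s) p \<in> U"
  proof (intro exI[of _ "d + n"] allI impI)
    fix m H p \<phi> assume m: "d + n \<le> m" and H: "(H, p) \<in> rooted_graphs D \<and> ball_iso \<phi> G r H p m"
    then have Hc: "connected_graph D H" "p \<in> verts H" by (auto simp: rooted_graphs_iff)
    have iso: "ball_iso \<phi> G r H p (d + n)" using ball_iso_mono[OF G(1,2) Hc _ m] H by blast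
    have "ball_iso \<phi> G s H (\<phi> s) n" "\<phi> s \<in> verts H"
      using ball_iso_recenter[OF G(1,2) Hc iso d] vball_subset_verts by auto
    then show "drclass D H (\<phi> s) p \<in> U"
      using n[of H "\<phi> s" \<phi>] Hc ball_iso_root[OF iso] by (simp add: rooted_graphs_iff)
  qed
qed (use drclass_iso drclass_in_space in \<open>auto simp: doubly_rooted_graphs_iff\<close>)

abbreviation unif :: "real measure" where "unif \<equiv> restrict_space lborel {0..1}"

lemma prob_space_unif: "prob_space unif"
  by (rule prob_spaceI) (simp add: emeasure_restrict_space space_restrict_space)

lemma space_PiM_unif: "space (PiM I (\<lambda>_. unif)) = I \<rightarrow>\<^sub>E {0..1}"
  by (simp add: space_PiM space_restrict_space)

lemma measurable_label [measurable]:
  "v \<in> I \<Longrightarrow> (\<lambda>\<xi>. \<xi> v) \<in> borel_measurable (PiM I (\<lambda>_. unif))"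
  by (rule measurable_compose[OF measurable_component_singleton]) (auto intro: measurable_restrict_space1)

lemma ball_iso_cong:
  assumes "\<And>v. v \<in> vball G r n \<Longrightarrow> \<phi> v = \<psi> v" "r \<in> verts G"
  shows "ball_iso \<phi> G r H p n \<longleftrightarrow> ball_iso \<psi> G r H p n"
proof -
  have "\<phi> r = \<psi> r" using assms by simp
  moreover have "bij_betw \<phi> (vball G r n) (vball H p n) \<longleftrightarrow> bij_betw \<psi> (vball G r n) (vball H p n)"
    using assms(1) by (rule bij_betw_cong)
  ultimately show ?thesis using assms(1) by (auto simp: ball_iso_def graph_iso_def)
qed

lemma measurable_lclass:
  assumes "(G, r) \<in> rooted_graphs D"
  shows "(\<lambda>\<xi>. lclass D G \<xi> r) \<in> PiM (verts G) (\<lambda>_. unif) \<rightarrow>\<^sub>M labelled_space D"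
proof (rule measurable_sigma_sets[OF sets_labelled_space])
  let ?P = "PiM (verts G) (\<lambda>_. unif)"
  have G: "connected_graph D G" "r \<in> verts G" using assms by (auto simp: rooted_graphs_iff)
  have L: "(G, \<xi>, r) \<in> labelled_graphs D" if "\<xi> \<in> space ?P" for \<xi>
    using that G by (simp add: labelled_graphs_iff space_PiM_unif)
  show "{labelled_cylinder D H p n U |H p n U. (H, p) \<in> rooted_graphs D \<and> (\<forall>v. open (U v))}
      \<subseteq> Pow (labelled_graphs D // labelled_iso D)"
    using labelled_cylinder_subset space_labelled_space by blast
  show "(\<lambda>\<xi>. lclass D G \<xi> r) \<in> space ?P \<rightarrow> labelled_graphs D // labelled_iso D"
    using lclass_in_space[OF L] space_labelled_space by blast
  fix A assume "A \<in> {labelled_cylinder D H p n U |H p n U. (H, p) \<in> rooted_graphs D \<and> (\<forall>v. open (U v))}"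
  then obtain H p n U where A: "A = labelled_cylinder D H p n U" "(H, p) \<in> rooted_graphs D" "\<And>v. open (U v)" by blast
  let ?S = "{\<sigma> \<in> vball G r n \<rightarrow>\<^sub>E vball H p n. ball_iso \<sigma> G r H p n}"
  have fin: "finite ?S"
    using finite_vball[OF G(1)] finite_vball[of D H] A(2)
    by (intro finite_subset[OF _ finite_PiE[of "vball G r n" "\<lambda>_. vball H p n"]]) (auto simp: rooted_graphs_iff)
  have "(\<lambda>\<xi>. lclass D G \<xi> r) -` A \<inter> space ?P =
      (\<Union>\<sigma>\<in>?S. {\<xi> \<in> space ?P. \<forall>v\<in>vball G r n. \<xi> v \<in> U (\<sigma> v)})"
  proof safe
    fix \<xi> assume \<xi>: "\<xi> \<in> space ?P" "lclass D G \<xi> r \<in> A"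
    then obtain \<phi> where \<phi>: "ball_iso \<phi> G r H p n" "\<forall>v\<in>vball G r n. \<xi> v \<in> U (\<phi> v)"
      unfolding A(1) lclass_in_labelled_cylinder_iff[OF L[OF \<xi>(1)]] by (elim exE conjE)
    let ?\<sigma> = "restrict \<phi> (vball G r n)"
    have "ball_iso ?\<sigma> G r H p n" using ball_iso_cong[of G r n ?\<sigma> \<phi>] \<phi> G by simp
    then have \<sigma>: "?\<sigma> \<in> ?S" using ball_iso_mem[OF \<phi>(1)] by auto
    have "\<forall>v\<in>vball G r n. \<xi> v \<in> U (?\<sigma> v)" using \<phi>(2) by simp
    then have "\<xi> \<in> {\<xi> \<in> space ?P. \<forall>v\<in>vball G r n. \<xi> v \<in> U (?\<sigma> v)}" using \<xi>(1) by simp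
    then show "\<xi> \<in> (\<Union>\<sigma>\<in>?S. {\<xi> \<in> space ?P. \<forall>v\<in>vball G r n. \<xi> v \<in> U (\<sigma> v)})"
      by (rule UN_I[OF \<sigma>])
  next
    fix \<xi> \<sigma> assume \<xi>: "\<xi> \<in> space ?P" and "ball_iso \<sigma> G r H p n" "\<forall>v\<in>vball G r n. \<xi> v \<in> U (\<sigma> v)"
    then show "\<xi> \<in> (\<lambda>\<xi>. lclass D G \<xi> r) -` A"
      unfolding A(1) vimage_eq lclass_in_labelled_cylinder_iff[OF L[OF \<xi>]] by (intro exI[of _ \<sigma>] conjI)
  qed
  moreover have "{\<xi> \<in> space ?P. \<forall>v\<in>vball G r n. \<xi> v \<in> U (\<sigma> v)} \<in> sets ?P" for \<sigma>
  proof (rule sets.sets_Collect_finite_All'[OF _ finite_vball[OF G(1)]])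
    fix v assume "v \<in> vball G r n"
    then have v: "v \<in> verts G" by (rule subsetD[OF vball_subset_verts])
    have "(\<lambda>\<xi>. \<xi> v) -` U (\<sigma> v) \<inter> space ?P \<in> sets ?P"
      by (rule measurable_sets[OF measurable_label[OF v]]) (simp add: A(3))
    then show "{\<xi> \<in> space ?P. \<xi> v \<in> U (\<sigma> v)} \<in> sets ?P"
      by (simp add: vimage_def Int_def conj_commute)
  qed (use G(2) root_in_vball[of r G n] in blast)
  ultimately show "(\<lambda>\<xi>. lclass D G \<xi> r) -` A \<inter> space ?P \<in> sets ?P"
    using fin by (simp only:) (rule sets.finite_UN, auto)
qed

text \<open>The conditional law of the labelled class given the rooted graph; the Bernoulli measure is the
  mixture of these laws.\<close>
definition bern :: "nat \<Rightarrow> graph \<Rightarrow> nat \<Rightarrow> labelled_class measure" where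
  "bern D G r = distr (PiM (verts G) (\<lambda>_. unif)) (labelled_space D) (\<lambda>\<xi>. lclass D G \<xi> r)"

lemma sets_bern [simp, measurable_cong]: "sets (bern D G r) = sets (labelled_space D)"
  by (simp add: bern_def)

lemma prob_space_PiM_unif: "prob_space (PiM I (\<lambda>_. unif))"
  by (intro prob_space_PiM prob_space_unif)

lemma prob_space_bern: "(G, r) \<in> rooted_graphs D \<Longrightarrow> prob_space (bern D G r)"
  unfolding bern_def by (intro prob_space.prob_space_distr prob_space_PiM_unif measurable_lclass)

text \<open>Events that depend on the graph and the labels within distance \<open>n\<close>. They generate
  the \<open>\<sigma>\<close>-algebra, and their conditional probabilities are local functions
  of the graph.\<close>
definition llocal :: "nat \<Rightarrow> nat \<Rightarrow> labelled_class set \<Rightarrow> bool" where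
  "llocal D n A \<longleftrightarrow> A \<in> sets (labelled_space D) \<and>
     (\<forall>G \<xi> r H \<eta> p \<phi>. (G, \<xi>, r) \<in> labelled_graphs D \<longrightarrow> (H, \<eta>, p) \<in> labelled_graphs D \<longrightarrow>
       ball_iso \<phi> G r H p n \<longrightarrow> (\<forall>v\<in>vball G r n. \<eta> (\<phi> v) = \<xi> v) \<longrightarrow>
       (lclass D G \<xi> r \<in> A \<longleftrightarrow> lclass D H \<eta> p \<in> A))"

lemma llocalD:
  "llocal D n A \<Longrightarrow> (G, \<xi>, r) \<in> labelled_graphs D \<Longrightarrow> (H, \<eta>, p) \<in> labelled_graphs D \<Longrightarrow>
    ball_iso \<phi> G r H p n \<Longrightarrow> (\<And>v. v \<in> vball G r n \<Longrightarrow> \<eta> (\<phi> v) = \<xi> v) \<Longrightarrow>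
    lclass D G \<xi> r \<in> A \<longleftrightarrow> lclass D H \<eta> p \<in> A"
  unfolding llocal_def by blast

lemma llocal_labelled_cylinder:
  assumes "(K, k) \<in> rooted_graphs D" "\<And>v. open (U v)"
  shows "llocal D n (labelled_cylinder D K k n U)"
  unfolding llocal_def
proof (intro conjI allI impI)
  show "labelled_cylinder D K k n U \<in> sets (labelled_space D)"
    by (rule lopen_sets[OF lopen_labelled_cylinder[OF assms]])
  have aux: "lclass D H \<eta> p \<in> labelled_cylinder D K k n U"
    if c: "(G, \<xi>, r) \<in> labelled_graphs D" "(H, \<eta>, p) \<in> labelled_graphs D"
      "ball_iso \<phi> H p G r n" "\<forall>v\<in>vball H p n. \<xi> (\<phi> v) = \<eta> v" "lclass D G \<xi> r \<in> labelled_cylinder D K k n U"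
    for G \<xi> r H \<eta> p \<phi>
  proof -
    obtain \<psi> where \<psi>: "ball_iso \<psi> G r K k n" "\<forall>v\<in>vball G r n. \<xi> v \<in> U (\<psi> v)"
      using c(5) lclass_in_labelled_cylinder_iff[OF c(1)] by blast
    have "\<forall>v\<in>vball H p n. \<eta> v \<in> U (\<psi> (\<phi> v))" using \<psi>(2) c(4) ball_iso_mem[OF c(3)] by metis
    then show ?thesis
      using lclass_in_labelled_cylinder_iff[OF c(2)] ball_iso_comp[OF c(3) \<psi>(1)] by blast
  qed
  fix G \<xi> r H \<eta> p \<phi>
  assume c: "(G, \<xi>, r) \<in> labelled_graphs D" "(H, \<eta>, p) \<in> labelled_graphs D"
    "ball_iso \<phi> G r H p n" "\<forall>v\<in>vball G r n. \<eta> (\<phi> v) = \<xi> v"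
  have r: "r \<in> verts G" using c(1) by (simp add: labelled_graphs_iff)
  let ?\<psi> = "inv_into (vball G r n) \<phi>"
  have i: "ball_iso ?\<psi> H p G r n" by (rule ball_iso_inv[OF c(3) r])
  have "\<forall>v\<in>vball H p n. \<xi> (?\<psi> v) = \<eta> v"
    using c(4) ball_iso_mem[OF i] bij_betw_inv_into_right[OF ball_iso_bij[OF c(3)]] by metis
  then show "lclass D G \<xi> r \<in> labelled_cylinder D K k n U \<longleftrightarrow> lclass D H \<eta> p \<in> labelled_cylinder D K k n U"
    using aux[OF c(1,2) i] aux[OF c(2,1,3)] c(4) by blast
qed

lemma llocal_Int:
  assumes "llocal D m A" "llocal D n B"
  shows "llocal D (max m n) (A \<inter> B)"
  unfolding llocal_def
proof (intro conjI allI impI)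
  show "A \<inter> B \<in> sets (labelled_space D)" using assms by (auto simp: llocal_def)
  fix G \<xi> r H \<eta> p \<phi>
  assume c: "(G, \<xi>, r) \<in> labelled_graphs D" "(H, \<eta>, p) \<in> labelled_graphs D"
    "ball_iso \<phi> G r H p (max m n)" "\<forall>v\<in>vball G r (max m n). \<eta> (\<phi> v) = \<xi> v"
  then have "connected_graph D G" "r \<in> verts G" "connected_graph D H" "p \<in> verts H"
    by (auto simp: labelled_graphs_iff)
  note mono = ball_iso_mono[OF this c(3)]
  have "lclass D G \<xi> r \<in> A \<longleftrightarrow> lclass D H \<eta> p \<in> A"
    using c(4) vball_mono[of m "max m n" G r] by (intro llocalD[OF assms(1) c(1,2) mono]) auto
  moreover have "lclass D G \<xi> r \<in> B \<longleftrightarrow> lclass D H \<eta> p \<in> B"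
    using c(4) vball_mono[of n "max m n" G r] by (intro llocalD[OF assms(2) c(1,2) mono]) auto
  ultimately show "lclass D G \<xi> r \<in> A \<inter> B \<longleftrightarrow> lclass D H \<eta> p \<in> A \<inter> B" by blast
qed

text \<open>Labels beyond distance \<open>n\<close> are irrelevant, and the independent labels within that
  distance are merely reindexed by an isomorphism of balls.\<close>
lemma bern_llocal:
  assumes A: "llocal D n A"
  shows "local_fun D n (\<lambda>G r. emeasure (bern D G r) A)"
  unfolding local_fun_def
proof (intro allI impI)
  fix G r H p \<phi>
  assume Gr: "(G, r) \<in> rooted_graphs D" and Hp: "(H, p) \<in> rooted_graphs D" and iso: "ball_iso \<phi> G r H p n"
  have G: "connected_graph D G" "r \<in> verts G" using Gr by (auto simp: rooted_graphs_iff)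
  let ?B = "vball G r n"
  \<comment> \<open>the label 0 outside the ball is arbitrary\<close>
  define ext where "ext = (\<lambda>\<zeta> :: nat \<Rightarrow> real. \<lambda>v\<in>verts G. if v \<in> ?B then \<zeta> v else 0)"
  have ext: "ext \<in> PiM ?B (\<lambda>_. unif) \<rightarrow>\<^sub>M PiM (verts G) (\<lambda>_. unif)"
    unfolding ext_def
  proof (rule measurable_restrict)
    fix v assume "v \<in> verts G"
    show "(\<lambda>\<zeta>. if v \<in> ?B then \<zeta> v else 0) \<in> PiM ?B (\<lambda>_. unif) \<rightarrow>\<^sub>M unif"
      by (cases "v \<in> ?B") (auto simp: space_restrict_space)
  qed
  define S where "S = (\<lambda>\<zeta>. lclass D G (ext \<zeta>) r) -` A \<inter> space (PiM ?B (\<lambda>_. unif))"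
  have S: "S \<in> sets (PiM ?B (\<lambda>_. unif))"
    unfolding S_def using A by (intro measurable_sets[OF measurable_compose[OF ext measurable_lclass[OF Gr]]])
      (auto simp: llocal_def)
  have key: "emeasure (bern D H p) A = emeasure (PiM ?B (\<lambda>_. unif)) S"
    if Hp: "(H, p) \<in> rooted_graphs D" and iso: "ball_iso \<phi> G r H p n" for H p \<phi>
  proof -
    have H: "connected_graph D H" "p \<in> verts H" using Hp by (auto simp: rooted_graphs_iff)
    let ?t = "\<lambda>\<eta> :: nat \<Rightarrow> real. \<lambda>v\<in>?B. \<eta> (\<phi> v)"
    have inj: "inj_on \<phi> ?B" "\<phi> \<in> ?B \<rightarrow> verts H"
      using ball_iso_bij[OF iso] vball_subset_verts[of H p n] by (auto simp: bij_betw_def)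
    have d: "distr (PiM (verts H) (\<lambda>_. unif)) (PiM ?B (\<lambda>_. unif)) ?t = PiM ?B (\<lambda>_. unif)"
      using distr_PiM_reindex[of "verts H" "\<lambda>_. unif" \<phi> ?B] inj prob_space_unif by simp
    have t: "?t \<in> PiM (verts H) (\<lambda>_. unif) \<rightarrow>\<^sub>M PiM ?B (\<lambda>_. unif)"
      using inj(2) by (intro measurable_restrict) (auto intro: measurable_component_singleton)
    have "emeasure (bern D H p) A =
        emeasure (PiM (verts H) (\<lambda>_. unif)) ((\<lambda>\<eta>. lclass D H \<eta> p) -` A \<inter> space (PiM (verts H) (\<lambda>_. unif)))"
      unfolding bern_def using A by (intro emeasure_distr measurable_lclass Hp) (auto simp: llocal_def)
    also have "(\<lambda>\<eta>. lclass D H \<eta> p) -` A \<inter> space (PiM (verts H) (\<lambda>_. unif)) =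
        ?t -` S \<inter> space (PiM (verts H) (\<lambda>_. unif))"
    proof -
      have "lclass D H \<eta> p \<in> A \<longleftrightarrow> ?t \<eta> \<in> S" if \<eta>: "\<eta> \<in> space (PiM (verts H) (\<lambda>_. unif))" for \<eta>
      proof -
        have ts: "?t \<eta> \<in> space (PiM ?B (\<lambda>_. unif))" using measurable_space[OF t \<eta>] .
        then have "ext (?t \<eta>) \<in> space (PiM (verts G) (\<lambda>_. unif))" using measurable_space[OF ext] by blast
        then have "(G, ext (?t \<eta>), r) \<in> labelled_graphs D" "(H, \<eta>, p) \<in> labelled_graphs D"
          using G H \<eta> by (auto simp: labelled_graphs_iff space_PiM_unif)
        then have "lclass D G (ext (?t \<eta>)) r \<in> A \<longleftrightarrow> lclass D H \<eta> p \<in> A"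
          using vball_subset_verts[of G r n] by (intro llocalD[OF A _ _ iso]) (auto simp: ext_def)
        then show ?thesis using ts by (simp add: S_def)
      qed
      then show ?thesis by blast
    qed
    also have "emeasure (PiM (verts H) (\<lambda>_. unif)) \<dots> = emeasure (PiM ?B (\<lambda>_. unif)) S"
      using emeasure_distr[OF t S] d by simp
    finally show ?thesis .
  qed
  have "ball_iso (\<lambda>x. x) G r G r n" using graph_iso_id by (simp add: ball_iso_def)
  then show "emeasure (bern D G r) A = emeasure (bern D H p) A"
    using key[OF Gr] key[OF Hp iso] by simp
qed

lemma sets_labelled_space_llocal:
  "sets (labelled_space D) = sigma_sets (space (labelled_space D)) {A. \<exists>n. llocal D n A}"
proof
  show "sets (labelled_space D) \<subseteq> sigma_sets (space (labelled_space D)) {A. \<exists>n. llocal D n A}"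
    unfolding sets_labelled_space space_labelled_space
    by (rule sigma_sets_mono') (use llocal_labelled_cylinder in blast)
  show "sigma_sets (space (labelled_space D)) {A. \<exists>n. llocal D n A} \<subseteq> sets (labelled_space D)"
    by (rule sets.sigma_sets_subset) (auto simp: llocal_def)
qed

lemma measurable_bern:
  "(\<lambda>c. bern D (rep_graph c) (rep_root c)) \<in> rooted_space D \<rightarrow>\<^sub>M subprob_algebra (labelled_space D)"
proof (rule measurable_subprob_algebra_generated[OF sets_labelled_space_llocal])
  show "Int_stable {A. \<exists>n. llocal D n A}" using llocal_Int by (force simp: Int_stable_def)
  show "{A. \<exists>n. llocal D n A} \<subseteq> Pow (space (labelled_space D))"
    using sets.sets_into_space by (auto simp: llocal_def)
  have p: "prob_space (bern D (rep_graph c) (rep_root c))" if "c \<in> space (rooted_space D)" for c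
    using prob_space_bern rep_rooted(1)[OF that] by blast
  then show "subprob_space (bern D (rep_graph c) (rep_root c))" if "c \<in> space (rooted_space D)" for c
    using that prob_space_imp_subprob_space by blast
  show "(\<lambda>c. emeasure (bern D (rep_graph c) (rep_root c)) A) \<in> borel_measurable (rooted_space D)"
    if A: "A \<in> {A. \<exists>n. llocal D n A}" for A
  proof -
    obtain n where "llocal D n A" using A by blast
    from measurable_local_fun[OF bern_llocal[OF this]] show ?thesis
      by (rule measurable_compose[where g = "\<lambda>x. x"]) simp
  qed
  have "emeasure (bern D (rep_graph c) (rep_root c)) (space (labelled_space D)) = 1"
    if "c \<in> space (rooted_space D)" for c
    using prob_space.emeasure_space_1[OF p[OF that]] sets_eq_imp_space_eq[OF sets_bern] by metis
  then show "(\<lambda>c. emeasure (bern D (rep_graph c) (rep_root c)) (space (labelled_space D))) \<in> borel_measurable (rooted_space D)"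
    by (subst measurable_cong[where g = "\<lambda>_. 1"]) auto
qed simp

section \<open>Spectra of operators on seminormed spaces\<close>

text \<open>Vectors are functions, and equality of vectors means that the difference has seminorm 0.
  Spectral theory is developed directly for such spaces, without passing to quotients.\<close>
locale seminormed =
  fixes H :: "('a \<Rightarrow> complex) set" and N :: "('a \<Rightarrow> complex) \<Rightarrow> real"
  assumes H_add: "f \<in> H \<Longrightarrow> g \<in> H \<Longrightarrow> (\<lambda>x. f x + g x) \<in> H"
    and H_scale: "f \<in> H \<Longrightarrow> (\<lambda>x. c * f x) \<in> H"
    and N_nonneg: "0 \<le> N f"
    and N_add: "f \<in> H \<Longrightarrow> g \<in> H \<Longrightarrow> N (\<lambda>x. f x + g x) \<le> N f + N g"
    and N_scale: "f \<in> H \<Longrightarrow> N (\<lambda>x. c * f x) = cmod c * N f"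
begin

lemma H_diff: "f \<in> H \<Longrightarrow> g \<in> H \<Longrightarrow> (\<lambda>x. f x - g x) \<in> H"
  using H_add[of f "\<lambda>x. - 1 * g x"] H_scale[of g "-1"] by simp

lemma N_diff: "f \<in> H \<Longrightarrow> g \<in> H \<Longrightarrow> N (\<lambda>x. f x - g x) \<le> N f + N g"
  using N_add[of f "\<lambda>x. - 1 * g x"] H_scale[of g "-1"] N_scale[of g "-1"] by simp

lemma N_diff_ge: "f \<in> H \<Longrightarrow> g \<in> H \<Longrightarrow> N f - N g \<le> N (\<lambda>x. f x - g x)"
  using N_add[of "\<lambda>x. f x - g x" g] H_diff[of f g] by simp

lemma H_sum: "finite I \<Longrightarrow> H \<noteq> {} \<Longrightarrow> (\<And>i. i \<in> I \<Longrightarrow> f i \<in> H) \<Longrightarrow> (\<lambda>x. \<Sum>i\<in>I. f i x) \<in> H"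
proof (induction I rule: finite_induct)
  case empty
  then obtain g where "g \<in> H" by blast
  from H_scale[OF this, of 0] show ?case by simp
next
  case (insert i I) then show ?case using H_add[of "f i" "\<lambda>x. \<Sum>i\<in>I. f i x"] by simp
qed

text \<open>A bounded inverse of \<open>T - z\<close> would bound \<open>N f\<close> by a multiple of
  \<open>N (T f - z f)\<close>.\<close>
lemma in_spectrum_if_approx_eigen:
  assumes "\<And>f. f \<in> H \<Longrightarrow> T f \<in> H"
    and approx: "\<And>\<epsilon>. \<epsilon> > 0 \<Longrightarrow> \<exists>f\<in>H. N (\<lambda>x. T f x - z * f x) < \<epsilon> * N f"
  shows "z \<in> spectrum_on H N T"
  unfolding spectrum_on_def
proof safe
  fix S assume S: "bounded_operator H N S"
    and inv: "\<forall>f\<in>H. N (\<lambda>x. S (\<lambda>y. T f y - z * f y) x - f x) = 0 \<and> N (\<lambda>x. (T (S f) x - z * S f x) - f x) = 0"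
  obtain C where C: "\<And>f. f \<in> H \<Longrightarrow> N (S f) \<le> C * N f" and SH: "S \<in> H \<rightarrow> H"
    using S unfolding bounded_operator_def by blast
  \<comment> \<open>the bound \<open>C\<close> may be negative if all seminorms vanish\<close>
  have "1 / (\<bar>C\<bar> + 1) > 0" by simp
  from approx[OF this] obtain f where f: "f \<in> H" "N (\<lambda>x. T f x - z * f x) < 1 / (\<bar>C\<bar> + 1) * N f" by blast
  let ?h = "\<lambda>x. T f x - z * f x"
  have h: "?h \<in> H" using assms(1)[OF f(1)] H_scale[OF f(1)] by (rule H_diff)
  then have Sh: "S ?h \<in> H" using SH by blast
  have "N (S ?h) \<le> \<bar>C\<bar> * N ?h" using C[OF h] N_nonneg[of ?h] by (meson abs_ge_self mult_right_mono order_trans)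
  moreover have "N f \<le> N (S ?h) + N (\<lambda>x. S ?h x - f x)"
    using N_diff[OF Sh H_diff[OF Sh f(1)]] by simp
  moreover have "N (\<lambda>x. S ?h x - f x) = 0" using inv f(1) by simp
  ultimately have "N f \<le> (\<bar>C\<bar> + 1) * N ?h" using N_nonneg[of ?h] by (simp add: distrib_right)
  moreover have "(\<bar>C\<bar> + 1) * N ?h < N f" using f(2) by (simp add: field_simps)
  ultimately show False by simp
qed

end

text \<open>Completeness in the form used by the Neumann series: geometrically dominated series converge.\<close>
locale complete_seminormed = seminormed +
  assumes complete: "(\<And>k. f k \<in> H) \<Longrightarrow> (\<And>k. N (f k) \<le> C * q ^ k) \<Longrightarrow> 0 \<le> q \<Longrightarrow> q < 1 \<Longrightarrow>
      \<exists>g\<in>H. (\<lambda>n. N (\<lambda>x. g x - (\<Sum>k<n. f k x))) \<longlonglongrightarrow> 0"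
begin

text \<open>The inverse of \<open>T - z\<close> is the Neumann series with terms \<open>- (1/z)^(k+1)
  T^k\<close>. A limit is determined only up to seminorm 0, so the inverse is obtained by
  choice, and it is linear up to seminorm 0 because \<open>T - z\<close> is bounded below.\<close>
lemma not_in_spectrum:
  assumes TH: "\<And>f. f \<in> H \<Longrightarrow> T f \<in> H"
    and T_add: "\<And>f g. T (\<lambda>x. f x + g x) = (\<lambda>x. T f x + T g x)"
    and T_scale: "\<And>c f. T (\<lambda>x. c * f x) = (\<lambda>x. c * T f x)"
    and T_bound: "\<And>f. f \<in> H \<Longrightarrow> N (T f) \<le> c * N f"
    and c: "0 \<le> c" "c < cmod z" and nonempty: "H \<noteq> {}"
  shows "z \<notin> spectrum_on H N T"
proof -
  let ?A = "\<lambda>f x. T f x - z * f x"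
  have T_diff: "T (\<lambda>x. f x - g x) = (\<lambda>x. T f x - T g x)" for f g
    using T_add[of f "\<lambda>x. - 1 * g x"] T_scale[of "-1" g] by simp
  have z0: "z \<noteq> 0" using c by auto
  have AH: "?A f \<in> H" if "f \<in> H" for f using H_diff[OF TH[OF that] H_scale[OF that]] .
  have below: "(cmod z - c) * N f \<le> N (?A f)" if f: "f \<in> H" for f
  proof -
    have "N (\<lambda>x. z * f x) - N (T f) \<le> N (\<lambda>x. z * f x - T f x)" by (rule N_diff_ge[OF H_scale[OF f] TH[OF f]])
    also have "\<dots> = N (?A f)" using N_scale[OF AH[OF f], of "-1"] by simp
    finally show ?thesis using N_scale[OF f, of z] T_bound[OF f] by (simp add: algebra_simps)
  qed
  have above: "N (?A f) \<le> (c + cmod z) * N f" if f: "f \<in> H" for f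
    using N_diff[OF TH[OF f] H_scale[OF f, of z]] N_scale[OF f, of z] T_bound[OF f] by (simp add: algebra_simps)
  have zero: "N f = 0" if "f \<in> H" "N (?A f) = 0" for f
  proof -
    have "(cmod z - c) * N f \<le> 0" using below[OF that(1)] that(2) by simp
    then show ?thesis using c(2) N_nonneg[of f] by (simp add: mult_le_0_iff)
  qed
  have sol: "\<exists>g\<in>H. N (\<lambda>x. ?A g x - h x) = 0" if h: "h \<in> H" for h
  proof -
    define f where "f = (\<lambda>k x. - ((1 / z) ^ Suc k) * (T ^^ k) h x)"
    have TkH: "(T ^^ k) h \<in> H" for k by (induction k) (simp_all add: h TH)
    have Tk: "N ((T ^^ k) h) \<le> c ^ k * N h" for k
    proof (induction k)
      case (Suc k)
      have "N ((T ^^ Suc k) h) \<le> c * N ((T ^^ k) h)" using T_bound[OF TkH] by simp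
      also have "\<dots> \<le> c * (c ^ k * N h)" using Suc c(1) by (rule mult_left_mono)
      finally show ?case by simp
    qed simp
    have fH: "f k \<in> H" for k unfolding f_def by (rule H_scale[OF TkH])
    have "N (f k) \<le> (N h / cmod z) * (c / cmod z) ^ k" for k
    proof -
      have "N (f k) = (1 / cmod z) ^ Suc k * N ((T ^^ k) h)"
        unfolding f_def by (subst N_scale[OF TkH]) (simp add: norm_power norm_divide norm_mult)
      also have "\<dots> \<le> (1 / cmod z) ^ Suc k * (c ^ k * N h)" by (intro mult_left_mono Tk) simp
      finally show ?thesis by (simp add: field_simps power_divide)
    qed
    from complete[OF fH this] c z0 obtain g where g: "g \<in> H"
      "(\<lambda>n. N (\<lambda>x. g x - (\<Sum>k<n. f k x))) \<longlonglongrightarrow> 0" by (auto simp: divide_less_eq)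
    let ?p = "\<lambda>n x. \<Sum>k<n. f k x"
    have pH: "?p n \<in> H" for n using fH nonempty by (intro H_sum) auto
    have Ap: "?A (?p n) = (\<lambda>x. h x - ((1 / z) ^ n) * (T ^^ n) h x)" for n
    proof (induction n)
      case 0
      have "T (\<lambda>x. 0 * h x) = (\<lambda>x. 0 * T h x)" by (rule T_scale)
      then show ?case by simp
    next
      case (Suc n)
      have "?A (?p (Suc n)) x = ?A (?p n) x + (T (f n) x - z * f n x)" for x
        using fun_cong[OF T_add[of "?p n" "f n"], of x] by (simp add: algebra_simps)
      moreover have "T (f n) x = - ((1 / z) ^ Suc n) * (T ^^ Suc n) h x" for x
        unfolding f_def using fun_cong[OF T_scale[of "- ((1 / z) ^ Suc n)" "(T ^^ n) h"], of x] by simp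
      moreover have "z * f n x = - ((1 / z) ^ n) * (T ^^ n) h x" for x
        using z0 by (simp add: f_def)
      ultimately show ?case using Suc by (simp add: fun_eq_iff)
    qed
    \<comment> \<open>the error is the image of the tail of the series plus a telescoped remainder\<close>
    have le: "N (\<lambda>x. ?A g x - h x) \<le> (c + cmod z) * N (\<lambda>x. g x - ?p n x) + (c / cmod z) ^ n * N h" for n
    proof -
      let ?d = "\<lambda>x. g x - ?p n x"
      have dH: "?d \<in> H" by (rule H_diff[OF g(1) pH])
      have eq: "(\<lambda>x. ?A g x - h x) = (\<lambda>x. ?A ?d x + (- ((1 / z) ^ n)) * (T ^^ n) h x)"
      proof
        fix x
        have "?A ?d x = ?A g x - ?A (?p n) x" using fun_cong[OF T_diff[of g "?p n"], of x] by (simp add: algebra_simps)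
        then show "?A g x - h x = ?A ?d x + (- ((1 / z) ^ n)) * (T ^^ n) h x"
          using fun_cong[OF Ap[of n], of x] by simp
      qed
      have "N (\<lambda>x. ?A g x - h x) \<le> N (?A ?d) + N (\<lambda>x. (- ((1 / z) ^ n)) * (T ^^ n) h x)"
        unfolding eq by (rule N_add[OF AH[OF dH] H_scale[OF TkH]])
      also have "N (\<lambda>x. (- ((1 / z) ^ n)) * (T ^^ n) h x) = (1 / cmod z) ^ n * N ((T ^^ n) h)"
        by (subst N_scale[OF TkH]) (simp add: norm_power norm_divide)
      also have "\<dots> \<le> (1 / cmod z) ^ n * (c ^ n * N h)" by (intro mult_left_mono Tk) simp
      also have "\<dots> = (c / cmod z) ^ n * N h" by (simp add: power_divide)
      finally show ?thesis using above[OF dH] by linarith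
    qed
    have "(\<lambda>n. (c + cmod z) * N (\<lambda>x. g x - ?p n x) + (c / cmod z) ^ n * N h) \<longlonglongrightarrow> (c + cmod z) * 0 + 0 * N h"
      using c z0 by (intro tendsto_intros g(2) LIMSEQ_realpow_zero) (auto simp: divide_less_eq)
    then have "(\<lambda>n. (c + cmod z) * N (\<lambda>x. g x - ?p n x) + (c / cmod z) ^ n * N h) \<longlonglongrightarrow> 0" by simp
    then have "N (\<lambda>x. ?A g x - h x) \<le> 0" by (rule LIMSEQ_le_const) (use le in blast)
    then show ?thesis using g(1) N_nonneg antisym by blast
  qed
  define S where "S = (\<lambda>h. SOME g. g \<in> H \<and> N (\<lambda>x. ?A g x - h x) = 0)"
  have S: "S h \<in> H" "N (\<lambda>x. ?A (S h) x - h x) = 0" if "h \<in> H" for h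
    using someI_ex[of "\<lambda>g. g \<in> H \<and> N (\<lambda>x. ?A g x - h x) = 0"] sol[OF that] unfolding S_def by blast+
  \<comment> \<open>linearity of \<open>S\<close> is checked after applying \<open>T - z\<close>, where both sides agree up to seminorm 0\<close>
  have NA: "N f = 0" if f: "f \<in> H" and ex: "\<exists>a\<in>H. \<exists>b\<in>H. N a = 0 \<and> N b = 0 \<and> ?A f = (\<lambda>x. a x + b x)" for f
  proof -
    obtain a b where ab: "a \<in> H" "b \<in> H" "N a = 0" "N b = 0" "?A f = (\<lambda>x. a x + b x)"
      using ex by blast
    have "N (?A f) \<le> 0" using N_add[OF ab(1,2)] ab by simp
    then show ?thesis using zero[OF f] N_nonneg[of "?A f"] by simp
  qed
  have res: "(\<lambda>x. ?A (S h) x - h x) \<in> H" if "h \<in> H" for h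
    by (rule H_diff[OF AH[OF S(1)[OF that]] that])
  have "bounded_operator H N S"
    unfolding bounded_operator_def
  proof (intro conjI ballI allI)
    show "S \<in> H \<rightarrow> H" using S(1) by blast
    fix f g assume f: "f \<in> H" and g: "g \<in> H"
    let ?fg = "\<lambda>x. f x + g x"
    have fg: "?fg \<in> H" by (rule H_add[OF f g])
    have d: "(\<lambda>x. S ?fg x - (S f x + S g x)) \<in> H"
      using S(1)[OF fg] H_add[OF S(1)[OF f] S(1)[OF g]] by (rule H_diff)
    show "N (\<lambda>x. S ?fg x - (S f x + S g x)) = 0"
    proof -
      let ?a = "\<lambda>x. ?A (S ?fg) x - ?fg x"
      let ?bb = "\<lambda>x. (?A (S f) x - f x) + (?A (S g) x - g x)"
      let ?b = "\<lambda>x. (- 1) * ?bb x"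
      have 1: "?a \<in> H" "N ?a = 0" using S(2)[OF fg] res[OF fg] by auto
      have b0: "?bb \<in> H" by (rule H_add[OF res[OF f] res[OF g]])
      have 2: "?b \<in> H" by (rule H_scale[OF b0])
      have "N ?bb \<le> 0" using N_add[OF res[OF f] res[OF g]] S(2)[OF f] S(2)[OF g] by simp
      then have "N ?bb = 0" using N_nonneg[of ?bb] by simp
      then have 3: "N ?b = 0" using N_scale[OF b0, of "-1"] by simp
      have 4: "?A (\<lambda>x. S ?fg x - (S f x + S g x)) = (\<lambda>x. ?a x + ?b x)"
        using T_diff[of "S ?fg" "\<lambda>x. S f x + S g x"] T_add[of "S f" "S g"]
        by (simp add: fun_eq_iff algebra_simps)
      show ?thesis by (intro NA[OF d] bexI[of _ ?a] bexI[of _ ?b] conjI 1 2 3 4)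
    qed
  next
    fix a f assume f: "f \<in> H"
    let ?af = "\<lambda>x. a * f x"
    have af: "?af \<in> H" by (rule H_scale[OF f])
    have d: "(\<lambda>x. S ?af x - a * S f x) \<in> H"
      using S(1)[OF af] H_scale[OF S(1)[OF f]] by (rule H_diff)
    show "N (\<lambda>x. S ?af x - a * S f x) = 0"
    proof -
      let ?a = "\<lambda>x. ?A (S ?af) x - ?af x"
      let ?b = "\<lambda>x. - a * (?A (S f) x - f x)"
      have 1: "?a \<in> H" "N ?a = 0" using S(2)[OF af] res[OF af] by auto
      have 2: "?b \<in> H" by (rule H_scale[OF res[OF f]])
      have 3: "N ?b = 0" using N_scale[OF res[OF f], of "-a"] S(2)[OF f] by simp
      have 4: "?A (\<lambda>x. S ?af x - a * S f x) = (\<lambda>x. ?a x + ?b x)"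
        using T_diff[of "S ?af" "\<lambda>x. a * S f x"] T_scale[of a "S f"]
        by (simp add: fun_eq_iff algebra_simps)
      show ?thesis by (intro NA[OF d] bexI[of _ ?a] bexI[of _ ?b] conjI 1 2 3 4)
    qed
  next
    show "\<exists>C. \<forall>f\<in>H. N (S f) \<le> C * N f"
    proof (intro exI[of _ "1 / (cmod z - c)"] ballI)
      fix f assume f: "f \<in> H"
      have "N (?A (S f)) \<le> N (\<lambda>x. ?A (S f) x - f x) + N f"
        using N_add[OF res[OF f] f] by simp
      then have "(cmod z - c) * N (S f) \<le> N f" using below[OF S(1)[OF f]] S(2)[OF f] by simp
      then show "N (S f) \<le> 1 / (cmod z - c) * N f" using c(2) by (simp add: field_simps)
    qed
  qed
  moreover have "N (\<lambda>x. S (?A f) x - f x) = 0" if f: "f \<in> H" for f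
  proof -
    have d: "(\<lambda>x. S (?A f) x - f x) \<in> H" using S(1)[OF AH[OF f]] f by (rule H_diff)
    have "?A (\<lambda>x. S (?A f) x - f x) = (\<lambda>x. ?A (S (?A f)) x - ?A f x)"
      using T_diff[of "S (?A f)" f] by (simp add: fun_eq_iff algebra_simps)
    then show ?thesis using zero[OF d] S(2)[OF AH[OF f]] by simp
  qed
  ultimately show ?thesis using S(2) unfolding spectrum_on_def by blast
qed

end

text \<open>Optimising the weight \<open>t\<close> in the quadratic inequality gives the triangle inequality
  for the \<open>L2\<close> norm. The best weight \<open>b / a\<close> degenerates when
  \<open>a\<close> or \<open>b\<close> vanishes and is then replaced by a limit.\<close>
lemma le_square_sum:
  assumes "\<And>t :: real. t > 0 \<Longrightarrow> c \<le> (1 + t) * a\<^sup>2 + (1 + 1 / t) * b\<^sup>2" "0 \<le> a" "0 \<le> b"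
  shows "c \<le> (a + b)\<^sup>2"
proof (cases "a = 0 \<or> b = 0")
  case False
  then have ab: "a > 0" "b > 0" using assms by auto
  have "c \<le> (1 + b / a) * a\<^sup>2 + (1 + a / b) * b\<^sup>2" using assms(1)[of "b / a"] ab by simp
  also have "\<dots> = (a + b)\<^sup>2" using ab by (simp add: field_simps power2_eq_square)
  finally show ?thesis .
next
  case True
  show ?thesis
  proof (rule field_le_epsilon)
    fix e :: real assume e: "e > 0"
    show "c \<le> (a + b)\<^sup>2 + e"
    proof (cases "a = 0")
      case True
      let ?t = "(b\<^sup>2 + 1) / e"
      have t: "?t > 0" using e by (simp add: add_nonneg_pos)
      have "b\<^sup>2 / ?t = e * (b\<^sup>2 / (b\<^sup>2 + 1))" by simp
      also have "\<dots> \<le> e * 1" using e by (intro mult_left_mono) (auto simp: divide_le_eq add_nonneg_pos)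
      finally have "b\<^sup>2 / ?t \<le> e" by simp
      with t obtain t where "t > 0" "b\<^sup>2 / t \<le> e" by blast
      then show ?thesis using assms(1)[of t] True by (simp add: distrib_right)
    next
      case False
      then have b: "b = 0" using \<open>a = 0 \<or> b = 0\<close> by simp
      let ?t = "e / (a\<^sup>2 + 1)"
      have t: "?t > 0" using e by (simp add: add_nonneg_pos)
      have "?t * a\<^sup>2 = e * (a\<^sup>2 / (a\<^sup>2 + 1))" by simp
      also have "\<dots> \<le> e * 1" using e by (intro mult_left_mono) (auto simp: divide_le_eq add_nonneg_pos)
      finally have "?t * a\<^sup>2 \<le> e" by simp
      with t obtain t where "t > 0" "t * a\<^sup>2 \<le> e" by blast
      then show ?thesis using assms(1)[of t] b by (simp add: distrib_right)
    qed
  qed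
qed

lemma norm_add_square_le:
  fixes a b :: complex assumes "t > (0 :: real)"
  shows "(cmod (a + b))\<^sup>2 \<le> (1 + t) * (cmod a)\<^sup>2 + (1 + 1 / t) * (cmod b)\<^sup>2"
proof -
  let ?x = "cmod a" and ?y = "cmod b"
  have "(cmod (a + b))\<^sup>2 \<le> (?x + ?y)\<^sup>2" by (intro power_mono norm_triangle_ineq) simp
  also have "\<dots> = ?x\<^sup>2 + ?y\<^sup>2 + 2 * ?x * ?y" by (simp add: power2_sum)
  also have "2 * ?x * ?y \<le> t * ?x\<^sup>2 + 1 / t * ?y\<^sup>2"
  proof -
    have "0 \<le> (t * ?x - ?y)\<^sup>2 / t" using assms by simp
    also have "\<dots> = t * ?x\<^sup>2 + 1 / t * ?y\<^sup>2 - 2 * ?x * ?y"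
      using assms by (simp add: field_simps power2_eq_square)
    finally show ?thesis by simp
  qed
  finally show ?thesis by (simp add: algebra_simps)
qed

lemma L2D: "f \<in> L2 M \<Longrightarrow> f \<in> borel_measurable M" "f \<in> L2 M \<Longrightarrow> integrable M (\<lambda>x. (cmod (f x))\<^sup>2)"
  by (auto simp: L2_def)

lemma L2_norm_square: "(L2_norm M f)\<^sup>2 = (\<integral>x. (cmod (f x))\<^sup>2 \<partial>M)"
  by (simp add: L2_norm_def)

lemma L2_norm_nonneg: "0 \<le> L2_norm M f"
  by (simp add: L2_norm_def)

lemma L2_norm_ennreal:
  assumes "f \<in> L2 M"
  shows "ennreal ((L2_norm M f)\<^sup>2) = (\<integral>\<^sup>+ x. ennreal ((cmod (f x))\<^sup>2) \<partial>M)"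
  using nn_integral_eq_integral[OF L2D(2)[OF assms]] by (simp add: L2_norm_square)

lemma L2_I:
  assumes [measurable]: "f \<in> borel_measurable M" and le: "(\<integral>\<^sup>+ x. ennreal ((cmod (f x))\<^sup>2) \<partial>M) \<le> ennreal (B\<^sup>2)"
    and "0 \<le> B"
  shows "f \<in> L2 M" "L2_norm M f \<le> B"
proof -
  have "integrable M (\<lambda>x. (cmod (f x))\<^sup>2)"
    using le_less_trans[OF le ennreal_less_top] by (intro integrableI_nonneg) auto
  then show "f \<in> L2 M" by (simp add: L2_def)
  then have "ennreal ((L2_norm M f)\<^sup>2) \<le> ennreal (B\<^sup>2)" using le L2_norm_ennreal[of f M] by simp
  then have "(L2_norm M f)\<^sup>2 \<le> B\<^sup>2" by (subst (asm) ennreal_le_iff) simp_all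
  then show "L2_norm M f \<le> B" using assms(3) by (rule power2_le_imp_le)
qed

lemma L2_add:
  assumes "f \<in> L2 M" "g \<in> L2 M"
  shows "(\<lambda>x. f x + g x) \<in> L2 M" "L2_norm M (\<lambda>x. f x + g x) \<le> L2_norm M f + L2_norm M g"
proof -
  note [measurable] = L2D(1)[OF assms(1)] L2D(1)[OF assms(2)]
  note i = L2D(2)[OF assms(1)] L2D(2)[OF assms(2)]
  have int: "integrable M (\<lambda>x. (cmod (f x + g x))\<^sup>2)"
  proof (rule Bochner_Integration.integrable_bound)
    show "integrable M (\<lambda>x. (1 + 1) * (cmod (f x))\<^sup>2 + (1 + 1 / 1) * (cmod (g x))\<^sup>2)"
      using i by (intro Bochner_Integration.integrable_add integrable_mult_right) auto
    show "AE x in M. norm ((cmod (f x + g x))\<^sup>2) \<le> norm ((1 + 1) * (cmod (f x))\<^sup>2 + (1 + 1 / 1) * (cmod (g x))\<^sup>2)"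
      using norm_add_square_le[of 1] by (intro AE_I2) simp
  qed simp
  then show "(\<lambda>x. f x + g x) \<in> L2 M" by (simp add: L2_def)
  have "(L2_norm M (\<lambda>x. f x + g x))\<^sup>2 \<le> (L2_norm M f + L2_norm M g)\<^sup>2"
  proof (rule le_square_sum)
    fix t :: real assume t: "t > 0"
    have "(L2_norm M (\<lambda>x. f x + g x))\<^sup>2 \<le> (\<integral>x. (1 + t) * (cmod (f x))\<^sup>2 + (1 + 1 / t) * (cmod (g x))\<^sup>2 \<partial>M)"
      unfolding L2_norm_square using int i norm_add_square_le[OF t]
      by (intro integral_mono Bochner_Integration.integrable_add integrable_mult_right) auto
    then show "(L2_norm M (\<lambda>x. f x + g x))\<^sup>2 \<le> (1 + t) * (L2_norm M f)\<^sup>2 + (1 + 1 / t) * (L2_norm M g)\<^sup>2"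
      unfolding L2_norm_square using i by simp
  qed (auto simp: L2_norm_nonneg)
  then show "L2_norm M (\<lambda>x. f x + g x) \<le> L2_norm M f + L2_norm M g"
    by (rule power2_le_imp_le) (simp add: L2_norm_nonneg add_nonneg_nonneg)
qed

lemma L2_scale:
  assumes "f \<in> L2 M"
  shows "(\<lambda>x. c * f x) \<in> L2 M" "L2_norm M (\<lambda>x. c * f x) = cmod c * L2_norm M f"
  using L2D[OF assms]
  by (auto simp: L2_def L2_norm_def norm_mult power_mult_distrib real_sqrt_mult intro: borel_measurable_times)

lemma zero_in_L2: "(\<lambda>x. 0) \<in> L2 M"
  by (simp add: L2_def)

lemma seminormed_L2: "seminormed (L2 M) (L2_norm M)"
  by standard (use L2_add L2_scale L2_norm_nonneg in auto)

text \<open>The sum of the absolute values is square integrable by monotone convergence. It makes the series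
  converge almost everywhere and dominates its tails.\<close>
lemma L2_complete:
  assumes f: "\<And>k. f k \<in> L2 M" and le: "\<And>k. L2_norm M (f k) \<le> C * q ^ k" and q: "0 \<le> q" "q < 1"
  shows "\<exists>g\<in>L2 M. (\<lambda>n. L2_norm M (\<lambda>x. g x - (\<Sum>k<n. f k x))) \<longlonglongrightarrow> 0"
proof -
  interpret seminormed "L2 M" "L2_norm M" by (rule seminormed_L2)
  have [measurable]: "f k \<in> borel_measurable M" for k by (rule L2D(1)[OF f])
  define h where "h = (\<lambda>k x. of_real (cmod (f k x)) :: complex)"
  have [measurable]: "h k \<in> borel_measurable M" for k unfolding h_def by measurable
  have hL: "h k \<in> L2 M" and hN: "L2_norm M (h k) = L2_norm M (f k)" for k
    using L2D[OF f[of k]] by (auto simp: h_def L2_def L2_norm_def)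
  let ?s = "\<lambda>n x. \<Sum>k<n. cmod (f k x)"
  define B where "B = C / (1 - q)"
  have C: "0 \<le> C" using le[of 0] L2_norm_nonneg[of M "f 0"] by simp
  have B: "0 \<le> B" using C q by (simp add: B_def)
  have sL: "(\<lambda>x. \<Sum>k<n. h k x) \<in> L2 M \<and> L2_norm M (\<lambda>x. \<Sum>k<n. h k x) \<le> (\<Sum>k<n. C * q ^ k)" for n
  proof (induction n)
    case 0 show ?case using zero_in_L2 by (simp add: L2_norm_def)
  next
    case (Suc n)
    then show ?case using L2_add[of "\<lambda>x. \<Sum>k<n. h k x" M "h n"] hL hN le[of n] by force
  qed
  have "(\<Sum>k<n. C * q ^ k) \<le> B" for n
  proof -
    have "(\<Sum>k<n. q ^ k) = (1 - q ^ n) / (1 - q)" using q by (simp add: sum_gp_strict)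
    also have "\<dots> \<le> 1 / (1 - q)" using q by (intro divide_right_mono) auto
    finally have "C * (\<Sum>k<n. q ^ k) \<le> C * (1 / (1 - q))" using C by (rule mult_left_mono)
    then show ?thesis by (simp add: B_def sum_distrib_left)
  qed
  then have sB: "L2_norm M (\<lambda>x. \<Sum>k<n. h k x) \<le> B" for n using sL order_trans by blast
  have cs: "cmod (\<Sum>k<n. h k x) = ?s n x" for n x
  proof -
    have "(\<Sum>k<n. h k x) = of_real (?s n x)" by (simp add: h_def)
    then show ?thesis by (simp only: norm_of_real abs_of_nonneg[OF sum_nonneg] norm_ge_zero)
  qed
  have "(\<integral>\<^sup>+ x. ennreal ((?s n x)\<^sup>2) \<partial>M) \<le> ennreal (B\<^sup>2)" for n
  proof -
    have "(\<integral>\<^sup>+ x. ennreal ((?s n x)\<^sup>2) \<partial>M) = ennreal ((L2_norm M (\<lambda>x. \<Sum>k<n. h k x))\<^sup>2)"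
      using L2_norm_ennreal[of "\<lambda>x. \<Sum>k<n. h k x" M] sL[of n] cs by simp
    also have "\<dots> \<le> ennreal (B\<^sup>2)" using sB[of n] L2_norm_nonneg by (intro ennreal_leI power_mono)
    finally show ?thesis .
  qed
  moreover have "(\<integral>\<^sup>+ x. (SUP n. ennreal ((?s n x)\<^sup>2)) \<partial>M) = (SUP n. \<integral>\<^sup>+ x. ennreal ((?s n x)\<^sup>2) \<partial>M)"
    by (rule nn_integral_monotone_convergence_SUP)
       (auto simp: incseq_def le_fun_def intro!: ennreal_leI power_mono sum_mono2 sum_nonneg)
  ultimately have fin: "(\<integral>\<^sup>+ x. (SUP n. ennreal ((?s n x)\<^sup>2)) \<partial>M) \<le> ennreal (B\<^sup>2)"
    by (simp add: SUP_le_iff)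
  have "(\<integral>\<^sup>+ x. (SUP n. ennreal ((?s n x)\<^sup>2)) \<partial>M) \<noteq> \<infinity>"
    using le_less_trans[OF fin ennreal_less_top] by simp
  then have AEfin: "AE x in M. (SUP n. ennreal ((?s n x)\<^sup>2)) \<noteq> \<infinity>"
    by (rule nn_integral_PInf_AE[rotated]) measurable
  have summ: "AE x in M. summable (\<lambda>k. cmod (f k x)) \<and>
      ennreal ((\<Sum>k. cmod (f k x))\<^sup>2) \<le> (SUP n. ennreal ((?s n x)\<^sup>2))"
    using AEfin
  proof eventually_elim
    case (elim x)
    let ?u = "SUP n. ennreal ((?s n x)\<^sup>2)"
    obtain b where b: "0 \<le> b" "?u = ennreal b" using elim by (cases ?u) auto
    have bd: "(?s n x)\<^sup>2 \<le> b" for n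
    proof -
      have "ennreal ((?s n x)\<^sup>2) \<le> ?u" by (rule SUP_upper) simp
      then show ?thesis using b by (simp add: ennreal_le_iff)
    qed
    then have bd': "?s n x \<le> sqrt b" for n by (simp add: real_le_rsqrt)
    have sm: "summable (\<lambda>k. cmod (f k x))"
      by (rule summableI_nonneg_bounded[where x = "sqrt b"]) (use bd' in auto)
    have "(\<Sum>k. cmod (f k x)) \<le> sqrt b" by (rule suminf_le_const[OF sm bd'])
    then have "(\<Sum>k. cmod (f k x))\<^sup>2 \<le> b"
      using b(1) suminf_nonneg[OF sm] by (metis norm_ge_zero power_mono real_sqrt_pow2)
    then show ?case using sm b by (simp add: ennreal_leI)
  qed
  define g where "g = (\<lambda>x. \<Sum>k. f k x)"
  have [measurable]: "g \<in> borel_measurable M" unfolding g_def by measurable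
  define w where "w = (\<lambda>x. (\<Sum>k. cmod (f k x))\<^sup>2)"
  have [measurable]: "w \<in> borel_measurable M" unfolding w_def by measurable
  have "(\<integral>\<^sup>+ x. ennreal (w x) \<partial>M) \<le> ennreal (B\<^sup>2)"
    using order_trans[OF nn_integral_mono_AE fin] summ unfolding w_def by (auto elim: eventually_mono)
  then have w: "integrable M w"
    using le_less_trans[OF _ ennreal_less_top] by (intro integrableI_nonneg) (auto simp: w_def)
  have tail: "AE x in M. (cmod (g x - (\<Sum>k<n. f k x)))\<^sup>2 \<le> w x" for n
    using summ
  proof eventually_elim
    case (elim x)
    then have sm: "summable (\<lambda>k. cmod (f k x))" by simp
    then have sf: "summable (\<lambda>k. f k x)" by (rule summable_norm_cancel)
    have smn: "summable (\<lambda>k. cmod (f (k + n) x))" using sm by (rule summable_ignore_initial_segment)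
    have "g x - (\<Sum>k<n. f k x) = (\<Sum>k. f (k + n) x)"
      unfolding g_def using suminf_minus_initial_segment[OF sf, of n] by simp
    then have "cmod (g x - (\<Sum>k<n. f k x)) \<le> (\<Sum>k. cmod (f (k + n) x))"
      using summable_norm[OF smn] by simp
    also have "\<dots> = (\<Sum>k. cmod (f k x)) - ?s n x"
      by (rule suminf_minus_initial_segment[OF sm])
    also have "\<dots> \<le> (\<Sum>k. cmod (f k x))" by (simp add: sum_nonneg)
    finally show ?case unfolding w_def by (intro power_mono) auto
  qed
  have "(\<lambda>n. \<integral>x. (cmod (g x - (\<Sum>k<n. f k x)))\<^sup>2 \<partial>M) \<longlonglongrightarrow> (\<integral>x. 0 \<partial>M)"
  proof (rule integral_dominated_convergence[where w = w])
    show "AE x in M. (\<lambda>n. (cmod (g x - (\<Sum>k<n. f k x)))\<^sup>2) \<longlonglongrightarrow> 0"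
      using summ
    proof eventually_elim
      case (elim x)
      then have "summable (\<lambda>k. f k x)" by (auto intro: summable_norm_cancel)
      then have "(\<lambda>n. \<Sum>k<n. f k x) \<longlonglongrightarrow> g x" unfolding g_def by (rule summable_LIMSEQ)
      then have "(\<lambda>n. (cmod (g x - (\<Sum>k<n. f k x)))\<^sup>2) \<longlonglongrightarrow> (cmod (g x - g x))\<^sup>2"
        by (intro tendsto_intros)
      then show ?case by simp
    qed
    show "AE x in M. norm ((cmod (g x - (\<Sum>k<n. f k x)))\<^sup>2) \<le> w x" for n using tail[of n] by simp
  qed (auto intro: w)
  then have "(\<lambda>n. sqrt (\<integral>x. (cmod (g x - (\<Sum>k<n. f k x)))\<^sup>2 \<partial>M)) \<longlonglongrightarrow> sqrt 0"
    by (intro tendsto_real_sqrt) simp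
  then have "(\<lambda>n. L2_norm M (\<lambda>x. g x - (\<Sum>k<n. f k x))) \<longlonglongrightarrow> 0" by (simp add: L2_norm_def)
  moreover have "integrable M (\<lambda>x. (cmod (g x))\<^sup>2)"
  proof (rule Bochner_Integration.integrable_bound[OF w])
    show "AE x in M. norm ((cmod (g x))\<^sup>2) \<le> norm (w x)"
      using tail[of 0] by eventually_elim (simp add: w_def)
  qed measurable
  then have "g \<in> L2 M" by (simp add: L2_def)
  ultimately show ?thesis by blast
qed

lemma complete_seminormed_L2: "complete_seminormed (L2 M) (L2_norm M)"
proof -
  interpret seminormed "L2 M" "L2_norm M" by (rule seminormed_L2)
  show ?thesis by standard (rule L2_complete)
qed

lemma L2_finite_measure_integrable:
  assumes "finite_measure M" "f \<in> L2 M"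
  shows "integrable M f"
proof (rule Bochner_Integration.integrable_bound)
  interpret finite_measure M by fact
  show "integrable M (\<lambda>x. 1 + (cmod (f x))\<^sup>2)" using L2D[OF assms(2)] by simp
  have "cmod (f x) \<le> 1 + (cmod (f x))\<^sup>2" for x
  proof -
    have "0 \<le> (cmod (f x) - 1)\<^sup>2" by simp
    then have "2 * cmod (f x) \<le> (cmod (f x))\<^sup>2 + 1" by (simp add: power2_diff)
    then show ?thesis using norm_ge_zero[of "f x"] by linarith
  qed
  then show "AE x in M. norm (f x) \<le> norm (1 + (cmod (f x))\<^sup>2)" by (intro AE_I2) simp
qed (rule L2D(1)[OF assms(2)])

lemma L2_norm_ge_integral:
  assumes M: "prob_space M" and f: "f \<in> L2 M"
  shows "cmod (\<integral>x. f x \<partial>M) \<le> L2_norm M f"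
proof -
  interpret prob_space M by fact
  have i: "integrable M f" by (rule L2_finite_measure_integrable[OF _ f]) unfold_locales
  have "(cmod (\<integral>x. f x \<partial>M))\<^sup>2 \<le> (\<integral>x. cmod (f x) \<partial>M)\<^sup>2"
    by (intro power_mono integral_norm_bound) simp
  also have "\<dots> \<le> (\<integral>x. (cmod (f x))\<^sup>2 \<partial>M)"
  proof -
    have "0 \<le> variance (\<lambda>x. cmod (f x))" by (rule variance_positive)
    also have "\<dots> = (\<integral>x. (cmod (f x))\<^sup>2 \<partial>M) - (\<integral>x. cmod (f x) \<partial>M)\<^sup>2"
      using i L2D(2)[OF f] by (intro variance_eq) auto
    finally show ?thesis by simp
  qed
  finally have "(cmod (\<integral>x. f x \<partial>M))\<^sup>2 \<le> (L2_norm M f)\<^sup>2" by (simp add: L2_norm_square)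
  then show ?thesis by (rule power2_le_imp_le) (rule L2_norm_nonneg)
qed

lemma orthogonal_to_constants_iff:
  "f \<in> orthogonal_to_constants M \<longleftrightarrow> f \<in> L2 M \<and> (\<integral>x. f x \<partial>M) = 0"
  unfolding orthogonal_to_constants_def by (auto dest: spec[of _ 1])

text \<open>On a probability space the integral is continuous in the \<open>L2\<close> norm, so the
  orthogonal complement of the constants is closed.\<close>
lemma complete_seminormed_orthogonal:
  assumes M: "prob_space M"
  shows "complete_seminormed (orthogonal_to_constants M) (L2_norm M)"
proof -
  interpret L: complete_seminormed "L2 M" "L2_norm M" by (rule complete_seminormed_L2)
  have int: "integrable M f" if "f \<in> L2 M" for f
    using L2_finite_measure_integrable[OF _ that] M by (simp add: prob_space_def)
  show ?thesis
  proof
    fix f g assume "f \<in> orthogonal_to_constants M" "g \<in> orthogonal_to_constants M"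
    then show "(\<lambda>x. f x + g x) \<in> orthogonal_to_constants M" "L2_norm M (\<lambda>x. f x + g x) \<le> L2_norm M f + L2_norm M g"
      using L2_add[of f M g] int by (auto simp: orthogonal_to_constants_iff)
  next
    fix f c assume "f \<in> orthogonal_to_constants M"
    then show "(\<lambda>x. c * f x) \<in> orthogonal_to_constants M" "L2_norm M (\<lambda>x. c * f x) = cmod c * L2_norm M f"
      using L2_scale[of f M c] int by (auto simp: orthogonal_to_constants_iff)
  next
    fix f C q
    assume f: "\<And>k. f k \<in> orthogonal_to_constants M" and le: "\<And>k. L2_norm M (f k) \<le> C * q ^ k"
      and q: "0 \<le> q" "q < (1 :: real)"
    then have fL: "f k \<in> L2 M" and f0: "(\<integral>x. f k x \<partial>M) = 0" for k by (auto simp: orthogonal_to_constants_iff)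
    obtain g where g: "g \<in> L2 M" "(\<lambda>n. L2_norm M (\<lambda>x. g x - (\<Sum>k<n. f k x))) \<longlonglongrightarrow> 0"
      using L2_complete[OF fL le q] by blast
    have "cmod (\<integral>x. g x \<partial>M) \<le> L2_norm M (\<lambda>x. g x - (\<Sum>k<n. f k x))" for n
    proof -
      have s: "(\<lambda>x. \<Sum>k<n. f k x) \<in> L2 M" using fL g(1) by (intro L.H_sum) auto
      have "(\<integral>x. g x - (\<Sum>k<n. f k x) \<partial>M) = (\<integral>x. g x \<partial>M) - (\<Sum>k<n. \<integral>x. f k x \<partial>M)"
        using int[OF g(1)] int[OF s] int[OF fL] by (simp add: integral_sum)
      then show ?thesis using L2_norm_ge_integral[OF M L.H_diff[OF g(1) s]] f0 by simp
    qed
    then have "cmod (\<integral>x. g x \<partial>M) \<le> 0" using g(2) LIMSEQ_le_const by blast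
    then show "\<exists>g\<in>orthogonal_to_constants M. (\<lambda>n. L2_norm M (\<lambda>x. g x - (\<Sum>k<n. f k x))) \<longlonglongrightarrow> 0"
      using g by (auto simp: orthogonal_to_constants_iff)
  qed (rule L2_norm_nonneg)
qed

lemma markov_add: "markov R (\<lambda>x. f x + g x) = (\<lambda>x. markov R f x + markov R g x)"
  by (simp add: markov_def sum.distrib distrib_left fun_eq_iff)

lemma markov_scale: "markov R (\<lambda>x. c * f x) = (\<lambda>x. c * markov R f x)"
  by (simp add: markov_def fun_eq_iff flip: sum_distrib_left)

section \<open>Reversibility of the Bernoulli graphing\<close>

text \<open>Fubini's theorem on the two coordinates: given the label of \<open>v\<close>, the label of
  \<open>u\<close> avoids it almost surely.\<close>
lemma AE_labels_neq:
  assumes uv: "u \<in> I" "v \<in> I" "u \<noteq> v"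
  shows "AE \<xi> in PiM I (\<lambda>_. unif). \<xi> u \<noteq> \<xi> (v :: nat)"
proof -
  interpret product_sigma_finite "\<lambda>_ :: nat. unif"
    unfolding product_sigma_finite_def using prob_space_unif
    by (auto simp: prob_space_def finite_measure_def)
  let ?P2 = "PiM (insert u {v}) (\<lambda>_. unif)"
  let ?B = "{\<zeta> \<in> space ?P2. \<zeta> u = \<zeta> v}"
  have [measurable]: "(\<lambda>\<xi>. \<xi> u) \<in> borel_measurable ?P2" "(\<lambda>\<xi>. \<xi> v) \<in> borel_measurable ?P2"
    by (intro measurable_label; simp)+
  have B: "?B \<in> sets ?P2" by measurable
  have "emeasure ?P2 ?B = (\<integral>\<^sup>+ \<zeta>. indicator ?B \<zeta> \<partial>?P2)" using B by simp
  also have "\<dots> = (\<integral>\<^sup>+ x. (\<integral>\<^sup>+ y. indicator ?B (x(u := y)) \<partial>unif) \<partial>PiM {v} (\<lambda>_. unif))"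
    using B uv by (intro product_nn_integral_insert) auto
  also have "\<dots> = (\<integral>\<^sup>+ x. 0 \<partial>PiM {v} (\<lambda>_. unif))"
  proof (intro nn_integral_cong)
    fix x :: "nat \<Rightarrow> real"
    have s: "{x v} \<inter> {0..1} \<in> sets unif" by (subst sets_restrict_space_iff) simp_all
    have "(\<integral>\<^sup>+ y. indicator ?B (x(u := y)) \<partial>unif) \<le> (\<integral>\<^sup>+ y. indicator ({x v} \<inter> {0..1}) y \<partial>unif)"
    proof (intro nn_integral_mono)
      fix y assume y: "y \<in> space unif"
      show "indicator ?B (x(u := y)) \<le> (indicator ({x v} \<inter> {0..1}) y :: ennreal)"
      proof (cases "x(u := y) \<in> ?B")
        case True
        then have "(x(u := y)) u = (x(u := y)) v" by blast
        then have "y = x v" using uv(3) by simp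
        then show ?thesis using y by (simp add: space_restrict_space indicator_def)
      next
        case False
        then show ?thesis by (subst indicator_simps(2)) simp_all
      qed
    qed
    also have "\<dots> = emeasure unif ({x v} \<inter> {0..1})" by (rule nn_integral_indicator[OF s])
    also have "\<dots> = emeasure lborel ({x v} \<inter> {0..1})" by (rule emeasure_restrict_space) simp_all
    also have "\<dots> \<le> emeasure lborel {x v}" by (rule emeasure_mono) simp_all
    also have "\<dots> = 0" by simp
    finally show "(\<integral>\<^sup>+ y. indicator ?B (x(u := y)) \<partial>unif) = 0" by simp
  qed
  finally have null: "emeasure ?P2 ?B = 0" by simp
  let ?t = "\<lambda>\<omega> :: nat \<Rightarrow> real. \<lambda>n\<in>insert u {v}. \<omega> n"
  have t: "?t \<in> PiM I (\<lambda>_. unif) \<rightarrow>\<^sub>M ?P2"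
    using uv by (intro measurable_restrict) (auto intro: measurable_component_singleton)
  have "distr (PiM I (\<lambda>_. unif)) ?P2 ?t = ?P2"
    using distr_PiM_reindex[of I "\<lambda>_. unif" "\<lambda>n. n" "insert u {v}"] uv prob_space_unif by auto
  then have "emeasure (PiM I (\<lambda>_. unif)) (?t -` ?B \<inter> space (PiM I (\<lambda>_. unif))) = 0"
    using emeasure_distr[OF t B] null by simp
  then show ?thesis
    using measurable_sets[OF t B] measurable_space[OF t]
    by (intro AE_I[of _ _ "?t -` ?B \<inter> space (PiM I (\<lambda>_. unif))"]) auto
qed

lemma AE_labels_inj: "AE \<xi> in PiM I (\<lambda>_. unif). inj_on \<xi> (I :: nat set)"
proof -
  have "AE \<xi> in PiM I (\<lambda>_. unif). \<forall>u\<in>I. \<forall>v\<in>I. u \<noteq> v \<longrightarrow> \<xi> u \<noteq> \<xi> v"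
    using AE_labels_neq[of _ I] by (auto simp: AE_ball_countable)
  then show ?thesis by eventually_elim (auto simp: inj_on_def)
qed

text \<open>An isomorphism that preserves distinct labels fixes every vertex.\<close>
lemma inj_on_lclass:
  assumes "(G, \<xi>, r) \<in> labelled_graphs D" "inj_on \<xi> (verts G)"
  shows "inj_on (lclass D G \<xi>) (verts G)"
proof (rule inj_onI)
  fix s t assume st: "s \<in> verts G" "t \<in> verts G" "lclass D G \<xi> s = lclass D G \<xi> t"
  have "(G, \<xi>, s) \<in> labelled_graphs D" "(G, \<xi>, t) \<in> labelled_graphs D"
    using assms st by (auto simp: labelled_graphs_iff)
  from lclass_eq_iff[OF this] st(3) obtain \<phi> where "\<phi> s = t" "\<forall>v\<in>verts G. \<xi> (\<phi> v) = \<xi> v" by auto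
  then have "\<xi> t = \<xi> s" using st(1) by auto
  then show "s = t" using assms(2) st by (auto simp: inj_on_def)
qed

text \<open>With distinct labels no two neighbours of the root are identified in the Bernoulli graph.\<close>
lemma nbr_sum_lclass:
  assumes L: "(G, \<xi>, r) \<in> labelled_graphs D" and inj: "inj_on \<xi> (verts G)"
  shows "nbr_sum D f (lclass D G \<xi> r) = (\<Sum>s | (r, s) \<in> edges G. f (lclass D G \<xi> s))"
proof -
  have "connected_graph D G" using L by (auto simp: labelled_graphs_iff)
  then have "{s. (r, s) \<in> edges G} \<subseteq> verts G" using connected_graph_edgeD(2) by blast
  then have "inj_on (lclass D G \<xi>) {s. (r, s) \<in> edges G}"
    using inj_on_lclass[OF L inj] by (rule inj_on_subset[rotated])
  then show ?thesis unfolding bernoulli_nbrs[OF L] by (rule sum.reindex_cong) auto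
qed

lemma deg_lclass:
  assumes "(G, \<xi>, r) \<in> labelled_graphs D" "inj_on \<xi> (verts G)"
  shows "deg (bernoulli_graph D) (lclass D G \<xi> r) = deg (edges G) r"
  using nbr_sum_lclass[OF assms, of "\<lambda>_. 1 :: nat"] by (simp add: deg_def)

lemma llocal_space: "llocal D 0 (space (labelled_space D))"
  by (auto simp: llocal_def lclass_in_space)

lemma bern_rep:
  assumes "(G, r) \<in> rooted_graphs D"
  shows "bern D (rep_graph (rclass D G r)) (rep_root (rclass D G r)) = bern D G r"
proof (rule measure_eqI_generator_eq[where E = "{A. \<exists>n. llocal D n A}" and \<Omega> = "space (labelled_space D)" and A = "\<lambda>_. space (labelled_space D)"])
  show "Int_stable {A. \<exists>n. llocal D n A}" using llocal_Int by (force simp: Int_stable_def)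
  show "{A. \<exists>n. llocal D n A} \<subseteq> Pow (space (labelled_space D))"
    using sets.sets_into_space by (auto simp: llocal_def)
  show "emeasure (bern D (rep_graph (rclass D G r)) (rep_root (rclass D G r))) A = emeasure (bern D G r) A"
    if "A \<in> {A. \<exists>n. llocal D n A}" for A
    using that local_fun_rep[OF bern_llocal assms] by blast
  show "range (\<lambda>_. space (labelled_space D)) \<subseteq> {A. \<exists>n. llocal D n A}" using llocal_space by blast
  have "(rep_graph (rclass D G r), rep_root (rclass D G r)) \<in> rooted_graphs D"
    using rep_rooted(1)[OF rclass_in_space[OF assms]] .
  then interpret prob_space "bern D (rep_graph (rclass D G r)) (rep_root (rclass D G r))"
    by (rule prob_space_bern)
  show "emeasure (bern D (rep_graph (rclass D G r)) (rep_root (rclass D G r))) (space (labelled_space D)) \<noteq> \<infinity>"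
    by (rule emeasure_finite[unfolded top.not_eq_extremum infinity_ennreal_def[symmetric]] ) simp?
qed (simp_all add: sets_labelled_space_llocal)

text \<open>All members of a class give the same value.\<close>
definition first_root :: "nat \<Rightarrow> doubly_rooted_class \<Rightarrow> rooted_class" where
  "first_root D d = (case SOME x. x \<in> d of (G, r, s) \<Rightarrow> rclass D G r)"

lemma first_root_drclass:
  assumes "(G, r, s) \<in> doubly_rooted_graphs D"
  shows "first_root D (drclass D G r s) = rclass D G r"
proof -
  have "(G, r, s) \<in> drclass D G r s"
    unfolding drclass_def using equiv_class_self[OF equiv_doubly_rooted_iso assms] .
  then have "(SOME x. x \<in> drclass D G r s) \<in> drclass D G r s" by (rule someI)
  moreover obtain H p q where x: "(SOME x. x \<in> drclass D G r s) = (H, p, q)" by (cases "SOME x. x \<in> drclass D G r s")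
  ultimately have "((G, r, s), (H, p, q)) \<in> doubly_rooted_iso D" by (simp add: drclass_def)
  then have "rclass D G r = rclass D H p"
    by (subst rclass_eq_iff) (auto simp: doubly_rooted_iso_def doubly_rooted_graphs_iff rooted_graphs_iff)
  then show ?thesis by (simp add: first_root_def x)
qed

lemma measurable_first_root: "first_root D \<in> doubly_rooted_space D \<rightarrow>\<^sub>M rooted_space D"
proof (rule measurable_sigma_sets[OF sets_rooted_space])
  show "{cylinder D H p n |H p n. (H, p) \<in> rooted_graphs D} \<subseteq> Pow (rooted_graphs D // rooted_iso D)"
    using cylinder_subset space_rooted_space by blast
  show "first_root D \<in> space (doubly_rooted_space D) \<rightarrow> rooted_graphs D // rooted_iso D"
  proof
    fix d assume "d \<in> space (doubly_rooted_space D)"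
    then obtain G r s where G: "(G, r, s) \<in> doubly_rooted_graphs D" "d = drclass D G r s" by (rule drclass_cases)
    then have "(G, r) \<in> rooted_graphs D" by (simp add: doubly_rooted_graphs_iff rooted_graphs_iff)
    then show "first_root D d \<in> rooted_graphs D // rooted_iso D"
      using first_root_drclass[OF G(1)] G(2) rclass_in_space[of G r D] by (simp add: space_rooted_space)
  qed
  fix A assume "A \<in> {cylinder D H p n |H p n. (H, p) \<in> rooted_graphs D}"
  then obtain K k n where A: "A = cylinder D K k n" "(K, k) \<in> rooted_graphs D" by blast
  have "dopen D (first_root D -` A \<inter> space (doubly_rooted_space D))"
    unfolding dopen_def
  proof (intro conjI allI impI)
    fix G r s assume *: "(G, r, s) \<in> doubly_rooted_graphs D \<and> drclass D G r s \<in> first_root D -` A \<inter> space (doubly_rooted_space D)"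
    then have G: "connected_graph D G" "r \<in> verts G" "s \<in> verts G" and Gr: "(G, r) \<in> rooted_graphs D"
      by (auto simp: doubly_rooted_graphs_iff rooted_graphs_iff)
    have "rclass D G r \<in> A" using * first_root_drclass[of G r s D] by simp
    then obtain \<psi> where \<psi>: "ball_iso \<psi> G r K k n" using rclass_in_cylinder_iff[OF Gr] A(1) by blast
    obtain d where d: "s \<in> vball G r d" using in_some_vball[OF G] .
    show "\<exists>n. s \<in> vball G r n \<and> (\<forall>H p \<phi>. (H, p) \<in> rooted_graphs D \<and> ball_iso \<phi> G r H p n \<longrightarrow>
        drclass D H p (\<phi> s) \<in> first_root D -` A \<inter> space (doubly_rooted_space D))"
    proof (intro exI[of _ "max d n"] conjI allI impI)
      show s: "s \<in> vball G r (max d n)" using subsetD[OF vball_mono d, of "max d n"] by simp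
      fix H p \<phi> assume H: "(H, p) \<in> rooted_graphs D \<and> ball_iso \<phi> G r H p (max d n)"
      then have Hc: "connected_graph D H" "p \<in> verts H" and iso: "ball_iso \<phi> G r H p (max d n)"
        by (auto simp: rooted_graphs_iff)
      have "\<phi> s \<in> verts H" using subsetD[OF vball_subset_verts ball_iso_mem[OF iso s]] .
      then have HD: "(H, p, \<phi> s) \<in> doubly_rooted_graphs D" using Hc by (simp add: doubly_rooted_graphs_iff)
      have "ball_iso \<phi> G r H p n" using ball_iso_mono[OF G(1,2) Hc iso] by simp
      then have "\<exists>\<theta>. ball_iso \<theta> H p K k n" using ball_iso_comp[OF ball_iso_inv[OF _ G(2)] \<psi>] by blast
      then have "rclass D H p \<in> A" using rclass_in_cylinder_iff[of H p D K k n] H A(1) by blast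
      then show "drclass D H p (\<phi> s) \<in> first_root D -` A \<inter> space (doubly_rooted_space D)"
        using first_root_drclass[OF HD] drclass_in_space[OF HD] by simp
    qed
  qed simp
  then show "first_root D -` A \<inter> space (doubly_rooted_space D) \<in> sets (doubly_rooted_space D)"
    by (rule dopen_sets)
qed

definition adjacent_roots :: "nat \<Rightarrow> doubly_rooted_class set" where
  "adjacent_roots D = {drclass D G r s | G r s. (G, r, s) \<in> doubly_rooted_graphs D \<and> (r, s) \<in> edges G}"

lemma drclass_adjacent_iff:
  assumes "(G, r, s) \<in> doubly_rooted_graphs D"
  shows "drclass D G r s \<in> adjacent_roots D \<longleftrightarrow> (r, s) \<in> edges G"
proof
  assume "drclass D G r s \<in> adjacent_roots D"
  then obtain H p q where H: "drclass D G r s = drclass D H p q" "(H, p, q) \<in> doubly_rooted_graphs D" "(p, q) \<in> edges H"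
    unfolding adjacent_roots_def by blast
  then obtain \<phi> where "graph_iso \<phi> G H" "\<phi> r = p" "\<phi> s = q" using drclass_eq_iff[OF assms H(2)] by blast
  then show "(r, s) \<in> edges G" using H(3) assms by (auto simp: graph_iso_def doubly_rooted_graphs_iff)
qed (use assms in \<open>auto simp: adjacent_roots_def\<close>)

lemma adjacent_roots_sets: "adjacent_roots D \<in> sets (doubly_rooted_space D)"
proof (rule dopen_sets, unfold dopen_def, intro conjI allI impI)
  show "adjacent_roots D \<subseteq> space (doubly_rooted_space D)"
    by (auto simp: adjacent_roots_def intro: drclass_in_space)
  fix G r s assume *: "(G, r, s) \<in> doubly_rooted_graphs D \<and> drclass D G r s \<in> adjacent_roots D"
  then have e: "(r, s) \<in> edges G" using drclass_adjacent_iff by blast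
  have G: "connected_graph D G" "r \<in> verts G" using * by (auto simp: doubly_rooted_graphs_iff)
  show "\<exists>n. s \<in> vball G r n \<and> (\<forall>H p \<phi>. (H, p) \<in> rooted_graphs D \<and> ball_iso \<phi> G r H p n \<longrightarrow>
      drclass D H p (\<phi> s) \<in> adjacent_roots D)"
  proof (intro exI[of _ "Suc 0"] conjI allI impI)
    show s: "s \<in> vball G r (Suc 0)" by (rule nbr_in_vball[OF G(1) e])
    fix H p \<phi> assume H: "(H, p) \<in> rooted_graphs D \<and> ball_iso \<phi> G r H p (Suc 0)"
    then have iso: "ball_iso \<phi> G r H p (Suc 0)" by blast
    have "(p, \<phi> s) \<in> edges H" using ball_iso_edge[OF iso root_in_vball[OF G(2)] s] e ball_iso_root[OF iso] by simp
    moreover have "\<phi> s \<in> verts H" using subsetD[OF vball_subset_verts ball_iso_mem[OF iso s]] .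
    ultimately show "drclass D H p (\<phi> s) \<in> adjacent_roots D"
      using H by (intro drclass_adjacent_iff[THEN iffD2]) (auto simp: doubly_rooted_graphs_iff rooted_graphs_iff)
  qed
qed

locale unimodular =
  fixes D :: nat and \<nu> :: "rooted_class measure"
  assumes unimodular: "unimodular_random_graph D \<nu>"
begin

abbreviation "B \<equiv> bernoulli_measure D \<nu>"
abbreviation "R \<equiv> bernoulli_graph D"
abbreviation "dg c \<equiv> deg (bernoulli_graph D) c"

sublocale N: prob_space \<nu>
  by (rule iffD1[OF unimodular_random_graph_def unimodular, THEN conjunct1])

lemma sets_nu [measurable_cong]: "sets \<nu> = sets (rooted_space D)"
  by (rule iffD1[OF unimodular_random_graph_def unimodular, THEN conjunct2, THEN conjunct1])

lemma space_nu: "space \<nu> = space (rooted_space D)"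
  by (rule sets_eq_imp_space_eq[OF sets_nu])

lemma rep_nu:
  assumes "c \<in> space \<nu>"
  shows "(rep_graph c, rep_root c) \<in> rooted_graphs D" "connected_graph D (rep_graph c)"
    "rep_root c \<in> verts (rep_graph c)"
  using rep_rooted(1)[of c D] assms by (auto simp: space_nu rooted_graphs_iff)

lemma kernel: "(\<lambda>c. bern D (rep_graph c) (rep_root c)) \<in> \<nu> \<rightarrow>\<^sub>M subprob_algebra (labelled_space D)"
  unfolding measurable_cong_sets[OF sets_nu refl] by (rule measurable_bern)

lemma B_eq: "B = \<nu> \<bind> (\<lambda>c. bern D (rep_graph c) (rep_root c))"
  unfolding bernoulli_measure_def bern_def ..

lemma sets_B [measurable_cong]: "sets B = sets (labelled_space D)"
  unfolding B_eq by (rule sets_bind[OF sets_bern N.not_empty])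

lemma space_B: "space B = space (labelled_space D)"
  by (rule sets_eq_imp_space_eq[OF sets_B])

lemma nn_integral_B:
  assumes "F \<in> borel_measurable (labelled_space D)"
  shows "(\<integral>\<^sup>+ x. F x \<partial>B) = (\<integral>\<^sup>+ c. (\<integral>\<^sup>+ \<xi>. F (lclass D (rep_graph c) \<xi> (rep_root c))
      \<partial>PiM (verts (rep_graph c)) (\<lambda>_. unif)) \<partial>\<nu>)"
  unfolding B_eq nn_integral_bind[OF assms kernel]
  by (intro nn_integral_cong, unfold bern_def)
     (intro nn_integral_distr measurable_lclass rep_nu, simp_all add: assms)

lemma prob_space_B: "prob_space B"
proof
  have "emeasure B (space B) = (\<integral>\<^sup>+ x. 1 \<partial>B)" by simp
  also have "\<dots> = (\<integral>\<^sup>+ c. 1 \<partial>\<nu>)"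
    by (subst nn_integral_B) (simp_all add: prob_space.emeasure_space_1[OF prob_space_PiM_unif])
  finally show "emeasure B (space B) = 1" by (simp add: N.emeasure_space_1)
qed

lemma bern_eq_PiM:
  assumes "(G, s) \<in> rooted_graphs D" "A \<in> sets (labelled_space D)"
  shows "(\<integral>\<^sup>+ \<xi>. indicator A (lclass D G \<xi> s) \<partial>PiM (verts G) (\<lambda>_. unif)) = emeasure (bern D G s) A"
proof -
  have "emeasure (bern D G s) A = (\<integral>\<^sup>+ x. indicator A x \<partial>bern D G s)" using assms(2) by simp
  also have "\<dots> = (\<integral>\<^sup>+ \<xi>. indicator A (lclass D G \<xi> s) \<partial>PiM (verts G) (\<lambda>_. unif))"
    unfolding bern_def using assms by (intro nn_integral_distr measurable_lclass) auto
  finally show ?thesis by simp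
qed

lemma labelled_if_space:
  "c \<in> space \<nu> \<Longrightarrow> \<xi> \<in> space (PiM (verts (rep_graph c)) (\<lambda>_. unif)) \<Longrightarrow>
    (rep_graph c, \<xi>, rep_root c) \<in> labelled_graphs D"
  using rep_nu by (auto simp: labelled_graphs_iff space_PiM_unif)

lemma measurable_of_nat_dg [measurable]: "(\<lambda>x. of_nat (dg x) :: ennreal) \<in> borel_measurable (labelled_space D)"
  unfolding ennreal_of_nat_eq_real_of_nat
  by (rule measurable_compose[OF measurable_deg_bernoulli measurable_ennreal])

text \<open>Both sides are expectations of one mass transport: each vertex sends to each of its neighbours
  the conditional probability that the labelled class rooted at the sender lies in
  \<open>A\<close>. The left side is what the root receives and the right side what it sends.\<close>
lemma reversible_indicator:
  assumes A: "A \<in> sets (labelled_space D)"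
  shows "(\<integral>\<^sup>+ x. nbr_sum D (indicator A) x \<partial>B) = (\<integral>\<^sup>+ x. of_nat (dg x) * indicator A x \<partial>B)"
proof -
  let ?P = "\<lambda>c. PiM (verts (rep_graph c)) (\<lambda>_. unif)"
  let ?E = "\<lambda>c s. (rep_root c, s) \<in> edges (rep_graph c)"
  define f where "f = (\<lambda>d. indicator (adjacent_roots D) d *
      measure (bern D (rep_graph (first_root D d)) (rep_root (first_root D d))) A)"
  have f_meas: "f \<in> borel_measurable (doubly_rooted_space D)"
  proof -
    have "(\<lambda>c. measure (bern D (rep_graph c) (rep_root c)) A) \<in> borel_measurable (rooted_space D)"
      by (rule measurable_compose[OF measurable_bern measurable_measure_subprob_algebra[OF A]])
    then have "(\<lambda>d. measure (bern D (rep_graph (first_root D d)) (rep_root (first_root D d))) A)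
        \<in> borel_measurable (doubly_rooted_space D)"
      by (rule measurable_compose[OF measurable_first_root])
    then show ?thesis unfolding f_def using adjacent_roots_sets by measurable
  qed
  have f_eq: "ennreal (f (drclass D G r s)) = indicator (edges G) (r, s) * emeasure (bern D G r) A"
    if c: "(G, r, s) \<in> doubly_rooted_graphs D" for G r s
  proof -
    have Gr: "(G, r) \<in> rooted_graphs D" using c by (simp add: doubly_rooted_graphs_iff rooted_graphs_iff)
    interpret P: prob_space "bern D G r" by (rule prob_space_bern[OF Gr])
    have "f (drclass D G r s) = indicator (edges G) (r, s) * measure (bern D G r) A"
      unfolding f_def first_root_drclass[OF c] bern_rep[OF Gr]
      using drclass_adjacent_iff[OF c] by (simp split: split_indicator)
    then show ?thesis by (simp add: P.emeasure_eq_measure split: split_indicator)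
  qed
  have sum_nbrs: "(\<integral>\<^sup>+ s. indicator {s. ?E c s} s * h s \<partial>count_space (verts (rep_graph c))) = (\<Sum>s | ?E c s. h s)"
    if c: "c \<in> space \<nu>" for c and h :: "nat \<Rightarrow> ennreal"
  proof -
    have "{s. ?E c s} \<subseteq> verts (rep_graph c)" using connected_graph_edgeD(2)[OF rep_nu(2)[OF c]] by blast
    then have "(\<integral>\<^sup>+ s. indicator {s. ?E c s} s * h s \<partial>count_space (verts (rep_graph c))) =
        (\<integral>\<^sup>+ s. h s \<partial>count_space {s. ?E c s})"
      by (simp add: nn_integral_count_space_indicator) (intro nn_integral_cong, auto split: split_indicator)
    then show ?thesis
      using nn_integral_count_space_finite[OF connected_graph_finite_nbrs[OF rep_nu(2)[OF c]]] by simp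
  qed
  have lhs: "(\<integral>\<^sup>+ \<xi>. nbr_sum D (indicator A) (lclass D (rep_graph c) \<xi> (rep_root c)) \<partial>?P c) =
      (\<integral>\<^sup>+ s. ennreal (f (drclass D (rep_graph c) s (rep_root c))) \<partial>count_space (verts (rep_graph c)))"
    if c: "c \<in> space \<nu>" for c
  proof -
    let ?G = "rep_graph c" and ?r = "rep_root c"
    note G = rep_nu[OF c]
    have nb: "(?G, s) \<in> rooted_graphs D" if "?E c s" for s
      using connected_graph_edgeD(2)[OF G(2) that] G(2) by (simp add: rooted_graphs_iff)
    have "(\<integral>\<^sup>+ \<xi>. nbr_sum D (indicator A) (lclass D ?G \<xi> ?r) \<partial>?P c) =
        (\<integral>\<^sup>+ \<xi>. (\<Sum>s | ?E c s. indicator A (lclass D ?G \<xi> s)) \<partial>?P c)"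
      using AE_labels_inj[of "verts ?G"] AE_space
      by (intro nn_integral_cong_AE, eventually_elim) (rule nbr_sum_lclass[OF labelled_if_space[OF c]])
    also have "\<dots> = (\<Sum>s | ?E c s. \<integral>\<^sup>+ \<xi>. indicator A (lclass D ?G \<xi> s) \<partial>?P c)"
      using measurable_compose[OF measurable_lclass[OF nb] borel_measurable_indicator[OF A]]
      by (intro nn_integral_sum) auto
    also have "\<dots> = (\<Sum>s | ?E c s. emeasure (bern D ?G s) A)"
      using bern_eq_PiM[OF nb A] by (intro sum.cong) auto
    also have "\<dots> = (\<integral>\<^sup>+ s. ennreal (f (drclass D ?G s ?r)) \<partial>count_space (verts ?G))"
    proof -
      have "ennreal (f (drclass D ?G s ?r)) = indicator {s. ?E c s} s * emeasure (bern D ?G s) A"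
        if "s \<in> verts ?G" for s
        using f_eq[of ?G s ?r] that G connected_graph_edgeD(4)[OF G(2)]
        by (auto simp: doubly_rooted_graphs_iff split: split_indicator)
      then show ?thesis using sum_nbrs[OF c, of "\<lambda>s. emeasure (bern D ?G s) A"]
        by (simp cong: nn_integral_cong_simp)
    qed
    finally show ?thesis .
  qed
  have rhs: "(\<integral>\<^sup>+ \<xi>. of_nat (dg (lclass D (rep_graph c) \<xi> (rep_root c))) *
        indicator A (lclass D (rep_graph c) \<xi> (rep_root c)) \<partial>?P c) =
      (\<integral>\<^sup>+ s. ennreal (f (drclass D (rep_graph c) (rep_root c) s)) \<partial>count_space (verts (rep_graph c)))"
    if c: "c \<in> space \<nu>" for c
  proof -
    let ?G = "rep_graph c" and ?r = "rep_root c"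
    note G = rep_nu[OF c]
    have "(\<integral>\<^sup>+ \<xi>. of_nat (dg (lclass D ?G \<xi> ?r)) * indicator A (lclass D ?G \<xi> ?r) \<partial>?P c) =
        (\<integral>\<^sup>+ \<xi>. of_nat (deg (edges ?G) ?r) * indicator A (lclass D ?G \<xi> ?r) \<partial>?P c)"
      using AE_labels_inj[of "verts ?G"] AE_space
      by (intro nn_integral_cong_AE, eventually_elim) (simp add: deg_lclass[OF labelled_if_space[OF c]])
    also have "\<dots> = of_nat (deg (edges ?G) ?r) * emeasure (bern D ?G ?r) A"
      unfolding bern_eq_PiM[OF G(1) A, symmetric]
      by (rule nn_integral_cmult[OF measurable_compose[OF measurable_lclass[OF G(1)] borel_measurable_indicator[OF A]]])
    also have "\<dots> = (\<Sum>s | ?E c s. emeasure (bern D ?G ?r) A)" by (simp add: deg_def)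
    also have "\<dots> = (\<integral>\<^sup>+ s. ennreal (f (drclass D ?G ?r s)) \<partial>count_space (verts ?G))"
    proof -
      have "ennreal (f (drclass D ?G ?r s)) = indicator {s. ?E c s} s * emeasure (bern D ?G ?r) A"
        if "s \<in> verts ?G" for s
        using f_eq[of ?G ?r s] that G by (auto simp: doubly_rooted_graphs_iff split: split_indicator)
      then show ?thesis using sum_nbrs[OF c, of "\<lambda>s. emeasure (bern D ?G ?r) A"]
        by (simp cong: nn_integral_cong_simp)
    qed
    finally show ?thesis .
  qed
  have "\<forall>d\<in>space (doubly_rooted_space D). 0 \<le> f d" by (simp add: f_def)
  from conjI[OF f_meas this] have mtp: "(\<integral>\<^sup>+ c. (\<integral>\<^sup>+ s. ennreal (f (drclass D (rep_graph c) s (rep_root c)))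
                   \<partial>count_space (verts (rep_graph c))) \<partial>\<nu>) =
        (\<integral>\<^sup>+ c. (\<integral>\<^sup>+ s. ennreal (f (drclass D (rep_graph c) (rep_root c) s))
                   \<partial>count_space (verts (rep_graph c))) \<partial>\<nu>)"
    by (rule iffD1[OF unimodular_random_graph_def unimodular, THEN conjunct2, THEN conjunct2, THEN spec, THEN mp])
  have d: "(\<lambda>x. of_nat (dg x) * indicator A x :: ennreal) \<in> borel_measurable (labelled_space D)"
    by (intro borel_measurable_times_ennreal measurable_of_nat_dg borel_measurable_indicator A)
  show ?thesis
    unfolding nn_integral_B[OF measurable_nbr_sum_indicator[OF A]] nn_integral_B[OF d]
    using mtp by (simp add: lhs rhs cong: nn_integral_cong_simp)
qed

lemma reversible:
  assumes "F \<in> borel_measurable (labelled_space D)"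
  shows "nbr_sum D F \<in> borel_measurable (labelled_space D) \<and>
    (\<integral>\<^sup>+ x. nbr_sum D F x \<partial>B) = (\<integral>\<^sup>+ x. of_nat (dg x) * F x \<partial>B)"
  using assms
proof (induction rule: borel_measurable_induct)
  case (cong f g)
  have eq: "nbr_sum D f x = nbr_sum D g x" for x
    using cong(3) bernoulli_nbrs_space by (intro sum.cong) auto
  have "(\<integral>\<^sup>+ x. of_nat (dg x) * f x \<partial>B) = (\<integral>\<^sup>+ x. of_nat (dg x) * g x \<partial>B)"
    using cong(3) by (intro nn_integral_cong) (simp add: space_B)
  then show ?case using cong(4) eq by simp
next
  case (set A)
  then show ?case using measurable_nbr_sum_indicator reversible_indicator by blast
next
  case (mult u c)
  then have m: "nbr_sum D u \<in> borel_measurable (labelled_space D)"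
    and [measurable]: "u \<in> borel_measurable (labelled_space D)" by auto
  have eq: "nbr_sum D (\<lambda>x. c * u x) = (\<lambda>x. c * nbr_sum D u x)" by (simp add: sum_distrib_left)
  have "(\<integral>\<^sup>+ x. of_nat (dg x) * (c * u x) \<partial>B) = (\<integral>\<^sup>+ x. c * (of_nat (dg x) * u x) \<partial>B)"
    by (simp add: mult.left_commute)
  also have "\<dots> = c * (\<integral>\<^sup>+ x. of_nat (dg x) * u x \<partial>B)" by (intro nn_integral_cmult) measurable
  also have "\<dots> = c * (\<integral>\<^sup>+ x. nbr_sum D u x \<partial>B)" using mult by simp
  also have "\<dots> = (\<integral>\<^sup>+ x. c * nbr_sum D u x \<partial>B)" using m by (intro nn_integral_cmult[symmetric]) measurable
  finally show ?case unfolding eq using m by simp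
next
  case (add u v)
  then have m: "nbr_sum D u \<in> borel_measurable (labelled_space D)" "nbr_sum D v \<in> borel_measurable (labelled_space D)"
    and [measurable]: "u \<in> borel_measurable (labelled_space D)" "v \<in> borel_measurable (labelled_space D)" by auto
  note [measurable] = m
  have eq: "nbr_sum D (\<lambda>x. v x + u x) = (\<lambda>x. nbr_sum D v x + nbr_sum D u x)" by (simp add: sum.distrib)
  have "(\<integral>\<^sup>+ x. nbr_sum D v x + nbr_sum D u x \<partial>B) = (\<integral>\<^sup>+ x. nbr_sum D v x \<partial>B) + (\<integral>\<^sup>+ x. nbr_sum D u x \<partial>B)"
    by (intro nn_integral_add) measurable
  also have "\<dots> = (\<integral>\<^sup>+ x. of_nat (dg x) * v x \<partial>B) + (\<integral>\<^sup>+ x. of_nat (dg x) * u x \<partial>B)" using add by simp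
  also have "\<dots> = (\<integral>\<^sup>+ x. of_nat (dg x) * v x + of_nat (dg x) * u x \<partial>B)"
    by (intro nn_integral_add[symmetric]) measurable
  finally show ?case unfolding eq by (simp add: distrib_left)
next
  case (seq U)
  then have m: "\<And>i. nbr_sum D (U i) \<in> borel_measurable (labelled_space D)"
    and U[measurable]: "\<And>i. U i \<in> borel_measurable (labelled_space D)" by auto
  note [measurable] = m
  have "incseq U" using seq by blast
  then have inc: "incseq (\<lambda>i. U i y)" for y by (auto simp: incseq_def le_fun_def)
  have eq: "nbr_sum D (SUP i. U i) = (\<lambda>x. SUP i. nbr_sum D (U i) x)"
    unfolding SUP_apply ennreal_SUP_sum[OF inc] ..
  have "(\<integral>\<^sup>+ x. (SUP i. nbr_sum D (U i) x) \<partial>B) = (SUP i. \<integral>\<^sup>+ x. nbr_sum D (U i) x \<partial>B)"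
    using inc by (intro nn_integral_monotone_convergence_SUP) (auto simp: incseq_def le_fun_def intro: sum_mono)
  also have "\<dots> = (SUP i. \<integral>\<^sup>+ x. of_nat (dg x) * U i x \<partial>B)" using seq by simp
  also have "\<dots> = (\<integral>\<^sup>+ x. (SUP i. of_nat (dg x) * U i x) \<partial>B)"
    using inc by (intro nn_integral_monotone_convergence_SUP[symmetric])
      (auto simp: incseq_def le_fun_def intro: mult_left_mono)
  also have "\<dots> = (\<integral>\<^sup>+ x. of_nat (dg x) * (SUP i. U i) x \<partial>B)"
    unfolding SUP_apply SUP_mult_left_ennreal ..
  finally show ?case unfolding eq using m by simp
qed

end

section \<open>Spectral radius one without strong ergodicity\<close>

text \<open>The weighted form of the Cauchy-Schwarz inequality: with equal weights it is Jensen's inequality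
  for averages, and general weights give the Schur test.\<close>
lemma norm_sum_square_le:
  fixes f :: "'a \<Rightarrow> complex" and w :: "'a \<Rightarrow> real"
  assumes "\<And>i. i \<in> I \<Longrightarrow> w i > 0"
  shows "(cmod (\<Sum>i\<in>I. f i))\<^sup>2 \<le> (\<Sum>i\<in>I. w i) * (\<Sum>i\<in>I. (cmod (f i))\<^sup>2 / w i)"
proof -
  have "(cmod (\<Sum>i\<in>I. f i))\<^sup>2 \<le> (\<Sum>i\<in>I. cmod (f i))\<^sup>2" by (intro power_mono norm_sum) simp
  also have "\<dots> = (\<Sum>i\<in>I. sqrt (w i) * (cmod (f i) / sqrt (w i)))\<^sup>2"
    using assms by (intro arg_cong[where f = "\<lambda>x. x\<^sup>2"] sum.cong) (auto simp: less_imp_neq[symmetric])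
  also have "\<dots> \<le> (\<Sum>i\<in>I. (sqrt (w i))\<^sup>2) * (\<Sum>i\<in>I. (cmod (f i) / sqrt (w i))\<^sup>2)"
    by (rule Cauchy_Schwarz_ineq_sum)
  also have "\<dots> = (\<Sum>i\<in>I. w i) * (\<Sum>i\<in>I. (cmod (f i))\<^sup>2 / w i)"
    using assms by (intro arg_cong2[where f = "(*)"] sum.cong) (auto simp: power_divide less_imp_le)
  finally show ?thesis .
qed

context unimodular
begin

lemma dg_bounds:
  assumes "x \<in> space (labelled_space D)"
  shows "1 \<le> dg x" "dg x \<le> D"
proof -
  obtain G \<xi> r where x: "(G, \<xi>, r) \<in> labelled_graphs D" "x = lclass D G \<xi> r"
    using assms by (rule lclass_cases)
  then have G: "connected_graph D G" "r \<in> verts G" by (auto simp: labelled_graphs_iff)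
  have fin: "finite {s. (r, s) \<in> edges G}" by (rule connected_graph_finite_nbrs[OF G(1)])
  have eq: "dg x = card (lclass D G \<xi> ` {s. (r, s) \<in> edges G})"
    unfolding deg_def x(2) bernoulli_nbrs[OF x(1)] ..
  have d: "1 \<le> card {s. (r, s) \<in> edges G}" "card {s. (r, s) \<in> edges G} \<le> D"
    using connected_graph_deg[OF G] by (auto simp: deg_def)
  then have "{s. (r, s) \<in> edges G} \<noteq> {}" by (metis card.empty not_one_le_zero)
  then show "1 \<le> dg x" unfolding eq using fin by (simp add: Suc_le_eq card_gt_0_iff)
  show "dg x \<le> D" unfolding eq using card_image_le[OF fin] d(2) by (rule order_trans)
qed

sublocale B: prob_space B
  by (rule prob_space_B)

abbreviation "Z \<equiv> (\<integral>x. real (dg x) \<partial>B)"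
abbreviation "M \<equiv> deg_biased R B"

lemma measurable_dg [measurable]: "(\<lambda>x. real (dg x)) \<in> borel_measurable (labelled_space D)"
  by (rule measurable_deg_bernoulli)

lemma measurable_dg_B [measurable]: "(\<lambda>x. real (dg x)) \<in> borel_measurable B"
  unfolding measurable_cong_sets[OF sets_B refl] by (rule measurable_deg_bernoulli)

lemma integrable_dg: "integrable B (\<lambda>x. real (dg x))"
proof (rule B.integrable_const_bound[of _ "real D"])
  show "AE x in B. norm (real (dg x)) \<le> real D"
    by (rule AE_I2) (simp add: dg_bounds(2) space_B)
qed (rule measurable_dg_B)

lemma Z_bounds: "1 \<le> Z" "Z \<le> real D"
proof -
  have "(\<integral>x. 1 \<partial>B) \<le> Z"
    using dg_bounds by (intro integral_mono integrable_dg) (auto simp: space_B)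
  then show "1 \<le> Z" by (simp add: B.prob_space)
  have "Z \<le> (\<integral>x. real D \<partial>B)"
    using dg_bounds by (intro integral_mono integrable_dg) (auto simp: space_B)
  then show "Z \<le> real D" by (simp add: B.prob_space)
qed

lemma M_eq: "M = density B (\<lambda>x. ennreal (real (dg x) / Z))"
  by (simp add: deg_biased_def)

lemma sets_M [measurable_cong]: "sets M = sets (labelled_space D)"
  by (simp add: M_eq sets_B)

lemma space_M: "space M = space (labelled_space D)"
  by (rule sets_eq_imp_space_eq[OF sets_M])

lemma borel_M: "borel_measurable M = borel_measurable (labelled_space D)"
  by (rule measurable_cong_sets[OF sets_M refl])

lemma borel_B: "borel_measurable B = borel_measurable (labelled_space D)"
  by (rule measurable_cong_sets[OF sets_B refl])

lemma nn_integral_M: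
  assumes "g \<in> borel_measurable (labelled_space D)"
  shows "(\<integral>\<^sup>+ x. g x \<partial>M) = ennreal (1 / Z) * (\<integral>\<^sup>+ x. of_nat (dg x) * g x \<partial>B)"
proof -
  have m: "(\<lambda>x. of_nat (dg x) * g x) \<in> borel_measurable B"
    unfolding borel_B by (intro borel_measurable_times_ennreal measurable_of_nat_dg assms)
  have d: "(\<lambda>x. ennreal (real (dg x) / Z)) \<in> borel_measurable B"
    using measurable_dg_B by measurable
  have e: "ennreal (real (dg x) / Z) = ennreal (1 / Z) * of_nat (dg x)" for x
    using Z_bounds unfolding ennreal_of_nat_eq_real_of_nat
    by (subst ennreal_mult[symmetric]) auto
  have "(\<integral>\<^sup>+ x. g x \<partial>M) = (\<integral>\<^sup>+ x. ennreal (real (dg x) / Z) * g x \<partial>B)"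
    unfolding M_eq using assms borel_B by (intro nn_integral_density d) auto
  also have "\<dots> = (\<integral>\<^sup>+ x. ennreal (1 / Z) * (of_nat (dg x) * g x) \<partial>B)"
    unfolding e by (simp add: mult.assoc)
  also have "\<dots> = ennreal (1 / Z) * (\<integral>\<^sup>+ x. of_nat (dg x) * g x \<partial>B)"
    by (rule nn_integral_cmult[OF m])
  finally show ?thesis .
qed

lemma nn_integral_nbr_sum:
  assumes "g \<in> borel_measurable (labelled_space D)"
  shows "ennreal (1 / Z) * (\<integral>\<^sup>+ x. nbr_sum D g x \<partial>B) = (\<integral>\<^sup>+ x. g x \<partial>M)"
  using reversible[OF assms] nn_integral_M[OF assms] by simp

lemma prob_space_M: "prob_space M"
proof
  have "emeasure M (space M) = (\<integral>\<^sup>+ x. 1 \<partial>M)" by simp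
  also have "\<dots> = ennreal (1 / Z) * (\<integral>\<^sup>+ x. of_nat (dg x) \<partial>B)"
    by (subst nn_integral_M) auto
  also have "(\<integral>\<^sup>+ x. of_nat (dg x) \<partial>B) = ennreal Z"
    unfolding ennreal_of_nat_eq_real_of_nat by (rule nn_integral_eq_integral[OF integrable_dg]) simp
  also have "ennreal (1 / Z) * ennreal Z = 1"
    using Z_bounds by (subst ennreal_mult[symmetric]) auto
  finally show "emeasure M (space M) = 1" .
qed

sublocale M: prob_space M
  by (rule prob_space_M)

abbreviation "T \<equiv> markov R"

lemma measurable_T:
  assumes "f \<in> borel_measurable M"
  shows "T f \<in> borel_measurable M"
proof -
  have "(\<lambda>x. complex_of_real (1 / real (dg x)) * nbr_sum D f x) \<in> borel_measurable (labelled_space D)"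
  proof (rule borel_measurable_times)
    show "nbr_sum D f \<in> borel_measurable (labelled_space D)"
      by (rule measurable_nbr_sum_complex[OF assms[unfolded borel_M]])
    have "(\<lambda>x. 1 / real (dg x)) \<in> borel_measurable (labelled_space D)"
      by (rule borel_measurable_divide[OF borel_measurable_const measurable_dg])
    then show "(\<lambda>x. complex_of_real (1 / real (dg x))) \<in> borel_measurable (labelled_space D)"
      by (rule measurable_compose[OF _ borel_measurable_continuous_onI[OF continuous_on_of_real[OF continuous_on_id]]])
  qed
  then show ?thesis unfolding borel_M by (simp add: markov_def[abs_def])
qed

text \<open>Jensen's inequality for the average over neighbours. The constant \<open>a\<close> is 0 when
  \<open>T\<close> is shown to be a contraction and \<open>f x\<close> when \<open>T f -
  f\<close> is estimated.\<close>
lemma dg_markov_square_le: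
  assumes "x \<in> space (labelled_space D)"
  shows "of_nat (dg x) * ennreal ((cmod (T f x - a))\<^sup>2) \<le> nbr_sum D (\<lambda>y. ennreal ((cmod (f y - a))\<^sup>2)) x"
proof -
  have d: "dg x > 0" using dg_bounds[OF assms] by simp
  have "T f x - a = nbr_sum D (\<lambda>y. f y - a) x / of_nat (dg x)"
    using d by (simp add: markov_def sum_subtractf deg_def field_simps)
  then have "(cmod (T f x - a))\<^sup>2 = (cmod (nbr_sum D (\<lambda>y. f y - a) x))\<^sup>2 / (real (dg x))\<^sup>2"
    by (simp add: norm_divide power_divide)
  moreover have "(cmod (nbr_sum D (\<lambda>y. f y - a) x))\<^sup>2 \<le> real (dg x) * nbr_sum D (\<lambda>y. (cmod (f y - a))\<^sup>2) x"
    using norm_sum_square_le[of "{y. (x, y) \<in> R}" "\<lambda>_. 1" "\<lambda>y. f y - a"] by (simp add: deg_def)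
  ultimately have "real (dg x) * (cmod (T f x - a))\<^sup>2 \<le> nbr_sum D (\<lambda>y. (cmod (f y - a))\<^sup>2) x"
  proof -
    assume eq: "(cmod (T f x - a))\<^sup>2 = (cmod (nbr_sum D (\<lambda>y. f y - a) x))\<^sup>2 / (real (dg x))\<^sup>2"
      and le: "(cmod (nbr_sum D (\<lambda>y. f y - a) x))\<^sup>2 \<le> real (dg x) * nbr_sum D (\<lambda>y. (cmod (f y - a))\<^sup>2) x"
    have "real (dg x) * (cmod (T f x - a))\<^sup>2 = (cmod (nbr_sum D (\<lambda>y. f y - a) x))\<^sup>2 / real (dg x)"
      unfolding eq using d by (simp add: power2_eq_square)
    also have "\<dots> \<le> (real (dg x) * nbr_sum D (\<lambda>y. (cmod (f y - a))\<^sup>2) x) / real (dg x)"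
      using le by (rule divide_right_mono) simp
    also have "\<dots> = nbr_sum D (\<lambda>y. (cmod (f y - a))\<^sup>2) x" using d by simp
    finally show ?thesis .
  qed
  then have "ennreal (real (dg x) * (cmod (T f x - a))\<^sup>2) \<le> ennreal (nbr_sum D (\<lambda>y. (cmod (f y - a))\<^sup>2) x)"
    by (rule ennreal_leI)
  then show ?thesis
    unfolding ennreal_of_nat_eq_real_of_nat by (simp add: ennreal_mult sum_ennreal)
qed

text \<open>Jensen's inequality at each point and reversibility, which says that averaging over neighbours
  preserves integrals.\<close>
lemma T_contraction:
  assumes "f \<in> L2 M"
  shows "T f \<in> L2 M" "L2_norm M (T f) \<le> L2_norm M f"
proof -
  note fm = L2D(1)[OF assms]
  have sq: "(\<lambda>x. ennreal ((cmod (h x))\<^sup>2)) \<in> borel_measurable (labelled_space D)"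
    if "h \<in> borel_measurable M" for h :: "_ \<Rightarrow> complex"
    using that unfolding borel_M by measurable
  have "(\<integral>\<^sup>+ x. ennreal ((cmod (T f x))\<^sup>2) \<partial>M) = ennreal (1 / Z) * (\<integral>\<^sup>+ x. of_nat (dg x) * ennreal ((cmod (T f x))\<^sup>2) \<partial>B)"
    by (rule nn_integral_M[OF sq[OF measurable_T[OF fm]]])
  also have "\<dots> \<le> ennreal (1 / Z) * (\<integral>\<^sup>+ x. nbr_sum D (\<lambda>y. ennreal ((cmod (f y))\<^sup>2)) x \<partial>B)"
    using dg_markov_square_le[of _ f 0] by (intro mult_left_mono nn_integral_mono) (auto simp: space_B)
  also have "\<dots> = (\<integral>\<^sup>+ x. ennreal ((cmod (f x))\<^sup>2) \<partial>M)" by (rule nn_integral_nbr_sum[OF sq[OF fm]])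
  also have "\<dots> = ennreal ((L2_norm M f)\<^sup>2)" by (rule L2_norm_ennreal[OF assms, symmetric])
  finally have "(\<integral>\<^sup>+ x. ennreal ((cmod (T f x))\<^sup>2) \<partial>M) \<le> ennreal ((L2_norm M f)\<^sup>2)" .
  from L2_I[OF measurable_T[OF fm] this L2_norm_nonneg]
  show "T f \<in> L2 M" "L2_norm M (T f) \<le> L2_norm M f" by auto
qed

abbreviation avg :: "(labelled_class \<Rightarrow> real) \<Rightarrow> labelled_class \<Rightarrow> real" where
  "avg g x \<equiv> nbr_sum D g x / real (dg x)"

lemma nn_integral_avg:
  assumes g: "g \<in> borel_measurable (labelled_space D)" "\<And>x. 0 \<le> g x"
  shows "(\<integral>\<^sup>+ x. ennreal (avg g x) \<partial>M) = (\<integral>\<^sup>+ x. ennreal (g x) \<partial>M)"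
proof -
  have m: "(\<lambda>x. ennreal (avg g x)) \<in> borel_measurable (labelled_space D)"
    by (rule measurable_compose[OF borel_measurable_divide[OF measurable_nbr_sum_real[OF g(1)] measurable_dg] measurable_ennreal])
  have "of_nat (dg x) * ennreal (avg g x) = nbr_sum D (\<lambda>y. ennreal (g y)) x" if "x \<in> space B" for x
  proof -
    have "dg x > 0" using dg_bounds(1)[of x] that unfolding space_B by simp
    then have "real (dg x) * avg g x = nbr_sum D g x" by simp
    then have "ennreal (real (dg x)) * ennreal (avg g x) = ennreal (nbr_sum D g x)"
      by (subst ennreal_mult[symmetric]) (auto simp: g(2) sum_nonneg)
    then show ?thesis unfolding ennreal_of_nat_eq_real_of_nat by (simp add: sum_ennreal g(2))
  qed
  then have "(\<integral>\<^sup>+ x. of_nat (dg x) * ennreal (avg g x) \<partial>B) = (\<integral>\<^sup>+ x. nbr_sum D (\<lambda>y. ennreal (g y)) x \<partial>B)"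
    by (rule nn_integral_cong)
  then have "(\<integral>\<^sup>+ x. ennreal (avg g x) \<partial>M) = ennreal (1 / Z) * (\<integral>\<^sup>+ x. nbr_sum D (\<lambda>y. ennreal (g y)) x \<partial>B)"
    unfolding nn_integral_M[OF m] by (rule arg_cong)
  then show ?thesis
    using nn_integral_nbr_sum[OF measurable_compose[OF g(1) measurable_ennreal]] by (rule trans)
qed

lemma integral_avg_nonneg:
  assumes g: "integrable M g" "\<And>x. 0 \<le> g x"
  shows "integrable M (avg g)" "(\<integral>x. avg g x \<partial>M) = (\<integral>x. g x \<partial>M)"
proof -
  have gm: "g \<in> borel_measurable (labelled_space D)" using g(1) borel_M by auto
  have am: "avg g \<in> borel_measurable M"
    unfolding borel_M by (rule borel_measurable_divide[OF measurable_nbr_sum_real[OF gm] measurable_dg])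
  have nn: "0 \<le> avg g x" for x using g(2) by (simp add: sum_nonneg)
  have ig: "(\<integral>\<^sup>+ x. ennreal (g x) \<partial>M) = ennreal (\<integral>x. g x \<partial>M)"
    by (rule nn_integral_eq_integral[OF g(1) AE_I2[OF g(2)]])
  have ia: "(\<integral>\<^sup>+ x. ennreal (avg g x) \<partial>M) = ennreal (\<integral>x. g x \<partial>M)"
    using nn_integral_avg[OF gm g(2)] ig by (rule trans)
  then have "(\<integral>\<^sup>+ x. ennreal (avg g x) \<partial>M) < \<infinity>" by (simp only: ennreal_less_top infinity_ennreal_def)
  then show i: "integrable M (avg g)" by (rule integrableI_nonneg[OF am AE_I2[OF nn]])
  have "ennreal (\<integral>x. avg g x \<partial>M) = ennreal (\<integral>x. g x \<partial>M)"
    using nn_integral_eq_integral[OF i AE_I2[OF nn]] ia by (rule trans[OF sym])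
  moreover have "0 \<le> (\<integral>x. avg g x \<partial>M)" "0 \<le> (\<integral>x. g x \<partial>M)"
    by (rule integral_nonneg_AE[OF AE_I2[OF nn]], rule integral_nonneg_AE[OF AE_I2[OF g(2)]])
  ultimately show "(\<integral>x. avg g x \<partial>M) = (\<integral>x. g x \<partial>M)" by (simp only: ennreal_inj)
qed

lemma integral_avg:
  assumes g: "integrable M g"
  shows "(\<integral>x. avg g x \<partial>M) = (\<integral>x. g x \<partial>M)"
proof -
  let ?p = "\<lambda>x. max 0 (g x)" and ?n = "\<lambda>x. max 0 (- g x)"
  have i: "integrable M ?p" "integrable M ?n" using g by auto
  have eq: "avg g x = avg ?p x - avg ?n x" for x
    unfolding diff_divide_distrib[symmetric] sum_subtractf[symmetric]
    by (intro arg_cong2[where f = "(/)"] sum.cong) (auto simp: max_def)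
  have "(\<integral>x. avg g x \<partial>M) = (\<integral>x. avg ?p x \<partial>M) - (\<integral>x. avg ?n x \<partial>M)"
    unfolding eq using integral_avg_nonneg(1)[OF i(1)] integral_avg_nonneg(1)[OF i(2)]
    by (intro Bochner_Integration.integral_diff) auto
  also have "\<dots> = (\<integral>x. ?p x \<partial>M) - (\<integral>x. ?n x \<partial>M)"
    using integral_avg_nonneg(2)[OF i(1)] integral_avg_nonneg(2)[OF i(2)] by auto
  also have "\<dots> = (\<integral>x. ?p x - ?n x \<partial>M)" using i by (intro Bochner_Integration.integral_diff[symmetric]) auto
  also have "\<dots> = (\<integral>x. g x \<partial>M)" by (intro Bochner_Integration.integral_cong) (auto simp: max_def)
  finally show ?thesis .
qed

text \<open>Invariance of the integral makes the orthogonal complement of the constants invariant under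
  \<open>T\<close>.\<close>
lemma integral_T:
  assumes "f \<in> L2 M"
  shows "(\<integral>x. T f x \<partial>M) = (\<integral>x. f x \<partial>M)"
proof -
  have i: "integrable M f" "integrable M (T f)"
    using L2_finite_measure_integrable[OF M.finite_measure_axioms] assms T_contraction(1)[OF assms] by auto
  have re: "Re (T f x) = avg (\<lambda>y. Re (f y)) x" for x by (simp add: markov_def)
  have im: "Im (T f x) = avg (\<lambda>y. Im (f y)) x" for x by (simp add: markov_def)
  have "Re (\<integral>x. T f x \<partial>M) = (\<integral>x. avg (\<lambda>y. Re (f y)) x \<partial>M)"
    unfolding integral_Re[OF i(2), symmetric] re ..
  also have "\<dots> = Re (\<integral>x. f x \<partial>M)" using integral_avg[of "\<lambda>y. Re (f y)"] i(1) by simp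
  finally have 1: "Re (\<integral>x. T f x \<partial>M) = Re (\<integral>x. f x \<partial>M)" .
  have "Im (\<integral>x. T f x \<partial>M) = (\<integral>x. avg (\<lambda>y. Im (f y)) x \<partial>M)"
    unfolding integral_Im[OF i(2), symmetric] im ..
  also have "\<dots> = Im (\<integral>x. f x \<partial>M)" using integral_avg[of "\<lambda>y. Im (f y)"] i(1) by simp
  finally show ?thesis using 1 by (simp add: complex_eq_iff)
qed

abbreviation "H \<equiv> orthogonal_to_constants M"

lemma T_H: "f \<in> H \<Longrightarrow> T f \<in> H"
  using T_contraction(1) integral_T by (auto simp: orthogonal_to_constants_iff)

lemma spectrum_le_1:
  assumes "z \<in> spectrum_on H (L2_norm M) T"
  shows "cmod z \<le> 1"
proof (rule ccontr)
  assume z: "\<not> cmod z \<le> 1"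
  interpret complete_seminormed H "L2_norm M" by (rule complete_seminormed_orthogonal[OF prob_space_M])
  have "z \<notin> spectrum_on H (L2_norm M) T"
  proof (rule not_in_spectrum)
    show "T f \<in> H" if "f \<in> H" for f by (rule T_H[OF that])
    show "L2_norm M (T f) \<le> 1 * L2_norm M f" if "f \<in> H" for f
      using T_contraction(2) that by (auto simp: orthogonal_to_constants_iff)
    have "(\<lambda>x. 0) \<in> H" using zero_in_L2 by (auto simp: orthogonal_to_constants_iff)
    then show "H \<noteq> {}" by blast
  qed (use z markov_add markov_scale in auto)
  then show False using assms by simp
qed

abbreviation bdry :: "labelled_class set \<Rightarrow> labelled_class set" where
  "bdry A \<equiv> {x \<in> A. \<exists>y. (x, y) \<in> R \<and> y \<notin> A}"

lemma bdry_nbr_sum: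
  assumes x: "x \<in> space (labelled_space D)"
  shows "(\<exists>y. (x, y) \<in> R \<and> y \<notin> A) \<longleftrightarrow> nbr_sum D (indicator (- A) :: _ \<Rightarrow> real) x > 0"
proof -
  have "nbr_sum D (indicator (- A) :: _ \<Rightarrow> real) x = 0 \<longleftrightarrow> (\<forall>y\<in>{y. (x, y) \<in> R}. indicator (- A) y = (0 :: real))"
    using finite_bernoulli_nbrs[OF x] by (intro sum_nonneg_eq_0_iff) auto
  moreover have "nbr_sum D (indicator (- A) :: _ \<Rightarrow> real) x \<ge> 0" by (simp add: sum_nonneg)
  ultimately show ?thesis by (auto simp: indicator_def less_le)
qed

lemma indicator_compl_measurable:
  assumes "A \<in> sets (labelled_space D)"
  shows "(indicator (- A) :: _ \<Rightarrow> real) \<in> borel_measurable (labelled_space D)"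
proof -
  have "(\<lambda>x. 1 - indicator A x :: real) \<in> borel_measurable (labelled_space D)"
    by (intro borel_measurable_diff borel_measurable_const borel_measurable_indicator assms)
  moreover have "(\<lambda>x. 1 - indicator A x :: real) = indicator (- A)"
    by (rule ext) (simp add: indicator_def)
  ultimately show ?thesis by (simp only:)
qed

lemma bdry_sets:
  assumes A: "A \<in> sets (labelled_space D)"
  shows "bdry A \<in> sets B"
proof -
  have "(\<lambda>x. nbr_sum D (indicator (- A) :: _ \<Rightarrow> real) x) \<in> borel_measurable (labelled_space D)"
    by (rule measurable_nbr_sum_real[OF indicator_compl_measurable[OF A]])
  then have "A \<inter> {x \<in> space (labelled_space D). nbr_sum D (indicator (- A) :: _ \<Rightarrow> real) x > 0} \<in> sets (labelled_space D)"
    by (intro sets.Int A iffD1[OF borel_measurable_iff_greater, THEN spec])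
  moreover have "bdry A = A \<inter> {x \<in> space (labelled_space D). nbr_sum D (indicator (- A) :: _ \<Rightarrow> real) x > 0}"
    using bdry_nbr_sum sets.sets_into_space[OF A] by blast
  ultimately show ?thesis using sets_B by simp
qed

text \<open>By reversibility there are as many edges from \<open>A\<close> to its complement as back. They
  start at boundary points, each of which has at most \<open>D\<close> neighbours.\<close>
lemma Dirichlet_form_indicator:
  assumes A: "A \<in> sets (labelled_space D)"
  shows "(\<integral>\<^sup>+ x. nbr_sum D (\<lambda>y. ennreal ((indicator A y - indicator A x)\<^sup>2)) x \<partial>B) \<le> ennreal (2 * real D * measure B (bdry A))"
proof -
  let ?i = "indicator A :: _ \<Rightarrow> ennreal" and ?c = "indicator (space (labelled_space D) - A) :: _ \<Rightarrow> ennreal"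
  have Ac: "space (labelled_space D) - A \<in> sets (labelled_space D)" using A by blast
  have [measurable]: "nbr_sum D ?i \<in> borel_measurable B" "nbr_sum D ?c \<in> borel_measurable B"
    "?i \<in> borel_measurable B" "?c \<in> borel_measurable B"
    unfolding borel_B using A Ac by (auto intro: measurable_nbr_sum_indicator)
  let ?out = "\<integral>\<^sup>+ x. ?i x * nbr_sum D ?c x \<partial>B"
  let ?inn = "\<integral>\<^sup>+ x. ?c x * nbr_sum D ?i x \<partial>B"
  let ?in = "\<integral>\<^sup>+ x. ?i x * nbr_sum D ?i x \<partial>B"
  have yx: "y \<in> space (labelled_space D)" if "(x, y) \<in> R" for x y using bernoulli_nbrs_space that by blast
  have sum_dg: "nbr_sum D ?i x + nbr_sum D ?c x = of_nat (dg x)" for x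
  proof -
    have "nbr_sum D ?i x + nbr_sum D ?c x = nbr_sum D (\<lambda>y. 1) x"
      unfolding sum.distrib[symmetric] using yx by (intro sum.cong) (auto simp: indicator_def)
    then show ?thesis by (simp add: deg_def)
  qed
  have le: "nbr_sum D ?i x \<le> of_nat (dg x)" "nbr_sum D ?c x \<le> of_nat (dg x)" for x
    unfolding sum_dg[symmetric] by simp_all
  have ind_le: "indicator E x \<le> (1 :: ennreal)" for E and x :: labelled_class by (simp add: indicator_def)
  have "?inn + ?in = (\<integral>\<^sup>+ x. ?c x * nbr_sum D ?i x + ?i x * nbr_sum D ?i x \<partial>B)"
    by (intro nn_integral_add[symmetric]) measurable
  also have "\<dots> = (\<integral>\<^sup>+ x. nbr_sum D ?i x \<partial>B)"
    by (intro nn_integral_cong) (auto simp: space_B indicator_def)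
  also have "\<dots> = (\<integral>\<^sup>+ x. of_nat (dg x) * ?i x \<partial>B)" by (rule reversible_indicator[OF A])
  also have "\<dots> = (\<integral>\<^sup>+ x. ?i x * nbr_sum D ?c x + ?i x * nbr_sum D ?i x \<partial>B)"
    unfolding sum_dg[symmetric] by (intro nn_integral_cong) (simp add: algebra_simps)
  also have "\<dots> = ?out + ?in" by (intro nn_integral_add) measurable
  finally have eq: "?inn + ?in = ?out + ?in" .
  \<comment> \<open>the edges inside \<open>A\<close> have finite measure and can be cancelled\<close>
  have "?in \<le> (\<integral>\<^sup>+ x. ennreal (real D) \<partial>B)"
  proof (intro nn_integral_mono)
    fix x assume x: "x \<in> space B"
    have "?i x * nbr_sum D ?i x \<le> 1 * of_nat (dg x)"
      by (intro mult_mono ind_le le) simp_all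
    also have "\<dots> \<le> of_nat D" using dg_bounds(2)[of x] x space_B by simp
    finally show "?i x * nbr_sum D ?i x \<le> ennreal (real D)" by (simp add: ennreal_of_nat_eq_real_of_nat)
  qed
  also have "\<dots> < \<top>" by (simp add: B.emeasure_space_1)
  finally have "?in \<noteq> \<top>" by simp
  then have sym: "?inn = ?out" using eq ennreal_add_left_cancel[of ?in ?inn ?out] by (simp add: add.commute)
  have out: "?out \<le> ennreal (real D * measure B (bdry A))"
  proof -
    have "?out \<le> (\<integral>\<^sup>+ x. ennreal (real D) * indicator (bdry A) x \<partial>B)"
    proof (intro nn_integral_mono)
      fix x assume x: "x \<in> space B"
      show "?i x * nbr_sum D ?c x \<le> ennreal (real D) * indicator (bdry A) x"
      proof (cases "x \<in> bdry A")
        case True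
        have "?i x * nbr_sum D ?c x \<le> 1 * of_nat (dg x)"
          by (intro mult_mono ind_le le) simp_all
        also have "\<dots> \<le> of_nat D" using dg_bounds(2)[of x] x space_B by simp
        finally show ?thesis using True by (simp add: ennreal_of_nat_eq_real_of_nat)
      next
        case False
        then have "?i x * nbr_sum D ?c x = 0" by (auto simp: indicator_def intro!: sum.neutral)
        then show ?thesis by (simp only: zero_le)
      qed
    qed
    also have "\<dots> = ennreal (real D) * emeasure B (bdry A)"
      using bdry_sets[OF A] by (simp add: nn_integral_cmult)
    also have "\<dots> = ennreal (real D * measure B (bdry A))"
      by (simp add: B.emeasure_eq_measure ennreal_mult)
    finally show ?thesis .
  qed
  have "(\<integral>\<^sup>+ x. nbr_sum D (\<lambda>y. ennreal ((indicator A y - indicator A x)\<^sup>2)) x \<partial>B) =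
      (\<integral>\<^sup>+ x. ?i x * nbr_sum D ?c x + ?c x * nbr_sum D ?i x \<partial>B)"
  proof (intro nn_integral_cong)
    fix x assume x: "x \<in> space B"
    show "nbr_sum D (\<lambda>y. ennreal ((indicator A y - indicator A x)\<^sup>2)) x = ?i x * nbr_sum D ?c x + ?c x * nbr_sum D ?i x"
      unfolding sum_distrib_left sum.distrib[symmetric] using x yx
      by (intro sum.cong) (auto simp: indicator_def space_B)
  qed
  also have "\<dots> = ?out + ?inn" by (intro nn_integral_add) measurable
  also have "\<dots> \<le> ennreal (real D * measure B (bdry A)) + ennreal (real D * measure B (bdry A))"
    unfolding sym by (intro add_mono out)
  also have "\<dots> = ennreal (2 * real D * measure B (bdry A))" by (subst ennreal_plus[symmetric]) auto
  finally show ?thesis .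
qed

lemma measure_M_ge:
  assumes A: "A \<in> sets (labelled_space D)"
  shows "measure B A / Z \<le> measure M A"
proof -
  have "ennreal (1 / Z) * emeasure B A = ennreal (1 / Z) * (\<integral>\<^sup>+ x. indicator A x \<partial>B)"
    using A sets_B by simp
  also have "\<dots> \<le> ennreal (1 / Z) * (\<integral>\<^sup>+ x. of_nat (dg x) * indicator A x \<partial>B)"
  proof (intro mult_left_mono nn_integral_mono)
    fix x assume "x \<in> space B"
    then have "(1 :: ennreal) \<le> of_nat (dg x)"
      using dg_bounds(1)[of x] unfolding space_B by (metis of_nat_1 of_nat_mono)
    then show "(indicator A x :: ennreal) \<le> of_nat (dg x) * indicator A x"
      by (simp add: indicator_def)
  qed simp
  also have "\<dots> = emeasure M A"
    using nn_integral_M[of "indicator A"] A sets_M by simp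
  finally have "ennreal (1 / Z) * ennreal (measure B A) \<le> ennreal (measure M A)"
    by (simp add: B.emeasure_eq_measure M.emeasure_eq_measure)
  then have "ennreal (1 / Z * measure B A) \<le> ennreal (measure M A)"
    using Z_bounds by (subst ennreal_mult) auto
  then show ?thesis by (subst (asm) ennreal_le_iff) (auto simp: field_simps)
qed

text \<open>The value of \<open>T f - f\<close> at \<open>x\<close> is the average of \<open>f y - f
  x\<close> over the neighbours, so its norm is bounded by the Dirichlet form and hence by the
  boundary. The norm of \<open>f\<close> is the variance of the indicator under the
  degree-biased measure, which is comparable to that under \<open>B\<close>.\<close>
lemma approx_eigen:
  assumes A: "A \<in> sets (labelled_space D)"
  defines "f \<equiv> \<lambda>x. complex_of_real (indicator A x - measure M A)"
  shows "f \<in> H" "(L2_norm M (\<lambda>x. T f x - 1 * f x))\<^sup>2 \<le> 2 * real D * measure B (bdry A)"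
    "measure B A * (1 - measure B A) / Z\<^sup>2 \<le> (L2_norm M f)\<^sup>2"
proof -
  let ?m = "measure M A"
  have AM: "A \<in> sets M" using A sets_M by simp
  have [measurable]: "f \<in> borel_measurable M" unfolding f_def using AM by measurable
  have sq: "(cmod (f x))\<^sup>2 = (1 - 2 * ?m) * indicator A x + ?m\<^sup>2" for x
    by (auto simp: f_def indicator_def power2_eq_square algebra_simps simp flip: of_real_diff)
  have "integrable M (\<lambda>x. (cmod (f x))\<^sup>2)" unfolding sq
    by (intro Bochner_Integration.integrable_add integrable_mult_right integrable_real_indicator M.integrable_const)
       (simp_all add: AM M.emeasure_eq_measure)
  then have fL: "f \<in> L2 M" by (simp add: L2_def)
  have iA: "integrable M (indicator A :: _ \<Rightarrow> real)"
    by (rule integrable_real_indicator) (simp_all add: AM M.emeasure_eq_measure)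
  have "(\<integral>x. f x \<partial>M) = of_real (\<integral>x. indicator A x - ?m \<partial>M)"
    unfolding f_def by (rule integral_of_real[OF Bochner_Integration.integrable_diff[OF iA M.integrable_const]])
  also have "(\<integral>x. indicator A x - ?m \<partial>M) = 0"
  proof -
    show ?thesis
      unfolding Bochner_Integration.integral_diff[OF iA M.integrable_const] using AM by (simp add: M.prob_space)
  qed
  finally show fH: "f \<in> H" using fL by (simp add: orthogonal_to_constants_iff)
  have "(L2_norm M f)\<^sup>2 = (1 - 2 * ?m) * ?m + ?m\<^sup>2"
    unfolding L2_norm_square sq
      Bochner_Integration.integral_add[OF integrable_mult_right[OF iA] M.integrable_const]
    using AM by (simp add: M.prob_space)
  also have "\<dots> = ?m * (1 - ?m)" by (simp add: power2_eq_square algebra_simps)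
  also have "1 - ?m = measure M (space M - A)" using M.prob_compl[OF AM] by simp
  finally have N: "(L2_norm M f)\<^sup>2 = ?m * measure M (space M - A)" .
  have "measure B A / Z * (measure B (space M - A) / Z) \<le> ?m * measure M (space M - A)"
    using A Z_bounds by (intro mult_mono measure_M_ge) (auto simp: space_M)
  moreover have "measure B (space M - A) = 1 - measure B A"
    using B.prob_compl[of A] A sets_B by (simp add: space_M space_B)
  ultimately show "measure B A * (1 - measure B A) / Z\<^sup>2 \<le> (L2_norm M f)\<^sup>2"
    unfolding N by (simp add: power2_eq_square)
  let ?g = "\<lambda>x. T f x - 1 * f x"
  have gL: "?g \<in> L2 M"
    using seminormed.H_diff[OF seminormed_L2 T_contraction(1)[OF fL] L2_scale(1)[OF fL]] .
  have gm: "(\<lambda>x. ennreal ((cmod (?g x))\<^sup>2)) \<in> borel_measurable (labelled_space D)"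
    using L2D(1)[OF gL] unfolding borel_M by measurable
  have "ennreal ((L2_norm M ?g)\<^sup>2) = (\<integral>\<^sup>+ x. ennreal ((cmod (?g x))\<^sup>2) \<partial>M)" by (rule L2_norm_ennreal[OF gL])
  also have "\<dots> = ennreal (1 / Z) * (\<integral>\<^sup>+ x. of_nat (dg x) * ennreal ((cmod (?g x))\<^sup>2) \<partial>B)"
    by (rule nn_integral_M[OF gm])
  also have "\<dots> \<le> ennreal 1 * (\<integral>\<^sup>+ x. nbr_sum D (\<lambda>y. ennreal ((indicator A y - indicator A x)\<^sup>2)) x \<partial>B)"
  proof (intro mult_mono nn_integral_mono)
    show "ennreal (1 / Z) \<le> ennreal 1" using Z_bounds by (intro ennreal_leI) simp
    fix x assume x: "x \<in> space B"
    have "f y - f x = of_real (indicator A y - indicator A x)" for y by (simp add: f_def)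
    then have "cmod (f y - f x) = \<bar>indicator A y - indicator A x\<bar>" for y by (simp only: norm_of_real)
    then have "(cmod (f y - f x))\<^sup>2 = (indicator A y - indicator A x)\<^sup>2" for y by simp
    then show "of_nat (dg x) * ennreal ((cmod (?g x))\<^sup>2) \<le> nbr_sum D (\<lambda>y. ennreal ((indicator A y - indicator A x)\<^sup>2)) x"
      using dg_markov_square_le[of x f "f x"] x space_B by simp
  qed auto
  also have "\<dots> \<le> ennreal (2 * real D * measure B (bdry A))"
    using Dirichlet_form_indicator[OF A] by simp
  finally show "(L2_norm M ?g)\<^sup>2 \<le> 2 * real D * measure B (bdry A)"
    by (subst (asm) ennreal_le_iff) auto
qed

text \<open>Sets that refute strong ergodicity have vanishing boundary, and the variance of their indicators
  is bounded below along a subsequence.\<close>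
lemma one_in_spectrum:
  assumes "\<not> strongly_ergodic R B"
  shows "1 \<in> spectrum_on H (L2_norm M) T"
proof -
  interpret complete_seminormed H "L2_norm M" by (rule complete_seminormed_orthogonal[OF prob_space_M])
  obtain A where A: "\<And>n. A n \<in> sets B" and bd: "(\<lambda>n. measure B (bdry (A n))) \<longlonglongrightarrow> 0"
    and no: "\<not> (\<lambda>n :: nat. measure B (A n) * (1 - measure B (A n))) \<longlonglongrightarrow> 0"
    using assms unfolding strongly_ergodic_def by blast
  let ?v = "\<lambda>n. measure B (A n) * (1 - measure B (A n))"
  have vpos: "0 \<le> ?v n" for n using B.prob_le_1 by (simp add: mult_nonneg_nonneg)
  obtain \<delta> where d: "\<delta> > 0" "\<exists>\<^sub>F n in sequentially. \<delta> \<le> ?v n"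
  proof -
    obtain \<delta> where "\<delta> > 0" "\<not> (\<forall>\<^sub>F n in sequentially. dist (?v n) 0 < \<delta>)" using no by (auto simp: tendsto_iff)
    then show thesis using that[of \<delta>] vpos by (auto simp: frequently_def not_le not_less abs_of_nonneg)
  qed
  show ?thesis
  proof (rule in_spectrum_if_approx_eigen[OF T_H])
    fix \<epsilon> :: real assume e: "\<epsilon> > 0"
    \<comment> \<open>small enough that the Dirichlet form is below \<open>\<epsilon>\<^sup>2\<close> times the variance bound \<open>\<delta> / Z\<^sup>2\<close>; the summand 1 avoids division by 0\<close>
    define \<eta> where "\<eta> = \<epsilon>\<^sup>2 * (\<delta> / Z\<^sup>2) / (2 * real D + 1)"
    have eta: "\<eta> > 0" unfolding \<eta>_def using e d(1) Z_bounds by (intro divide_pos_pos mult_pos_pos) auto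
    have "\<forall>\<^sub>F n in sequentially. measure B (bdry (A n)) < \<eta>"
      using bd eta by (rule order_tendstoD(2))
    with d(2) have "\<exists>\<^sub>F n in sequentially. measure B (bdry (A n)) < \<eta> \<and> \<delta> \<le> ?v n"
      by (rule frequently_eventually_conj)
    from frequently_ex[OF this] obtain n where n: "\<delta> \<le> ?v n" "measure B (bdry (A n)) < \<eta>" by blast
    have An: "A n \<in> sets (labelled_space D)" using A sets_B by blast
    let ?f = "\<lambda>x. complex_of_real (indicator (A n) x - measure M (A n))"
    note f = approx_eigen[OF An]
    have "(L2_norm M (\<lambda>x. T ?f x - 1 * ?f x))\<^sup>2 \<le> 2 * real D * measure B (bdry (A n))" by (rule f(2))
    also have "\<dots> \<le> 2 * real D * \<eta>" using n(2) by (intro mult_left_mono) auto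
    also have "\<dots> < (2 * real D + 1) * \<eta>" using eta by simp
    also have "\<dots> = \<epsilon>\<^sup>2 * (\<delta> / Z\<^sup>2)" by (simp add: \<eta>_def)
    also have "\<dots> \<le> \<epsilon>\<^sup>2 * (?v n / Z\<^sup>2)" using n(1) by (intro mult_left_mono divide_right_mono) auto
    also have "\<dots> \<le> \<epsilon>\<^sup>2 * (L2_norm M ?f)\<^sup>2" using f(3) by (intro mult_left_mono) auto
    finally have "(L2_norm M (\<lambda>x. T ?f x - 1 * ?f x))\<^sup>2 < (\<epsilon> * L2_norm M ?f)\<^sup>2" by (simp add: power_mult_distrib)
    then have "L2_norm M (\<lambda>x. T ?f x - 1 * ?f x) < \<epsilon> * L2_norm M ?f"
      by (rule power2_less_imp_less[OF _ mult_nonneg_nonneg[OF less_imp_le[OF e] L2_norm_nonneg]])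
    then show "\<exists>f\<in>H. L2_norm M (\<lambda>x. T f x - 1 * f x) < \<epsilon> * L2_norm M f" using f(1) by blast
  qed
qed

theorem rho_graphing_eq_1:
  assumes "\<not> strongly_ergodic R B"
  shows "rho_graphing R B = 1"
  unfolding rho_graphing_def spectral_radius_on_def
proof (rule cSup_eq_maximum)
  show "1 \<in> cmod ` spectrum_on H (L2_norm M) T"
    using one_in_spectrum[OF assms] by (intro image_eqI[of _ _ 1]) auto
  show "x \<le> 1" if "x \<in> cmod ` spectrum_on H (L2_norm M) T" for x
    using that spectrum_le_1 by blast
qed

end

section \<open>The Schur test on a graph\<close>

text \<open>A positive function whose average over neighbours is at most \<open>q\<close> times its value.
  Only a ball is considered, which makes the property local; the weights for different radii
  need not be related.\<close>
definition superharmonic_weight :: "real \<Rightarrow> nat \<Rightarrow> graph \<Rightarrow> nat \<Rightarrow> bool" where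
  "superharmonic_weight q m G r \<longleftrightarrow> (\<exists>w. (\<forall>v. w v > 0) \<and>
     (\<forall>v\<in>vball G r m. (\<Sum>u | (v, u) \<in> edges G. w u) \<le> q * real (deg (edges G) v) * w v))"

text \<open>The difference of the indicators of two vertices with the same neighbours is annihilated by the
  Markov operator.\<close>
definition has_twin :: "graph \<Rightarrow> nat \<Rightarrow> bool" where
  "has_twin G r \<longleftrightarrow> (\<exists>s\<in>vball G r 2. s \<noteq> r \<and> {t. (s, t) \<in> edges G} = {t. (r, t) \<in> edges G})"

lemma local_fun_if_imp:
  fixes P :: "graph \<Rightarrow> nat \<Rightarrow> bool"
  assumes "\<And>G r H p \<phi>. (G, r) \<in> rooted_graphs D \<Longrightarrow> (H, p) \<in> rooted_graphs D \<Longrightarrow> ball_iso \<phi> G r H p n \<Longrightarrow>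
    P G r \<Longrightarrow> P H p"
  shows "local_fun D n P"
  unfolding local_fun_def
proof (intro allI impI)
  fix G r H p \<phi>
  assume *: "(G, r) \<in> rooted_graphs D" "(H, p) \<in> rooted_graphs D" "ball_iso \<phi> G r H p n"
  then have "ball_iso (inv_into (vball G r n) \<phi>) H p G r n"
    by (intro ball_iso_inv) (auto simp: rooted_graphs_iff)
  then show "P G r = P H p" using assms * by blast
qed

lemma local_superharmonic_weight: "local_fun D (Suc m) (superharmonic_weight q m)"
proof (rule local_fun_if_imp)
  fix G r H p \<phi>
  assume "(G, r) \<in> rooted_graphs D" "(H, p) \<in> rooted_graphs D" and iso: "ball_iso \<phi> G r H p (Suc m)"
    and P: "superharmonic_weight q m G r"
  then have G: "connected_graph D G" "r \<in> verts G" and H: "connected_graph D H" "p \<in> verts H"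
    by (auto simp: rooted_graphs_iff)
  obtain w where w: "\<And>v. w v > 0"
    "\<And>v. v \<in> vball G r m \<Longrightarrow> (\<Sum>u | (v, u) \<in> edges G. w u) \<le> q * real (deg (edges G) v) * w v"
    using P unfolding superharmonic_weight_def by blast
  let ?\<psi> = "inv_into (vball G r (Suc m)) \<phi>"
  have inv: "ball_iso ?\<psi> H p G r (Suc m)" by (rule ball_iso_inv[OF iso G(2)])
  show "superharmonic_weight q m H p"
    unfolding superharmonic_weight_def
  proof (intro exI[of _ "\<lambda>x. w (?\<psi> x)"] conjI allI ballI)
    fix v assume v: "v \<in> vball H p m"
    have bij: "bij_betw ?\<psi> {t. (v, t) \<in> edges H} {t. (?\<psi> v, t) \<in> edges G}"
      by (rule ball_iso_nbrs[OF H G inv v])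
    have "?\<psi> v \<in> vball G r m"
      using ball_iso_mem[OF ball_iso_mono[OF H G inv] v] by simp
    then have "(\<Sum>u | (?\<psi> v, u) \<in> edges G. w u) \<le> q * real (deg (edges G) (?\<psi> v)) * w (?\<psi> v)" by (rule w(2))
    moreover have "(\<Sum>u | (v, u) \<in> edges H. w (?\<psi> u)) = (\<Sum>u | (?\<psi> v, u) \<in> edges G. w u)"
      by (rule sum.reindex_bij_betw[OF bij])
    moreover have "deg (edges G) (?\<psi> v) = deg (edges H) v" by (rule ball_iso_deg[OF H G inv v])
    ultimately show "(\<Sum>u | (v, u) \<in> edges H. w (?\<psi> u)) \<le> q * real (deg (edges H) v) * w (?\<psi> v)" by simp
  qed (rule w(1))
qed

lemma local_has_twin: "local_fun D 3 has_twin"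
proof (rule local_fun_if_imp)
  fix G r H p \<phi>
  assume "(G, r) \<in> rooted_graphs D" "(H, p) \<in> rooted_graphs D" and iso3: "ball_iso \<phi> G r H p 3"
    and P: "has_twin G r"
  then have G: "connected_graph D G" "r \<in> verts G" and H: "connected_graph D H" "p \<in> verts H"
    by (auto simp: rooted_graphs_iff)
  have iso: "ball_iso \<phi> G r H p (Suc 2)" using iso3 by (simp add: eval_nat_numeral)
  obtain s where s: "s \<in> vball G r 2" "s \<noteq> r" "{t. (s, t) \<in> edges G} = {t. (r, t) \<in> edges G}"
    using P unfolding has_twin_def by blast
  have b2: "bij_betw \<phi> (vball G r 2) (vball H p 2)" by (rule ball_iso_vball[OF G H iso]) simp
  have r2: "r \<in> vball G r 2" by (rule root_in_vball[OF G(2)])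
  have "\<phi> s \<noteq> \<phi> r" using bij_betw_imp_inj_on[OF b2] s r2 by (auto dest: inj_onD)
  moreover have "\<phi> s \<in> vball H p 2" using b2 s(1) by (rule bij_betw_apply)
  moreover have "{t. (\<phi> s, t) \<in> edges H} = {t. (\<phi> r, t) \<in> edges H}"
    using bij_betw_imp_surj_on[OF ball_iso_nbrs[OF G H iso s(1)]]
      bij_betw_imp_surj_on[OF ball_iso_nbrs[OF G H iso r2]] s(3) by simp
  ultimately show "has_twin H p"
    unfolding has_twin_def ball_iso_root[OF iso, symmetric] by blast
qed

lemma nn_integral_deg_measure:
  assumes "connected_graph D G" "r \<in> verts G"
  shows "(\<integral>\<^sup>+ u. f u \<partial>deg_measure G) = (SUP n. \<Sum>u\<in>vball G r n. of_nat (deg (edges G) u) * f u)"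
proof -
  have "(\<integral>\<^sup>+ u. f u \<partial>deg_measure G) = (\<integral>\<^sup>+ u. of_nat (deg (edges G) u) * f u \<partial>count_space (verts G))"
    unfolding deg_measure_def point_measure_def by (rule nn_integral_density) simp_all
  then show ?thesis unfolding nn_integral_vballs[OF assms] .
qed

lemma measurable_deg_measure: "(f :: nat \<Rightarrow> complex) \<in> borel_measurable (deg_measure G)"
  by (simp add: deg_measure_def measurable_point_measure_eq1)

text \<open>The Schur test: the Cauchy-Schwarz inequality with weights \<open>w\<close> uses the inequality
  for \<open>w\<close> once, and exchanging the sums uses it a second time, at the neighbours.\<close>
lemma markov_ball_bound:
  fixes f :: "nat \<Rightarrow> complex"
  assumes G: "connected_graph D G" "r \<in> verts G" and q: "0 \<le> q" and P: "superharmonic_weight q (Suc m) G r"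
  shows "(\<Sum>u\<in>vball G r m. real (deg (edges G) u) * (cmod (markov (edges G) f u))\<^sup>2) \<le>
    q\<^sup>2 * (\<Sum>v\<in>vball G r (Suc m). real (deg (edges G) v) * (cmod (f v))\<^sup>2)"
proof -
  let ?E = "edges G" and ?d = "\<lambda>u. real (deg (edges G) u)"
  let ?N = "\<lambda>u. {v. (u, v) \<in> ?E}"
  obtain w where w: "\<And>v. w v > 0"
    "\<And>v. v \<in> vball G r (Suc m) \<Longrightarrow> (\<Sum>u\<in>?N v. w u) \<le> q * ?d v * w v"
    using P unfolding superharmonic_weight_def by blast
  have fin: "finite (vball G r n)" for n by (rule finite_vball[OF G(1)])
  have finN: "finite (?N u)" for u by (rule connected_graph_finite_nbrs[OF G(1)])
  have dpos: "?d u > 0" if "u \<in> vball G r n" for u n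
    using connected_graph_deg(1)[OF G(1) subsetD[OF vball_subset_verts that]] by simp
  have Nsub: "?N u \<subseteq> vball G r (Suc m)" if "u \<in> vball G r m" for u
  proof
    fix v assume "v \<in> ?N u"
    then have "v \<in> vball G u (Suc 0)" using nbr_in_vball[OF G(1)] by blast
    then show "v \<in> vball G r (Suc m)" using vball_trans[OF that] by fastforce
  qed
  have one: "?d u * (cmod (markov ?E f u))\<^sup>2 \<le> (\<Sum>v\<in>vball G r (Suc m). if (u, v) \<in> ?E then q * w u * ((cmod (f v))\<^sup>2 / w v) else 0)"
    if u: "u \<in> vball G r m" for u
  proof -
    have d: "?d u > 0" by (rule dpos[OF u])
    have um: "u \<in> vball G r (Suc m)" using subsetD[OF vball_mono u, of "Suc m"] by simp
    have "?d u * (cmod (markov ?E f u))\<^sup>2 = (cmod (\<Sum>v\<in>?N u. f v))\<^sup>2 / ?d u"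
      using d by (simp add: markov_def norm_divide power_divide power2_eq_square norm_mult)
    also have "\<dots> \<le> ((\<Sum>v\<in>?N u. w v) * (\<Sum>v\<in>?N u. (cmod (f v))\<^sup>2 / w v)) / ?d u"
      using w(1) by (intro divide_right_mono norm_sum_square_le) auto
    also have "\<dots> \<le> ((q * ?d u * w u) * (\<Sum>v\<in>?N u. (cmod (f v))\<^sup>2 / w v)) / ?d u"
      using w(2)[OF um] less_imp_le[OF w(1)] by (intro divide_right_mono mult_right_mono sum_nonneg) auto
    also have "\<dots> = q * w u * (\<Sum>v\<in>?N u. (cmod (f v))\<^sup>2 / w v)" using d by simp
    also have "\<dots> = (\<Sum>v\<in>?N u. q * w u * ((cmod (f v))\<^sup>2 / w v))" by (rule sum_distrib_left)
    also have "\<dots> = (\<Sum>v\<in>vball G r (Suc m). if (u, v) \<in> ?E then q * w u * ((cmod (f v))\<^sup>2 / w v) else 0)"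
      using Nsub[OF u] fin by (intro sum.mono_neutral_cong_left) auto
    finally show ?thesis .
  qed
  have "(\<Sum>u\<in>vball G r m. ?d u * (cmod (markov ?E f u))\<^sup>2) \<le>
      (\<Sum>u\<in>vball G r m. \<Sum>v\<in>vball G r (Suc m). if (u, v) \<in> ?E then q * w u * ((cmod (f v))\<^sup>2 / w v) else 0)"
    by (rule sum_mono[OF one])
  also have "\<dots> = (\<Sum>v\<in>vball G r (Suc m). \<Sum>u\<in>vball G r m. if (u, v) \<in> ?E then q * w u * ((cmod (f v))\<^sup>2 / w v) else 0)"
    by (rule sum.swap)
  also have "\<dots> \<le> (\<Sum>v\<in>vball G r (Suc m). q\<^sup>2 * (?d v * (cmod (f v))\<^sup>2))"
  proof (rule sum_mono)
    fix v assume v: "v \<in> vball G r (Suc m)"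
    let ?h = "(cmod (f v))\<^sup>2 / w v"
    have h: "0 \<le> ?h" using w(1)[of v] by simp
    have "(\<Sum>u\<in>vball G r m. if (u, v) \<in> ?E then q * w u * ?h else 0) = (\<Sum>u\<in>vball G r m \<inter> ?N v. q * w u * ?h)"
      using fin connected_graph_edgeD(4)[OF G(1)]
      by (simp add: sum.inter_restrict) (intro sum.cong, auto)
    also have "\<dots> \<le> (\<Sum>u\<in>?N v. q * w u * ?h)"
      using finN q h less_imp_le[OF w(1)] by (intro sum_mono2) auto
    also have "\<dots> = q * ?h * (\<Sum>u\<in>?N v. w u)"
      unfolding sum_distrib_left by (intro sum.cong refl) (simp add: mult_ac)
    also have "\<dots> \<le> q * ?h * (q * ?d v * w v)"
      using w(2)[OF v] mult_nonneg_nonneg[OF q h] by (rule mult_left_mono)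
    also have "\<dots> = q\<^sup>2 * (?d v * (cmod (f v))\<^sup>2)"
      using w(1)[of v] by (simp add: power2_eq_square)
    finally show "(\<Sum>u\<in>vball G r m. if (u, v) \<in> ?E then q * w u * ?h else 0) \<le> q\<^sup>2 * (?d v * (cmod (f v))\<^sup>2)" .
  qed
  finally show ?thesis by (simp add: sum_distrib_left)
qed

lemma markov_L2_bound:
  fixes f :: "nat \<Rightarrow> complex"
  assumes G: "connected_graph D G" "r \<in> verts G" and q: "0 \<le> q" and P: "\<And>m. superharmonic_weight q m G r"
    and f: "f \<in> L2 (deg_measure G)"
  shows "markov (edges G) f \<in> L2 (deg_measure G)"
    "L2_norm (deg_measure G) (markov (edges G) f) \<le> q * L2_norm (deg_measure G) f"
proof -
  let ?M = "deg_measure G" and ?d = "\<lambda>u. real (deg (edges G) u)"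
  have conv: "(\<Sum>u\<in>A. of_nat (deg (edges G) u) * ennreal ((cmod (h u))\<^sup>2)) =
      ennreal (\<Sum>u\<in>A. ?d u * (cmod (h u))\<^sup>2)" for A and h :: "nat \<Rightarrow> complex"
    unfolding ennreal_of_nat_eq_real_of_nat by (simp add: ennreal_mult[symmetric] sum_ennreal)
  have "(\<integral>\<^sup>+ u. ennreal ((cmod (markov (edges G) f u))\<^sup>2) \<partial>?M) \<le> ennreal ((q * L2_norm ?M f)\<^sup>2)"
    unfolding nn_integral_deg_measure[OF G] conv
  proof (rule SUP_least)
    fix m
    have "ennreal (\<Sum>u\<in>vball G r (Suc m). ?d u * (cmod (f u))\<^sup>2) \<le> (SUP n. ennreal (\<Sum>u\<in>vball G r n. ?d u * (cmod (f u))\<^sup>2))"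
      by (rule SUP_upper) simp
    also have "\<dots> = ennreal ((L2_norm ?M f)\<^sup>2)"
      using L2_norm_ennreal[OF f] unfolding nn_integral_deg_measure[OF G] conv by (rule sym)
    finally have "(\<Sum>u\<in>vball G r (Suc m). ?d u * (cmod (f u))\<^sup>2) \<le> (L2_norm ?M f)\<^sup>2"
      by (subst (asm) ennreal_le_iff) simp_all
    then have "q\<^sup>2 * (\<Sum>u\<in>vball G r (Suc m). ?d u * (cmod (f u))\<^sup>2) \<le> q\<^sup>2 * (L2_norm ?M f)\<^sup>2"
      by (rule mult_left_mono) simp
    with markov_ball_bound[OF G q P, where m = m and f = f]
    show "ennreal (\<Sum>u\<in>vball G r m. ?d u * (cmod (markov (edges G) f u))\<^sup>2) \<le> ennreal ((q * L2_norm ?M f)\<^sup>2)"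
      unfolding power_mult_distrib by (intro ennreal_leI) (rule order_trans)
  qed
  from L2_I[OF measurable_deg_measure this mult_nonneg_nonneg[OF q L2_norm_nonneg]]
  show "markov (edges G) f \<in> L2 ?M" "L2_norm ?M (markov (edges G) f) \<le> q * L2_norm ?M f" by auto
qed

text \<open>The spectral radius is the supremum over a set of reals, and a bound for the norm of the
  operator controls it only if the spectrum is nonempty. A twin of the root puts 0 into the
  spectrum.\<close>
theorem rho_graph_less_1:
  assumes G: "connected_graph D G" "r \<in> verts G" and q: "0 \<le> q" "q < 1"
    and P: "\<And>m. superharmonic_weight q m G r" and twin: "has_twin G r"
  shows "rho_graph G < 1"
proof -
  let ?M = "deg_measure G" and ?T = "markov (edges G)"
  interpret complete_seminormed "L2 ?M" "L2_norm ?M" by (rule complete_seminormed_L2)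
  note T = markov_L2_bound[OF G q(1) P]
  let ?\<sigma> = "spectrum_on (L2 ?M) (L2_norm ?M) ?T"
  have le: "cmod z \<le> q" if "z \<in> ?\<sigma>" for z
  proof (rule ccontr)
    assume "\<not> cmod z \<le> q"
    then have "q < cmod z" by simp
    from not_in_spectrum[OF T(1) markov_add markov_scale T(2) q(1) this] zero_in_L2 that show False by blast
  qed
  obtain s where s: "s \<in> vball G r 2" "s \<noteq> r" "{t. (s, t) \<in> edges G} = {t. (r, t) \<in> edges G}"
    using twin unfolding has_twin_def by blast
  define f :: "nat \<Rightarrow> complex" where "f = (\<lambda>u. (if u = r then 1 else 0) - (if u = s then 1 else 0))"
  \<comment> \<open>every vertex is adjacent to both or to none of \<open>r\<close> and \<open>s\<close>\<close>
  have Tf: "?T f u = 0" for u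
  proof -
    have "(u, r) \<in> edges G \<longleftrightarrow> (u, s) \<in> edges G"
      using s(3) connected_graph_edgeD(4)[OF G(1)] by blast
    then have "(\<Sum>v | (u, v) \<in> edges G. f v) = 0"
      unfolding f_def sum_subtractf using connected_graph_finite_nbrs[OF G(1), of u] by simp
    then show ?thesis by (simp add: markov_def)
  qed
  have fL: "f \<in> L2 ?M"
  proof (rule L2_I(1)[OF measurable_deg_measure])
    let ?C = "real (deg (edges G) r) + real (deg (edges G) s)"
    show "(\<integral>\<^sup>+ u. ennreal ((cmod (f u))\<^sup>2) \<partial>?M) \<le> ennreal ((sqrt ?C)\<^sup>2)"
      unfolding nn_integral_deg_measure[OF G]
    proof (rule SUP_least)
      fix n
      have "(\<Sum>u\<in>vball G r n. of_nat (deg (edges G) u) * ennreal ((cmod (f u))\<^sup>2)) =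
          (\<Sum>u\<in>vball G r n \<inter> {r, s}. of_nat (deg (edges G) u))"
        using finite_vball[OF G(1)] s(2) by (intro sum.mono_neutral_cong_right) (auto simp: f_def)
      also have "\<dots> \<le> (\<Sum>u\<in>{r, s}. of_nat (deg (edges G) u))" by (intro sum_mono2) auto
      also have "\<dots> = ennreal ?C"
        unfolding ennreal_of_nat_eq_real_of_nat using s(2) by (simp add: ennreal_plus)
      finally show "(\<Sum>u\<in>vball G r n. of_nat (deg (edges G) u) * ennreal ((cmod (f u))\<^sup>2)) \<le> ennreal ((sqrt ?C)\<^sup>2)"
        by simp
    qed
  qed simp
  have Nf: "L2_norm ?M f > 0"
  proof (rule ccontr)
    assume "\<not> L2_norm ?M f > 0"
    then have "L2_norm ?M f = 0" using L2_norm_nonneg[of ?M f] by simp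
    then have "(SUP n. \<Sum>u\<in>vball G r n. of_nat (deg (edges G) u) * ennreal ((cmod (f u))\<^sup>2)) = 0"
      using L2_norm_ennreal[OF fL] unfolding nn_integral_deg_measure[OF G] by simp
    moreover have "(\<Sum>u\<in>vball G r 0. of_nat (deg (edges G) u) * ennreal ((cmod (f u))\<^sup>2)) \<le>
        (SUP n. \<Sum>u\<in>vball G r n. of_nat (deg (edges G) u) * ennreal ((cmod (f u))\<^sup>2))"
      by (rule SUP_upper) simp
    ultimately have "(\<Sum>u\<in>vball G r 0. of_nat (deg (edges G) u) * ennreal ((cmod (f u))\<^sup>2)) = 0"
      by (simp only: le_zero_eq)
    then have "of_nat (deg (edges G) r) * ennreal ((cmod (f r))\<^sup>2) = 0"
      using finite_vball[OF G(1)] root_in_vball[OF G(2), of 0] by (subst (asm) sum_eq_0_iff) blast+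
    moreover have "cmod (f r) = 1" using s(2) by (simp add: f_def)
    ultimately show False using connected_graph_deg(1)[OF G] by simp
  qed
  have "0 \<in> ?\<sigma>"
  proof (rule in_spectrum_if_approx_eigen[OF T(1)])
    fix \<epsilon> :: real assume "\<epsilon> > 0"
    then have "L2_norm ?M (\<lambda>x. ?T f x - 0 * f x) < \<epsilon> * L2_norm ?M f"
      using Nf unfolding Tf by (simp add: L2_norm_def)
    then show "\<exists>f\<in>L2 ?M. L2_norm ?M (\<lambda>x. ?T f x - 0 * f x) < \<epsilon> * L2_norm ?M f" using fL by blast
  qed
  then have "Sup (cmod ` ?\<sigma>) \<le> q" by (intro cSup_least) (use le in auto)
  then show ?thesis using q(2) by (simp add: rho_graph_def spectral_radius_on_def)
qed

section \<open>Reduced words in four involutions\<close>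

text \<open>Reduced words are the elements of the free product of four groups of order two, whose Cayley
  graph is the regular tree of degree four. Right multiplication by generators gives the edges,
  left multiplication the symmetries.\<close>
definition reduced :: "nat list \<Rightarrow> bool" where
  "reduced t \<longleftrightarrow> set t \<subseteq> {..<4} \<and> distinct_adj t"

definition rmul :: "nat list \<Rightarrow> nat \<Rightarrow> nat list" where
  "rmul t a = (if t \<noteq> [] \<and> last t = a then butlast t else t @ [a])"

definition lmul :: "nat \<Rightarrow> nat list \<Rightarrow> nat list" where
  "lmul a t = (if t \<noteq> [] \<and> hd t = a then tl t else a # t)"

lemma reduced_snoc: "reduced (t @ [a]) \<longleftrightarrow> reduced t \<and> a < 4 \<and> (t = [] \<or> last t \<noteq> a)"
  by (auto simp: reduced_def distinct_adj_append_iff)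

lemma reduced_Cons: "reduced (a # t) \<longleftrightarrow> reduced t \<and> a < 4 \<and> (t = [] \<or> hd t \<noteq> a)"
  by (auto simp: reduced_def distinct_adj_Cons)

lemma reduced_Nil [simp]: "reduced []"
  by (simp add: reduced_def)

lemma rmul_snoc: "rmul (t @ [b]) a = (if b = a then t else t @ [b, a])"
  by (simp add: rmul_def)

lemma rmul_Nil: "rmul [] a = [a]"
  by (simp add: rmul_def)

lemma rmul_Cons: "t \<noteq> [] \<Longrightarrow> rmul (c # t) a = c # rmul t a"
  by (simp add: rmul_def)

lemma lmul_Cons: "lmul a (c # t) = (if c = a then t else a # c # t)"
  by (simp add: lmul_def)

lemma lmul_Nil: "lmul a [] = [a]"
  by (simp add: lmul_def)

lemma reduced_snoc2: "reduced (t @ [b, a]) \<longleftrightarrow> reduced (t @ [b]) \<and> a < 4 \<and> b \<noteq> a"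
  using reduced_snoc[of "t @ [b]" a] by simp

lemma reduced_rmul:
  assumes "reduced t" "a < 4"
  shows "reduced (rmul t a)"
proof (cases t rule: rev_cases)
  case Nil then show ?thesis using assms(2) by (simp add: rmul_Nil reduced_Cons)
next
  case (snoc u b)
  then have "reduced (u @ [b])" "reduced u" using assms(1) by (simp_all add: reduced_snoc)
  then show ?thesis unfolding snoc rmul_snoc using assms(2) by (simp add: reduced_snoc2)
qed

lemma rmul_rmul:
  assumes "reduced t"
  shows "rmul (rmul t a) a = t"
proof (cases t rule: rev_cases)
  case Nil then show ?thesis by (simp add: rmul_def)
next
  case (snoc u b)
  then have "u = [] \<or> last u \<noteq> b" using assms by (simp add: reduced_snoc)
  then show ?thesis
    unfolding snoc rmul_snoc by (auto simp: rmul_def butlast_append)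
qed

lemma rmul_neq: "rmul t a \<noteq> t"
  by (cases t rule: rev_cases) (auto simp: rmul_def dest: arg_cong[of _ _ length])

lemma rmul_inj: "rmul t a = rmul t b \<Longrightarrow> a = b"
  by (cases t rule: rev_cases) (auto simp: rmul_snoc rmul_Nil split: if_splits)

lemma reduced_lmul: "reduced t \<Longrightarrow> a < 4 \<Longrightarrow> reduced (lmul a t)"
  by (cases t) (auto simp: lmul_Cons lmul_Nil reduced_Cons)

lemma lmul_lmul: "reduced t \<Longrightarrow> lmul a (lmul a t) = t"
  by (cases t) (auto simp: lmul_def reduced_Cons)

lemma lmul_rmul: "lmul a (rmul t b) = rmul (lmul a t) b"
proof (cases t)
  case Nil then show ?thesis by (auto simp: rmul_Nil lmul_Nil lmul_Cons rmul_def)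
next
  case (Cons c u)
  show ?thesis
  proof (cases "u = []")
    case True then show ?thesis using Cons by (auto simp: rmul_def lmul_def)
  next
    case False
    then show ?thesis using Cons by (auto simp: rmul_Cons lmul_Cons)
  qed
qed

lemma reduced_set: "reduced t \<Longrightarrow> set t \<subseteq> {..<4}"
  by (simp add: reduced_def)

lemma reduced_fold: "set s \<subseteq> {..<4} \<Longrightarrow> reduced t \<Longrightarrow> reduced (fold lmul s t)"
  by (induction s arbitrary: t) (auto simp: reduced_lmul)

lemma fold_rmul: "fold lmul s (rmul t a) = rmul (fold lmul s t) a"
  by (induction s arbitrary: t) (auto simp: lmul_rmul)

text \<open>Folding \<open>lmul\<close> over \<open>s\<close> is left multiplication by the inverse of
  \<open>s\<close>, the reversed word.\<close>
lemma fold_rev_cancel: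
  assumes "set s \<subseteq> {..<4}" "reduced t"
  shows "fold lmul (rev s) (fold lmul s t) = t"
  using assms
proof (induction s arbitrary: t)
  case (Cons a s)
  then have "fold lmul (rev s) (fold lmul s (lmul a t)) = lmul a t" by (simp add: reduced_lmul)
  then show ?case using Cons by (simp add: lmul_lmul)
qed simp

lemma fold_self: "reduced s \<Longrightarrow> fold lmul s s = []"
  by (induction s) (auto simp: lmul_Cons reduced_Cons)

lemma fold_Nil: "reduced (rev u @ s) \<Longrightarrow> fold lmul s u = rev s @ u"
proof (induction s arbitrary: u)
  case (Cons a s)
  have "lmul a u = a # u"
  proof (cases u)
    case (Cons c v)
    then have "distinct_adj ((rev v @ [c]) @ a # s)" using Cons.prems by (simp add: reduced_def)
    then have "c \<noteq> a" by (subst (asm) distinct_adj_append_iff) simp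
    then show ?thesis using Cons by (simp add: lmul_Cons)
  qed (simp add: lmul_Nil)
  moreover have "reduced (rev (a # u) @ s)" using Cons.prems by simp
  ultimately show ?case using Cons.IH[of "a # u"] by simp
qed simp

lemma reduced_rev: "reduced (rev t) = reduced t"
  by (simp add: reduced_def distinct_adj_rev)

lemma fold_lmul_inj:
  assumes "set s \<subseteq> {..<4}" "reduced t" "reduced t'" "fold lmul s t = fold lmul s t'"
  shows "t = t'"
proof -
  have "t = fold lmul (rev s) (fold lmul s t)" by (rule fold_rev_cancel[OF assms(1,2), symmetric])
  also have "\<dots> = t'" unfolding assms(4) by (rule fold_rev_cancel[OF assms(1,3)])
  finally show ?thesis .
qed

section \<open>The canopy tree of bit sequences\<close>

type_synonym bits = "nat \<Rightarrow> bool"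

text \<open>Finite sets of positions act on bit sequences by flips. For a given sequence, its orbit is thus
  parametrised by finite sets.\<close>
definition act :: "nat set \<Rightarrow> bits \<Rightarrow> bits" where
  "act d x = (\<lambda>i. x i \<noteq> (i \<in> d))"

definition first :: "bits \<Rightarrow> nat \<Rightarrow> bool" where
  "first y k \<longleftrightarrow> y k \<and> (\<forall>j<k. \<not> y j)"

text \<open>A sequence \<open>0 ... 0 1 b z\<close> has the parent \<open>0 ... 0 0 1 z\<close>. The zero
  sequence has no first one; it is sent to \<open>1 0 0 ...\<close>, which keeps the graph
  connected for every \<open>x\<close>.\<close>
definition par :: "bits \<Rightarrow> bits" where
  "par y = (\<lambda>i. (\<exists>k<i. first y k \<and> (i = Suc k \<or> y i)) \<or> ((\<forall>j. \<not> y j) \<and> i = 0))"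

text \<open>The bit that the parent forgets.\<close>
definition mark :: "bits \<Rightarrow> bool" where
  "mark y \<longleftrightarrow> (\<exists>k. first y k \<and> y (Suc k))"

text \<open>The mark is made visible in the graph by a fourth generator.\<close>
definition gens :: "bits \<Rightarrow> nat" where
  "gens y = (if mark y then 4 else 3)"

lemma first_unique: "first y k \<Longrightarrow> first y l \<Longrightarrow> k = l"
  unfolding first_def by (metis linorder_neqE_nat)

lemma first_exists: "y i \<Longrightarrow> \<exists>k\<le>i. first y k"
  by (intro exI[of _ "LEAST j. y j"]) (auto simp: first_def intro: LeastI Least_le dest: not_less_Least)

lemma par_first: "first y k \<Longrightarrow> par y i \<longleftrightarrow> i = Suc k \<or> (i > Suc k \<and> y i)"
proof -
  assume k: "first y k"
  then have "\<not> (\<forall>j. \<not> y j)" by (auto simp: first_def)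
  then have "par y i \<longleftrightarrow> (\<exists>l<i. first y l \<and> (i = Suc l \<or> y i))"
    unfolding par_def by blast
  also have "\<dots> \<longleftrightarrow> k < i \<and> (i = Suc k \<or> y i)" using k first_unique by blast
  finally show ?thesis by (cases "i = Suc k") auto
qed

lemma par_zero: "(\<And>j. \<not> y j) \<Longrightarrow> par y = (\<lambda>i. i = 0)"
  by (auto simp: par_def first_def)

lemma first_par: "first y k \<Longrightarrow> first (par y) (Suc k)"
  by (auto simp: first_def[of "par y"] par_first)

lemma par_neq: "par y \<noteq> y"
proof (cases "\<exists>k. first y k")
  case True
  then obtain k where k: "first y k" by blast
  show ?thesis
  proof
    assume "par y = y"
    then have "first y (Suc k)" using first_par[OF k] by simp
    then show False using first_unique[OF k, of "Suc k"] by simp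
  qed
next
  case False
  then have "\<not> y j" for j using first_exists by blast
  then show ?thesis using par_zero[of y] by (auto simp: fun_eq_iff)
qed

lemma finite_par_diff: "finite {i. par y i \<noteq> y i}"
proof (cases "\<exists>k. first y k")
  case True
  then obtain k where k: "first y k" by blast
  have "{i. par y i \<noteq> y i} \<subseteq> {..Suc k}"
    by (auto simp: par_first[OF k] not_le dest: leI)
  then show ?thesis by (rule finite_subset) simp
next
  case False
  then have "\<not> y j" for j using first_exists by blast
  then have "{i. par y i \<noteq> y i} \<subseteq> {0}" using par_zero[of y] by auto
  then show ?thesis by (rule finite_subset) simp
qed

definition child :: "bits \<Rightarrow> nat \<Rightarrow> bool \<Rightarrow> bits" where
  "child y k b = (\<lambda>i. if i \<le> k then i = k else if i = Suc k then b else y i)"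

lemma first_child: "first (child y k b) k"
  by (simp add: first_def child_def)

lemma par_child: "first y (Suc k) \<Longrightarrow> par (child y k b) = y"
proof
  fix i assume "first y (Suc k)"
  then show "par (child y k b) i = y i"
    using par_first[OF first_child, of y k b i] by (cases i "Suc k" rule: linorder_cases) (auto simp: child_def first_def)
qed

text \<open>Apart from the two children, only the zero sequence can have a given parent.\<close>
lemma par_eq_cases:
  assumes "par y' = y"
  shows "(\<exists>k. first y' k \<and> first y (Suc k) \<and> y' = child y k (y' (Suc k))) \<or> (\<forall>j. \<not> y' j)"
proof (cases "\<exists>k. first y' k")
  case True
  then obtain k where k: "first y' k" by blast
  have "y' i = child y k (y' (Suc k)) i" for i
  proof (cases i "Suc k" rule: linorder_cases)
    case less
    then show ?thesis using k by (cases "i = k") (auto simp: child_def first_def)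
  next
    case greater
    then show ?thesis using par_first[OF k, of i] assms by (auto simp: child_def)
  qed (simp add: child_def)
  then show ?thesis using k first_par[OF k] assms by blast
next
  case False
  then show ?thesis using first_exists by blast
qed

lemma card_le_3: "card {a, b, c} \<le> 3"
  by (auto simp: card_insert_if)

lemma finite_children: "finite {y'. par y' = y}" "card {y'. par y' = y} \<le> 3"
proof -
  have sub: "\<exists>S. {y'. par y' = y} \<subseteq> S \<and> finite S \<and> card S \<le> 3"
  proof (cases "\<exists>k. first y (Suc k)")
    case True
    then obtain k where k: "first y (Suc k)" by blast
    have "{y'. par y' = y} \<subseteq> {child y k True, child y k False, \<lambda>_. False}"
    proof
      fix y' assume "y' \<in> {y'. par y' = y}"
      then consider l where "first y (Suc l)" "y' = child y l (y' (Suc l))" | "\<forall>j. \<not> y' j"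
        using par_eq_cases by blast
      then show "y' \<in> {child y k True, child y k False, \<lambda>_. False}"
      proof cases
        case 1
        then have "l = k" using first_unique[OF k, of "Suc l"] by simp
        then show ?thesis using 1(2) by (cases "y' (Suc l)") auto
      qed auto
    qed
    moreover have "card {child y k True, child y k False, \<lambda>_. False} \<le> 3"
      using card_le_3[of "child y k True" "child y k False" "\<lambda>_. False"] .
    ultimately show ?thesis by blast
  next
    case False
    then have "{y'. par y' = y} \<subseteq> {\<lambda>_. False}" using par_eq_cases by blast
    then show ?thesis by (intro exI[of _ "{\<lambda>_. False}"]) auto
  qed
  then show "finite {y'. par y' = y}" "card {y'. par y' = y} \<le> 3"
    using finite_subset card_mono order_trans by metis+
qed

lemma act_act: "act ((d - e) \<union> (e - d)) (act e x) = act d x"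
  by (auto simp: act_def fun_eq_iff)

lemma act_inj: "act d x = act d' x \<longleftrightarrow> d = d'"
  by (auto simp: act_def fun_eq_iff)

lemma act_empty [simp]: "act {} x = x"
  by (simp add: act_def)

lemma act_diff: "act {i. y i \<noteq> x i} x = y"
  by (auto simp: act_def)

lemma finite_act_diff:
  assumes "finite d" "finite {i. y i \<noteq> act d x i}"
  shows "finite {i. y i \<noteq> x i}"
proof (rule finite_subset)
  show "{i. y i \<noteq> x i} \<subseteq> d \<union> {i. y i \<noteq> act d x i}" by (auto simp: act_def)
qed (use assms in simp)

section \<open>Adjacency\<close>

text \<open>The flips that lead from \<open>x\<close> to the sequence of a vertex are recorded rather than
  the sequence itself, so that the set of vertices is the same for all \<open>x\<close>.\<close>
type_synonym vtx = "nat list \<times> nat set \<times> bool"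

definition carrier :: "vtx set" where
  "carrier = {(t, d, i). reduced t \<and> finite d}"

definition seq_nbrs :: "bits \<Rightarrow> nat set \<Rightarrow> nat set set" where
  "seq_nbrs x d = {d'. act d' x = par (act d x) \<or> act d x = par (act d' x)}"

text \<open>The copy numbers \<open>i\<close> and \<open>j\<close> do not occur on the right-hand side, so
  the two copies of a vertex are twins.\<close>
definition adj :: "bits \<Rightarrow> vtx \<Rightarrow> vtx \<Rightarrow> bool" where
  "adj x = (\<lambda>(t, d, i) (t', d', j). (d = d' \<and> (\<exists>a<gens (act d x). t' = rmul t a)) \<or> (t = t' \<and> d' \<in> seq_nbrs x d))"

lemma gens_le: "gens y \<le> 4" "3 \<le> gens y"
  by (auto simp: gens_def)

lemma seq_nbrs_sym: "d' \<in> seq_nbrs x d \<longleftrightarrow> d \<in> seq_nbrs x d'"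
  by (auto simp: seq_nbrs_def)

lemma act_diff_set: "{i. act d x i \<noteq> x i} = d"
  by (auto simp: act_def)

lemma finite_of_par:
  assumes "finite d" "act d' x = par (act d x)"
  shows "finite d'"
proof -
  have "finite {i. act d' x i \<noteq> act d x i}" unfolding assms(2) by (rule finite_par_diff)
  from finite_act_diff[OF assms(1) this] show ?thesis unfolding act_diff_set .
qed

lemma finite_to_par:
  assumes "finite d" "act d x = par (act d' x)"
  shows "finite d'"
proof -
  have eq: "{i. act d' x i \<noteq> act d x i} = {i. par (act d' x) i \<noteq> act d' x i}" unfolding assms(2) by auto
  have "finite {i. act d' x i \<noteq> act d x i}" unfolding eq by (rule finite_par_diff)
  from finite_act_diff[OF assms(1) this] show ?thesis unfolding act_diff_set .
qed

lemma seq_nbrs_finite_elem: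
  assumes "finite d" "d' \<in> seq_nbrs x d"
  shows "finite d'"
proof -
  have "act d' x = par (act d x) \<or> act d x = par (act d' x)" using assms(2) by (simp add: seq_nbrs_def)
  then show ?thesis using finite_of_par[OF assms(1)] finite_to_par[OF assms(1)] by blast
qed

lemma adj_iff:
  "adj x (t, d, i) (t', d', j) \<longleftrightarrow> d = d' \<and> (\<exists>a<gens (act d x). t' = rmul t a) \<or> t = t' \<and> d' \<in> seq_nbrs x d"
  by (simp add: adj_def)

lemma adj_carrier:
  assumes "u \<in> carrier" "adj x u w"
  shows "w \<in> carrier"
proof -
  obtain t d i where u: "u = (t, d, i)" by (cases u)
  obtain t' d' j where w: "w = (t', d', j)" by (cases w)
  have td: "reduced t" "finite d" using assms(1) by (simp_all add: u carrier_def)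
  consider a where "d = d'" "a < gens (act d x)" "t' = rmul t a" | "t = t'" "d' \<in> seq_nbrs x d"
    using assms(2) unfolding u w adj_iff by blast
  then show ?thesis
  proof cases
    case 1
    then have "a < 4" using gens_le(1)[of "act d x"] by simp
    then show ?thesis using reduced_rmul[OF td(1)] 1 td(2) by (simp add: w carrier_def)
  next
    case 2
    then show ?thesis using seq_nbrs_finite_elem[OF td(2)] td(1) by (simp add: w carrier_def)
  qed
qed

lemma adj_sym:
  assumes "u \<in> carrier" "adj x u w"
  shows "adj x w u"
proof -
  obtain t d i where u: "u = (t, d, i)" by (cases u)
  obtain t' d' j where w: "w = (t', d', j)" by (cases w)
  have t: "reduced t" using assms(1) by (simp add: u carrier_def)
  consider a where "d = d'" "a < gens (act d x)" "t' = rmul t a" | "t = t'" "d' \<in> seq_nbrs x d"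
    using assms(2) unfolding u w adj_iff by blast
  then show ?thesis
  proof cases
    case 1
    then have "t = rmul t' a" using rmul_rmul[OF t] by simp
    then show ?thesis using 1 unfolding u w adj_iff by blast
  next
    case 2
    then have "d \<in> seq_nbrs x d'" by (subst seq_nbrs_sym)
    then show ?thesis using 2(1) unfolding u w adj_iff by blast
  qed
qed

lemma adj_irrefl: "\<not> adj x u u"
proof -
  have "d \<notin> seq_nbrs x d" for d using par_neq[of "act d x"] by (auto simp: seq_nbrs_def dest: sym)
  then show ?thesis using rmul_neq[symmetric] by (cases u) (simp add: adj_iff)
qed

lemma card_seq_nbrs: "finite (seq_nbrs x d)" "card (seq_nbrs x d) \<le> 4"
proof -
  have im: "(\<lambda>d'. act d' x) ` seq_nbrs x d \<subseteq> insert (par (act d x)) {y'. par y' = act d x}"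
    by (auto simp: seq_nbrs_def)
  have inj: "inj_on (\<lambda>d'. act d' x) (seq_nbrs x d)" by (simp add: inj_on_def act_inj)
  have fin: "finite (insert (par (act d x)) {y'. par y' = act d x})" using finite_children by simp
  show "finite (seq_nbrs x d)" using finite_imageD[OF finite_subset[OF im fin] inj] .
  have "card (seq_nbrs x d) = card ((\<lambda>d'. act d' x) ` seq_nbrs x d)" using card_image[OF inj] by simp
  also have "\<dots> \<le> card (insert (par (act d x)) {y'. par y' = act d x})" by (rule card_mono[OF fin im])
  also have "\<dots> \<le> Suc (card {y'. par y' = act d x})" by (rule card_insert_le_m1) simp_all
  also have "\<dots> \<le> 4" using finite_children(2)[of "act d x"] by simp
  finally show "card (seq_nbrs x d) \<le> 4" .
qed

lemma adj_set:
  "{w. adj x (t, d, i) w} = (\<lambda>(a, j). (rmul t a, d, j)) ` ({..<gens (act d x)} \<times> UNIV) \<union>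
     (\<lambda>(d', j). (t, d', j)) ` (seq_nbrs x d \<times> UNIV)"
  by (auto simp: adj_def image_iff)

lemma sum_adj:
  fixes f :: "nat list \<Rightarrow> nat set \<Rightarrow> real"
  shows "(\<Sum>w | adj x (t, d, i) w. case w of (t', d', j) \<Rightarrow> f t' d') =
    2 * ((\<Sum>a<gens (act d x). f (rmul t a) d) + (\<Sum>d'\<in>seq_nbrs x d. f t d'))"
proof -
  let ?g = "\<lambda>w :: vtx. case w of (t', d', j) \<Rightarrow> f t' d'"
  let ?A = "(\<lambda>(a, j). (rmul t a, d, j)) ` ({..<gens (act d x)} \<times> (UNIV :: bool set))"
  let ?B = "(\<lambda>(d', j). (t, d', j)) ` (seq_nbrs x d \<times> (UNIV :: bool set))"
  have "(\<Sum>w | adj x (t, d, i) w. ?g w) = sum ?g ?A + sum ?g ?B"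
    unfolding adj_set using card_seq_nbrs(1)[of x d] rmul_neq
    by (intro sum.union_disjoint) auto
  also have "sum ?g ?A = (\<Sum>(a, j)\<in>{..<gens (act d x)} \<times> (UNIV :: bool set). f (rmul t a) d)"
    by (subst sum.reindex) (auto simp: inj_on_def rmul_inj intro!: sum.cong)
  also have "\<dots> = 2 * (\<Sum>a<gens (act d x). f (rmul t a) d)"
    by (simp add: sum.cartesian_product[symmetric] UNIV_bool sum_distrib_left)
  also have "sum ?g ?B = (\<Sum>(d', j)\<in>seq_nbrs x d \<times> (UNIV :: bool set). f t d')"
    by (subst sum.reindex) (auto simp: inj_on_def intro!: sum.cong)
  also have "\<dots> = 2 * (\<Sum>d'\<in>seq_nbrs x d. f t d')"
    by (simp add: sum.cartesian_product[symmetric] UNIV_bool sum_distrib_left)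
  finally show ?thesis by simp
qed

lemma finite_adj: "finite {w. adj x u w}"
proof -
  obtain t d i where "u = (t, d, i)" by (cases u)
  then show ?thesis using card_seq_nbrs(1)[of x d] by (simp add: adj_set)
qed

lemma card_adj: "card {w. adj x (t, d, i) w} = 2 * (gens (act d x) + card (seq_nbrs x d))"
proof -
  have "real (card {w. adj x (t, d, i) w}) = real (2 * (gens (act d x) + card (seq_nbrs x d)))"
    using sum_adj[where f = "\<lambda>_ _. 1" and x = x and t = t and d = d and i = i] by simp
  then show ?thesis by (simp only: of_nat_eq_iff)
qed

definition wt :: "nat list \<Rightarrow> real" where
  "wt t = (3 / 5) ^ length t"

lemma wt_rmul_snoc: "wt (rmul (t @ [b]) a) = (if b = a then 5 / 3 else 3 / 5) * wt (t @ [b])"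
  by (simp add: rmul_snoc wt_def)

text \<open>With \<open>g\<close> generators, at most one neighbour of a word is shorter and the others are
  longer, so the average weight is at most \<open>(5/3 + 3/5 (g - 1)) / g\<close> times the
  weight of the word. This is \<open>43/45\<close> for \<open>g = 3\<close> and
  \<open>13/15\<close> for \<open>g = 4\<close>.\<close>
lemma sum_wt_rmul: "(\<Sum>a<gens y. wt (rmul t a)) \<le> 43 / 45 * real (gens y) * wt t"
proof -
  have pos: "wt t \<ge> 0" by (simp add: wt_def)
  have four: "{..<4 :: nat} = {0, 1, 2, 3}" "{..<3 :: nat} = {0, 1, 2}" by auto
  show ?thesis
  proof (cases t rule: rev_cases)
    case Nil
    then show ?thesis by (auto simp: gens_def four rmul_Nil wt_def)
  next
    case (snoc u b)
    show ?thesis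
      using pos unfolding snoc wt_rmul_snoc gens_def four sum_distrib_right[symmetric]
      by (auto simp: four intro!: mult_right_mono)
  qed
qed

text \<open>The gain \<open>43/45\<close> applies to at least three generators and there are at most four
  moves without gain, which gives \<open>59/60\<close> overall.\<close>
lemma sum_adj_wt:
  "(\<Sum>w | adj x (t, d, i) w. wt (fst w)) \<le> 59 / 60 * real (card {w. adj x (t, d, i) w}) * wt t"
proof -
  let ?g = "gens (act d x)" and ?c = "card (seq_nbrs x d)"
  have pos: "wt t \<ge> 0" by (simp add: wt_def)
  have "(\<Sum>w | adj x (t, d, i) w. wt (fst w)) = (\<Sum>w | adj x (t, d, i) w. case w of (t', d', j) \<Rightarrow> wt t')"
    by (intro sum.cong) auto
  also have "\<dots> = 2 * ((\<Sum>a<?g. wt (rmul t a)) + real ?c * wt t)" by (subst sum_adj) simp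
  also have "\<dots> \<le> 2 * (43 / 45 * real ?g * wt t + real ?c * wt t)"
    by (intro mult_left_mono add_right_mono sum_wt_rmul) simp
  also have "\<dots> = (2 * (43 / 45 * real ?g + real ?c)) * wt t" by (simp add: algebra_simps)
  also have "\<dots> \<le> (59 / 60 * real (2 * (?g + ?c))) * wt t"
    using card_seq_nbrs(2)[of x d] gens_le(2)[of "act d x"] pos by (intro mult_right_mono) simp_all
  finally show ?thesis unfolding card_adj .
qed

section \<open>Symmetries\<close>

text \<open>The vertices as seen from \<open>v = (s, e, b)\<close>: words are multiplied by the inverse of
  \<open>s\<close> from the left, and flips are counted relative to the sequence at
  \<open>v\<close>.\<close>
definition shift :: "vtx \<Rightarrow> vtx \<Rightarrow> vtx" where
  "shift = (\<lambda>(s, e, b) (t, d, i). (fold lmul s t, (d - e) \<union> (e - d), i \<noteq> b))"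

lemma shift_carrier: "v \<in> carrier \<Longrightarrow> u \<in> carrier \<Longrightarrow> shift v u \<in> carrier"
  using reduced_fold reduced_set by (auto simp: shift_def carrier_def)

lemma sdiff_cancel: "((d - e) \<union> (e - d) - e) \<union> (e - ((d - e) \<union> (e - d))) = d"
  by auto

lemma shift_bij:
  assumes "v \<in> carrier"
  shows "bij_betw (shift v) carrier carrier"
proof -
  obtain s e b where v: "v = (s, e, b)" by (cases v)
  have s: "reduced s" "set s \<subseteq> {..<4}" "finite e" using assms reduced_set by (auto simp: v carrier_def)
  have v': "(rev s, e, b) \<in> carrier" using s by (simp add: carrier_def reduced_rev)
  show ?thesis
  proof (rule bij_betw_byWitness[where f' = "shift (rev s, e, b)"])
    show "\<forall>u\<in>carrier. shift (rev s, e, b) (shift v u) = u"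
      using fold_rev_cancel[OF s(2)] sdiff_cancel by (auto simp: v shift_def carrier_def)
    show "\<forall>u\<in>carrier. shift v (shift (rev s, e, b) u) = u"
      using fold_rev_cancel[of "rev s"] s(2) sdiff_cancel by (auto simp: v shift_def carrier_def)
  qed (use shift_carrier[OF assms] shift_carrier[OF v'] in auto)
qed

lemma shift_self: "v \<in> carrier \<Longrightarrow> shift v v = ([], {}, False)"
  by (auto simp: shift_def carrier_def fold_self)

text \<open>The position of the old origin as seen from \<open>v\<close>.\<close>
definition vinv :: "vtx \<Rightarrow> vtx" where
  "vinv = (\<lambda>(s, e, b). (rev s, e, b))"

lemma shift_origin: "v \<in> carrier \<Longrightarrow> shift v ([], {}, False) = vinv v"
  using fold_Nil[of "[]"] by (auto simp: shift_def carrier_def vinv_def)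

lemma vinv_bij: "bij_betw vinv carrier carrier"
  by (rule bij_betw_byWitness[where f' = vinv]) (auto simp: vinv_def carrier_def reduced_rev)

lemma seq_nbrs_shift:
  "(d' - e) \<union> (e - d') \<in> seq_nbrs (act e x) ((d - e) \<union> (e - d)) \<longleftrightarrow> d' \<in> seq_nbrs x d"
  by (simp add: seq_nbrs_def act_act)

lemma sdiff_inj: "(d - e) \<union> (e - d) = (d' - e) \<union> (e - d') \<longleftrightarrow> d = d'"
  by auto

text \<open>Left multiplication commutes with right multiplication, and the flips in \<open>e\<close> are
  transferred from the vertices to the sequence.\<close>
lemma adj_shift:
  assumes "v \<in> carrier" "u \<in> carrier" "w \<in> carrier"
  shows "adj (act (fst (snd v)) x) (shift v u) (shift v w) \<longleftrightarrow> adj x u w"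
proof -
  obtain s e b where v: "v = (s, e, b)" by (cases v)
  obtain t d i where u: "u = (t, d, i)" by (cases u)
  obtain t' d' j where w: "w = (t', d', j)" by (cases w)
  have s: "set s \<subseteq> {..<4}" and t: "reduced t" "reduced t'"
    using assms reduced_set by (auto simp: u v w carrier_def)
  have r: "reduced (rmul t a)" if "a < gens (act d x)" for a
    using reduced_rmul[OF t(1)] that gens_le(1)[of "act d x"] by simp
  have 1: "(\<exists>a<gens (act d x). fold lmul s t' = rmul (fold lmul s t) a) \<longleftrightarrow> (\<exists>a<gens (act d x). t' = rmul t a)"
    unfolding fold_rmul[symmetric] using fold_lmul_inj[OF s t(2) r] by metis
  have 2: "fold lmul s t = fold lmul s t' \<longleftrightarrow> t = t'" using fold_lmul_inj[OF s t] by blast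
  show ?thesis
    unfolding u v w adj_def shift_def by (simp add: act_act seq_nbrs_shift sdiff_inj 1 2)
qed

section \<open>Connectivity\<close>

definition arel :: "bits \<Rightarrow> vtx rel" where
  "arel x = {(u, w). u \<in> carrier \<and> w \<in> carrier \<and> adj x u w}"

lemma arel_sym: "(u, w) \<in> (arel x)\<^sup>* \<Longrightarrow> (w, u) \<in> (arel x)\<^sup>*"
proof -
  have "sym (arel x)" using adj_sym by (auto simp: arel_def sym_def)
  then show "(u, w) \<in> (arel x)\<^sup>* \<Longrightarrow> (w, u) \<in> (arel x)\<^sup>*" by (metis sym_rtrancl symD)
qed

lemma par_step:
  assumes "reduced t" "finite d" "act d' x = par (act d x)"
  shows "((t, d, i), (t, d', j)) \<in> arel x"
  using assms finite_of_par[OF assms(2,3)] by (simp add: arel_def carrier_def adj_def seq_nbrs_def)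

lemma par_path:
  assumes t: "reduced t" and d: "finite d"
  shows "\<exists>d'. finite d' \<and> act d' x = (par ^^ m) (act d x) \<and> ((t, d, i), (t, d', i)) \<in> (arel x)\<^sup>*"
proof (induction m)
  case 0 show ?case using d by (intro exI[of _ d]) simp
next
  case (Suc m)
  then obtain d' where d': "finite d'" "act d' x = (par ^^ m) (act d x)" "((t, d, i), (t, d', i)) \<in> (arel x)\<^sup>*" by blast
  let ?d = "{k. par (act d' x) k \<noteq> x k}"
  have "finite ?d" by (rule finite_act_diff[OF d'(1) finite_par_diff])
  moreover have eq: "act ?d x = par (act d' x)" by (rule act_diff)
  moreover have "((t, d, i), (t, ?d, i)) \<in> (arel x)\<^sup>*"
    using d'(3) par_step[OF t d'(1) eq] by (rule rtrancl_into_rtrancl)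
  ultimately show ?case using d'(2) by (intro exI[of _ ?d]) simp
qed

lemma par_pow: "first y k \<Longrightarrow> (par ^^ m) y = (\<lambda>i. i = k + m \<or> (i > k + m \<and> y i))"
proof (induction m)
  case 0
  then show ?case by (auto simp: first_def fun_eq_iff not_less_iff_gr_or_eq)
next
  case (Suc m)
  let ?z = "(par ^^ m) y"
  have z: "?z = (\<lambda>i. i = k + m \<or> (i > k + m \<and> y i))" using Suc by simp
  then have f: "first ?z (k + m)" by (simp add: first_def)
  show ?case
  proof
    fix i
    have "(par ^^ Suc m) y i \<longleftrightarrow> i = Suc (k + m) \<or> (i > Suc (k + m) \<and> ?z i)"
      using par_first[OF f, of i] by simp
    also have "?z i \<longleftrightarrow> i = k + m \<or> (i > k + m \<and> y i)" using fun_cong[OF z] .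
    finally show "(par ^^ Suc m) y i = (i = k + Suc m \<or> (i > k + Suc m \<and> y i))" by auto
  qed
qed

text \<open>Two sequences in one orbit agree beyond some position and therefore have a common ancestor.\<close>
lemma connect_nonzero:
  assumes t: "reduced t" and d: "finite d" "finite d'"
    and k: "first (act d x) k" and k': "first (act d' x) k'"
  shows "((t, d, i), (t, d', i)) \<in> (arel x)\<^sup>*"
proof -
  obtain n where n: "\<And>j. j \<in> d \<union> d' \<Longrightarrow> j < n" using d by (meson finite_UnI finite_nat_set_iff_bounded)
  define N where "N = Max {n, k, k'}"
  have N: "n \<le> N" "k \<le> N" "k' \<le> N" by (auto simp: N_def)
  obtain e where e: "act e x = (par ^^ (N - k)) (act d x)" "((t, d, i), (t, e, i)) \<in> (arel x)\<^sup>*"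
    using par_path[OF t d(1)] by blast
  obtain e' where e': "act e' x = (par ^^ (N - k')) (act d' x)" "((t, d', i), (t, e', i)) \<in> (arel x)\<^sup>*"
    using par_path[OF t d(2)] by blast
  have "act d x j = act d' x j" if "j > N" for j
    using n[of j] N(1) that by (auto simp: act_def)
  then have "act e x = act e' x"
    unfolding e(1) e'(1) par_pow[OF k] par_pow[OF k'] using N by (auto simp: fun_eq_iff)
  then have "e = e'" by (simp add: act_inj)
  then show ?thesis using rtrancl_trans[OF e(2) arel_sym] e'(2) by blast
qed

text \<open>One step to the parent leaves the zero sequence, if necessary.\<close>
lemma connect_seq:
  assumes t: "reduced t" and d: "finite d" "finite d'"
  shows "((t, d, i), (t, d', i)) \<in> (arel x)\<^sup>*"
proof -
  have up: "\<exists>e k. finite e \<and> first (act e x) k \<and> ((t, d, i), (t, e, i)) \<in> (arel x)\<^sup>*" if d: "finite d" for d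
  proof -
    obtain e where e: "finite e" "act e x = par (act d x)" "((t, d, i), (t, e, i)) \<in> (arel x)\<^sup>*"
      using par_path[OF t d, of x 1 i] by auto
    have "\<exists>k. first (par (act d x)) k"
    proof (cases "\<exists>k. first (act d x) k")
      case True then show ?thesis using first_par by blast
    next
      case False
      then have "\<not> act d x j" for j using first_exists by blast
      then have "par (act d x) = (\<lambda>i. i = 0)" by (rule par_zero)
      then show ?thesis by (auto simp: first_def)
    qed
    then show ?thesis using e(1,3) unfolding e(2)[symmetric] by blast
  qed
  obtain e k where e: "finite e" "first (act e x) k" "((t, d, i), (t, e, i)) \<in> (arel x)\<^sup>*" using up[OF d(1)] by blast
  obtain e' k' where e': "finite e'" "first (act e' x) k'" "((t, d', i), (t, e', i)) \<in> (arel x)\<^sup>*" using up[OF d(2)] by blast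
  have "((t, e, i), (t, e', i)) \<in> (arel x)\<^sup>*" by (rule connect_nonzero[OF t e(1) e'(1) e(2) e'(2)])
  with e(3) have "((t, d, i), (t, e', i)) \<in> (arel x)\<^sup>*" by (rule rtrancl_trans)
  then show ?thesis using arel_sym[OF e'(3)] by (rule rtrancl_trans)
qed

lemma connect_twin:
  assumes t: "reduced t" and d: "finite d"
  shows "((t, d, i), (t, d, j)) \<in> (arel x)\<^sup>*"
proof -
  let ?d = "{k. par (act d x) k \<noteq> x k}"
  have f: "finite ?d" by (rule finite_act_diff[OF d finite_par_diff])
  have eq: "act ?d x = par (act d x)" by (rule act_diff)
  have "((t, d, i), (t, ?d, i)) \<in> (arel x)\<^sup>*" "((t, d, j), (t, ?d, i)) \<in> (arel x)\<^sup>*"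
    by (intro r_into_rtrancl par_step[OF t d eq])+
  then show ?thesis using rtrancl_trans[OF _ arel_sym] by blast
qed

text \<open>The last letter may be the fourth generator, which is available over marked sequences only. The
  path therefore moves to a sequence that starts with two ones, removes the letter there and
  moves back.\<close>
lemma connect_word:
  assumes "reduced t" "finite d"
  shows "((t, d, i), ([], d, i)) \<in> (arel x)\<^sup>*"
  using assms(1)
proof (induction t rule: rev_induct)
  case (snoc a t)
  then have t: "reduced t" "a < 4" and ta: "reduced (t @ [a])" by (auto simp: reduced_snoc)
  \<comment> \<open>flipping \<open>?e\<close> makes the first two bits ones\<close>
  let ?e = "{k \<in> {0, 1}. \<not> x k}"
  have e: "finite ?e" by simp
  have "first (act ?e x) 0" "act ?e x (Suc 0)" by (auto simp: act_def first_def)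
  then have "gens (act ?e x) = 4" by (auto simp: gens_def mark_def)
  then have "rmul (t @ [a]) a = t \<and> a < gens (act ?e x)" using t(2) by (simp add: rmul_snoc)
  then have "((t @ [a], ?e, i), (t, ?e, i)) \<in> arel x"
    using t(1) ta e by (auto simp: arel_def carrier_def adj_def)
  then have "((t @ [a], d, i), (t, ?e, i)) \<in> (arel x)\<^sup>*"
    by (rule rtrancl_into_rtrancl[OF connect_seq[OF ta assms(2) e]])
  moreover have "((t, ?e, i), (t, d, i)) \<in> (arel x)\<^sup>*" by (rule connect_seq[OF t(1) e assms(2)])
  ultimately have "((t @ [a], d, i), (t, d, i)) \<in> (arel x)\<^sup>*" by (rule rtrancl_trans)
  then show ?case using snoc.IH[OF t(1)] by (rule rtrancl_trans)
qed simp

lemma connected_arel: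
  assumes "u \<in> carrier" "w \<in> carrier"
  shows "(u, w) \<in> (arel x)\<^sup>*"
proof -
  have "(u, ([], {}, False)) \<in> (arel x)\<^sup>*" if u: "u \<in> carrier" for u
  proof -
    obtain t d i where u': "u = (t, d, i)" by (cases u)
    then have t: "reduced t" and d: "finite d" using u by (auto simp: carrier_def)
    have "(u, ([], d, i)) \<in> (arel x)\<^sup>*" unfolding u' by (rule connect_word[OF t d])
    also have "(([], d, i), ([], d, False)) \<in> (arel x)\<^sup>*" by (rule connect_twin[OF reduced_Nil d])
    also have "(([], d, False), ([], {}, False)) \<in> (arel x)\<^sup>*" by (rule connect_seq[OF reduced_Nil d finite.emptyI])
    finally show ?thesis .
  qed
  from this[OF assms(1)] arel_sym[OF this[OF assms(2)]] show ?thesis by (rule rtrancl_trans)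
qed

section \<open>Sequences with infinitely many ones\<close>

lemma seq_nbrs_images:
  assumes d: "finite d"
  shows "(\<lambda>d'. act d' x) ` seq_nbrs x d = insert (par (act d x)) {y'. par y' = act d x}"
proof -
  have "y' \<in> (\<lambda>d'. act d' x) ` seq_nbrs x d" if "y' = par (act d x) \<or> par y' = act d x" for y'
    using that act_diff[of y' x] by (intro image_eqI[of _ _ "{i. y' i \<noteq> x i}"]) (auto simp: seq_nbrs_def)
  then show ?thesis by (auto simp: seq_nbrs_def)
qed

lemma generic_act:
  assumes "infinite {i. x i}" "finite d"
  shows "\<exists>k. first (act d x) k"
proof -
  have "{i. x i} \<subseteq> d \<union> {i. act d x i}" by (auto simp: act_def)
  then have "infinite {i. act d x i}" using assms by (meson finite_UnI finite_subset)
  then obtain i where "act d x i" using not_finite_existsD by blast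
  then show ?thesis using first_exists by blast
qed

text \<open>The neighbours are the parent and, above level 0, two children. Infinitely many ones exclude the
  zero sequence from the orbit.\<close>
lemma card_seq_nbrs_generic:
  assumes x: "infinite {i. x i}" and d: "finite d" and k: "first (act d x) k"
  shows "card (seq_nbrs x d) = (if k = 0 then 1 else 3)"
proof -
  let ?y = "act d x"
  have inf: "infinite {i. ?y i}"
  proof
    assume "finite {i. ?y i}"
    moreover have "{i. x i} \<subseteq> d \<union> {i. ?y i}" by (auto simp: act_def)
    ultimately show False using x d by (meson finite_UnI finite_subset)
  qed
  have inj: "inj_on (\<lambda>d'. act d' x) (seq_nbrs x d)" by (simp add: inj_on_def act_inj)
  have c: "card (seq_nbrs x d) = card (insert (par ?y) {y'. par y' = ?y})"
    using card_image[OF inj] seq_nbrs_images[OF d] by simp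
  have nz: "\<not> (\<forall>j. \<not> y' j)" if "par y' = ?y" for y'
  proof
    assume "\<forall>j. \<not> y' j"
    then have "?y = (\<lambda>i. i = 0)" using par_zero[of y'] that by simp
    then have "{i. ?y i} = {0}" by auto
    then show False using inf by simp
  qed
  show ?thesis
  proof (cases k)
    case 0
    have "par y' \<noteq> ?y" for y'
    proof
      assume e: "par y' = ?y"
      obtain l where "first ?y (Suc l)" using par_eq_cases[OF e] nz[OF e] by blast
      then show False using first_unique[OF k, of "Suc l"] 0 by simp
    qed
    then have "{y'. par y' = ?y} = {}" by blast
    then show ?thesis using c 0 by simp
  next
    case (Suc l)
    have ch: "{y'. par y' = ?y} = {child ?y l True, child ?y l False}"
    proof (intro equalityI subsetI)
      fix y' assume "y' \<in> {y'. par y' = ?y}"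
      then have e: "par y' = ?y" by simp
      obtain m where m: "first ?y (Suc m)" "y' = child ?y m (y' (Suc m))" using par_eq_cases[OF e] nz[OF e] by blast
      then have "m = l" using first_unique[OF k, of "Suc m"] Suc by simp
      then have "y' = child ?y l (y' (Suc l))" using m(2) by simp
      then show "y' \<in> {child ?y l True, child ?y l False}" by (cases "y' (Suc l)") simp_all
    next
      fix y' assume "y' \<in> {child ?y l True, child ?y l False}"
      then show "y' \<in> {y'. par y' = ?y}" using par_child[OF k[unfolded Suc]] by blast
    qed
    have "par ?y \<noteq> child ?y l b" for b
    proof
      assume "par ?y = child ?y l b"
      then have "first (child ?y l b) (Suc k)" using first_par[OF k] by simp
      then show False using first_unique[OF first_child] Suc by force
    qed
    moreover have "child ?y l True (Suc l) \<noteq> child ?y l False (Suc l)" by (simp add: child_def)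
    then have "child ?y l True \<noteq> child ?y l False" by (rule contrapos_nn) (rule fun_cong)
    ultimately show ?thesis using c ch Suc by simp
  qed
qed

section \<open>Local properties as events of the Bernoulli graphing\<close>

definition lift_pred :: "nat \<Rightarrow> (graph \<Rightarrow> nat \<Rightarrow> bool) \<Rightarrow> labelled_class set" where
  "lift_pred D P = {lclass D G \<xi> r | G \<xi> r. (G, \<xi>, r) \<in> labelled_graphs D \<and> P G r}"

lemma lclass_in_lift_pred:
  assumes P: "local_fun D n P" and G: "(G, \<xi>, r) \<in> labelled_graphs D"
  shows "lclass D G \<xi> r \<in> lift_pred D P \<longleftrightarrow> P G r"
proof
  assume "lclass D G \<xi> r \<in> lift_pred D P"
  then obtain H \<eta> p where H: "lclass D G \<xi> r = lclass D H \<eta> p" "(H, \<eta>, p) \<in> labelled_graphs D" "P H p"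
    unfolding lift_pred_def by blast
  then obtain \<phi> where \<phi>: "graph_iso \<phi> G H" "\<phi> r = p" using lclass_eq_iff[OF G H(2)] by blast
  have "ball_iso \<phi> G r H p n"
    using graph_iso_ball_iso[of D G r H \<phi> n] G H(2) \<phi> by (simp add: labelled_graphs_iff)
  then show "P G r" using local_funD[OF P, of G r H p \<phi>] G H by (simp add: labelled_graphs_iff rooted_graphs_iff)
qed (use G in \<open>auto simp: lift_pred_def\<close>)

lemma lift_pred_sets:
  assumes P: "local_fun D n P"
  shows "lift_pred D P \<in> sets (labelled_space D)"
proof (rule lopen_sets, unfold lopen_def, intro conjI allI impI)
  show "lift_pred D P \<subseteq> space (labelled_space D)"
    by (auto simp: lift_pred_def intro: lclass_in_space)
  fix G \<xi> r assume G: "(G, \<xi>, r) \<in> labelled_graphs D \<and> lclass D G \<xi> r \<in> lift_pred D P"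
  then have PG: "P G r" using lclass_in_lift_pred[OF P] by blast
  show "\<exists>n \<epsilon>. \<epsilon> > 0 \<and> (\<forall>H \<eta> p \<phi>. (H, \<eta>, p) \<in> labelled_graphs D \<and> ball_iso \<phi> G r H p n \<and>
      (\<forall>v\<in>vball G r n. \<bar>\<eta> (\<phi> v) - \<xi> v\<bar> < \<epsilon>) \<longrightarrow> lclass D H \<eta> p \<in> lift_pred D P)"
  proof (intro exI[of _ n] exI[of _ "1 :: real"] conjI allI impI)
    fix H \<eta> p \<phi> assume H: "(H, \<eta>, p) \<in> labelled_graphs D \<and> ball_iso \<phi> G r H p n \<and>
      (\<forall>v\<in>vball G r n. \<bar>\<eta> (\<phi> v) - \<xi> v\<bar> < 1)"
    then have "P H p" using local_funD[OF P, of G r H p \<phi>] G PG by (simp add: labelled_graphs_iff rooted_graphs_iff)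
    then show "lclass D H \<eta> p \<in> lift_pred D P" using lclass_in_lift_pred[OF P] H by blast
  qed simp
qed

context unimodular
begin

lemma emeasure_lift_pred:
  assumes P: "local_fun D n P"
  shows "emeasure B (lift_pred D P) = emeasure \<nu> {c \<in> space \<nu>. P (rep_graph c) (rep_root c)}"
proof -
  let ?E = "{c \<in> space \<nu>. P (rep_graph c) (rep_root c)}"
  have E: "?E \<in> sets \<nu>"
    using measurable_sets[OF measurable_local_fun[OF P], of "{True}"]
    by (simp add: sets_nu space_nu vimage_def Int_def conj_commute)
  have S: "lift_pred D P \<in> sets B" using lift_pred_sets[OF P] sets_B by simp
  have "emeasure B (lift_pred D P) = (\<integral>\<^sup>+ x. indicator (lift_pred D P) x \<partial>B)"
    by (rule nn_integral_indicator[OF S, symmetric])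
  also have "\<dots> = (\<integral>\<^sup>+ c. (\<integral>\<^sup>+ \<xi>. indicator (lift_pred D P) (lclass D (rep_graph c) \<xi> (rep_root c))
      \<partial>PiM (verts (rep_graph c)) (\<lambda>_. unif)) \<partial>\<nu>)"
    by (rule nn_integral_B) (intro borel_measurable_indicator lift_pred_sets[OF P])
  also have "\<dots> = (\<integral>\<^sup>+ c. indicator ?E c \<partial>\<nu>)"
  proof (rule nn_integral_cong)
    fix c assume c: "c \<in> space \<nu>"
    have "(\<integral>\<^sup>+ \<xi>. indicator (lift_pred D P) (lclass D (rep_graph c) \<xi> (rep_root c)) \<partial>PiM (verts (rep_graph c)) (\<lambda>_. unif)) =
        (\<integral>\<^sup>+ \<xi>. indicator ?E c \<partial>PiM (verts (rep_graph c)) (\<lambda>_. unif))"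
      using c lclass_in_lift_pred[OF P labelled_if_space[OF c]]
      by (intro nn_integral_cong) (simp add: indicator_def)
    also have "\<dots> = indicator ?E c"
      by (simp add: prob_space.emeasure_space_1[OF prob_space_PiM_unif])
    finally show "(\<integral>\<^sup>+ \<xi>. indicator (lift_pred D P) (lclass D (rep_graph c) \<xi> (rep_root c)) \<partial>PiM (verts (rep_graph c)) (\<lambda>_. unif)) = indicator ?E c" .
  qed
  also have "\<dots> = emeasure \<nu> ?E" by (rule nn_integral_indicator[OF E])
  finally show ?thesis .
qed

lemma bdry_lift_pred_subset:
  assumes P: "local_fun D n P"
  shows "bdry (lift_pred D P) \<subseteq> lift_pred D (\<lambda>G r. P G r \<and> (\<exists>s. (r, s) \<in> edges G \<and> \<not> P G s))"
proof
  fix x assume "x \<in> bdry (lift_pred D P)"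
  then obtain y where x: "x \<in> lift_pred D P" and y: "(x, y) \<in> R" "y \<notin> lift_pred D P" by blast
  then obtain G \<xi> r where G: "(G, \<xi>, r) \<in> labelled_graphs D" "x = lclass D G \<xi> r" "P G r"
    unfolding lift_pred_def by blast
  obtain s where s: "(r, s) \<in> edges G" "y = lclass D G \<xi> s" using bernoulli_nbrs[OF G(1)] y(1) G(2) by blast
  have "connected_graph D G" using G(1) by (simp add: labelled_graphs_iff)
  then have "(G, \<xi>, s) \<in> labelled_graphs D"
    using G(1) connected_graph_edgeD(2)[OF _ s(1)] by (simp add: labelled_graphs_iff)
  then have "\<not> P G s" using lclass_in_lift_pred[OF P] y(2) s(2) by blast
  then show "x \<in> lift_pred D (\<lambda>G r. P G r \<and> (\<exists>s. (r, s) \<in> edges G \<and> \<not> P G s))"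
    using G s(1) unfolding lift_pred_def by blast
qed

end

lemma (in root_pair_map) vertex_sum_rclass:
  assumes "(G, r) \<in> rooted_graphs D"
  shows "(\<integral>\<^sup>+ s. f (\<kappa> (rep_graph (rclass D G r)) (rep_root (rclass D G r)) s) \<partial>count_space (verts (rep_graph (rclass D G r)))) =
    (\<integral>\<^sup>+ s. f (\<kappa> G r s) \<partial>count_space (verts G))"
proof -
  let ?H = "rep_graph (rclass D G r)"
  obtain \<phi> where \<phi>: "graph_iso \<phi> G ?H" "\<phi> r = rep_root (rclass D G r)" using rep_rclass_iso[OF assms] .
  have G: "connected_graph D G" "r \<in> verts G" and H: "connected_graph D ?H"
    using assms rep_rooted(1)[OF rclass_in_space[OF assms]] by (auto simp: rooted_graphs_iff)
  have "(\<integral>\<^sup>+ s. f (\<kappa> G r s) \<partial>count_space (verts G)) = (\<integral>\<^sup>+ s. f (\<kappa> ?H (\<phi> r) (\<phi> s)) \<partial>count_space (verts G))"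
    by (intro nn_integral_cong) (simp add: inv[OF G(1) H \<phi>(1) G(2)])
  also have "\<dots> = (\<integral>\<^sup>+ s. f (\<kappa> ?H (\<phi> r) s) \<partial>count_space (verts ?H))"
    using \<phi>(1) by (intro nn_integral_bij_count_space) (simp add: graph_iso_def)
  finally show ?thesis unfolding \<phi>(2) by simp
qed

section \<open>Random graphs from equivariant families\<close>

text \<open>Random graphs with a fixed set of vertices, whose edges are events.\<close>
locale graph_family =
  fixes D :: nat and \<mu> :: "'x measure" and \<Gamma> :: "'x \<Rightarrow> graph"
  assumes verts: "\<And>x. verts (\<Gamma> x) = UNIV"
    and conn: "\<And>x. connected_graph D (\<Gamma> x)"
    and edge: "\<And>u v. Measurable.pred \<mu> (\<lambda>x. (u, v) \<in> edges (\<Gamma> x))"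
begin

lemma rooted: "(\<Gamma> x, u) \<in> rooted_graphs D"
  by (simp add: rooted_graphs_iff verts conn)

lemma doubly_rooted: "(\<Gamma> x, u, v) \<in> doubly_rooted_graphs D"
  by (simp add: doubly_rooted_graphs_iff verts conn)

lemma path: "Measurable.pred \<mu> (\<lambda>x. (u, v) \<in> edges (\<Gamma> x) ^^ k)"
proof (induction k arbitrary: v)
  case 0 show ?case by simp
next
  case (Suc k)
  have eq: "(u, v) \<in> edges (\<Gamma> x) ^^ Suc k \<longleftrightarrow> (\<exists>w. (u, w) \<in> edges (\<Gamma> x) ^^ k \<and> (w, v) \<in> edges (\<Gamma> x))" for x
    by auto
  show ?case unfolding eq by (intro pred_intros_countable pred_intros_logic Suc edge)
qed

lemma in_ball: "Measurable.pred \<mu> (\<lambda>x. v \<in> vball (\<Gamma> x) u n)"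
proof -
  have eq: "v \<in> vball (\<Gamma> x) u n \<longleftrightarrow> (\<exists>k. k \<le> n \<and> (u, v) \<in> edges (\<Gamma> x) ^^ k)" for x
    by (auto simp: vball_eq verts)
  show ?thesis unfolding eq by (intro pred_intros_countable pred_intros_conj1' path)
qed

lemma measurable_ball_graph: "(\<lambda>x. ball_graph (\<Gamma> x) u n) \<in> \<mu> \<rightarrow>\<^sub>M count_space {K. finite (verts K) \<and> finite (edges K)}"
proof (subst measurable_count_space_eq_countable[OF countable_finite_graphs], intro conjI ballI)
  show "(\<lambda>x. ball_graph (\<Gamma> x) u n) \<in> space \<mu> \<rightarrow> {K. finite (verts K) \<and> finite (edges K)}"
    using finite_ball_graph[OF conn] by blast
  fix K :: graph
  have eq: "ball_graph (\<Gamma> x) u n = K \<longleftrightarrow> (\<forall>v. v \<in> vball (\<Gamma> x) u n \<longleftrightarrow> v \<in> verts K) \<and>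
      (\<forall>v w. ((v, w) \<in> edges (\<Gamma> x) \<and> v \<in> vball (\<Gamma> x) u n \<and> w \<in> vball (\<Gamma> x) u n) \<longleftrightarrow> (v, w) \<in> edges K)" for x
  proof -
    have "ball_graph (\<Gamma> x) u n = K \<longleftrightarrow> vball (\<Gamma> x) u n = verts K \<and> edges (ball_graph (\<Gamma> x) u n) = edges K" by auto
    then show ?thesis unfolding edges_ball_graph by (auto simp: set_eq_iff)
  qed
  have "Measurable.pred \<mu> (\<lambda>x. ball_graph (\<Gamma> x) u n = K)"
    unfolding eq by (intro pred_intros_countable pred_intros_logic in_ball edge; simp)
  then show "(\<lambda>x. ball_graph (\<Gamma> x) u n) -` {K} \<inter> space \<mu> \<in> sets \<mu>"
    by (simp add: pred_def vimage_def Int_def conj_commute)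
qed

lemma pred_ball_graph: "Measurable.pred \<mu> (\<lambda>x. P (ball_graph (\<Gamma> x) u n))"
  by (rule measurable_compose[OF measurable_ball_graph]) simp

lemma measurable_rclass: "(\<lambda>x. rclass D (\<Gamma> x) u) \<in> \<mu> \<rightarrow>\<^sub>M rooted_space D"
proof (rule measurable_sigma_sets[OF sets_rooted_space])
  show "{cylinder D H p n |H p n. (H, p) \<in> rooted_graphs D} \<subseteq> Pow (rooted_graphs D // rooted_iso D)"
    using cylinder_subset space_rooted_space by blast
  show "(\<lambda>x. rclass D (\<Gamma> x) u) \<in> space \<mu> \<rightarrow> rooted_graphs D // rooted_iso D"
    using rclass_in_space[OF rooted] space_rooted_space by blast
  fix A assume "A \<in> {cylinder D H p n |H p n. (H, p) \<in> rooted_graphs D}"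
  then obtain H p n where A: "A = cylinder D H p n" by blast
  have "(\<lambda>x. rclass D (\<Gamma> x) u) -` A \<inter> space \<mu> =
      {x \<in> space \<mu>. \<exists>\<phi>. graph_iso \<phi> (ball_graph (\<Gamma> x) u n) (ball_graph H p n) \<and> \<phi> u = p}"
    unfolding A by (auto simp: rclass_in_cylinder_iff[OF rooted] ball_iso_def)
  then show "(\<lambda>x. rclass D (\<Gamma> x) u) -` A \<inter> space \<mu> \<in> sets \<mu>"
    using pred_ball_graph[of "\<lambda>K. \<exists>\<phi>. graph_iso \<phi> K (ball_graph H p n) \<and> \<phi> u = p" u n] by (simp add: pred_def)
qed

lemma measurable_drclass: "(\<lambda>x. drclass D (\<Gamma> x) u v) \<in> \<mu> \<rightarrow>\<^sub>M doubly_rooted_space D"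
proof (rule measurable_sigma_sets[OF sets_doubly_rooted_space])
  show "{doubly_cylinder D H p q n |H p q n. (H, p, q) \<in> doubly_rooted_graphs D} \<subseteq> Pow (doubly_rooted_graphs D // doubly_rooted_iso D)"
    using doubly_cylinder_subset space_doubly_rooted_space by blast
  show "(\<lambda>x. drclass D (\<Gamma> x) u v) \<in> space \<mu> \<rightarrow> doubly_rooted_graphs D // doubly_rooted_iso D"
    using drclass_in_space[OF doubly_rooted] space_doubly_rooted_space by blast
  fix A assume "A \<in> {doubly_cylinder D H p q n |H p q n. (H, p, q) \<in> doubly_rooted_graphs D}"
  then obtain H p q n where A: "A = doubly_cylinder D H p q n" by blast
  have "(\<lambda>x. drclass D (\<Gamma> x) u v) -` A \<inter> space \<mu> =
      {x \<in> space \<mu>. v \<in> verts (ball_graph (\<Gamma> x) u n) \<and> (\<exists>\<phi>. graph_iso \<phi> (ball_graph (\<Gamma> x) u n) (ball_graph H p n) \<and> \<phi> u = p \<and> \<phi> v = q)}"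
    unfolding A by (auto simp: drclass_in_doubly_cylinder_iff[OF doubly_rooted] ball_iso_def)
  then show "(\<lambda>x. drclass D (\<Gamma> x) u v) -` A \<inter> space \<mu> \<in> sets \<mu>"
    using pred_ball_graph[of "\<lambda>K. v \<in> verts K \<and> (\<exists>\<phi>. graph_iso \<phi> K (ball_graph H p n) \<and> \<phi> u = p \<and> \<phi> v = q)" u n]
    by (simp add: pred_def)
qed

end

text \<open>Moving the root to \<open>v\<close> is compensated by a measure-preserving change \<open>S
  v\<close> of the randomness, as happens for random graphs that are built equivariantly on a
  group.\<close>
locale equivariant_family = graph_family + prob_space \<mu> +
  fixes r :: nat and S :: "nat \<Rightarrow> 'a \<Rightarrow> 'a" and \<sigma> :: "nat \<Rightarrow> nat \<Rightarrow> nat"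
  assumes S_pres: "\<And>v. S v \<in> \<mu> \<rightarrow>\<^sub>M \<mu>" "\<And>v. distr \<mu> \<mu> (S v) = \<mu>"
    and iso: "\<And>v x. graph_iso (\<sigma> v) (\<Gamma> x) (\<Gamma> (S v x))"
    and root: "\<And>v. \<sigma> v v = r"
    and inv_bij: "bij (\<lambda>v. \<sigma> v r)"
begin

definition law :: "rooted_class measure" where
  "law = distr \<mu> (rooted_space D) (\<lambda>x. rclass D (\<Gamma> x) r)"

lemma drclass_shift: "drclass D (\<Gamma> x) v r = drclass D (\<Gamma> (S v x)) r (\<sigma> v r)"
  using drclass_iso[OF conn conn iso[of v x], of v r] root by (simp add: verts)

text \<open>Seen from \<open>v\<close>, the old root is at \<open>\<sigma> v r\<close>. So what
  \<open>v\<close> sends to the root under \<open>x\<close> is what the root sends to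
  \<open>\<sigma> v r\<close> under \<open>S v x\<close>, and every vertex is \<open>\<sigma> v
  r\<close> for exactly one \<open>v\<close>.\<close>
lemma mass_transport:
  assumes f: "f \<in> borel_measurable (doubly_rooted_space D)"
  shows "(\<integral>\<^sup>+ x. (\<integral>\<^sup>+ s. f (drclass D (\<Gamma> x) s r) \<partial>count_space UNIV) \<partial>\<mu>) =
    (\<integral>\<^sup>+ x. (\<integral>\<^sup>+ s. f (drclass D (\<Gamma> x) r s) \<partial>count_space UNIV) \<partial>\<mu>)"
proof -
  have m: "(\<lambda>x. f (drclass D (\<Gamma> x) u v) :: ennreal) \<in> borel_measurable \<mu>" for u v
    by (rule measurable_compose[OF measurable_drclass f])
  have swap: "(\<integral>\<^sup>+ x. (\<integral>\<^sup>+ s. g x s \<partial>count_space UNIV) \<partial>\<mu>) = (\<integral>\<^sup>+ s. (\<integral>\<^sup>+ x. g x s \<partial>\<mu>) \<partial>count_space UNIV)"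
    if "\<And>s. (\<lambda>x. g x s) \<in> borel_measurable \<mu>" for g :: "'a \<Rightarrow> nat \<Rightarrow> ennreal"
    unfolding nn_integral_count_space_nat by (rule nn_integral_suminf[OF that])
  have "(\<integral>\<^sup>+ x. (\<integral>\<^sup>+ s. f (drclass D (\<Gamma> x) s r) \<partial>count_space UNIV) \<partial>\<mu>) =
      (\<integral>\<^sup>+ s. (\<integral>\<^sup>+ x. f (drclass D (\<Gamma> x) s r) \<partial>\<mu>) \<partial>count_space UNIV)" by (rule swap[OF m])
  also have "\<dots> = (\<integral>\<^sup>+ s. (\<integral>\<^sup>+ x. f (drclass D (\<Gamma> x) r (\<sigma> s r)) \<partial>\<mu>) \<partial>count_space UNIV)"
  proof (rule nn_integral_cong)
    fix s
    have "(\<integral>\<^sup>+ x. f (drclass D (\<Gamma> x) s r) \<partial>\<mu>) = (\<integral>\<^sup>+ x. f (drclass D (\<Gamma> (S s x)) r (\<sigma> s r)) \<partial>\<mu>)"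
      unfolding drclass_shift[of _ s] ..
    also have "\<dots> = (\<integral>\<^sup>+ x. f (drclass D (\<Gamma> x) r (\<sigma> s r)) \<partial>distr \<mu> \<mu> (S s))"
      by (rule nn_integral_distr[OF S_pres(1), unfolded measurable_distr_eq1, OF m, symmetric])
    finally show "(\<integral>\<^sup>+ x. f (drclass D (\<Gamma> x) s r) \<partial>\<mu>) = (\<integral>\<^sup>+ x. f (drclass D (\<Gamma> x) r (\<sigma> s r)) \<partial>\<mu>)"
      unfolding S_pres(2) .
  qed
  also have "\<dots> = (\<integral>\<^sup>+ s. (\<integral>\<^sup>+ x. f (drclass D (\<Gamma> x) r s) \<partial>\<mu>) \<partial>count_space UNIV)"
    by (rule nn_integral_bij_count_space[OF inv_bij])
  also have "\<dots> = (\<integral>\<^sup>+ x. (\<integral>\<^sup>+ s. f (drclass D (\<Gamma> x) r s) \<partial>count_space UNIV) \<partial>\<mu>)" by (rule swap[OF m, symmetric])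
  finally show ?thesis .
qed

lemma unimodular_law: "unimodular_random_graph D law"
  unfolding unimodular_random_graph_def
proof (intro conjI allI impI)
  show "prob_space law" unfolding law_def by (rule prob_space_distr[OF measurable_rclass])
  show "sets law = sets (rooted_space D)" by (simp add: law_def)
  fix f :: "doubly_rooted_class \<Rightarrow> real"
  assume f: "f \<in> borel_measurable (doubly_rooted_space D) \<and> (\<forall>c\<in>space (doubly_rooted_space D). 0 \<le> f c)"
  have fm: "(\<lambda>d. ennreal (f d)) \<in> borel_measurable (doubly_rooted_space D)"
    by (rule measurable_compose[OF conjunct1[OF f] measurable_ennreal])
  have key: "(\<integral>\<^sup>+ c. (\<integral>\<^sup>+ s. ennreal (f (\<kappa> (rep_graph c) (rep_root c) s)) \<partial>count_space (verts (rep_graph c))) \<partial>law) =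
      (\<integral>\<^sup>+ x. (\<integral>\<^sup>+ s. ennreal (f (\<kappa> (\<Gamma> x) r s)) \<partial>count_space UNIV) \<partial>\<mu>)"
    if "root_pair_map D \<kappa>" for \<kappa>
  proof -
    interpret K: root_pair_map D \<kappa> by fact
    have "(\<integral>\<^sup>+ c. (\<integral>\<^sup>+ s. ennreal (f (\<kappa> (rep_graph c) (rep_root c) s)) \<partial>count_space (verts (rep_graph c))) \<partial>law) =
      (\<integral>\<^sup>+ x. (\<integral>\<^sup>+ s. ennreal (f (\<kappa> (rep_graph (rclass D (\<Gamma> x) r)) (rep_root (rclass D (\<Gamma> x) r)) s))
        \<partial>count_space (verts (rep_graph (rclass D (\<Gamma> x) r)))) \<partial>\<mu>)"
      unfolding law_def
    proof (rule nn_integral_distr[OF measurable_rclass, unfolded measurable_distr_eq1], rule K.measurable_vertex_sum)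
      show "f \<in> borel_measurable (doubly_rooted_space D)" using f by (rule conjunct1)
      show "0 \<le> f c" if "c \<in> space (doubly_rooted_space D)" for c using conjunct2[OF f] that by (rule bspec)
    qed
    then show ?thesis unfolding K.vertex_sum_rclass[OF rooted, where f = "\<lambda>d. ennreal (f d)"] verts .
  qed
  show "(\<integral>\<^sup>+ c. (\<integral>\<^sup>+ s. ennreal (f (drclass D (rep_graph c) s (rep_root c))) \<partial>count_space (verts (rep_graph c))) \<partial>law) =
      (\<integral>\<^sup>+ c. (\<integral>\<^sup>+ s. ennreal (f (drclass D (rep_graph c) (rep_root c) s)) \<partial>count_space (verts (rep_graph c))) \<partial>law)"
    unfolding key[OF root_pair_map_drclass] key[OF root_pair_map_drclass_swap] by (rule mass_transport[OF fm])
qed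

lemma pred_local:
  assumes "local_fun D n P"
  shows "Measurable.pred \<mu> (\<lambda>x. P (\<Gamma> x) r)"
  using measurable_compose[OF measurable_rclass[where u = r] measurable_local_fun[OF assms]]
  unfolding local_fun_rep[OF assms rooted] .

lemma emeasure_law:
  assumes P: "local_fun D n P"
  shows "emeasure law {c \<in> space law. P (rep_graph c) (rep_root c)} = emeasure \<mu> {x \<in> space \<mu>. P (\<Gamma> x) r}"
proof -
  let ?E = "{c \<in> space law. P (rep_graph c) (rep_root c)}"
  have sp: "space law = space (rooted_space D)" by (simp add: law_def)
  have E: "?E \<in> sets (rooted_space D)"
    using measurable_sets[OF measurable_local_fun[OF P], of "{True}"]
    by (simp add: sp vimage_def Int_def conj_commute)
  have "emeasure law ?E = emeasure \<mu> ((\<lambda>x. rclass D (\<Gamma> x) r) -` ?E \<inter> space \<mu>)"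
    by (subst (1) law_def) (rule emeasure_distr[OF measurable_rclass E])
  also have "(\<lambda>x. rclass D (\<Gamma> x) r) -` ?E \<inter> space \<mu> = {x \<in> space \<mu>. P (\<Gamma> x) r}"
    using rclass_in_space[OF rooted] by (auto simp: sp local_fun_rep[OF P rooted])
  finally show ?thesis .
qed

lemma AE_law:
  assumes "\<And>i :: nat. local_fun D (n i) (P i)" "\<And>x i. P i (\<Gamma> x) r"
  shows "AE c in law. \<forall>i. P i (rep_graph c) (rep_root c)"
  unfolding AE_all_countable
proof
  fix i
  have "{c \<in> space (rooted_space D). P i (rep_graph c) (rep_root c)} \<in> sets (rooted_space D)"
    using measurable_local_fun[OF assms(1)[of i]] by (simp add: pred_def)
  then have "(AE c in law. P i (rep_graph c) (rep_root c)) \<longleftrightarrow>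
      (AE x in \<mu>. P i (rep_graph (rclass D (\<Gamma> x) r)) (rep_root (rclass D (\<Gamma> x) r)))"
    unfolding law_def by (rule AE_distr_iff[OF measurable_rclass])
  then show "AE c in law. P i (rep_graph c) (rep_root c)"
    unfolding local_fun_rep[OF assms(1) rooted] using assms(2) by simp
qed

end

section \<open>The graph of a bit sequence\<close>

lemma countable_carrier: "countable carrier"
proof (rule countable_subset)
  show "carrier \<subseteq> UNIV \<times> ({d. finite d \<and> d \<subseteq> UNIV} \<times> UNIV)" by (auto simp: carrier_def)
  show "countable ((UNIV :: nat list set) \<times> ({d :: nat set. finite d \<and> d \<subseteq> UNIV} \<times> (UNIV :: bool set)))"
    by (intro countable_SIGMA countable_Collect_finite_subset; simp)
qed

lemma infinite_carrier: "infinite carrier"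
proof
  assume "finite carrier"
  moreover have "range (\<lambda>n. ([], {n}, False)) \<subseteq> carrier" by (auto simp: carrier_def)
  ultimately have "finite (range (\<lambda>n :: nat. ([] :: nat list, {n}, False)))" by (rule finite_subset[rotated])
  then have "finite (UNIV :: nat set)" by (rule finite_imageD) (simp add: inj_on_def)
  then show False by simp
qed

text \<open>Vertices of graphs are natural numbers, so the triples are enumerated.\<close>
definition enc :: "nat \<Rightarrow> vtx" where
  "enc = from_nat_into carrier"

definition dec :: "vtx \<Rightarrow> nat" where
  "dec = inv_into UNIV enc"

lemma enc_bij: "bij_betw enc UNIV carrier"
  unfolding enc_def by (rule bij_betw_from_nat_into[OF countable_carrier infinite_carrier])

lemma enc_carrier: "enc n \<in> carrier"
  using enc_bij by (auto simp: bij_betw_def)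

lemma enc_dec: "v \<in> carrier \<Longrightarrow> enc (dec v) = v"
  unfolding dec_def using enc_bij by (rule bij_betw_inv_into_right)

lemma dec_enc: "dec (enc n) = n"
  unfolding dec_def using enc_bij by (auto intro: bij_betw_inv_into_left)

text \<open>All graphs have the same set of vertices; \<open>x\<close> is the bit sequence at the origin.\<close>
definition bit_graph :: "bits \<Rightarrow> graph" where
  "bit_graph x = \<lparr>verts = UNIV, edges = {(m, n). adj x (enc m) (enc n)}\<rparr>"

definition origin :: nat where
  "origin = dec ([], {}, False)"

lemma enc_origin: "enc origin = ([], {}, False)"
  unfolding origin_def by (rule enc_dec) (simp add: carrier_def)

lemma verts_bit_graph [simp]: "verts (bit_graph x) = UNIV"
  by (simp add: bit_graph_def)

lemma edges_bit_graph: "(m, n) \<in> edges (bit_graph x) \<longleftrightarrow> adj x (enc m) (enc n)"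
  by (simp add: bit_graph_def)

lemma nbrs_bit_graph: "bij_betw enc {n. (m, n) \<in> edges (bit_graph x)} {w. adj x (enc m) w}"
  unfolding bij_betw_def
proof
  show "inj_on enc {n. (m, n) \<in> edges (bit_graph x)}" using enc_bij by (auto simp: bij_betw_def intro: inj_on_subset)
  show "enc ` {n. (m, n) \<in> edges (bit_graph x)} = {w. adj x (enc m) w}"
  proof safe
    fix w assume w: "adj x (enc m) w"
    then have "enc (dec w) = w" by (intro enc_dec adj_carrier[OF enc_carrier])
    then show "w \<in> enc ` {n. (m, n) \<in> edges (bit_graph x)}"
      using w by (intro image_eqI[of _ _ "dec w"]) (simp_all add: edges_bit_graph)
  qed (simp add: edges_bit_graph)
qed

lemma deg_bit_graph: "deg (edges (bit_graph x)) m = card {w. adj x (enc m) w}"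
  unfolding deg_def by (rule bij_betw_same_card[OF nbrs_bit_graph])

lemma deg_bit_graph_bounds: "1 \<le> deg (edges (bit_graph x)) m" "deg (edges (bit_graph x)) m \<le> 16"
proof -
  obtain t d i where m: "enc m = (t, d, i)" by (cases "enc m")
  show "1 \<le> deg (edges (bit_graph x)) m" "deg (edges (bit_graph x)) m \<le> 16"
    unfolding deg_bit_graph m card_adj using gens_le[of "act d x"] card_seq_nbrs(2)[of x d] by auto
qed

lemma connected_bit_graph: "connected_graph 16 (bit_graph x)"
  unfolding connected_graph_def
proof (intro conjI ballI)
  show "sym (edges (bit_graph x))" using adj_sym[OF enc_carrier] by (auto simp: sym_def edges_bit_graph)
  show "irrefl (edges (bit_graph x))" using adj_irrefl by (auto simp: irrefl_def edges_bit_graph)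
  show "finite {v. (u, v) \<in> edges (bit_graph x)}" for u
    using bij_betw_finite[OF nbrs_bit_graph, of u x] finite_adj by simp
  fix u v
  have "(enc u, enc v) \<in> (arel x)\<^sup>*" by (rule connected_arel[OF enc_carrier enc_carrier])
  then have "(dec (enc u), dec (enc v)) \<in> (edges (bit_graph x))\<^sup>*"
  proof (induction rule: rtrancl_induct)
    case (step a b)
    then have "(dec a, dec b) \<in> edges (bit_graph x)" by (auto simp: arel_def edges_bit_graph enc_dec adj_carrier)
    then show ?case by (rule rtrancl_into_rtrancl[OF step.IH])
  qed simp
  then show "(u, v) \<in> (edges (bit_graph x))\<^sup>*" by (simp add: dec_enc)
qed (use deg_bit_graph_bounds in auto)

definition translate :: "nat \<Rightarrow> nat \<Rightarrow> nat" where
  "translate v n = dec (shift (enc v) (enc n))"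

text \<open>The bit sequence at the vertex \<open>v\<close>.\<close>
definition flip :: "nat \<Rightarrow> bits \<Rightarrow> bits" where
  "flip v = act (fst (snd (enc v)))"

lemma enc_translate: "enc (translate v n) = shift (enc v) (enc n)"
  unfolding translate_def by (rule enc_dec[OF shift_carrier[OF enc_carrier enc_carrier]])

lemma dec_bij: "bij_betw dec carrier UNIV"
  unfolding dec_def by (rule bij_betw_inv_into[OF enc_bij])

lemma translate_iso: "graph_iso (translate v) (bit_graph x) (bit_graph (flip v x))"
  unfolding graph_iso_def
proof (intro conjI ballI)
  have "bij_betw (dec \<circ> (shift (enc v) \<circ> enc)) UNIV UNIV"
    using bij_betw_trans[OF bij_betw_trans[OF enc_bij shift_bij[OF enc_carrier]] dec_bij] .
  then show "bij_betw (translate v) (verts (bit_graph x)) (verts (bit_graph (flip v x)))"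
    by (simp add: translate_def[abs_def] comp_def)
  fix m n
  show "(m, n) \<in> edges (bit_graph x) \<longleftrightarrow> (translate v m, translate v n) \<in> edges (bit_graph (flip v x))"
    unfolding edges_bit_graph enc_translate flip_def by (rule adj_shift[OF enc_carrier enc_carrier enc_carrier, symmetric])
qed

lemma translate_self: "translate v v = origin"
  unfolding translate_def origin_def shift_self[OF enc_carrier] ..

lemma translate_origin_bij: "bij (\<lambda>v. translate v origin)"
proof -
  have "bij_betw (dec \<circ> (vinv \<circ> enc)) UNIV UNIV"
    using bij_betw_trans[OF bij_betw_trans[OF enc_bij vinv_bij] dec_bij] .
  then show ?thesis
    unfolding translate_def enc_origin by (simp add: shift_origin[OF enc_carrier] comp_def)
qed

section \<open>Fair coin flips\<close>

abbreviation coin :: "bool measure" where "coin \<equiv> measure_pmf (pmf_of_set UNIV)"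

definition flips :: "bits measure" where
  "flips = PiM UNIV (\<lambda>_. coin)"

lemma product_prob_space_coin: "product_prob_space (\<lambda>_ :: nat. coin)"
  by unfold_locales

lemma space_flips [simp]: "space flips = UNIV"
  by (simp add: flips_def space_PiM)

lemma prob_space_flips: "prob_space flips"
  unfolding flips_def by (intro prob_space_PiM) (rule prob_space_measure_pmf)

lemma pred_coord [measurable]: "Measurable.pred flips (\<lambda>x. x i)"
proof -
  have "(\<lambda>x. x i) \<in> flips \<rightarrow>\<^sub>M coin" unfolding flips_def by (rule measurable_component_singleton) simp
  then show ?thesis by (simp add: measurable_pmf_measure2)
qed

lemma emeasure_flips:
  assumes "finite J"
  shows "emeasure flips {x. \<forall>j\<in>J. x j \<in> F j} = (\<Prod>j\<in>J. emeasure coin (F j))"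
proof -
  interpret product_prob_space "\<lambda>_ :: nat. coin" UNIV by (rule product_prob_space_coin)
  show ?thesis
    using emeasure_PiM_Collect[of J F] assms by (simp add: flips_def space_PiM)
qed

lemma measure_flips:
  assumes "finite J"
  shows "measure flips {x. \<forall>j\<in>J. x j = b j} = (1 / 2) ^ card J"
proof -
  have e: "emeasure coin {c} = ennreal (1 / 2)" for c
    by (simp only: emeasure_pmf_single) (simp add: pmf_of_set)
  have "emeasure flips {x. \<forall>j\<in>J. x j \<in> {b j}} = ennreal ((1 / 2) ^ card J)"
    unfolding emeasure_flips[OF assms] e prod_constant by (rule ennreal_power) simp
  then show ?thesis by (simp add: measure_def)
qed

lemma flip_coin: "emeasure coin {c. (c \<noteq> b) \<in> F} = emeasure coin F"
proof (cases b)
  case True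
  have "map_pmf Not (pmf_of_set (UNIV :: bool set)) = pmf_of_set (Not ` UNIV)"
    by (rule map_pmf_of_set_inj) (auto simp: inj_on_def)
  moreover have "Not ` (UNIV :: bool set) = UNIV" by (auto simp: image_iff)
  ultimately have "emeasure coin F = emeasure (map_pmf Not (pmf_of_set (UNIV :: bool set))) F" by simp
  also have "\<dots> = emeasure coin (Not -` F)" by simp
  finally show ?thesis using True by (simp add: vimage_def)
qed simp

lemma pred_act: "Measurable.pred flips (\<lambda>x. act d x i)"
  unfolding act_def by measurable

lemma measurable_act: "act d \<in> flips \<rightarrow>\<^sub>M flips"
proof -
  have "(\<lambda>x. \<lambda>i\<in>UNIV. act d x i) \<in> flips \<rightarrow>\<^sub>M PiM UNIV (\<lambda>_. coin)"
    using pred_act by (intro measurable_restrict) (simp add: measurable_pmf_measure2)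
  then show ?thesis by (simp add: flips_def restrict_def)
qed

lemma distr_act: "distr flips flips (act d) = flips"
proof -
  interpret P: product_prob_space "\<lambda>_ :: nat. coin" UNIV by (rule product_prob_space_coin)
  have "distr flips flips (act d) = PiM UNIV (\<lambda>_. coin)"
  proof (rule P.PiM_eq)
    show "sets (distr flips flips (act d)) = sets (PiM UNIV (\<lambda>_. coin))" by (simp add: flips_def)
    fix J :: "nat set" and F :: "nat \<Rightarrow> bool set" assume J: "finite J"
    have e: "prod_emb UNIV (\<lambda>_. coin) J (PiE J F) = {x. \<forall>j\<in>J. x j \<in> F j}"
      by (auto simp: prod_emb_def space_PiM restrict_PiE_iff)
    have "{x. \<forall>j\<in>J. x j \<in> F j} = prod_emb UNIV (\<lambda>_. coin) J (PiE J F)" by (rule e[symmetric])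
    also have "\<dots> \<in> sets flips" unfolding flips_def using J by (intro sets_PiM_I) auto
    finally have s: "{x. \<forall>j\<in>J. x j \<in> F j} \<in> sets flips" .
    have "emeasure (distr flips flips (act d)) {x. \<forall>j\<in>J. x j \<in> F j} = emeasure flips (act d -` {x. \<forall>j\<in>J. x j \<in> F j} \<inter> space flips)"
      by (rule emeasure_distr[OF measurable_act s])
    also have "act d -` {x. \<forall>j\<in>J. x j \<in> F j} \<inter> space flips = {x. \<forall>j\<in>J. x j \<in> {c. (c \<noteq> (j \<in> d)) \<in> F j}}"
      by (auto simp: act_def)
    also have "emeasure flips \<dots> = (\<Prod>j\<in>J. emeasure coin (F j))"
      unfolding emeasure_flips[OF J] flip_coin ..
    finally show "emeasure (distr flips flips (act d)) (prod_emb UNIV (\<lambda>_. coin) J (\<Pi>\<^sub>E j\<in>J. F j)) = (\<Prod>j\<in>J. emeasure coin (F j))"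
      unfolding e .
  qed
  then show ?thesis by (simp add: flips_def)
qed

lemma pred_first: "Measurable.pred flips (\<lambda>x. first (act d x) k)"
  unfolding first_def using pred_act by measurable

lemma pred_par: "Measurable.pred flips (\<lambda>x. par (act d x) i)"
  unfolding par_def using pred_act pred_first by measurable

lemma pred_adj: "Measurable.pred flips (\<lambda>x. adj x u w)"
proof -
  obtain t d i where u: "u = (t, d, i)" by (cases u)
  obtain t' d' j where w: "w = (t', d', j)" by (cases w)
  have eq: "adj x u w \<longleftrightarrow> (d = d' \<and> ((\<exists>a<3. t' = rmul t a) \<or> (mark (act d x) \<and> t' = rmul t 3))) \<or>
      (t = t' \<and> ((\<forall>k. act d' x k = par (act d x) k) \<or> (\<forall>k. act d x k = par (act d' x) k)))" for x
    unfolding u w adj_iff seq_nbrs_def gens_def mem_Collect_eq fun_eq_iff[symmetric]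
    by (auto simp: less_Suc_eq numeral_eq_Suc)
  have m: "Measurable.pred flips (\<lambda>x. mark (act d x))"
    unfolding mark_def using pred_act pred_first by measurable
  show ?thesis unfolding eq using m pred_act pred_par by measurable
qed

interpretation F: equivariant_family 16 flips bit_graph origin flip translate
proof (intro equivariant_family.intro graph_family.intro equivariant_family_axioms.intro prob_space_flips)
  show "Measurable.pred flips (\<lambda>x. (u, v) \<in> edges (bit_graph x))" for u v
    unfolding edges_bit_graph by (rule pred_adj)
qed (simp_all add: connected_bit_graph flip_def measurable_act distr_act translate_iso[unfolded flip_def] translate_self translate_origin_bij)

section \<open>Ergodicity\<close>

lemma measure_flips_prod:
  assumes "finite J"
  shows "measure flips {x. \<forall>j\<in>J. x j \<in> F j} = (\<Prod>j\<in>J. measure coin (F j))"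
proof -
  have "emeasure flips {x. \<forall>j\<in>J. x j \<in> F j} = ennreal (\<Prod>j\<in>J. measure coin (F j))"
    unfolding emeasure_flips[OF assms] measure_pmf.emeasure_eq_measure by (rule prod_ennreal) simp
  then show ?thesis by (simp add: measure_def prod_nonneg)
qed

text \<open>Replacing the first \<open>n\<close> bits by zeros is a finite flip. So an invariant event is
  determined by the bits from position \<open>n\<close> on, for every \<open>n\<close>, and
  Kolmogorov's zero-one law applies.\<close>
lemma zero_one_law:
  assumes E: "E \<in> sets flips" and inv: "\<And>d x. finite d \<Longrightarrow> act d x \<in> E \<longleftrightarrow> x \<in> E"
  shows "measure flips E \<in> {0, 1}"
proof -
  let ?V = "\<lambda>i. vimage_algebra UNIV (\<lambda>x :: bits. x i) (count_space (UNIV :: bool set))"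
  let ?A = "\<lambda>i. sets (?V i)"
  have A: "Z \<in> ?A i \<longleftrightarrow> (\<exists>F. Z = {x. x i \<in> F})" for Z i
    by (auto simp: sets_vimage_algebra2 vimage_def)
  have ev: "{x. x i \<in> F} \<in> sets flips" for i F
    using measurable_sets[of "\<lambda>x. x i" flips "count_space UNIV" F] pred_coord[of i]
    by (simp add: vimage_def)
  have "F.prob E = 0 \<or> F.prob E = 1"
  proof (rule F.kolmogorov_0_1_law)
    show "sigma_algebra (space flips) (?A i)" for i
      using sets.sigma_algebra_axioms[of "?V i"] by simp
    show "F.indep_sets ?A UNIV"
      unfolding F.indep_sets_def
    proof (intro conjI ballI allI impI)
      show "?A i \<subseteq> sets flips" for i
      proof
        fix Z assume "Z \<in> ?A i"
        then obtain F where "Z = {x. x i \<in> F}" unfolding A ..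
        then show "Z \<in> sets flips" using ev[of i F] by simp
      qed
      fix J :: "nat set" and Z assume J: "finite J" "Z \<in> Pi J ?A"
      have "\<forall>j\<in>J. \<exists>F. Z j = {x. x j \<in> F}" 
        by (intro ballI iffD1[OF A] Pi_mem[OF J(2)])
      then obtain F where F: "\<forall>j\<in>J. Z j = {x. x j \<in> F j}" by (rule bchoice[THEN exE])
      have Zj: "F.prob (Z j) = measure coin (F j)" if "j \<in> J" for j
        using measure_flips_prod[of "{j}" F] F that by simp
      have "(\<Inter>j\<in>J. Z j) = {x. \<forall>j\<in>J. x j \<in> F j}" using F by auto
      then show "F.prob (\<Inter>j\<in>J. Z j) = (\<Prod>j\<in>J. F.prob (Z j))"
        using measure_flips_prod[OF J(1), of F] Zj by simp
    qed
    show "E \<in> F.tail_events ?A"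
      unfolding F.tail_events_def
    proof (rule INT_I)
      fix n :: nat
      define N where "N = sigma (UNIV :: bits set) (\<Union>i\<in>{n..}. ?A i)"
      have N: "sets N = sigma_sets UNIV (\<Union>i\<in>{n..}. ?A i)" "space N = UNIV"
        by (simp_all add: N_def)
      have co: "(\<lambda>x. n \<le> i \<and> x i) \<in> N \<rightarrow>\<^sub>M coin" for i
      proof (cases "n \<le> i")
        case True
        have "{x. x i \<in> F} \<in> sets N" for F
          unfolding N(1) using True A[of "{x. x i \<in> F}" i] by (intro sigma_sets.Basic) auto
        then have "(\<lambda>x. x i) \<in> N \<rightarrow>\<^sub>M count_space UNIV"
          by (intro measurableI) (simp_all add: N(2) vimage_def)
        then show ?thesis using True by (simp add: measurable_pmf_measure2)
      qed simp
      have g: "(\<lambda>x i. n \<le> i \<and> x i) \<in> N \<rightarrow>\<^sub>M flips"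
      proof -
        have "(\<lambda>x. \<lambda>i\<in>UNIV. n \<le> i \<and> x i) \<in> N \<rightarrow>\<^sub>M PiM UNIV (\<lambda>_. coin)"
          by (rule measurable_restrict[OF co])
        then show ?thesis unfolding flips_def restrict_def by (simp only: UNIV_I if_True)
      qed
      have eq: "(\<lambda>i. n \<le> i \<and> x i) = act {i. i < n \<and> x i} x" for x :: bits
        by (auto simp: act_def)
      have "(\<lambda>x i. n \<le> i \<and> x i) -` E \<inter> space N \<in> sets N" by (rule measurable_sets[OF g E])
      also have "(\<lambda>x i. n \<le> i \<and> x i) -` E \<inter> space N = E"
      proof -
        have "(\<lambda>i. n \<le> i \<and> x i) \<in> E \<longleftrightarrow> x \<in> E" for x unfolding eq by (rule inv) simp
        then show ?thesis by (simp add: N(2) vimage_def)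
      qed
      finally show "E \<in> sigma_sets (space flips) (\<Union> (?A ` {n..}))" by (simp add: N(1))
    qed
  qed
  then show ?thesis by simp
qed

text \<open>Rerooting at a vertex with trivial word has the effect of flipping finitely many bits, so
  rerooting invariant events pull back to events invariant under finite flips.\<close>
lemma ergodic_law: "ergodic_random_graph 16 F.law"
  unfolding ergodic_random_graph_def
proof (intro ballI impI)
  fix U assume U: "U \<in> sets (rooted_space 16)" and inv: "rerooting_invariant 16 U"
  let ?c = "\<lambda>x. rclass 16 (bit_graph x) origin"
  let ?E = "?c -` U \<inter> space flips"
  have step: "?c (act d x) \<in> U" if d: "finite d" and x: "?c x \<in> U" for d x
  proof -
    let ?v = "dec ([], d, False)"
    have fl: "flip ?v x = act d x" using d by (simp add: flip_def enc_dec carrier_def)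
    have "?c (flip ?v x) = rclass 16 (bit_graph x) ?v"
      using iffD2[OF rclass_eq_iff[OF F.rooted F.rooted], OF exI, OF conjI, OF translate_iso translate_self]
      by (rule sym)
    moreover have "rclass 16 (bit_graph x) ?v \<in> U"
      using inv F.rooted[of x origin] x unfolding rerooting_invariant_def by (metis UNIV_I verts_bit_graph)
    ultimately show ?thesis unfolding fl by simp
  qed
  have "measure flips ?E \<in> {0, 1}"
  proof (rule zero_one_law)
    show "?E \<in> sets flips" by (rule measurable_sets[OF F.measurable_rclass U])
    fix d :: "nat set" and x assume d: "finite d"
    have "act d (act d x) = x" by (auto simp: act_def)
    then show "act d x \<in> ?E \<longleftrightarrow> x \<in> ?E" using step[OF d, of x] step[OF d, of "act d x"] by auto
  qed
  then show "measure F.law U \<in> {0, 1}"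
    unfolding F.law_def measure_distr[OF F.measurable_rclass U] .
qed

section \<open>Spectral radius below one\<close>

lemma superharmonic_weight_bit_graph: "superharmonic_weight (59 / 60) m (bit_graph x) v"
  unfolding superharmonic_weight_def
proof (intro exI[of _ "\<lambda>n. wt (fst (enc n))"] conjI allI ballI)
  show "0 < wt (fst (enc n))" for n by (simp add: wt_def)
  fix n
  obtain t d i where n: "enc n = (t, d, i)" by (cases "enc n")
  have "(\<Sum>u | (n, u) \<in> edges (bit_graph x). wt (fst (enc u))) = (\<Sum>w | adj x (enc n) w. wt (fst w))"
    by (rule sum.reindex_bij_betw[OF nbrs_bit_graph, where g = "\<lambda>w. wt (fst w)"])
  also have "\<dots> \<le> 59 / 60 * real (deg (edges (bit_graph x)) n) * wt (fst (enc n))"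
    unfolding deg_bit_graph n fst_conv by (rule sum_adj_wt)
  finally show "(\<Sum>u | (n, u) \<in> edges (bit_graph x). wt (fst (enc u))) \<le> 59 / 60 * real (deg (edges (bit_graph x)) n) * wt (fst (enc n))" .
qed

lemma has_twin_bit_graph: "has_twin (bit_graph x) origin"
  unfolding has_twin_def
proof (intro bexI[of _ "dec ([], {}, True)"] conjI)
  let ?s = "dec ([], {}, True)" and ?w = "dec ([0], {}, False)"
  have c: "([], {}, True) \<in> carrier" "([0], {}, False) \<in> carrier" by (auto simp: carrier_def reduced_def)
  have s: "enc ?s = ([], {}, True)" and w: "enc ?w = ([0], {}, False)" using c by (simp_all add: enc_dec)
  show "?s \<noteq> origin"
  proof
    assume "?s = origin"
    then have "enc ?s = enc origin" by simp
    then show False unfolding s enc_origin by simp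
  qed
  have "adj x ([], {}, True) u \<longleftrightarrow> adj x ([], {}, False) u" for u
    by (cases u) (simp add: adj_iff)
  then show "{t. (?s, t) \<in> edges (bit_graph x)} = {t. (origin, t) \<in> edges (bit_graph x)}"
    unfolding edges_bit_graph s enc_origin by simp
  have a: "adj x ([], {}, i) ([0], {}, False)" for i
    using gens_le(2)[of x] by (auto simp: adj_iff rmul_Nil)
  have "(origin, ?w) \<in> edges (bit_graph x)" unfolding edges_bit_graph w enc_origin by (rule a)
  moreover have "(?w, ?s) \<in> edges (bit_graph x)" unfolding edges_bit_graph w s by (rule adj_sym[OF c(1) a])
  ultimately have "(origin, ?s) \<in> edges (bit_graph x) ^^ 2" by (auto simp: numeral_2_eq_2)
  then show "?s \<in> vball (bit_graph x) origin 2" by (auto simp: vball_eq)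
qed

lemma rho_law: "AE c in F.law. rho_graph (rep_graph c) < 1"
proof -
  let ?P = "\<lambda>i :: nat. case i of 0 \<Rightarrow> has_twin | Suc m \<Rightarrow> superharmonic_weight (59 / 60) m"
  have "AE c in F.law. \<forall>i. ?P i (rep_graph c) (rep_root c)"
  proof (rule F.AE_law[where n = "\<lambda>i. i + 3"])
    show "local_fun 16 (i + 3) (?P i)" for i
    proof (cases i)
      case (Suc m)
      show ?thesis unfolding Suc nat.case by (rule local_fun_mono[OF local_superharmonic_weight]) simp
    qed (simp add: local_has_twin)
    show "?P i (bit_graph x) origin" for x i
      by (cases i) (simp_all add: has_twin_bit_graph superharmonic_weight_bit_graph)
  qed
  moreover have "AE c in F.law. c \<in> space (rooted_space 16)"
    using AE_space[of F.law] by (simp add: F.law_def)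
  ultimately show ?thesis
  proof eventually_elim
    case (elim c)
    have tw: "has_twin (rep_graph c) (rep_root c)" using elim(1)[rule_format, of 0] by simp
    have sw: "superharmonic_weight (59 / 60) m (rep_graph c) (rep_root c)" for m
      using elim(1)[rule_format, of "Suc m"] by simp
    have "connected_graph 16 (rep_graph c)" "rep_root c \<in> verts (rep_graph c)"
      using rep_rooted(1)[OF elim(2)] by (simp_all add: rooted_graphs_iff)
    then show ?case by (rule rho_graph_less_1[OF _ _ _ _ sw tw]) simp_all
  qed
qed

section \<open>Reading bits off the graph\<close>

text \<open>Degrees 8 and 10 occur at level 0 only, and degrees 12 and 14 above it, so the level of a
  sequence is the distance to the vertices of degree at most 10.\<close>
primrec near_leaf :: "nat \<Rightarrow> graph \<Rightarrow> nat \<Rightarrow> bool" where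
  "near_leaf 0 = (\<lambda>G v. deg (edges G) v \<le> 10)"
| "near_leaf (Suc k) = (\<lambda>G v. near_leaf k G v \<or> (\<exists>u. (v, u) \<in> edges G \<and> near_leaf k G u))"

definition level :: "nat \<Rightarrow> graph \<Rightarrow> nat \<Rightarrow> bool" where
  "level k G v \<longleftrightarrow> near_leaf k G v \<and> (\<forall>l<k. \<not> near_leaf l G v)"

text \<open>For a vertex of level \<open>m\<close>, the mark of its ancestor at level \<open>m + j\<close>.
  Parents are the neighbours one level up, and marked vertices are those of degree 10 or 14.\<close>
primrec anc :: "nat \<Rightarrow> nat \<Rightarrow> graph \<Rightarrow> nat \<Rightarrow> bool" where
  "anc 0 m = (\<lambda>G v. level m G v \<and> deg (edges G) v mod 4 = 2)"
| "anc (Suc j) m = (\<lambda>G v. level m G v \<and> (\<exists>u. (v, u) \<in> edges G \<and> anc j (Suc m) G u))"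

text \<open>The bit at position \<open>n + 1\<close>, as the mark of the ancestor at level \<open>n\<close>.\<close>
definition up_bit :: "nat \<Rightarrow> graph \<Rightarrow> nat \<Rightarrow> bool" where
  "up_bit n G v \<longleftrightarrow> (\<exists>m\<le>n. anc (n - m) m G v)"

lemma local_near_leaf: "local_fun D (Suc k) (near_leaf k)"
proof (induction k)
  case 0 show ?case unfolding near_leaf.simps by (rule local_fun_comp[OF local_fun_deg])
next
  case (Suc k)
  show ?case unfolding near_leaf.simps
    by (rule local_fun_comp2[OF local_fun_mono[OF Suc.IH] local_fun_ex_nbr[OF Suc.IH], where f = "(\<or>)"]) simp
qed

lemma local_fun_Ball:
  assumes "\<And>i. i \<in> I \<Longrightarrow> local_fun D n (P i)"
  shows "local_fun D n (\<lambda>G v. \<forall>i\<in>I. P i G v)"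
  unfolding local_fun_def
proof (intro allI impI)
  fix G r H p \<phi>
  assume "(G, r) \<in> rooted_graphs D" "(H, p) \<in> rooted_graphs D" "ball_iso \<phi> G r H p n"
  then have "P i G r = P i H p" if "i \<in> I" for i using local_funD[OF assms[OF that]] by blast
  then show "(\<forall>i\<in>I. P i G r) = (\<forall>i\<in>I. P i H p)" by simp
qed

lemma local_level: "local_fun D (Suc k) (level k)"
proof -
  have "local_fun D (Suc k) (\<lambda>G v. \<forall>l\<in>{..<k}. \<not> near_leaf l G v)"
    by (rule local_fun_Ball, rule local_fun_mono[OF local_fun_comp[OF local_near_leaf]]) simp
  then have "local_fun D (Suc k) (\<lambda>G v. near_leaf k G v \<and> (\<forall>l\<in>{..<k}. \<not> near_leaf l G v))"
    by (rule local_fun_comp2[OF local_near_leaf, where f = "(\<and>)"])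
  moreover have "level k = (\<lambda>G v. near_leaf k G v \<and> (\<forall>l\<in>{..<k}. \<not> near_leaf l G v))"
    by (intro ext) (simp add: level_def Ball_def)
  ultimately show ?thesis by simp
qed

lemma local_anc: "local_fun D (Suc (m + 2 * j)) (anc j m)"
proof (induction j arbitrary: m)
  case 0
  have "local_fun D (Suc m) (anc 0 m)" unfolding anc.simps
    by (rule local_fun_comp2[OF local_level local_fun_comp[OF local_fun_deg], where f = "(\<and>)" and f1 = "\<lambda>k. k mod 4 = 2"])
  then show ?case by simp
next
  case (Suc j)
  have "local_fun D (Suc (m + 2 * Suc j)) (\<lambda>G v. \<exists>u. (v, u) \<in> edges G \<and> anc j (Suc m) G u)"
    using local_fun_ex_nbr[OF Suc.IH[of "Suc m"]] by simp
  moreover have "local_fun D (Suc (m + 2 * Suc j)) (level m)"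
    by (rule local_fun_mono[OF local_level]) simp
  ultimately show ?case unfolding anc.simps by (intro local_fun_comp2[where f = "(\<and>)"])
qed

lemma local_up_bit: "local_fun D (Suc (2 * n)) (up_bit n)"
proof -
  have "local_fun D (Suc (2 * n)) (\<lambda>G v. \<forall>m\<in>{..n}. \<not> anc (n - m) m G v)"
    by (rule local_fun_Ball, rule local_fun_mono[OF local_fun_comp[OF local_anc]]) simp
  then have "local_fun D (Suc (2 * n)) (\<lambda>G v. \<not> (\<forall>m\<in>{..n}. \<not> anc (n - m) m G v))"
    by (rule local_fun_comp)
  moreover have "up_bit n = (\<lambda>G v. \<not> (\<forall>m\<in>{..n}. \<not> anc (n - m) m G v))"
    by (intro ext) (auto simp: up_bit_def)
  ultimately show ?thesis by simp
qed

context
  fixes x :: bits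
  assumes generic: "infinite {i. x i}"
begin

lemma finite_enc: "finite (fst (snd (enc v)))"
  using enc_carrier[of v] by (auto simp: carrier_def split: prod.splits)

lemma first_flip: "\<exists>k. first (flip v x) k"
  unfolding flip_def by (rule generic_act[OF generic finite_enc])

lemma deg_flip:
  assumes "first (flip v x) k"
  shows "deg (edges (bit_graph x)) v = 2 * (gens (flip v x) + (if k = 0 then 1 else 3))"
proof -
  obtain t d i where v: "enc v = (t, d, i)" by (cases "enc v")
  show ?thesis
    using card_seq_nbrs_generic[OF generic finite_enc[of v]] assms
    unfolding deg_bit_graph flip_def v fst_conv snd_conv card_adj by simp
qed

lemma edge_flip_cases:
  assumes e: "(v, u) \<in> edges (bit_graph x)"
  obtains "flip u x = flip v x" | "flip u x = par (flip v x)"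
    | l where "first (flip u x) l" "first (flip v x) (Suc l)" "par (flip u x) = flip v x"
proof -
  obtain t d i t' d' j where v: "enc v = (t, d, i)" and u: "enc u = (t', d', j)" by (cases "enc v", cases "enc u")
  have "d = d' \<or> act d' x = par (act d x) \<or> act d x = par (act d' x)"
    using e unfolding edges_bit_graph v u adj_iff seq_nbrs_def by auto
  then consider "flip u x = flip v x" | "flip u x = par (flip v x)" | "par (flip u x) = flip v x"
    unfolding flip_def v u by auto
  then show ?thesis
  proof cases
    case 3
    obtain l where l: "first (flip u x) l" using first_flip by blast
    then have "first (flip v x) (Suc l)" unfolding 3[symmetric] by (rule first_par)
    then show ?thesis using that(3)[OF l _ 3] by blast
  qed (use that in blast)+
qed

lemma ex_edge_flip:
  assumes "y = par (flip v x) \<or> flip v x = par y"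
  shows "\<exists>u. (v, u) \<in> edges (bit_graph x) \<and> flip u x = y"
proof -
  obtain t d i where v: "enc v = (t, d, i)" by (cases "enc v")
  let ?d = "{j. y j \<noteq> x j}"
  have y: "act ?d x = y" by (rule act_diff)
  have "?d \<in> seq_nbrs x d" using assms unfolding seq_nbrs_def mem_Collect_eq y flip_def v by simp
  then have a: "adj x (enc v) (t, ?d, i)" unfolding v adj_iff by simp
  have "enc (dec (t, ?d, i)) = (t, ?d, i)" by (rule enc_dec[OF adj_carrier[OF enc_carrier a]])
  then show ?thesis using a y by (intro exI[of _ "dec (t, ?d, i)"]) (simp add: edges_bit_graph flip_def)
qed

lemma near_leaf_iff: "first (flip v x) l \<Longrightarrow> near_leaf k (bit_graph x) v \<longleftrightarrow> l \<le> k"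
proof (induction k arbitrary: v l)
  case 0
  then show ?case using gens_le[of "flip v x"] by (simp add: deg_flip)
next
  case (Suc k)
  note l = Suc.prems
  show ?case
  proof
    assume "near_leaf (Suc k) (bit_graph x) v"
    then consider "near_leaf k (bit_graph x) v" | u where "(v, u) \<in> edges (bit_graph x)" "near_leaf k (bit_graph x) u" by auto
    then show "l \<le> Suc k"
    proof cases
      case 1 then show ?thesis using Suc.IH[OF l] by simp
    next
      case (2 u)
      obtain k' where k': "first (flip u x) k'" using first_flip by blast
      then have "k' \<le> k" using Suc.IH 2(2) by blast
      moreover have "l \<le> Suc k'"
        using 2(1)
      proof (cases rule: edge_flip_cases)
        case 1 then show ?thesis using first_unique[of "flip v x" l k'] l k' by simp
      next
        case 2 then show ?thesis using first_unique[OF first_par[OF l], of k'] k' by simp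
      next
        case (3 l') then show ?thesis using first_unique[OF l 3(2)] first_unique[OF k' 3(1)] by simp
      qed
      ultimately show ?thesis by simp
    qed
  next
    assume le: "l \<le> Suc k"
    show "near_leaf (Suc k) (bit_graph x) v"
    proof (cases "l \<le> k")
      case True then show ?thesis using Suc.IH[OF l] by simp
    next
      case False
      then have "first (flip v x) (Suc k)" using l le by (simp add: le_Suc_eq)
      then have "flip v x = par (child (flip v x) k False)" by (rule par_child[symmetric])
      then obtain u where u: "(v, u) \<in> edges (bit_graph x)" "flip u x = child (flip v x) k False"
        using ex_edge_flip by blast
      then have "first (flip u x) k" by (simp add: first_child)
      then have "near_leaf k (bit_graph x) u" using Suc.IH by blast
      then show ?thesis using u(1) by auto
    qed
  qed
qed

lemma level_iff: "level k (bit_graph x) v \<longleftrightarrow> first (flip v x) k"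
proof -
  obtain l where l: "first (flip v x) l" using first_flip by blast
  have "level k (bit_graph x) v \<longleftrightarrow> l \<le> k \<and> (\<forall>j<k. \<not> l \<le> j)"
    unfolding level_def near_leaf_iff[OF l] ..
  also have "\<dots> \<longleftrightarrow> l = k" by (metis linorder_not_less nat_less_le order_refl)
  also have "\<dots> \<longleftrightarrow> first (flip v x) k" using l first_unique by blast
  finally show ?thesis .
qed

lemma anc_iff: "anc j m (bit_graph x) v \<longleftrightarrow> first (flip v x) m \<and> flip v x (Suc (m + j))"
proof (induction j arbitrary: m v)
  case 0
  have "deg (edges (bit_graph x)) v mod 4 = 2 \<longleftrightarrow> flip v x (Suc m)" if m: "first (flip v x) m"
  proof -
    have "mark (flip v x) \<longleftrightarrow> flip v x (Suc m)" unfolding mark_def using m first_unique by blast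
    then show ?thesis unfolding deg_flip[OF m] gens_def by simp
  qed
  then show ?case by (auto simp: level_iff)
next
  case (Suc j)
  show ?case
  proof
    assume "anc (Suc j) m (bit_graph x) v"
    then obtain u where m: "first (flip v x) m" and u: "(v, u) \<in> edges (bit_graph x)" "anc j (Suc m) (bit_graph x) u"
      by (auto simp: level_iff)
    then have u': "first (flip u x) (Suc m)" "flip u x (Suc (Suc m + j))" using Suc.IH by blast+
    show "first (flip v x) m \<and> flip v x (Suc (m + Suc j))"
      using u(1)
    proof (cases rule: edge_flip_cases)
      case 1 then show ?thesis using first_unique[OF m, of "Suc m"] u'(1) by simp
    next
      case 2
      then show ?thesis using u'(2) m par_first[OF m] by simp
    next
      case (3 l) then show ?thesis using first_unique[OF m 3(2)] first_unique[OF u'(1) 3(1)] by simp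
    qed
  next
    assume *: "first (flip v x) m \<and> flip v x (Suc (m + Suc j))"
    then have m: "first (flip v x) m" ..
    obtain u where u: "(v, u) \<in> edges (bit_graph x)" "flip u x = par (flip v x)" using ex_edge_flip by blast
    have "first (flip u x) (Suc m) \<and> flip u x (Suc (Suc m + j))"
      unfolding u(2) using first_par[OF m] par_first[OF m] * by simp
    then have "anc j (Suc m) (bit_graph x) u" using Suc.IH by blast
    then show "anc (Suc j) m (bit_graph x) v" using u(1) m by (auto simp: level_iff)
  qed
qed

lemma up_bit_iff: "up_bit n (bit_graph x) v \<longleftrightarrow> (\<exists>m\<le>n. first (flip v x) m) \<and> flip v x (Suc n)"
  unfolding up_bit_def anc_iff by auto

text \<open>Neighbours have the same ancestor at level \<open>n\<close>, except for a vertex of level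
  \<open>n\<close> and its parent. At such a vertex the first \<open>n\<close> bits are zero.\<close>
lemma up_bit_boundary:
  assumes v: "up_bit n (bit_graph x) v" and u: "(v, u) \<in> edges (bit_graph x)" "\<not> up_bit n (bit_graph x) u" and i: "i < n"
  shows "\<not> flip v x i"
proof -
  obtain m where m: "m \<le> n" "first (flip v x) m" "flip v x (Suc n)" using v up_bit_iff by blast
  have "m = n"
  proof (rule ccontr)
    assume "m \<noteq> n"
    then have "m < n" using m(1) by simp
    show False using u(1)
    proof (cases rule: edge_flip_cases)
      case 1 then show False using u(2) v unfolding up_bit_iff by simp
    next
      case 2
      have "first (flip u x) (Suc m)" "flip u x (Suc n)"
        unfolding 2 using first_par[OF m(2)] par_first[OF m(2)] m(3) \<open>m < n\<close> by auto
      then show False using u(2) \<open>m < n\<close> up_bit_iff[of n u] Suc_leI by blast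
    next
      case (3 l)
      have ml: "m = Suc l" by (rule first_unique[OF m(2) 3(2)])
      have "flip u x (Suc n)" using m(3) par_first[OF 3(1), of "Suc n"] ml \<open>m < n\<close> unfolding 3(3) by simp
      moreover have "l \<le> n" using ml m(1) by simp
      ultimately show False using u(2) 3(1) up_bit_iff[of n u] by blast
    qed
  qed
  then show ?thesis using m(2) i by (simp add: first_def)
qed

end

lemma flip_origin: "flip origin x = x"
  by (simp add: flip_def enc_origin)

section \<open>Almost invariant sets\<close>

lemma cylinder_flips: "finite J \<Longrightarrow> {x. \<forall>j\<in>J. x j = b j} \<in> sets flips"
proof -
  assume "finite J"
  then have "Measurable.pred flips (\<lambda>x. \<forall>j\<in>J. x j = b j)" by measurable
  then show ?thesis by (simp add: pred_def)
qed

lemma AE_generic: "AE x in flips. infinite {i. x i}"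
proof -
  have "AE x in flips. \<exists>i>N. x i" for N
  proof -
    let ?Z = "{x :: bits. \<forall>i>N. \<not> x i}"
    have "Measurable.pred flips (\<lambda>x. \<forall>i\<in>{N<..}. \<not> x i)" by measurable
    then have Z: "?Z \<in> sets flips" by (simp add: pred_def Ball_def)
    have le: "F.prob ?Z \<le> (1 / 2) ^ k" for k
    proof -
      have "F.prob ?Z \<le> F.prob {x. \<forall>j\<in>{N<..N + k}. x j = False}"
        by (rule F.finite_measure_mono[OF _ cylinder_flips]) auto
      also have "\<dots> = (1 / 2) ^ k" by (subst measure_flips) simp_all
      finally show ?thesis .
    qed
    have "F.prob ?Z \<le> 0"
      by (rule LIMSEQ_le_const[OF LIMSEQ_realpow_zero[of "1 / 2"]]) (auto intro: le)
    then have "F.prob ?Z = 0" using measure_nonneg[of flips ?Z] by simp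
    then have "AE x in flips. x \<notin> ?Z" using F.prob_eq_0[OF Z] by simp
    then show ?thesis by simp
  qed
  then have "AE x in flips. \<forall>N. \<exists>i>N. x i" by (simp add: AE_all_countable)
  then show ?thesis by (simp add: infinite_nat_iff_unbounded)
qed

interpretation L: unimodular 16 F.law
  by (rule unimodular.intro[OF F.unimodular_law])

lemma measure_lift_pred:
  assumes "local_fun 16 n P"
  shows "measure L.B (lift_pred 16 P) = measure flips {x. P (bit_graph x) origin}"
  unfolding measure_def L.emeasure_lift_pred[OF assms] F.emeasure_law[OF assms] by simp

lemma pred_local_sets: "local_fun 16 n P \<Longrightarrow> {x. P (bit_graph x) origin} \<in> sets flips"
  using F.pred_local[of n P] by (simp add: pred_def)

lemma measure_up_bit:
  "1 / 4 \<le> measure L.B (lift_pred 16 (up_bit n))" "measure L.B (lift_pred 16 (up_bit n)) \<le> 1 / 2"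
proof -
  let ?U = "{x. up_bit n (bit_graph x) origin}"
  have "1 / 4 = F.prob {x. \<forall>j\<in>{0, Suc n}. x j = True}"
    by (subst measure_flips) (simp_all add: power2_eq_square numeral_2_eq_2[symmetric])
  also have "\<dots> \<le> F.prob ?U"
  proof (rule F.finite_measure_mono_AE[OF _ pred_local_sets[OF local_up_bit]])
    show "AE x in flips. x \<in> {x. \<forall>j\<in>{0, Suc n}. x j = True} \<longrightarrow> x \<in> ?U"
      using AE_generic by eventually_elim (auto simp: up_bit_iff flip_origin first_def intro!: exI[of _ 0])
  qed
  finally show "1 / 4 \<le> measure L.B (lift_pred 16 (up_bit n))" unfolding measure_lift_pred[OF local_up_bit] .
  have "F.prob ?U \<le> F.prob {x. \<forall>j\<in>{Suc n}. x j = True}"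
  proof (rule F.finite_measure_mono_AE[OF _ cylinder_flips])
    show "AE x in flips. x \<in> ?U \<longrightarrow> x \<in> {x. \<forall>j\<in>{Suc n}. x j = True}"
      using AE_generic by eventually_elim (auto simp: up_bit_iff flip_origin)
  qed simp
  also have "\<dots> = 1 / 2" by (subst measure_flips) simp_all
  finally show "measure L.B (lift_pred 16 (up_bit n)) \<le> 1 / 2" unfolding measure_lift_pred[OF local_up_bit] .
qed

lemma measure_bdry_up_bit: "measure L.B (L.bdry (lift_pred 16 (up_bit n))) \<le> (1 / 2) ^ n"
proof -
  let ?Q = "\<lambda>G v. up_bit n G v \<and> (\<exists>u. (v, u) \<in> edges G \<and> \<not> up_bit n G u)"
  have Q: "local_fun 16 (Suc (Suc (2 * n))) ?Q"
    by (rule local_fun_comp2[OF local_fun_mono[OF local_up_bit] local_fun_ex_nbr[OF local_fun_comp[OF local_up_bit]],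
        where f = "(\<and>)"]) simp
  have "measure L.B (L.bdry (lift_pred 16 (up_bit n))) \<le> measure L.B (lift_pred 16 ?Q)"
    using lift_pred_sets[OF Q] unfolding L.sets_B[symmetric]
    by (rule L.B.finite_measure_mono[OF L.bdry_lift_pred_subset[OF local_up_bit]])
  also have "\<dots> = F.prob {x. ?Q (bit_graph x) origin}" by (rule measure_lift_pred[OF Q])
  also have "\<dots> \<le> F.prob {x. \<forall>j\<in>{..<n}. x j = False}"
  proof (rule F.finite_measure_mono_AE[OF _ cylinder_flips])
    show "AE x in flips. x \<in> {x. ?Q (bit_graph x) origin} \<longrightarrow> x \<in> {x. \<forall>j\<in>{..<n}. x j = False}"
      using AE_generic
    proof eventually_elim
      case (elim x)
      show ?case using up_bit_boundary[OF elim, of n origin] unfolding flip_origin by blast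
    qed
  qed simp
  also have "\<dots> = (1 / 2) ^ n" by (subst measure_flips) simp_all
  finally show ?thesis .
qed

lemma not_strongly_ergodic: "\<not> strongly_ergodic L.R L.B"
proof
  let ?A = "\<lambda>n. lift_pred 16 (up_bit n)"
  assume se: "strongly_ergodic L.R L.B"
  have sets: "\<forall>n. ?A n \<in> sets L.B"
  proof
    show "?A n \<in> sets L.B" for n unfolding L.sets_B by (rule lift_pred_sets[OF local_up_bit])
  qed
  have bd: "(\<lambda>n. measure L.B (L.bdry (?A n))) \<longlonglongrightarrow> 0"
  proof (rule tendsto_sandwich[OF _ _ tendsto_const LIMSEQ_realpow_zero[of "1 / 2 :: real"]])
    show "\<forall>\<^sub>F n in sequentially. 0 \<le> measure L.B (L.bdry (?A n))" by (intro always_eventually allI measure_nonneg)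
    show "\<forall>\<^sub>F n in sequentially. measure L.B (L.bdry (?A n)) \<le> (1 / 2) ^ n"
      by (intro always_eventually allI measure_bdry_up_bit)
  qed simp_all
  have lim: "(\<lambda>n. measure L.B (?A n) * (1 - measure L.B (?A n))) \<longlonglongrightarrow> 0"
    by (rule mp[OF spec[OF se[unfolded strongly_ergodic_def], of ?A] conjI[OF sets bd]])
  have aux: "1 / 8 \<le> a * (1 - a)" if "1 / 4 \<le> a" "a \<le> 1 / 2" for a :: real
    using mult_mono[of "1 / 4" a "1 / 2" "1 - a"] that by simp
  have ge: "1 / 8 \<le> measure L.B (?A n) * (1 - measure L.B (?A n))" for n
    by (rule aux[OF measure_up_bit])
  have "1 / 8 \<le> (0 :: real)" by (rule LIMSEQ_le_const[OF lim]) (intro exI allI impI ge)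
  then show False by simp
qed

theorem theorem1p3:
  "\<exists>(D :: nat) (\<nu> :: rooted_class measure).
     unimodular_random_graph D \<nu> \<and> ergodic_random_graph D \<nu> \<and>
     (AE c in \<nu>. rho_graph (rep_graph c) < 1) \<and>
     \<not> strongly_ergodic (bernoulli_graph D) (bernoulli_measure D \<nu>) \<and>
     rho_graphing (bernoulli_graph D) (bernoulli_measure D \<nu>) = 1"
proof (intro exI[of _ 16] exI[of _ F.law] conjI)
  show "unimodular_random_graph 16 F.law" by (rule F.unimodular_law)
  show "ergodic_random_graph 16 F.law" by (rule ergodic_law)
  show "AE c in F.law. rho_graph (rep_graph c) < 1" by (rule rho_law)
  show "\<not> strongly_ergodic L.R L.B" by (rule not_strongly_ergodic)
  show "rho_graphing L.R L.B = 1" by (rule L.rho_graphing_eq_1[OF not_strongly_ergodic])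
qed

end
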